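(* In the setting of horizontal layers described in the context, $\mathcal G_n$ (for $n\in2\mathbb N$, $n\to\infty$) converges to $\mathcal G_{\rm hom}$ locally uniformly in $(0,L)$.
   Context: Geometry. $L,H>0$, $\Omega=(0,L)\times(-H,H)$, $K_l=[0,l]\times\{0\}$ for $l\in(0,L]$; $\partial_D\Omega=\{0\}\times((-H,0)\cup(0,H))\ \cup\ \{L\}\times(-H,H)$; $g\in H^{1/2}(\partial_D\Omega)$ (on each of the three open segments); $\mathcal U_l=\{u\in H^1(\Omega\setminus K_l):u=g\text{ on }\partial_D\Omega\}$. Horizontal layers. $\lambda\in(0,1)$, $n\in 2\mathbb N$, $n>0$, $h_n=H/n$. $\boldsymbol C_A=\mathrm{diag}(\mu_{A,1},\mu_{A,2})$, $\boldsymbol C_B=\mathrm{diag}(\mu_{B,1},\mu_{B,2})$ with positive entries. For integers $-n\le j\le n-1$: $\boldsymbol C_n(x)=\boldsymbol C_A$ if $x_2\in(jh_n,(j+\lambda)h_n)$ and $\boldsymbol C_n(x)=\boldsymbol C_B$ if $x_2\in((j+\lambda)h_n,(j+1)h_n)$. The crack lies in the interface $\{x_2=0\}$ between two layers. Energy release. $\mathcal E_n(l)=\min\{\tfrac12\int_{\Omega\setminus K_l}\nabla u\,\boldsymbol C_n\nabla u^T\,dx:u\in\mathcal U_l\}$ is of class $C^1(0,L)$ and $\mathcal G_n(l)=-\mathcal E_n'(l)$ for $l\in(0,L)$. Homogenized quantities. $\boldsymbol C_{\rm hom}=\mathrm{diag}(\mu_{{\rm hom},1},\mu_{{\rm hom},2})$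 with $\mu_{{\rm hom},1}=\lambda\mu_{A,1}+(1-\lambda)\mu_{B,1}$, $1/\mu_{{\rm hom},2}=\lambda/\mu_{A,2}+(1-\lambda)/\mu_{B,2}$. $\mathcal E_{\rm hom}(l)=\min\{\tfrac12\int_{\Omega\setminus K_l}\nabla u\,\boldsymbol C_{\rm hom}\nabla u^T\,dx:u\in\mathcal U_l\}$, of class $C^1(0,L)$; $\mathcal G_{\rm hom}(l)=-\mathcal E_{\rm hom}'(l)$ for $l\in(0,L)$. *)

theory Defs
  imports "HOL-Analysis.Analysis"
begin

section \<open>Smooth functions and Sobolev spaces in the plane\<close>

text \<open>\<open>C\<^sup>\<infinity>\<close>: all iterated directional derivatives exist and are Frechet differentiable.\<close>

coinductive smooth :: "(real \<times> real \<Rightarrow> real) \<Rightarrow> bool" where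
  "\<lbrakk>\<forall>x. f differentiable (at x); \<forall>e. smooth (\<lambda>x. frechet_derivative f (at x) e)\<rbrakk> \<Longrightarrow> smooth f"

definition grad :: "(real \<times> real \<Rightarrow> real) \<Rightarrow> real \<times> real \<Rightarrow> real \<times> real" where
  "grad f x = (frechet_derivative f (at x) (1, 0), frechet_derivative f (at x) (0, 1))"

definition test_function :: "(real \<times> real) set \<Rightarrow> (real \<times> real \<Rightarrow> real) \<Rightarrow> bool" where
  "test_function U \<phi> \<longleftrightarrow> smooth \<phi> \<and> compact (closure {x. \<phi> x \<noteq> 0}) \<and> closure {x. \<phi> x \<noteq> 0} \<subseteq> U"

definition L2_on :: "'a::euclidean_space set \<Rightarrow> ('a \<Rightarrow> 'b::euclidean_space) \<Rightarrow> bool" where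
  "L2_on U f \<longleftrightarrow> f \<in> borel_measurable (lebesgue_on U) \<and> integrable (lebesgue_on U) (\<lambda>x. (norm (f x))\<^sup>2)"

text \<open>\<open>H1_grad U u v\<close>: \<open>u \<in> H\<^sup>1(U)\<close> with weak gradient \<open>v\<close>. The gradient is an
  argument because it is determined only up to null sets.\<close>

definition H1_grad ::
    "(real \<times> real) set \<Rightarrow> (real \<times> real \<Rightarrow> real) \<Rightarrow> (real \<times> real \<Rightarrow> real \<times> real) \<Rightarrow> bool" where
  "H1_grad U u v \<longleftrightarrow> L2_on U u \<and> L2_on U v \<and>
     (\<forall>\<phi>. test_function U \<phi> \<longrightarrow>
        (\<integral>x. u x *\<^sub>R grad \<phi> x \<partial>lebesgue_on U) = - (\<integral>x. \<phi> x *\<^sub>R v x \<partial>lebesgue_on U))"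

definition H1 :: "(real \<times> real) set \<Rightarrow> (real \<times> real \<Rightarrow> real) set" where
  "H1 U = {u. \<exists>v. H1_grad U u v}"

text \<open>\<open>H\<^sup>1\<^sup>/\<^sup>2\<close> of an interval, with the Gagliardo (Sobolev--Slobodeckij) seminorm. The diagonal is a
  null set.\<close>

definition H_half :: "real set \<Rightarrow> (real \<Rightarrow> real) set" where
  "H_half I = {f. L2_on I f \<and>
     integrable (lebesgue_on (I \<times> I)) (\<lambda>(s, t). (f s - f t)\<^sup>2 / (s - t)\<^sup>2)}"

text \<open>For an open rectangle \<open>X \<times> I\<close> and an endpoint \<open>c\<close> of \<open>X\<close>: \<open>u\<close> belongs to
  \<open>H\<^sup>1(X \<times> I)\<close> and its trace on the side \<open>{c} \<times> I\<close> is \<open>t \<mapsto> f t\<close>. The trace operator is the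
  extension by continuity, from \<open>H\<^sup>1(X \<times> I)\<close> to \<open>L\<^sup>2(I)\<close>, of the restriction of functions that
  are smooth up to the boundary.\<close>

definition has_side_trace ::
    "real set \<Rightarrow> real set \<Rightarrow> real \<Rightarrow> (real \<times> real \<Rightarrow> real) \<Rightarrow> (real \<Rightarrow> real) \<Rightarrow> bool" where
  "has_side_trace X I c u f \<longleftrightarrow> L2_on I f \<and>
     (\<exists>v w. H1_grad (X \<times> I) u v \<and> (\<forall>k::nat. smooth (w k)) \<and>
        (\<lambda>k. \<integral>x. (w k x - u x)\<^sup>2 \<partial>lebesgue_on (X \<times> I)) \<longlonglongrightarrow> 0 \<and>
        (\<lambda>k. \<integral>x. (norm (grad (w k) x - v x))\<^sup>2 \<partial>lebesgue_on (X \<times> I)) \<longlonglongrightarrow> 0 \<and>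
        (\<lambda>k. \<integral>t. (w k (c, t) - f t)\<^sup>2 \<partial>lebesgue_on I) \<longlonglongrightarrow> 0)"


section \<open>Cracked rectangle\<close>

definition Omega :: "real \<Rightarrow> real \<Rightarrow> (real \<times> real) set" where
  "Omega L H = {0<..<L} \<times> {-H<..<H}"

definition crack :: "real \<Rightarrow> (real \<times> real) set" where
  "crack l = {0..l} \<times> {0}"

text \<open>Boundary data on \<open>{0} \<times> ((-H,0) \<union> (0,H)) \<union> {L} \<times> (-H,H)\<close>, in
  \<open>H\<^sup>1\<^sup>/\<^sup>2\<close> of each of the three open segments.\<close>

definition boundary_data :: "real \<Rightarrow> real \<Rightarrow> (real \<times> real \<Rightarrow> real) set" where
  "boundary_data L H = {g. (\<lambda>t. g (0, t)) \<in> H_half {-H<..<0} \<and>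
     (\<lambda>t. g (0, t)) \<in> H_half {0<..<H} \<and> (\<lambda>t. g (L, t)) \<in> H_half {-H<..<H}}"

text \<open>The cracked domain is not Lipschitz, but the open lower and upper halves of the rectangle are,
  and neither meets the crack; traces are taken from them. On the side \<open>{L} \<times> (-H,H)\<close> this
  leaves out only the point \<open>(L, 0)\<close>, which is negligible.\<close>

definition admissible ::
    "real \<Rightarrow> real \<Rightarrow> (real \<times> real \<Rightarrow> real) \<Rightarrow> real \<Rightarrow> (real \<times> real \<Rightarrow> real) set" where
  "admissible L H g l = {u \<in> H1 (Omega L H - crack l).
     \<forall>I \<in> {{-H<..<0}, {0<..<H}}. \<forall>c \<in> {0, L}.
       has_side_trace {0<..<L} I c u (\<lambda>t. g (c, t))}"


section \<open>Energy and energy release rate\<close>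

text \<open>A stiffness tensor is represented by the linear map it induces on gradients; \<open>C\<close> below is a
  field of such maps. \<open>energy\<close> is the minimum, not merely the infimum.\<close>

definition energy ::
    "real \<Rightarrow> real \<Rightarrow> (real \<times> real \<Rightarrow> real) \<Rightarrow> (real \<times> real \<Rightarrow> real \<times> real \<Rightarrow> real \<times> real) \<Rightarrow> real \<Rightarrow> real" where
  "energy L H g C l = (LEAST e. \<exists>u v. u \<in> admissible L H g l \<and> H1_grad (Omega L H - crack l) u v \<and>
     e = 1 / 2 * (\<integral>x. v x \<bullet> C x (v x) \<partial>lebesgue_on (Omega L H - crack l)))"

definition energy_release ::
    "real \<Rightarrow> real \<Rightarrow> (real \<times> real \<Rightarrow> real) \<Rightarrow> (real \<times> real \<Rightarrow> real \<times> real \<Rightarrow> real \<times> real) \<Rightarrow> real \<Rightarrow> real" where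
  "energy_release L H g C l = - deriv (energy L H g C) l"

definition diag :: "real \<Rightarrow> real \<Rightarrow> real \<times> real \<Rightarrow> real \<times> real" where
  "diag \<mu>1 \<mu>2 v = (\<mu>1 * fst v, \<mu>2 * snd v)"

text \<open>Horizontal layers. The interfaces, a null set, are assigned to the second material.\<close>

definition layered ::
    "(real \<times> real \<Rightarrow> real \<times> real) \<Rightarrow> (real \<times> real \<Rightarrow> real \<times> real) \<Rightarrow> real \<Rightarrow> real \<Rightarrow> nat
      \<Rightarrow> real \<times> real \<Rightarrow> real \<times> real \<Rightarrow> real \<times> real" where
  "layered CA CB lam H n x =
     (let h = H / real n in
      if \<exists>j::int. - int n \<le> j \<and> j \<le> int n - 1 \<and>
           snd x \<in> {of_int j * h<..<(of_int j + lam) * h}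
      then CA else CB)"

definition hom_tensor ::
    "real \<Rightarrow> real \<Rightarrow> real \<Rightarrow> real \<Rightarrow> real \<Rightarrow> real \<times> real \<Rightarrow> real \<times> real" where
  "hom_tensor \<mu>A1 \<mu>A2 \<mu>B1 \<mu>B2 lam =
     diag (lam * \<mu>A1 + (1 - lam) * \<mu>B1) (1 / (lam / \<mu>A2 + (1 - lam) / \<mu>B2))"

end

theory Submission
  imports Defs
begin

text \<open>
  The crack length enters the energy only through the domain, and it can be removed from the domain. An explicit flow of horizontal maps fixes
  both lateral sides and moves the point \<open>L/2\<close> to an arbitrary \<open>l\<close> between them. Pulling the problem back to the crack of length \<open>L/2\<close> changes
  nothing but the weights: they become \<open>\<mu>\<^sub>1 b\<close> and \<open>\<mu>\<^sub>2 / b\<close> with an explicit positive function \<open>b\<close> of the horizontal coordinate and of the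
  parameter \<open>s\<close> of the flow. Horizontal maps preserve the layers, so the stiffness itself does not move.

  For a quadratic minimization problem on a fixed class of competitors, the minimal energy has a second order expansion in \<open>s\<close> whose linear
  term is the derivative of the weights at the minimizer and whose remainder for an increment \<open>t\<close> is at most \<open>M t\<^sup>2\<close>. The constant depends on the ellipticity bounds and on
  the norm of one competitor (\<open>minimal_perturbation\<close>, \<open>pulled_expansion\<close>), so it does not depend on the number of layers. With such uniform
  expansions pointwise convergence of the energies implies uniform convergence of their derivatives on compact sets
  (\<open>uniform_derivative_convergence\<close>), and the change of parameter from \<open>s\<close> to \<open>l\<close> is the same for all materials.

  It remains to prove that the energies converge for each crack length (\<open>minimal_energy_convergence\<close>). Testing the Euler--Lagrange equations of
  the \<open>n\<close>-th minimizer \<open>v\<close> and of the homogenized minimizer \<open>v0\<close> with one another, the difference of the energies is an integral of products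
  of an oscillating function of mean zero, of one component of \<open>v0\<close>, and of either the horizontal derivative or the vertical flux of the
  \<open>n\<close>-th minimizer. The first of these two is controlled in the vertical direction because a gradient has no curl, the second because the flux has no
  divergence. Integration by parts in the direction of the oscillation then gives a factor \<open>H/n\<close> (\<open>oscillation_limit\<close>). This is why the
  arithmetic mean appears for \<open>\<mu>\<^sub>1\<close> and the harmonic mean for \<open>\<mu>\<^sub>2\<close>. The homogenized minimizer is a fixed field, so it can be
  approximated by test functions, for which the integration by parts is legitimate.

  The direct method needs completeness of \<open>L\<^sup>2\<close>, density of test functions and a Poincare inequality for the trace on the left side
  (\<open>L2_complete\<close>, \<open>test_functions_dense\<close>, \<open>admissible_poincare\<close>); these are proved first.
\<close>

section \<open>Smooth functions\<close>

text \<open>Smoothness in the sense of \<open>smooth\<close> is coinductive, so proving it for a concrete function needs a set of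
  functions that is stable under differentiation. The derivatives of a typical function are polynomials in finitely many functions
  of the same kind; \<open>alg S\<close> is the algebra of functions generated by \<open>S\<close>, and it suffices to
  differentiate the generators.\<close>

inductive alg :: "('a \<Rightarrow> real) set \<Rightarrow> ('a \<Rightarrow> real) \<Rightarrow> bool" for S where
  gen: "f \<in> S \<Longrightarrow> alg S f"
| const: "alg S (\<lambda>x. c)"
| add: "alg S f \<Longrightarrow> alg S g \<Longrightarrow> alg S (\<lambda>x. f x + g x)"
| mult: "alg S f \<Longrightarrow> alg S g \<Longrightarrow> alg S (\<lambda>x. f x * g x)"

text \<open>The coinduction invariant is membership in the generated algebra: by the sum and product rules the partial derivatives
  of all its elements stay in it once those of the generators do.\<close>

lemma smooth_alg:
  assumes S: "\<And>f. f \<in> S \<Longrightarrow> \<exists>f'. \<forall>x. (f has_derivative f' x) (at x) \<and> (\<forall>e. alg S (\<lambda>x. f' x e))"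
    and f: "alg S f"
  shows "smooth f"
proof -
  have *: "\<exists>f'. \<forall>x. (f has_derivative f' x) (at x) \<and> (\<forall>e. alg S (\<lambda>x. f' x e))" if "alg S f" for f
    using that
  proof induction
    case (gen f) then show ?case using S by blast
  next
    case (const c)
    show ?case by (intro exI[of _ "\<lambda>_ _. 0"]) (auto intro: alg.const)
  next
    case (add f g)
    then obtain f' g' where f': "\<And>x. (f has_derivative f' x) (at x)" "\<And>e. alg S (\<lambda>x. f' x e)"
      and g': "\<And>x. (g has_derivative g' x) (at x)" "\<And>e. alg S (\<lambda>x. g' x e)" by metis
    have "((\<lambda>x. f x + g x) has_derivative (\<lambda>e. f' x e + g' x e)) (at x)" for x
      by (intro has_derivative_add f' g')
    moreover have "alg S (\<lambda>x. f' x e + g' x e)" for e using f' g' by (intro alg.add)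
    ultimately show ?case by (intro exI[of _ "\<lambda>x e. f' x e + g' x e"]) auto
  next
    case (mult f g)
    then obtain f' g' where f': "\<And>x. (f has_derivative f' x) (at x)" "\<And>e. alg S (\<lambda>x. f' x e)"
      and g': "\<And>x. (g has_derivative g' x) (at x)" "\<And>e. alg S (\<lambda>x. g' x e)" by metis
    have "((\<lambda>x. f x * g x) has_derivative (\<lambda>e. f x * g' x e + f' x e * g x)) (at x)" for x
      by (intro has_derivative_mult f' g')
    moreover have "alg S (\<lambda>x. f x * g' x e + f' x e * g x)" for e
      using f' g' mult by (intro alg.add alg.mult)
    ultimately show ?case by (intro exI[of _ "\<lambda>x e. f x * g' x e + f' x e * g x"]) auto
  qed
  show ?thesis using f
  proof (coinduction arbitrary: f)
    case (smooth f)
    obtain f' where f': "\<And>x. (f has_derivative f' x) (at x)" "\<And>e. alg S (\<lambda>x. f' x e)"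
      using *[OF smooth] by blast
    have "frechet_derivative f (at x) = f' x" for x
      using frechet_derivative_at[OF f'(1)] by simp
    moreover have "f differentiable (at x)" for x using f'(1) unfolding differentiable_def by blast
    ultimately show ?case using f'(2) by auto
  qed
qed

lemma smooth_derivative:
  assumes "smooth f"
  shows "(f has_derivative frechet_derivative f (at x)) (at x)" "smooth (\<lambda>x. frechet_derivative f (at x) e)"
proof -
  have *: "(\<forall>x. f differentiable (at x)) \<and> (\<forall>e. smooth (\<lambda>x. frechet_derivative f (at x) e))"
    using assms by (rule smooth.cases) (intro conjI; hypsubst; assumption)
  show "(f has_derivative frechet_derivative f (at x)) (at x)"
    using * frechet_derivative_works[of f "at x"] by blast
  show "smooth (\<lambda>x. frechet_derivative f (at x) e)" using * by blast
qed

text \<open>Smooth functions may always be added to the generators, since their derivatives are again generators.\<close>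

lemma smooth_gen: "\<exists>f'. \<forall>x. (f has_derivative f' x) (at x) \<and> (\<forall>e. alg (Collect smooth \<union> S) (\<lambda>x. f' x e))"
  if "smooth f"
  using smooth_derivative[OF that]
  by (intro exI[of _ "\<lambda>x. frechet_derivative f (at x)"] allI conjI alg.gen) auto

lemma smooth_of_alg_smooth: "alg (Collect smooth) f \<Longrightarrow> smooth f"
  by (erule smooth_alg[rotated], drule CollectD, drule smooth_gen[where S = "{}"], simp only: Un_empty_right)

lemma smooth_const [simp]: "smooth (\<lambda>x. c)"
  and smooth_add: "smooth f \<Longrightarrow> smooth g \<Longrightarrow> smooth (\<lambda>x. f x + g x)"
  and smooth_mult: "smooth f \<Longrightarrow> smooth g \<Longrightarrow> smooth (\<lambda>x. f x * g x)"
  by (rule smooth_of_alg_smooth, rule alg.const)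
    (rule smooth_of_alg_smooth, (rule alg.add alg.mult; rule alg.gen; rule CollectI; assumption))+

lemma smooth_sum: "(\<And>i. i \<in> I \<Longrightarrow> smooth (f i)) \<Longrightarrow> smooth (\<lambda>x. \<Sum>i\<in>I. f i x)"
  by (induction I rule: infinite_finite_induct) (simp_all add: smooth_add)

lemma smooth_cont: "smooth f \<Longrightarrow> continuous_on X f"
  by (intro continuous_at_imp_continuous_on ballI has_derivative_continuous[OF smooth_derivative(1)])

lemma alg_comp: "alg S f \<Longrightarrow> alg ((\<lambda>f x. f (\<xi> x)) ` S) (\<lambda>x. f (\<xi> x))"
proof (induction rule: alg.induct)
  case (gen f) then show ?case by (intro alg.gen imageI)
next
  case (const c) then show ?case by (rule alg.const)
next
  case (add f g) then show ?case by (intro alg.add)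
next
  case (mult f g) then show ?case by (intro alg.mult)
qed

text \<open>A finite family of functions of one variable whose derivatives are polynomials in the family, for instance sine and
  cosine, gives smooth functions of the plane after composition with a linear functional.\<close>

lemma smooth_of_one_variable:
  fixes F :: "(real \<Rightarrow> real) set" and \<xi> :: "real \<times> real \<Rightarrow> real"
  assumes F: "\<And>f. f \<in> F \<Longrightarrow> \<exists>f'. (\<forall>t. (f has_real_derivative f' t) (at t)) \<and> alg F f'"
    and \<xi>: "bounded_linear \<xi>" and f: "f \<in> F"
  shows "smooth (\<lambda>x. f (\<xi> x))"
proof (rule smooth_alg[where S = "(\<lambda>f x. f (\<xi> x)) ` F"])
  show "alg ((\<lambda>f x. f (\<xi> x)) ` F) (\<lambda>x. f (\<xi> x))" using f by (auto intro: alg.gen)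
next
  fix h assume "h \<in> (\<lambda>f x. f (\<xi> x)) ` F"
  then obtain f where f: "f \<in> F" and h: "h = (\<lambda>x. f (\<xi> x))" by auto
  obtain f' where f': "\<And>t. (f has_real_derivative f' t) (at t)" "alg F f'" using F[OF f] by blast
  have "(h has_derivative (\<lambda>e. f' (\<xi> x) * \<xi> e)) (at x)" for x
    unfolding h
    using has_derivative_compose[OF bounded_linear_imp_has_derivative[OF \<xi>] f'(1)[unfolded has_field_derivative_def]]
    by simp
  moreover have "alg ((\<lambda>f x. f (\<xi> x)) ` F) (\<lambda>x. f' (\<xi> x) * \<xi> e)" for e
    by (intro alg.mult alg.const alg_comp f')
  ultimately show "\<exists>f'. \<forall>x. (h has_derivative f' x) (at x) \<and>
             (\<forall>e. alg ((\<lambda>f x. f (\<xi> x)) ` F) (\<lambda>x. f' x e))"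
    by (intro exI[of _ "\<lambda>x e. f' (\<xi> x) * \<xi> e"]) auto
qed

lemma smooth_exp: assumes G: "smooth G" shows "smooth (\<lambda>x. exp (G x))"
proof (rule smooth_alg[where S = "Collect smooth \<union> {\<lambda>x. exp (G x)}"])
  show "alg (Collect smooth \<union> {\<lambda>x. exp (G x)}) (\<lambda>x. exp (G x))" by (auto intro: alg.gen)
next
  fix f assume "f \<in> Collect smooth \<union> {\<lambda>x. exp (G x)}"
  then consider "smooth f" | "f = (\<lambda>x. exp (G x))" by auto
  then show "\<exists>f'. \<forall>x. (f has_derivative f' x) (at x) \<and> (\<forall>e. alg (Collect smooth \<union> {\<lambda>x. exp (G x)}) (\<lambda>x. f' x e))"
  proof cases
    case 1 then show ?thesis by (rule smooth_gen)
  next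
    case 2
    have "((\<lambda>x. exp (G x)) has_derivative (\<lambda>e. frechet_derivative G (at x) e * exp (G x))) (at x)" for x
      using has_derivative_compose[OF smooth_derivative(1)[OF G] DERIV_exp[unfolded has_field_derivative_def]]
      by (simp add: mult.commute)
    then show ?thesis unfolding 2
      by (intro exI[of _ "\<lambda>x e. frechet_derivative G (at x) e * exp (G x)"] allI conjI alg.mult)
        (auto intro: alg.gen smooth_derivative(2)[OF G])
  qed
qed

text \<open>Changes of variable that only move the first coordinate map layers onto themselves, so they leave the layered
  stiffness unchanged.\<close>

definition horiz :: "(real \<Rightarrow> real) \<Rightarrow> real \<times> real \<Rightarrow> real \<times> real" where
  "horiz f x = (f (fst x), snd x)"

lemma horiz_has_derivative:
  assumes d: "\<And>t. (\<Psi> has_real_derivative \<psi> t) (at t)" and w: "(w has_derivative w') (at (horiz \<Psi> x))"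
  shows "((\<lambda>x. w (horiz \<Psi> x)) has_derivative (\<lambda>e. w' (\<psi> (fst x) * fst e, snd e))) (at x)"
proof -
  have "((\<lambda>x. \<Psi> (fst x)) has_derivative (\<lambda>e. \<psi> (fst x) * fst e)) (at x)"
    using has_derivative_compose[OF has_derivative_fst[OF has_derivative_ident] d[unfolded has_field_derivative_def], of x UNIV] by simp
  then have "(horiz \<Psi> has_derivative (\<lambda>e. (\<psi> (fst x) * fst e, snd e))) (at x)"
    unfolding horiz_def[abs_def] by (intro has_derivative_Pair has_derivative_snd has_derivative_ident)
  from has_derivative_compose[OF this w] show ?thesis by simp
qed

lemma linear_pair_expand:
  fixes f :: "real \<times> real \<Rightarrow> real" assumes "linear f" shows "f (a, b) = a * f (1, 0) + b * f (0, 1)"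
proof -
  have "f (a, b) = f (a *\<^sub>R (1, 0) + b *\<^sub>R (0, 1))" by simp
  then show ?thesis using linear_add[OF assms] linear_scale[OF assms] by (metis real_scaleR_def)
qed

lemma has_derivative_pair_expand:
  fixes f :: "real \<times> real \<Rightarrow> real" assumes "(f has_derivative f') F"
  shows "f' (a, b) = a * f' (1, 0) + b * f' (0, 1)"
  using linear_pair_expand has_derivative_linear[OF assms] by blast

text \<open>Every derivative of a composition is a polynomial in smooth functions and in compositions of further smooth functions
  with the same map.\<close>

lemma smooth_horiz:
  assumes d: "\<And>t. (\<Psi> has_real_derivative \<psi> t) (at t)" and s: "smooth (\<lambda>x. \<psi> (fst x))" and w: "smooth w"
  shows "smooth (\<lambda>x. w (horiz \<Psi> x))"
proof (rule smooth_alg[where S = "Collect smooth \<union> {\<lambda>x. w (horiz \<Psi> x) | w. smooth w}"])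
  show "alg (Collect smooth \<union> {\<lambda>x. w (horiz \<Psi> x) | w. smooth w}) (\<lambda>x. w (horiz \<Psi> x))"
    using w by (auto intro: alg.gen)
next
  let ?S = "Collect smooth \<union> {\<lambda>x. w (horiz \<Psi> x) | w. smooth w}"
  fix f assume "f \<in> ?S"
  then consider "smooth f" | w where "f = (\<lambda>x. w (horiz \<Psi> x))" "smooth w" by auto
  then show "\<exists>f'. \<forall>x. (f has_derivative f' x) (at x) \<and> (\<forall>e. alg ?S (\<lambda>x. f' x e))"
  proof cases
    case 1 then show ?thesis by (rule smooth_gen)
  next
    case 2
    let ?w' = "\<lambda>x. frechet_derivative w (at x)"
    have "(f has_derivative (\<lambda>e. \<psi> (fst x) * fst e * ?w' (horiz \<Psi> x) (1,0) + snd e * ?w' (horiz \<Psi> x) (0,1))) (at x)" for x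
      using horiz_has_derivative[OF d smooth_derivative(1)[OF 2(2)]]
      unfolding has_derivative_pair_expand[OF smooth_derivative(1)[OF 2(2)], of _ "_ * _"] 2(1) .
    moreover have "(\<lambda>x. ?w' (horiz \<Psi> x) e) \<in> ?S" for e
      using smooth_derivative(2)[OF 2(2)] by (intro UnI2 CollectI exI[of _ "\<lambda>x. ?w' x e"]) auto
    then have "alg ?S (\<lambda>x. \<psi> (fst x) * fst e * ?w' (horiz \<Psi> x) (1,0) + snd e * ?w' (horiz \<Psi> x) (0,1))" for e
      using s by (intro alg.add alg.mult alg.const) (auto intro!: alg.gen)
    ultimately show ?thesis
      by (intro exI[of _ "\<lambda>x e. \<psi> (fst x) * fst e * ?w' (horiz \<Psi> x) (1,0) + snd e * ?w' (horiz \<Psi> x) (0,1)"]) auto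
  qed
qed

section \<open>Bump functions\<close>

text \<open>The family \<open>x\<^sup>-\<^sup>k exp (- 1/x)\<close>, extended by zero to the left half line, is closed under
  differentiation up to linear combinations; its member \<open>k = 0\<close> is the usual building block of bump
  functions.\<close>

definition flat :: "nat \<Rightarrow> real \<Rightarrow> real" where
  "flat k x = (if x > 0 then (1/x)^k * exp (- (1/x)) else 0)"

text \<open>One term of the exponential series of \<open>1/x\<close> dominates \<open>(1/x)\<^sup>k\<^sup>+\<^sup>2\<close>. The
  quadratic bound gives differentiability at the origin.\<close>

lemma flat_le: "\<bar>flat k x\<bar> \<le> fact (k+2) * x\<^sup>2"
proof (cases "x > 0")
  case True
  have "(1/x)^(k+2) / fact (k+2) \<le> exp (1/x)"
    using exp_ge_one_plus_x_over_n_power_n True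
      sum_le_suminf[OF summable_exp_generic[of "1/x"], of "{k+2}"]
    by (auto simp: exp_def divide_inverse scaleR_conv_of_real mult.commute)
  then have "(1/x)^k \<le> fact (k+2) * x\<^sup>2 * exp (1/x)"
    using True by (simp add: field_simps power_add power2_eq_square del: fact_Suc)
  then have "(1/x)^k * exp (-(1/x)) \<le> fact (k+2) * x\<^sup>2"
    using True by (simp add: exp_minus divide_inverse[symmetric] pos_divide_le_eq del: fact_Suc)
  then show ?thesis using True by (simp add: flat_def)
qed (simp add: flat_def)

lemma flat_deriv: "(flat k has_real_derivative (flat (k+2) x - k * flat (k+1) x)) (at x)"
proof -
  consider "x > 0" | "x < 0" | "x = 0" by linarith
  then show ?thesis
  proof cases
    case 1
    have "((\<lambda>x. (1/x)^k * exp (- (1/x))) has_real_derivative (flat (k+2) x - k * flat (k+1) x)) (at x)"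
    proof -
      have d: "((\<lambda>x. (1/x)^k * exp (- (1/x))) has_real_derivative
          (real k * (1/x)^(k - 1) * (- 1 / x\<^sup>2)) * exp (- (1/x)) + exp (- (1/x)) * (1 / x\<^sup>2) * (1/x)^k) (at x)"
        using 1 by (auto intro!: derivative_eq_intros simp: power2_eq_square)
      have e: "real k * (1/x)^(k - 1) * (- 1 / x\<^sup>2) = - real k * (1/x)^(k+1)"
        using 1 by (cases k) (auto simp: power2_eq_square power_divide field_simps)
      show ?thesis
        by (rule DERIV_cong[OF d[unfolded e]]) (use 1 in \<open>simp add: flat_def power_divide power2_eq_square field_simps\<close>)
    qed
    then show ?thesis
      by (rule has_field_derivative_transform_within_open[of _ _ _ "{0<..}"]) (use 1 in \<open>auto simp: flat_def\<close>)
  next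
    case 2
    have "((\<lambda>x. 0) has_real_derivative (flat (k+2) x - k * flat (k+1) x)) (at x)"
      using 2 by (simp add: flat_def)
    then show ?thesis
      by (rule has_field_derivative_transform_within_open[of _ _ _ "{..<0}"]) (use 2 in \<open>auto simp: flat_def\<close>)
  next
    case 3
    have "((\<lambda>h. flat k h / h) \<longlongrightarrow> 0) (at 0)"
    proof (rule Lim_null_comparison)
      show "\<forall>\<^sub>F h in at 0. norm (flat k h / h) \<le> fact (k+2) * \<bar>h\<bar>"
      proof (rule eventually_at_filter[THEN iffD2], intro always_eventually allI impI)
        fix h :: real assume "h \<noteq> 0"
        moreover have "\<bar>flat k h\<bar> \<le> fact (k+2) * \<bar>h\<bar> * \<bar>h\<bar>"
          using flat_le[of k h] by (simp only: power2_eq_square mult.assoc abs_mult_self_eq)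
        ultimately show "norm (flat k h / h) \<le> fact (k+2) * \<bar>h\<bar>"
          by (simp add: pos_divide_le_eq del: fact_Suc)
      qed
      show "((\<lambda>h::real. fact (k+2) * \<bar>h\<bar>) \<longlongrightarrow> 0) (at 0)" by (auto intro!: tendsto_eq_intros)
    qed
    then show ?thesis using 3 by (simp add: DERIV_def flat_def)
  qed
qed

lemma smooth_flat:
  assumes "bounded_linear \<xi>" shows "smooth (\<lambda>x. flat 0 (\<sigma> * \<xi> x + a))"
proof -
  let ?F = "range (\<lambda>k t. flat k (\<sigma> * t + a))"
  have "smooth (\<lambda>x. (\<lambda>t. flat 0 (\<sigma> * t + a)) (\<xi> x))"
  proof (rule smooth_of_one_variable[OF _ assms, where F = ?F])
    fix f assume "f \<in> ?F"
    then obtain k where f: "f = (\<lambda>t. flat k (\<sigma> * t + a))" by auto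
    have "(f has_real_derivative (flat (k+2) (\<sigma> * t + a) + (- real k) * flat (k+1) (\<sigma> * t + a)) * \<sigma>) (at t)" for t
      unfolding f by (rule DERIV_chain2[OF flat_deriv, THEN DERIV_cong]) (auto intro!: derivative_eq_intros)
    moreover have "alg ?F (\<lambda>t. (flat (k+2) (\<sigma> * t + a) + (- real k) * flat (k+1) (\<sigma> * t + a)) * \<sigma>)"
      by (intro alg.mult alg.add alg.const; rule alg.gen; blast)
    ultimately show "\<exists>f'. (\<forall>t. (f has_real_derivative f' t) (at t)) \<and> alg ?F f'"
      by (auto intro!: exI[of _ "\<lambda>t. (flat (k+2) (\<sigma> * t + a) + (- real k) * flat (k+1) (\<sigma> * t + a)) * \<sigma>"])
  qed auto
  then show ?thesis by simp
qed

lemma flat_pos_iff: "flat 0 x > 0 \<longleftrightarrow> x > 0" and flat_nonneg: "flat 0 x \<ge> 0"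
  by (auto simp: flat_def)

text \<open>A product of four flat functions, one for each side of the rectangle.\<close>

lemma smooth_box_bump:
  obtains G where "smooth G" "\<And>x. G x \<ge> 0" "{x. G x > 0} = box a (b::real\<times>real)"
proof
  let ?G = "\<lambda>x. (flat 0 (1 * fst x + - fst a) * flat 0 ((-1) * fst x + fst b)) *
    (flat 0 (1 * snd x + - snd a) * flat 0 ((-1) * snd x + snd b))"
  show "smooth ?G" by (intro smooth_mult smooth_flat bounded_linear_fst bounded_linear_snd)
  show "?G x \<ge> 0" for x by (intro mult_nonneg_nonneg flat_nonneg)
  have p: "0 < r * s \<longleftrightarrow> 0 < r \<and> 0 < s" if "r \<ge> 0" "s \<ge> 0" for r s :: real
    using that by (auto simp: zero_less_mult_iff)
  have "?G x > 0 \<longleftrightarrow> x \<in> box a b" for x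
    by (cases x; cases a; cases b) (auto simp: p flat_pos_iff flat_nonneg mem_box Basis_prod_def)
  then show "{x. ?G x > 0} = box a b" by blast
qed

section \<open>Square integrable functions\<close>

text \<open>The \<open>L\<^sup>2\<close> norm. The Bochner integral of a function that is not integrable is zero, so the value has
  its meaning only together with \<open>L2_on\<close>; two functions are equal almost everywhere when the norm of their difference
  vanishes.\<close>

definition norm2 :: "'a::euclidean_space set \<Rightarrow> ('a \<Rightarrow> 'b::euclidean_space) \<Rightarrow> real" where
  "norm2 U f = sqrt (\<integral>x. (norm (f x))\<^sup>2 \<partial>lebesgue_on U)"

lemma L2_on_measurable: "L2_on U f \<Longrightarrow> f \<in> borel_measurable (lebesgue_on U)"
  and L2_on_integrable: "L2_on U f \<Longrightarrow> integrable (lebesgue_on U) (\<lambda>x. (norm (f x))\<^sup>2)"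
  by (auto simp: L2_on_def)

lemma norm2_nonneg [simp]: "0 \<le> norm2 U f"
  by (simp add: norm2_def)

lemma norm2_sq: "(norm2 U f)\<^sup>2 = (\<integral>x. (norm (f x))\<^sup>2 \<partial>lebesgue_on U)"
  by (simp add: norm2_def)

lemma norm_sq_comb_le: "(norm (a *\<^sub>R x + b *\<^sub>R y))\<^sup>2 \<le> 2 * a\<^sup>2 * (norm x)\<^sup>2 + 2 * b\<^sup>2 * (norm (y::'b::real_normed_vector))\<^sup>2"
proof -
  have "(norm (a *\<^sub>R x + b *\<^sub>R y))\<^sup>2 \<le> (norm (a *\<^sub>R x) + norm (b *\<^sub>R y))\<^sup>2"
    by (intro power_mono norm_triangle_ineq) auto
  also have "\<dots> \<le> 2 * (norm (a *\<^sub>R x))\<^sup>2 + 2 * (norm (b *\<^sub>R y))\<^sup>2"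
    using sum_squares_bound[of "norm (a *\<^sub>R x)" "norm (b *\<^sub>R y)"] by (simp add: power2_sum)
  finally show ?thesis by (simp add: power_mult_distrib)
qed

lemma L2_on_comb:
  assumes "L2_on U f" "L2_on U g" shows "L2_on U (\<lambda>x. a *\<^sub>R f x + b *\<^sub>R g x)"
  unfolding L2_on_def
proof
  have [measurable]: "f \<in> borel_measurable (lebesgue_on U)" "g \<in> borel_measurable (lebesgue_on U)"
    using assms by (auto simp: L2_on_def)
  show "(\<lambda>x. a *\<^sub>R f x + b *\<^sub>R g x) \<in> borel_measurable (lebesgue_on U)" by measurable
  show "integrable (lebesgue_on U) (\<lambda>x. (norm (a *\<^sub>R f x + b *\<^sub>R g x))\<^sup>2)"
  proof (rule Bochner_Integration.integrable_bound)
    show "integrable (lebesgue_on U) (\<lambda>x. 2 * a\<^sup>2 * (norm (f x))\<^sup>2 + 2 * b\<^sup>2 * (norm (g x))\<^sup>2)"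
      using assms by (auto simp: L2_on_def)
  qed (auto intro!: AE_I2 norm_sq_comb_le)
qed

lemma L2_on_add: "L2_on U f \<Longrightarrow> L2_on U g \<Longrightarrow> L2_on U (\<lambda>x. f x + g x)"
  and L2_on_diff: "L2_on U f \<Longrightarrow> L2_on U g \<Longrightarrow> L2_on U (\<lambda>x. f x - g x)"
  and L2_on_scale: "L2_on U f \<Longrightarrow> L2_on U (\<lambda>x. a *\<^sub>R f x)"
  using L2_on_comb[of U f g 1 1] L2_on_comb[of U f g 1 "-1"] L2_on_comb[of U f f a 0] by simp_all

lemma L2_on_zero [simp]: "L2_on U (\<lambda>x. 0)" by (simp add: L2_on_def)

lemma L2_inner_integrable:
  assumes "L2_on U f" "L2_on U g" shows "integrable (lebesgue_on U) (\<lambda>x. f x \<bullet> g x)"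
proof (rule Bochner_Integration.integrable_bound)
  have [measurable]: "f \<in> borel_measurable (lebesgue_on U)" "g \<in> borel_measurable (lebesgue_on U)"
    using assms by (auto simp: L2_on_def)
  show "integrable (lebesgue_on U) (\<lambda>x. (norm (f x))\<^sup>2 + (norm (g x))\<^sup>2)"
    using assms by (auto simp: L2_on_def)
  show "(\<lambda>x. f x \<bullet> g x) \<in> borel_measurable (lebesgue_on U)" by measurable
  have "norm (x \<bullet> y) \<le> norm ((norm x)\<^sup>2 + (norm y)\<^sup>2)" for x y :: 'b
  proof -
    have "norm (x \<bullet> y) \<le> norm x * norm y" using Cauchy_Schwarz_ineq2 by simp
    also have "\<dots> \<le> 2 * norm x * norm y" by simp
    also have "\<dots> \<le> (norm x)\<^sup>2 + (norm y)\<^sup>2" by (rule sum_squares_bound)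
    finally show ?thesis by simp
  qed
  then show "AE x in lebesgue_on U. norm (f x \<bullet> g x) \<le> norm ((norm (f x))\<^sup>2 + (norm (g x))\<^sup>2)" by simp
qed

lemma L2_mult_integrable:
  fixes f g :: "_ \<Rightarrow> real"
  shows "L2_on U f \<Longrightarrow> L2_on U g \<Longrightarrow> integrable (lebesgue_on U) (\<lambda>x. f x * g x)"
  using L2_inner_integrable[of U f g] by simp

lemma norm2_comb_sq:
  assumes "L2_on U f" "L2_on U g"
  shows "(norm2 U (\<lambda>x. a *\<^sub>R f x + b *\<^sub>R g x))\<^sup>2 =
    a\<^sup>2 * (norm2 U f)\<^sup>2 + 2 * a * b * (\<integral>x. f x \<bullet> g x \<partial>lebesgue_on U) + b\<^sup>2 * (norm2 U g)\<^sup>2"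
proof -
  have e: "(norm (a *\<^sub>R x + b *\<^sub>R y))\<^sup>2 = a\<^sup>2 * (norm x)\<^sup>2 + 2 * a * b * (x \<bullet> y) + b\<^sup>2 * (norm y)\<^sup>2" for x y :: 'b
    unfolding power2_norm_eq_inner
    by (simp add: inner_add_left inner_add_right inner_commute[of y x] power2_eq_square algebra_simps)
  have "(norm2 U (\<lambda>x. a *\<^sub>R f x + b *\<^sub>R g x))\<^sup>2 =
    (\<integral>x. a\<^sup>2 * (norm (f x))\<^sup>2 + 2 * a * b * (f x \<bullet> g x) + b\<^sup>2 * (norm (g x))\<^sup>2 \<partial>lebesgue_on U)"
    unfolding norm2_sq e ..
  then show ?thesis
    using L2_inner_integrable[OF assms] assms[THEN L2_on_integrable] by (simp add: norm2_sq)
qed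

text \<open>The square of the norm of \<open>a f + b g\<close> is a nonnegative quadratic form in \<open>(a, b)\<close>, so its
  discriminant is not positive.\<close>

lemma L2_Cauchy_Schwarz:
  assumes "L2_on U f" "L2_on U g"
  shows "\<bar>\<integral>x. f x \<bullet> g x \<partial>lebesgue_on U\<bar> \<le> norm2 U f * norm2 U g"
proof -
  let ?I = "\<integral>x. f x \<bullet> g x \<partial>lebesgue_on U"
  have q: "0 \<le> a\<^sup>2 * (norm2 U f)\<^sup>2 + 2 * a * b * ?I + b\<^sup>2 * (norm2 U g)\<^sup>2" for a b
    using norm2_comb_sq[OF assms, of a b] by (metis zero_le_power2)
  have "?I\<^sup>2 \<le> (norm2 U f)\<^sup>2 * (norm2 U g)\<^sup>2"
  proof (cases "norm2 U g = 0")
    case True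
    have "?I = 0"
    proof (rule ccontr)
      assume "?I \<noteq> 0"
      then show False
        (* With vanishing quadratic coefficient the form is affine in b, and this b makes it negative. *)
        using q[of 1 "- ((norm2 U f)\<^sup>2 + 1) / (2 * ?I)"] True by (simp add: field_simps)
    qed
    then show ?thesis by simp
  next
    case False
    have "0 \<le> (norm2 U g)\<^sup>2 * ((norm2 U g)\<^sup>2 * (norm2 U f)\<^sup>2 - ?I\<^sup>2)"
      using q[of "(norm2 U g)\<^sup>2" "- ?I"] by (simp add: algebra_simps power2_eq_square)
    then show ?thesis using False by (auto simp: zero_le_mult_iff mult.commute)
  qed
  then have "\<bar>?I\<bar> \<le> \<bar>norm2 U f * norm2 U g\<bar>"
    unfolding abs_le_square_iff by (simp add: power_mult_distrib)
  then show ?thesis by simp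
qed

lemma norm2_scale: "norm2 U (\<lambda>x. a *\<^sub>R f x) = \<bar>a\<bar> * norm2 U f"
  by (simp add: norm2_def power_mult_distrib real_sqrt_mult)

lemma norm2_triangle:
  assumes "L2_on U f" "L2_on U g" shows "norm2 U (\<lambda>x. f x + g x) \<le> norm2 U f + norm2 U g"
proof (rule power2_le_imp_le)
  have "(norm2 U (\<lambda>x. f x + g x))\<^sup>2 \<le> (norm2 U f)\<^sup>2 + 2 * (norm2 U f * norm2 U g) + (norm2 U g)\<^sup>2"
    using norm2_comb_sq[OF assms, of 1 1] L2_Cauchy_Schwarz[OF assms] by simp
  then show "(norm2 U (\<lambda>x. f x + g x))\<^sup>2 \<le> (norm2 U f + norm2 U g)\<^sup>2" by (simp add: power2_sum)
qed simp

lemma norm2_minus_commute: "norm2 U (\<lambda>x. f x - g x) = norm2 U (\<lambda>x. g x - f x)"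
  by (simp add: norm2_def norm_minus_commute)

lemma norm2_diff_triangle:
  assumes "L2_on U f" "L2_on U g" "L2_on U h"
  shows "norm2 U (\<lambda>x. f x - h x) \<le> norm2 U (\<lambda>x. f x - g x) + norm2 U (\<lambda>x. g x - h x)"
  using norm2_triangle[OF L2_on_diff[OF assms(1,2)] L2_on_diff[OF assms(2,3)]] by simp

lemma norm2_le_add:
  assumes "L2_on U f" "L2_on U g"
  shows "norm2 U f \<le> norm2 U (\<lambda>x. f x - g x) + norm2 U g"
  using norm2_triangle[OF L2_on_diff[OF assms] assms(2)] by simp

lemma L2_on_bounded_mult:
  assumes f: "L2_on U f" and h: "h \<in> borel_measurable (lebesgue_on U)" and b: "\<And>x. x \<in> U \<Longrightarrow> \<bar>h x\<bar> \<le> C"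
  shows "L2_on U (\<lambda>x. h x *\<^sub>R f x)" "norm2 U (\<lambda>x. h x *\<^sub>R f x) \<le> C * norm2 U f"
proof -
  have [measurable]: "f \<in> borel_measurable (lebesgue_on U)" "h \<in> borel_measurable (lebesgue_on U)"
    using f h by (auto simp: L2_on_def)
  have i: "integrable (lebesgue_on U) (\<lambda>x. C\<^sup>2 * (norm (f x))\<^sup>2)" using f by (auto simp: L2_on_def)
  have le: "(norm (h x *\<^sub>R f x))\<^sup>2 \<le> C\<^sup>2 * (norm (f x))\<^sup>2" if "x \<in> U" for x
    using b[OF that] by (auto simp: power_mult_distrib intro!: mult_right_mono abs_le_square_iff[THEN iffD1])
  have i2: "integrable (lebesgue_on U) (\<lambda>x. (norm (h x *\<^sub>R f x))\<^sup>2)"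
    by (rule Bochner_Integration.integrable_bound[OF i]) (use le in \<open>auto intro!: AE_I2 simp del: norm_scaleR\<close>)
  then show "L2_on U (\<lambda>x. h x *\<^sub>R f x)" unfolding L2_on_def by auto
  show "norm2 U (\<lambda>x. h x *\<^sub>R f x) \<le> C * norm2 U f"
  proof (cases "U = {}")
    case False
    then have C: "0 \<le> C" using b by force
    have "(\<integral>x. (norm (h x *\<^sub>R f x))\<^sup>2 \<partial>lebesgue_on U) \<le> (\<integral>x. C\<^sup>2 * (norm (f x))\<^sup>2 \<partial>lebesgue_on U)"
      by (rule integral_mono[OF i2 i]) (use le in auto)
    also have "\<dots> = (C * norm2 U f)\<^sup>2" by (simp add: norm2_sq power_mult_distrib)
    finally show ?thesis unfolding norm2_def using C by (intro real_le_lsqrt) (auto simp flip: norm2_def)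
  qed (simp add: norm2_def)
qed

lemma L2_on_bounded_mult_real:
  fixes f h :: "_ \<Rightarrow> real"
  assumes f: "L2_on U f" and h: "h \<in> borel_measurable (lebesgue_on U)" and b: "\<And>x. x \<in> U \<Longrightarrow> \<bar>h x\<bar> \<le> C"
  shows "L2_on U (\<lambda>x. h x * f x)" "norm2 U (\<lambda>x. h x * f x) \<le> C * norm2 U f"
  using L2_on_bounded_mult[OF assms] by simp_all

lemma L2_on_pair:
  fixes v :: "'a::euclidean_space \<Rightarrow> real \<times> real"
  shows "L2_on U v \<longleftrightarrow> L2_on U (\<lambda>x. fst (v x)) \<and> L2_on U (\<lambda>x. snd (v x))" (is "?l \<longleftrightarrow> ?r")
proof
  have *: "(norm (v x))\<^sup>2 = (norm (fst (v x)))\<^sup>2 + (norm (snd (v x)))\<^sup>2" for x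
    by (simp add: norm_prod_def)
  show ?r if ?l
  proof -
    have [measurable]: "v \<in> borel_measurable (lebesgue_on U)" using that by (auto simp: L2_on_def)
    have i: "integrable (lebesgue_on U) (\<lambda>x. (norm (v x))\<^sup>2)" using that by (auto simp: L2_on_def)
    have [measurable]: "(\<lambda>x. fst (v x)) \<in> borel_measurable (lebesgue_on U)" "(\<lambda>x. snd (v x)) \<in> borel_measurable (lebesgue_on U)"
      by (auto intro!: measurable_compose[OF \<open>v \<in> _\<close>] borel_measurable_continuous_onI continuous_intros)
    have "integrable (lebesgue_on U) (\<lambda>x. (norm (fst (v x)))\<^sup>2)"
      by (rule Bochner_Integration.integrable_bound[OF i]) (auto simp: * intro!: AE_I2)
    moreover have "integrable (lebesgue_on U) (\<lambda>x. (norm (snd (v x)))\<^sup>2)"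
      by (rule Bochner_Integration.integrable_bound[OF i]) (auto simp: * intro!: AE_I2)
    ultimately show ?thesis unfolding L2_on_def by auto
  qed
  show ?l if ?r
  proof -
    have [measurable]: "(\<lambda>x. fst (v x)) \<in> borel_measurable (lebesgue_on U)"
       "(\<lambda>x. snd (v x)) \<in> borel_measurable (lebesgue_on U)" using that by (auto simp: L2_on_def)
    have "(\<lambda>x. (fst (v x), snd (v x))) \<in> borel_measurable (lebesgue_on U)" by measurable
    then have "v \<in> borel_measurable (lebesgue_on U)" by simp
    moreover have "integrable (lebesgue_on U) (\<lambda>x. (norm (v x))\<^sup>2)"
      unfolding * using that by (intro Bochner_Integration.integrable_add) (auto simp: L2_on_def)
    ultimately show ?thesis by (simp add: L2_on_def)
  qed
qed

lemma norm2_pair: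
  fixes v :: "'a::euclidean_space \<Rightarrow> real \<times> real"
  assumes "L2_on U v"
  shows "(norm2 U v)\<^sup>2 = (norm2 U (\<lambda>x. fst (v x)))\<^sup>2 + (norm2 U (\<lambda>x. snd (v x)))\<^sup>2"
proof -
  have "(norm2 U v)\<^sup>2 = (\<integral>x. (norm (fst (v x)))\<^sup>2 + (norm (snd (v x)))\<^sup>2 \<partial>lebesgue_on U)"
    unfolding norm2_sq by (simp add: norm_prod_def)
  then show ?thesis using assms[unfolded L2_on_pair] by (simp add: norm2_sq L2_on_def)
qed

lemma norm2_fst:
  fixes v :: "'a::euclidean_space \<Rightarrow> real \<times> real"
  shows "L2_on U v \<Longrightarrow> norm2 U (\<lambda>x. fst (v x)) \<le> norm2 U v"
  and norm2_snd: "L2_on U v \<Longrightarrow> norm2 U (\<lambda>x. snd (v x)) \<le> norm2 U v"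
  by (rule power2_le_imp_le; simp add: norm2_pair[of U v])+

lemma L2_on_subset:
  assumes f: "L2_on U f" and V: "V \<subseteq> U" "V \<in> sets lebesgue" "U \<in> sets lebesgue"
  shows "L2_on V f" "norm2 V f \<le> norm2 U f"
proof -
  have m: "f \<in> borel_measurable (lebesgue_on V)"
    by (rule measurable_restrict_mono[OF L2_on_measurable[OF f] V(1)])
  have Ui: "U \<inter> space lebesgue \<in> sets lebesgue" and Vi: "V \<inter> space lebesgue \<in> sets lebesgue"
    using V by simp_all
  have i: "integrable lebesgue (\<lambda>x. indicator U x *\<^sub>R (norm (f x))\<^sup>2)"
    using L2_on_integrable[OF f] unfolding integrable_restrict_space[OF Ui] .
  have "integrable lebesgue (\<lambda>x. indicator V x *\<^sub>R (indicator U x *\<^sub>R (norm (f x))\<^sup>2))"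
    by (rule integrable_mult_indicator[OF V(2) i])
  moreover have eq: "indicator V x *\<^sub>R (indicator U x *\<^sub>R (norm (f x))\<^sup>2) = indicator V x *\<^sub>R (norm (f x))\<^sup>2" for x
    using V(1) by (cases "x \<in> V") auto
  ultimately have i2: "integrable lebesgue (\<lambda>x. indicator V x *\<^sub>R (norm (f x))\<^sup>2)" by (simp only:)
  then have "integrable (lebesgue_on V) (\<lambda>x. (norm (f x))\<^sup>2)"
    unfolding integrable_restrict_space[OF Vi] .
  then show "L2_on V f" using m by (simp add: L2_on_def)
  have "(\<integral>x. indicator V x *\<^sub>R (norm (f x))\<^sup>2 \<partial>lebesgue) \<le> (\<integral>x. indicator U x *\<^sub>R (norm (f x))\<^sup>2 \<partial>lebesgue)"
    by (rule integral_mono[OF i2 i]) (use V(1) in \<open>simp add: indicator_def subset_iff\<close>)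
  then show "norm2 V f \<le> norm2 U f"
    unfolding norm2_def integral_restrict_space[OF Ui] integral_restrict_space[OF Vi] by simp
qed

section \<open>Completeness\<close>

text \<open>Fatou's lemma for the squares: bounds on the norm pass to almost everywhere limits.\<close>

lemma L2_Fatou:
  fixes f :: "nat \<Rightarrow> 'a::euclidean_space \<Rightarrow> 'b::euclidean_space"
  assumes f: "\<And>k. L2_on U (f k)" and g: "g \<in> borel_measurable (lebesgue_on U)"
    and lim: "AE x in lebesgue_on U. (\<lambda>k. f k x) \<longlonglongrightarrow> g x"
    and b: "\<forall>\<^sub>F k in sequentially. norm2 U (f k) \<le> C" and C: "C \<ge> 0"
  shows "L2_on U g" "norm2 U g \<le> C"
proof -
  have [measurable]: "f k \<in> borel_measurable (lebesgue_on U)" for k using f by (auto simp: L2_on_def)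
  have [measurable]: "g \<in> borel_measurable (lebesgue_on U)" by fact
  have n: "(\<integral>\<^sup>+x. ennreal ((norm (f k x))\<^sup>2) \<partial>lebesgue_on U) = ennreal ((norm2 U (f k))\<^sup>2)" for k
    unfolding norm2_sq using f by (intro nn_integral_eq_integral) (auto simp: L2_on_def)
  have "(\<integral>\<^sup>+x. ennreal ((norm (g x))\<^sup>2) \<partial>lebesgue_on U) =
     (\<integral>\<^sup>+x. liminf (\<lambda>k. ennreal ((norm (f k x))\<^sup>2)) \<partial>lebesgue_on U)"
  proof (rule nn_integral_cong_AE)
    show "AE x in lebesgue_on U. ennreal ((norm (g x))\<^sup>2) = liminf (\<lambda>k. ennreal ((norm (f k x))\<^sup>2))"
      using lim
    proof eventually_elim
      case (elim x)
      then have "(\<lambda>k. ennreal ((norm (f k x))\<^sup>2)) \<longlonglongrightarrow> ennreal ((norm (g x))\<^sup>2)"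
        by (intro tendsto_ennrealI tendsto_power tendsto_norm)
      from lim_imp_Liminf[OF _ this] show ?case by simp
    qed
  qed
  also have "\<dots> \<le> liminf (\<lambda>k. \<integral>\<^sup>+x. ennreal ((norm (f k x))\<^sup>2) \<partial>lebesgue_on U)"
    by (intro nn_integral_liminf) measurable
  also have "\<dots> \<le> ennreal (C\<^sup>2)"
    unfolding n
  proof (rule Liminf_le)
    show "\<forall>\<^sub>F k in sequentially. ennreal ((norm2 U (f k))\<^sup>2) \<le> ennreal (C\<^sup>2)"
      using b by eventually_elim (intro ennreal_leI power_mono, auto)
  qed simp
  finally have le: "(\<integral>\<^sup>+x. ennreal ((norm (g x))\<^sup>2) \<partial>lebesgue_on U) \<le> ennreal (C\<^sup>2)" .
  have i: "integrable (lebesgue_on U) (\<lambda>x. (norm (g x))\<^sup>2)"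
    using le by (intro integrableI_bounded) (auto intro: le_less_trans simp: ennreal_power)
  then show "L2_on U g" using g by (simp add: L2_on_def)
  have "ennreal (\<integral>x. (norm (g x))\<^sup>2 \<partial>lebesgue_on U) \<le> ennreal (C\<^sup>2)"
    using le nn_integral_eq_integral[OF i] by simp
  then have "(\<integral>x. (norm (g x))\<^sup>2 \<partial>lebesgue_on U) \<le> C\<^sup>2" by (simp add: ennreal_le_iff)
  then show "norm2 U g \<le> C" unfolding norm2_def using C by (intro real_le_lsqrt)
qed

text \<open>The Riesz--Fischer theorem. A subsequence with geometrically small increments converges almost everywhere, and Fatou's
  lemma, applied to the differences with a fixed member of the sequence, turns this limit into a limit in norm.\<close>

lemma L2_complete:
  fixes f :: "nat \<Rightarrow> 'a::euclidean_space \<Rightarrow> 'b::euclidean_space"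
  assumes f: "\<And>k. L2_on U (f k)"
    and Cauchy: "\<And>e. e > 0 \<Longrightarrow> \<exists>N. \<forall>i\<ge>N. \<forall>j\<ge>N. norm2 U (\<lambda>x. f i x - f j x) < e"
  obtains g where "L2_on U g" "(\<lambda>k. norm2 U (\<lambda>x. f k x - g x)) \<longlonglongrightarrow> 0"
proof -
  have m[measurable]: "f k \<in> borel_measurable (lebesgue_on U)" for k using f by (auto simp: L2_on_def)
  have "\<exists>r :: nat \<Rightarrow> nat. \<forall>k. (\<forall>i\<ge>r k. \<forall>j\<ge>r k. norm2 U (\<lambda>x. f i x - f j x) < (1/2)^k) \<and> r k < r (Suc k)"
  proof (rule dependent_nat_choice)
    show "\<exists>N. \<forall>i\<ge>N. \<forall>j\<ge>N. norm2 U (\<lambda>x. f i x - f j x) < (1/2)^0" using Cauchy[of 1] by simp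
    fix N n
    obtain N' where N': "\<forall>i\<ge>N'. \<forall>j\<ge>N'. norm2 U (\<lambda>x. f i x - f j x) < (1/2)^Suc n"
      using Cauchy[of "(1/2)^Suc n"] by auto
    show "\<exists>y. (\<forall>i\<ge>y. \<forall>j\<ge>y. norm2 U (\<lambda>x. f i x - f j x) < (1/2)^Suc n) \<and> N < y"
      by (rule exI[of _ "max N' (Suc N)"]) (use N' in auto)
  qed
  then obtain r :: "nat \<Rightarrow> nat" where r: "\<And>k i j. i \<ge> r k \<Longrightarrow> j \<ge> r k \<Longrightarrow> norm2 U (\<lambda>x. f i x - f j x) < (1/2)^k"
    and rS: "\<And>k. r k < r (Suc k)" by blast
  have "strict_mono r" using rS by (simp add: strict_mono_Suc_iff)
  define d where "d = (\<lambda>k x. norm (f (r (Suc k)) x - f (r k) x))"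
  have [measurable]: "d k \<in> borel_measurable (lebesgue_on U)" for k unfolding d_def by measurable
  have d: "(\<integral>\<^sup>+x. ennreal ((d k x)\<^sup>2) \<partial>lebesgue_on U) \<le> ennreal ((1/4)^k)" for k
  proof -
    have "(\<integral>\<^sup>+x. ennreal ((d k x)\<^sup>2) \<partial>lebesgue_on U) = ennreal ((norm2 U (\<lambda>x. f (r (Suc k)) x - f (r k) x))\<^sup>2)"
      unfolding norm2_sq d_def using L2_on_diff[OF f f]
      by (intro nn_integral_eq_integral) (auto simp: L2_on_def)
    also have "\<dots> \<le> ennreal (((1/2)^k)\<^sup>2)"
      using r[of k "r (Suc k)" "r k"] rS[of k] by (intro ennreal_leI power_mono) auto
    also have "((1/2)^k)\<^sup>2 = (1/4 :: real)^k"
      unfolding power2_eq_square power_mult_distrib[symmetric] by simp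
    finally show ?thesis .
  qed
  (* The weights 2^k leave a summable bound and still force the increments d k x to be summable almost everywhere. *)
  have "(\<integral>\<^sup>+x. (\<Sum>k. ennreal (2^k * (d k x)\<^sup>2)) \<partial>lebesgue_on U) = (\<Sum>k. \<integral>\<^sup>+x. ennreal (2^k * (d k x)\<^sup>2) \<partial>lebesgue_on U)"
    by (intro nn_integral_suminf) measurable
  also have "\<dots> \<le> (\<Sum>k. ennreal ((1/2)^k))"
  proof (intro suminf_le summableI)
    fix k
    have "(\<integral>\<^sup>+x. ennreal (2^k * (d k x)\<^sup>2) \<partial>lebesgue_on U) = ennreal (2^k) * (\<integral>\<^sup>+x. ennreal ((d k x)\<^sup>2) \<partial>lebesgue_on U)"
      by (subst nn_integral_cmult[symmetric]) (auto simp: ennreal_mult)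
    also have "\<dots> \<le> ennreal (2^k) * ennreal ((1/4)^k)" using d by (intro mult_left_mono) auto
    also have "\<dots> = ennreal (2^k * (1/4)^k)" by (rule ennreal_mult[symmetric]) simp_all
    also have "2^k * (1/4)^k = (1/2::real)^k" unfolding power_mult_distrib[symmetric] by simp
    finally show "(\<integral>\<^sup>+x. ennreal (2^k * (d k x)\<^sup>2) \<partial>lebesgue_on U) \<le> ennreal ((1/2)^k)" .
  qed
  also have "\<dots> = ennreal (\<Sum>k. (1/2)^k)"
    by (rule suminf_ennreal2) (simp, rule summable_geometric, simp)
  also have "\<dots> < \<infinity>" unfolding infinity_ennreal_def by (rule ennreal_less_top)
  finally have "AE x in lebesgue_on U. (\<Sum>k. ennreal (2^k * (d k x)\<^sup>2)) \<noteq> \<infinity>"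
    by (intro nn_integral_PInf_AE) auto
  then have conv: "AE x in lebesgue_on U. convergent (\<lambda>k. f (r k) x)"
  proof eventually_elim
    case (elim x)
    then have s: "summable (\<lambda>k. 2^k * (d k x)\<^sup>2)"
      by (intro summable_suminf_not_top) auto
    have "summable (\<lambda>k. 2^k * (d k x)\<^sup>2 + (1/2)^k)"
      by (intro summable_add s summable_geometric) simp
    then have "summable (\<lambda>k. norm (f (r (Suc k)) x - f (r k) x))"
    proof (rule summable_comparison_test')
      fix k :: nat
      (* Either d k x is below (1/2)^k, or multiplying it by 2^k * d k x, which exceeds one, enlarges it. *)
      have "d k x \<le> 2^k * (d k x)\<^sup>2 + (1/2)^k"
      proof (cases "d k x \<le> (1/2)^k")
        case False
        then have "2^k * (1/2)^k \<le> 2^k * d k x" by (intro mult_left_mono) auto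
        then have "1 \<le> 2^k * d k x" unfolding power_mult_distrib[symmetric] by simp
        then have "1 * d k x \<le> 2^k * d k x * d k x" by (intro mult_right_mono) (auto simp: d_def)
        moreover have "0 \<le> (1/2::real)^k" by simp
        ultimately show ?thesis unfolding power2_eq_square mult.assoc by linarith
      qed (simp add: add_increasing)
      then show "norm (norm (f (r (Suc k)) x - f (r k) x)) \<le> 2^k * (d k x)\<^sup>2 + (1/2)^k" by (simp add: d_def)
    qed
    then have "summable (\<lambda>k. f (r (Suc k)) x - f (r k) x)" by (rule summable_norm_cancel)
    then have "convergent (\<lambda>n. \<Sum>k<n. f (r (Suc k)) x - f (r k) x)" by (simp add: summable_iff_convergent)
    then have "convergent (\<lambda>n. f (r n) x - f (r 0) x)"
      by (simp add: sum_lessThan_telescope[where f = "\<lambda>k. f (r k) x"])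
    then show ?case by (simp add: convergent_diff_const_right_iff)
  qed
  define g where "g = (\<lambda>x. lim (\<lambda>k. f (r k) x))"
  have g[measurable]: "g \<in> borel_measurable (lebesgue_on U)"
    unfolding g_def by (rule borel_measurable_lim_metric) measurable
  have lim: "AE x in lebesgue_on U. (\<lambda>k. f (r k) x) \<longlonglongrightarrow> g x"
    using conv by eventually_elim (simp add: g_def convergent_LIMSEQ_iff)
  have F: "L2_on U (\<lambda>x. g x - f i x) \<and> norm2 U (\<lambda>x. g x - f i x) \<le> (1/2)^k" if "i \<ge> r k" for i k
  proof (intro conjI; rule L2_Fatou[where f="\<lambda>j x. f (r j) x - f i x" and C="(1/2)^k"])
    show "\<forall>\<^sub>F j in sequentially. norm2 U (\<lambda>x. f (r j) x - f i x) \<le> (1/2)^k"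
      using eventually_ge_at_top[of k]
    proof eventually_elim
      case (elim j)
      then have "r j \<ge> r k" using \<open>strict_mono r\<close> by (simp add: strict_mono_less_eq)
      then show ?case using r[of k "r j" i] that by simp
    qed
    then show "\<forall>\<^sub>F j in sequentially. norm2 U (\<lambda>x. f (r j) x - f i x) \<le> (1/2)^k" .
    show "AE x in lebesgue_on U. (\<lambda>j. f (r j) x - f i x) \<longlonglongrightarrow> g x - f i x"
      using lim by eventually_elim (intro tendsto_intros)
    then show "AE x in lebesgue_on U. (\<lambda>j. f (r j) x - f i x) \<longlonglongrightarrow> g x - f i x" .
  qed (auto intro!: L2_on_diff f)
  show ?thesis
  proof
    show "L2_on U g" using L2_on_add[OF F[of 0 "r 0", OF order_refl, THEN conjunct1] f[of "r 0"]] by simp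
    show "(\<lambda>k. norm2 U (\<lambda>x. f k x - g x)) \<longlonglongrightarrow> 0"
    proof (rule LIMSEQ_I)
      fix e :: real assume "e > 0"
      then obtain k where k: "(1/2)^k < e" using real_arch_pow_inv[of e "1/2"] by auto
      show "\<exists>no. \<forall>n\<ge>no. norm (norm2 U (\<lambda>x. f n x - g x) - 0) < e"
      proof (intro exI[of _ "r k"] allI impI)
        fix n assume "n \<ge> r k"
        from F[OF this] k show "norm (norm2 U (\<lambda>x. f n x - g x) - 0) < e"
          by (simp add: norm2_minus_commute[of U "f n"])
      qed
    qed
  qed
qed

section \<open>Density of test functions\<close>

lemma norm2_cong: "(\<And>x. x \<in> U \<Longrightarrow> f x = g x) \<Longrightarrow> norm2 U f = norm2 U g"
  unfolding norm2_def by (intro arg_cong[where f=sqrt] Bochner_Integration.integral_cong) auto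

lemma L2_on_bounded:
  fixes f :: "'a::euclidean_space \<Rightarrow> 'b::euclidean_space"
  assumes U: "U \<in> lmeasurable" and f: "f \<in> borel_measurable (lebesgue_on U)" and b: "\<And>x. x \<in> U \<Longrightarrow> norm (f x) \<le> C"
  shows "L2_on U f"
proof -
  interpret finite_measure "lebesgue_on U" by (rule finite_measure_lebesgue_on[OF U])
  have "integrable (lebesgue_on U) (\<lambda>x. (norm (f x))\<^sup>2)"
    using f b by (intro integrable_const_bound[where B = "C\<^sup>2"]) (auto intro!: AE_I2 power_mono)
  then show ?thesis using f by (simp add: L2_on_def)
qed

lemma norm2_dominated:
  fixes s :: "nat \<Rightarrow> 'a::euclidean_space \<Rightarrow> 'b::euclidean_space"
  assumes w: "integrable (lebesgue_on U) w"
    and m: "\<And>k. s k \<in> borel_measurable (lebesgue_on U)" "f \<in> borel_measurable (lebesgue_on U)"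
    and lim: "\<And>x. x \<in> U \<Longrightarrow> (\<lambda>k. s k x) \<longlonglongrightarrow> f x"
    and b: "\<And>k x. x \<in> U \<Longrightarrow> (norm (s k x - f x))\<^sup>2 \<le> w x"
  shows "(\<lambda>k. norm2 U (\<lambda>x. s k x - f x)) \<longlonglongrightarrow> 0"
proof -
  have [measurable]: "s k \<in> borel_measurable (lebesgue_on U)" "f \<in> borel_measurable (lebesgue_on U)" for k
    by (fact m)+
  have "(\<lambda>k. \<integral>x. (norm (s k x - f x))\<^sup>2 \<partial>lebesgue_on U) \<longlonglongrightarrow> (\<integral>x. 0 \<partial>lebesgue_on U)"
  proof (rule integral_dominated_convergence[OF _ _ w])
    show "AE x in lebesgue_on U. (\<lambda>k. (norm (s k x - f x))\<^sup>2) \<longlonglongrightarrow> 0"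
    proof (rule AE_I2)
      fix x assume "x \<in> space (lebesgue_on U)"
      then have "(\<lambda>k. (norm (s k x - f x))\<^sup>2) \<longlonglongrightarrow> (norm (f x - f x))\<^sup>2"
        using lim by (intro tendsto_intros) auto
      then show "(\<lambda>k. (norm (s k x - f x))\<^sup>2) \<longlonglongrightarrow> 0" by simp
    qed
    show "AE x in lebesgue_on U. norm ((norm (s k x - f x))\<^sup>2) \<le> w x" for k
      using b by (intro AE_I2) auto
  qed measurable
  from tendsto_real_sqrt[OF this] show ?thesis by (simp add: norm2_def)
qed

lemma test_function_smooth: "test_function U \<phi> \<Longrightarrow> smooth \<phi>"
  by (simp add: test_function_def)

lemma test_function_support:
  assumes "smooth \<phi>" "{x. \<phi> x \<noteq> 0} \<subseteq> K" "compact K" "K \<subseteq> U"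
  shows "test_function U \<phi>"
proof -
  have "closure {x. \<phi> x \<noteq> 0} \<subseteq> K" using assms by (intro closure_minimal compact_imp_closed)
  moreover then have "compact (closure {x. \<phi> x \<noteq> 0})"
    using compact_Int_closed[OF assms(3) closed_closure, of "{x. \<phi> x \<noteq> 0}"] by (simp only: Int_absorb1)
  ultimately show ?thesis using assms by (auto simp: test_function_def)
qed

lemma test_functionE:
  assumes "test_function U \<phi>"
  obtains K where "compact K" "K \<subseteq> U" "\<And>x. x \<notin> K \<Longrightarrow> \<phi> x = 0"
proof -
  have "\<phi> x = 0" if "x \<notin> closure {x. \<phi> x \<noteq> 0}" for x
    using subsetD[OF closure_subset, of x "{x. \<phi> x \<noteq> 0}"] that by (cases "\<phi> x = 0") simp_all
  then show ?thesis by (rule that[rotated 2]) (use assms[unfolded test_function_def] in blast)+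
qed

lemma test_function_mono: "test_function U \<phi> \<Longrightarrow> U \<subseteq> V \<Longrightarrow> test_function V \<phi>"
  by (auto simp: test_function_def)

lemma test_function_mult:
  assumes "test_function U \<phi>" "smooth f" shows "test_function U (\<lambda>x. f x * \<phi> x)"
proof -
  obtain K where K: "compact K" "K \<subseteq> U" "\<And>x. x \<notin> K \<Longrightarrow> \<phi> x = 0" using test_functionE[OF assms(1)] by blast
  show ?thesis
    by (rule test_function_support[OF smooth_mult[OF assms(2) test_function_smooth[OF assms(1)]] _ K(1,2)]) (use K(3) in auto)
qed

lemma test_function_add:
  assumes "test_function U \<phi>" "test_function U \<psi>" shows "test_function U (\<lambda>x. \<phi> x + \<psi> x)"
proof -
  obtain K where K: "compact K" "K \<subseteq> U" "\<And>x. x \<notin> K \<Longrightarrow> \<phi> x = 0" using test_functionE[OF assms(1)] by blast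
  obtain K' where K': "compact K'" "K' \<subseteq> U" "\<And>x. x \<notin> K' \<Longrightarrow> \<psi> x = 0" using test_functionE[OF assms(2)] by blast
  have "x \<in> K \<union> K'" if "\<phi> x + \<psi> x \<noteq> 0" for x
    using K(3)[of x] K'(3)[of x] that by (cases "x \<in> K"; cases "x \<in> K'") simp_all
  then have "{x. \<phi> x + \<psi> x \<noteq> 0} \<subseteq> K \<union> K'" by blast
  then show ?thesis
    by (rule test_function_support[OF smooth_add[OF assms[THEN test_function_smooth]] _ compact_Un[OF K(1) K'(1)]])
      (intro Un_least K(2) K'(2))
qed

lemma test_function_zero: "test_function U (\<lambda>x. 0)"
  by (rule test_function_support[where K = "{}"]) auto

lemma test_function_derivative:
  assumes "test_function U \<phi>" shows "test_function U (\<lambda>x. frechet_derivative \<phi> (at x) e)"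
proof -
  obtain K where K: "compact K" "K \<subseteq> U" "\<And>x. x \<notin> K \<Longrightarrow> \<phi> x = 0" using test_functionE[OF assms(1)] by blast
  have "frechet_derivative \<phi> (at x) e = 0" if "x \<notin> K" for x
  proof -
    have "(\<phi> has_derivative (\<lambda>_. 0)) (at x)"
      by (rule has_derivative_transform_within_open[of "\<lambda>_. 0" _ _ _ "- K"])
        (use K that in \<open>auto intro: open_Compl compact_imp_closed\<close>)
    from frechet_derivative_at[OF this, symmetric] show ?thesis by simp
  qed
  then show ?thesis
    by (intro test_function_support[OF smooth_derivative(2)[OF test_function_smooth[OF assms]] _ K(1,2)]) auto
qed

lemma test_function_bounded:
  assumes "test_function U \<phi>" obtains C where "\<And>x. \<bar>\<phi> x\<bar> \<le> C" "C \<ge> 0"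
proof -
  obtain K where K: "compact K" "K \<subseteq> U" "\<And>x. x \<notin> K \<Longrightarrow> \<phi> x = 0" using test_functionE[OF assms(1)] by blast
  have "bounded (\<phi> ` K)"
    by (intro compact_imp_bounded compact_continuous_image smooth_cont test_function_smooth[OF assms] K)
  then obtain C where "\<And>y. y \<in> \<phi> ` K \<Longrightarrow> norm y \<le> C" by (auto simp: bounded_iff)
  then have "\<bar>\<phi> x\<bar> \<le> max C 0" for x using K(3)[of x] by (cases "x \<in> K") (auto simp: le_max_iff_disj)
  then show ?thesis using that[of "max C 0"] by auto
qed

lemma smooth_measurable: "smooth f \<Longrightarrow> S \<in> sets lebesgue \<Longrightarrow> f \<in> borel_measurable (lebesgue_on S)"
  by (rule continuous_imp_measurable_on_sets_lebesgue[OF smooth_cont])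

lemma test_function_L2:
  assumes "U \<in> lmeasurable" "test_function V \<phi>" shows "L2_on U \<phi>"
proof -
  obtain C where "\<And>x. \<bar>\<phi> x\<bar> \<le> C" "C \<ge> 0" using test_function_bounded[OF assms(2)] by blast
  then show ?thesis
    using assms by (intro L2_on_bounded smooth_measurable test_function_smooth[OF assms(2)]) (auto simp: fmeasurable_def)
qed

lemma bounded_open_lmeasurable: "open U \<Longrightarrow> bounded U \<Longrightarrow> U \<in> lmeasurable"
  by (intro lmeasurable_open)

lemma indicator_L2:
  assumes "U \<in> lmeasurable" "S \<in> sets lebesgue" shows "L2_on U (indicat_real S)"
  by (rule L2_on_bounded[OF assms(1), where C=1])
    (use assms in \<open>auto intro: borel_measurable_indicator simp: sets_restrict_space_iff measurable_restrict_space1 indicator_def\<close>)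

text \<open>Regularity of the Lebesgue measure encloses all but a small part of the set in a finite union of boxes that is almost
  contained in it. For a smooth function \<open>g\<close> that is positive exactly on this union, \<open>1 - exp (- k g)\<close>
  increases to the indicator function of the union.\<close>

lemma test_function_approx_indicator:
  assumes U: "open U" "bounded U" and S: "S \<in> sets lebesgue" "S \<subseteq> U" and e: "e > 0"
  obtains \<eta> where "test_function U \<eta>" "norm2 U (\<lambda>x. indicat_real S x - \<eta> x) < e"
proof -
  have Um: "U \<in> lmeasurable" using U by (rule bounded_open_lmeasurable)
  then have Us: "U \<in> sets lebesgue" by auto
  interpret finite_measure "lebesgue_on U" by (rule finite_measure_lebesgue_on[OF Um])
  (* The union of boxes and the set differ by less than 2 * d in measure, which is (e/2)^2. *)
  define d where "d = e\<^sup>2 / 8"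
  have d: "d > 0" using e by (simp add: d_def)
  obtain T where T: "closed T" "T \<subseteq> S" "S - T \<in> lmeasurable" "emeasure lebesgue (S - T) < ennreal d"
    using sets_lebesgue_inner_closed[OF S(1) d] .
  have Tc: "compact T" using T S U(2) by (meson bounded_subset compact_eq_bounded_closed)
  have Ts: "T \<in> sets lebesgue" using T(1) by simp
  obtain Q where Q: "open Q" "T \<subseteq> Q" "Q - T \<in> lmeasurable" "emeasure lebesgue (Q - T) < ennreal d"
    using sets_lebesgue_outer_open[OF Ts d] .
  have "open (Q \<inter> U)" using Q U by auto
  have "\<exists>a b. cbox a b \<subseteq> Q \<inter> U \<and> x \<in> box a b" if "x \<in> T" for x
  proof -
    have "x \<in> Q \<inter> U" using that Q(2) T(2) S(2) by blast
    then obtain a b where "cbox a b \<subseteq> Q \<inter> U" "x \<in> box a b"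
      by (rule open_contains_cbox[OF \<open>open (Q \<inter> U)\<close>])
    then show ?thesis by blast
  qed
  then obtain a b where ab: "\<And>x. x \<in> T \<Longrightarrow> cbox (a x) (b x) \<subseteq> Q \<inter> U" "\<And>x. x \<in> T \<Longrightarrow> x \<in> box (a x) (b x)"
    by metis
  obtain F where F: "F \<subseteq> T" "finite F" "T \<subseteq> (\<Union>x\<in>F. box (a x) (b x))"
    by (rule compactE_image[OF Tc, of T "\<lambda>x. box (a x) (b x)"]) (use ab(2) in \<open>auto simp: open_box\<close>)
  define W where "W = (\<Union>x\<in>F. box (a x) (b x))"
  have "open W" unfolding W_def by (auto intro: open_box)
  then have Ws: "W \<in> sets lebesgue" by auto
  have W: "T \<subseteq> W" "W \<subseteq> Q \<inter> U"
    using F ab(1) box_subset_cbox unfolding W_def by blast+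
  have "\<exists>G. smooth G \<and> (\<forall>y. G y \<ge> 0) \<and> {y. G y > 0} = box (a x) (b x)" for x
    using smooth_box_bump[of "a x" "b x"] by metis
  then obtain G where G: "\<And>x. smooth (G x)" "\<And>x y. G x y \<ge> 0" "\<And>x. {y. G x y > 0} = box (a x) (b x)"
    by metis
  define g where "g = (\<lambda>y. \<Sum>x\<in>F. G x y)"
  have g: "smooth g" "\<And>y. g y \<ge> 0" unfolding g_def using G by (auto intro: smooth_sum sum_nonneg)
  have gW: "g y > 0 \<longleftrightarrow> y \<in> W" for y
  proof -
    have "g y > 0 \<longleftrightarrow> \<not> g y = 0" using g(2)[of y] by auto
    also have "\<dots> \<longleftrightarrow> (\<exists>x\<in>F. G x y > 0)"
      unfolding g_def using sum_nonneg_eq_0_iff[OF F(2), of "\<lambda>x. G x y"] G(2) by (auto simp: less_le)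
    also have "\<dots> \<longleftrightarrow> y \<in> W" unfolding W_def using G(3) by blast
    finally show ?thesis .
  qed
  (* The sequence 1 - exp (- k g), in the form in which smoothness is proved. *)
  define s where "s = (\<lambda>k y. 1 + (-1) * exp ((- real k) * g y))"
  have s_smooth: "smooth (s k)" for k
    unfolding s_def by (intro smooth_add smooth_mult smooth_exp smooth_const g)
  have s_test: "test_function U (s k)" for k
  proof (rule test_function_support[OF s_smooth])
    have "y \<in> W" if "s k y \<noteq> 0" for y
      using gW[of y] g(2)[of y] that by (cases "g y = 0") (simp_all add: s_def)
    moreover have "W \<subseteq> (\<Union>x\<in>F. cbox (a x) (b x))"
      unfolding W_def by (intro UN_mono box_subset_cbox order_refl)
    ultimately show "{x. s k x \<noteq> 0} \<subseteq> (\<Union>x\<in>F. cbox (a x) (b x))" by blast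
    show "compact (\<Union>x\<in>F. cbox (a x) (b x))" using F(2) by (intro compact_UN) auto
    show "(\<Union>x\<in>F. cbox (a x) (b x)) \<subseteq> U" using F(1) ab(1) by blast
  qed
  have s01: "0 \<le> s k y" "s k y \<le> 1" for k y using g(2)[of y] by (auto simp: s_def)
  have "(\<lambda>k. norm2 U (\<lambda>x. s k x - indicat_real W x)) \<longlonglongrightarrow> 0"
  proof (rule norm2_dominated[where w = "\<lambda>_. 1"])
    show "s k \<in> borel_measurable (lebesgue_on U)" for k by (rule smooth_measurable[OF s_smooth Us])
    show "indicat_real W \<in> borel_measurable (lebesgue_on U)"
      using indicator_L2[OF Um Ws] by (rule L2_on_measurable)
    fix x
    show "(\<lambda>k. s k x) \<longlonglongrightarrow> indicat_real W x"
    proof (cases "x \<in> W")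
      case True
      then have "g x > 0" using gW by blast
      then have "(\<lambda>k. exp (- g x) ^ k) \<longlonglongrightarrow> 0" by (intro LIMSEQ_power_zero) (simp add: real_norm_def)
      then have "(\<lambda>k. 1 + (-1) * exp (- g x) ^ k) \<longlonglongrightarrow> 1 + (-1) * 0"
        by (intro tendsto_add tendsto_mult tendsto_const)
      then show ?thesis using True by (simp add: s_def exp_of_nat_mult[symmetric])
    next
      case False
      then have "g x = 0" using gW[of x] g(2)[of x] by auto
      then show ?thesis using False by (simp add: s_def)
    qed
    show "(norm (s k x - indicat_real W x))\<^sup>2 \<le> 1" for k
      using s01[of k x] by (auto simp: indicator_def abs_le_square_iff[of _ 1, simplified, symmetric] abs_le_iff)
  qed simp
  then have "\<forall>\<^sub>F k in sequentially. norm2 U (\<lambda>x. s k x - indicat_real W x) < e / 2"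
    using e by (intro order_tendstoD) auto
  then obtain k where k: "norm2 U (\<lambda>x. s k x - indicat_real W x) < e / 2"
    by (auto simp: eventually_sequentially)
  have "norm2 U (\<lambda>x. indicat_real W x - indicat_real S x) \<le> e / 2"
  proof -
    let ?R = "(Q - T) \<union> (S - T)"
    have Rm: "?R \<in> lmeasurable" using Q T by (intro fmeasurable.Un)
    have "(\<integral>x. (norm (indicat_real W x - indicat_real S x))\<^sup>2 \<partial>lebesgue_on U) \<le> (\<integral>x. indicat_real ?R x \<partial>lebesgue_on U)"
    proof (rule integral_mono)
      show "integrable (lebesgue_on U) (\<lambda>x. (norm (indicat_real W x - indicat_real S x))\<^sup>2)"
        by (intro L2_on_integrable L2_on_diff indicator_L2 Um Ws S)
      show "integrable (lebesgue_on U) (indicat_real ?R)"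
      proof -
        have "(norm (indicat_real ?R x))\<^sup>2 = indicat_real ?R x" for x by (simp add: indicator_def)
        then show ?thesis using L2_on_integrable[OF indicator_L2[OF Um, of ?R]] Rm by (simp only: fmeasurableD)
      qed
      show "(norm (indicat_real W x - indicat_real S x))\<^sup>2 \<le> indicat_real ?R x" for x
        using W T Q by (auto simp: indicator_def)
    qed
    also have "\<dots> \<le> (\<integral>x. indicat_real ?R x \<partial>lebesgue)"
    proof -
      have iR: "integrable lebesgue (indicat_real ?R)"
        using Rm unfolding fmeasurable_def by (intro integrable_real_indicator) auto
      have Ui: "U \<inter> space lebesgue \<in> sets lebesgue" using Us by simp
      show ?thesis unfolding integral_restrict_space[OF Ui]
        by (rule integral_mono[OF integrable_mult_indicator[OF Us iR] iR]) (simp add: indicator_def)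
    qed
    also have "\<dots> = measure lebesgue ?R" using Rm by simp
    also have "\<dots> \<le> measure lebesgue (Q - T) + measure lebesgue (S - T)"
      using Q T by (intro measure_Un_le) auto
    also have "\<dots> \<le> d + d"
      using Q(4) T(4) d by (intro add_mono) (simp_all add: measure_def enn2real_leI less_imp_le)
    also have "\<dots> = (e/2)\<^sup>2" by (simp add: d_def power2_eq_square)
    finally show ?thesis unfolding norm2_def using e by (intro real_le_lsqrt) auto
  qed
  then have "norm2 U (\<lambda>x. s k x - indicat_real S x) < e"
    using norm2_diff_triangle[OF test_function_L2[OF Um s_test] indicator_L2[OF Um Ws] indicator_L2[OF Um S(1)], of k] k
    by simp
  then show ?thesis by (intro that[OF s_test[of k]]) (simp only: norm2_minus_commute[of U "indicat_real S"])
qed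

text \<open>The functions approximable by test functions form a vector space that contains the indicator functions, hence the
  simple functions, which are dense by dominated convergence.\<close>

lemma test_functions_dense:
  assumes U: "open U" "bounded U" and f: "L2_on U f" and e: "e > 0"
  obtains \<eta> where "test_function U \<eta>" "norm2 U (\<lambda>x. f x - \<eta> x) < e"
proof -
  have Um: "U \<in> lmeasurable" using U by (rule bounded_open_lmeasurable)
  then have Us: "U \<in> sets lebesgue" by auto
  define P where "P h \<longleftrightarrow> L2_on U h \<and> (\<forall>e>0. \<exists>\<eta>. test_function U \<eta> \<and> norm2 U (\<lambda>x. h x - \<eta> x) < e)" for h
  have PD: "\<exists>\<eta>. test_function U \<eta> \<and> norm2 U (\<lambda>x. h x - \<eta> x) < e" if "P h" "e > 0" for h e
    using that by (simp add: P_def)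
  have P_scale: "P (\<lambda>x. c * h x)" if "P h" for c h
    unfolding P_def
  proof (intro conjI allI impI)
    show "L2_on U (\<lambda>x. c * h x)" using that L2_on_scale[of U h c] by (simp add: P_def)
    fix e :: real assume "e > 0"
    then have "e / (\<bar>c\<bar> + 1) > 0" by simp
    then obtain \<eta> where \<eta>: "test_function U \<eta>" "norm2 U (\<lambda>x. h x - \<eta> x) < e / (\<bar>c\<bar> + 1)"
      using PD[OF \<open>P h\<close>] by blast
    have "norm2 U (\<lambda>x. c * h x - c * \<eta> x) = \<bar>c\<bar> * norm2 U (\<lambda>x. h x - \<eta> x)"
      using norm2_scale[of U c "\<lambda>x. h x - \<eta> x"] by (simp add: right_diff_distrib)
    also have "\<dots> \<le> (\<bar>c\<bar> + 1) * norm2 U (\<lambda>x. h x - \<eta> x)" by (intro mult_right_mono) auto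
    also have "\<dots> < e" using \<eta>(2) by (simp add: pos_less_divide_eq mult.commute)
    finally show "\<exists>\<eta>. test_function U \<eta> \<and> norm2 U (\<lambda>x. c * h x - \<eta> x) < e"
      using test_function_mult[OF \<eta>(1) smooth_const] by blast
  qed
  have P_add: "P (\<lambda>x. h x + h' x)" if "P h" "P h'" for h h'
    unfolding P_def
  proof (intro conjI allI impI)
    show "L2_on U (\<lambda>x. h x + h' x)" using that L2_on_add by (auto simp: P_def)
    fix e :: real assume "e > 0"
    then have "e / 2 > 0" by simp
    then obtain \<eta> \<eta>' where \<eta>: "test_function U \<eta>" "norm2 U (\<lambda>x. h x - \<eta> x) < e / 2"
      "test_function U \<eta>'" "norm2 U (\<lambda>x. h' x - \<eta>' x) < e / 2"
      using PD[OF \<open>P h\<close>] PD[OF \<open>P h'\<close>] by blast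
    have "norm2 U (\<lambda>x. (h x - \<eta> x) + (h' x - \<eta>' x)) < e"
      using norm2_triangle[of U "\<lambda>x. h x - \<eta> x" "\<lambda>x. h' x - \<eta>' x"] \<eta> that test_function_L2[OF Um]
      by (force simp: P_def intro: L2_on_diff)
    moreover have "(h x - \<eta> x) + (h' x - \<eta>' x) = h x + h' x - (\<eta> x + \<eta>' x)" for x by simp
    ultimately show "\<exists>\<eta>. test_function U \<eta> \<and> norm2 U (\<lambda>x. h x + h' x - \<eta> x) < e"
      using test_function_add[OF \<eta>(1,3)] by (auto simp only:)
  qed
  have P_ind: "P (indicat_real S)" if "S \<in> sets lebesgue" "S \<subseteq> U" for S
    unfolding P_def using test_function_approx_indicator[OF U that] indicator_L2[OF Um that(1)] by metis
  have P_cong: "P h'" if "P h" "\<And>x. x \<in> U \<Longrightarrow> h x = h' x" for h h'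
  proof -
    have "norm2 U (\<lambda>x. h x - \<eta> x) = norm2 U (\<lambda>x. h' x - \<eta> x)" for \<eta> using that by (intro norm2_cong) auto
    moreover have "L2_on U h \<longleftrightarrow> L2_on U h'" unfolding L2_on_def
      using that(2) by (intro arg_cong2[where f="(\<and>)"] measurable_cong Bochner_Integration.integrable_cong) auto
    ultimately show ?thesis using that(1) by (simp add: P_def)
  qed
  have P_sum: "P (\<lambda>x. \<Sum>y\<in>Y. y * indicat_real (S y) x)" if "finite Y" "\<And>y. S y \<in> sets lebesgue" "\<And>y. S y \<subseteq> U" for Y S
    using that(1)
  proof induction
    case empty show ?case by (auto simp: P_def norm2_def intro!: exI[of _ "\<lambda>x. 0"] test_function_zero)
  next
    case (insert y Y)
    have "P (\<lambda>x. y * indicat_real (S y) x + (\<Sum>y\<in>Y. y * indicat_real (S y) x))"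
      by (rule P_add[OF P_scale[OF P_ind[OF that(2,3)]] insert.IH])
    then show ?case by (simp only: sum.insert[OF insert.hyps(1,2)])
  qed
  have P_simple: "P h" if "simple_function (lebesgue_on U) h" for h
  proof -
    have fin: "finite (h ` U)" using simple_functionD(1)[OF that] by simp
    let ?S = "\<lambda>y. h -` {y} \<inter> U"
    have "?S y \<in> sets (lebesgue_on U)" for y using simple_functionD(2)[OF that, of "{y}"] by simp
    then have S: "?S y \<in> sets lebesgue" for y using Us by (simp add: sets_restrict_space_iff)
    have "P (\<lambda>x. \<Sum>y\<in>h ` U. y * indicat_real (?S y) x)" by (rule P_sum[OF fin S]) auto
    moreover have "(\<Sum>y\<in>h ` U. y * indicat_real (?S y) x) = h x" if "x \<in> U" for x
    proof -
      have "(\<Sum>y\<in>h ` U. y * indicat_real (?S y) x) = (\<Sum>y\<in>h ` U. if y = h x then y else 0)"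
        using that by (intro sum.cong) (auto simp: indicator_def)
      also have "\<dots> = h x" using fin that by (subst sum.delta) auto
      finally show ?thesis .
    qed
    ultimately show ?thesis by (rule P_cong)
  qed
  obtain s where "\<forall>i. simple_function (lebesgue_on U) (s i)" "\<forall>x\<in>U. (\<lambda>i. s i x) \<longlonglongrightarrow> f x"
    "\<forall>i. \<forall>x\<in>U. norm (s i x) \<le> 2 * norm (f x)"
    using borel_measurable_implies_sequence_metric[OF L2_on_measurable[OF f], of 0] by (auto simp: dist_norm)
  then have s: "simple_function (lebesgue_on U) (s i)" "x \<in> U \<Longrightarrow> (\<lambda>i. s i x) \<longlonglongrightarrow> f x"
    "x \<in> U \<Longrightarrow> norm (s i x) \<le> 2 * norm (f x)" for i x by blast+
  have "(\<lambda>k. norm2 U (\<lambda>x. s k x - f x)) \<longlonglongrightarrow> 0"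
  proof (rule norm2_dominated[where w = "\<lambda>x. 9 * (norm (f x))\<^sup>2"])
    show "integrable (lebesgue_on U) (\<lambda>x. 9 * (norm (f x))\<^sup>2)" using L2_on_integrable[OF f] by simp
    fix k x assume "x \<in> U"
    have "norm (s k x - f x) \<le> 3 * norm (f x)" using s(3)[OF \<open>x \<in> U\<close>, of k] norm_triangle_ineq4[of "s k x" "f x"] by linarith
    from power_mono[OF this, of 2] show "(norm (s k x - f x))\<^sup>2 \<le> 9 * (norm (f x))\<^sup>2" by (simp add: power_mult_distrib)
  qed (rule s borel_measurable_simple_function[OF s(1)] L2_on_measurable[OF f]; assumption?)+
  then have "\<forall>\<^sub>F k in sequentially. norm2 U (\<lambda>x. s k x - f x) < e / 2"
    using e by (intro order_tendstoD) auto
  then obtain k where k: "norm2 U (\<lambda>x. s k x - f x) < e / 2" by (auto simp: eventually_sequentially)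
  have "e / 2 > 0" using e by simp
  then obtain \<eta> where \<eta>: "test_function U \<eta>" "norm2 U (\<lambda>x. s k x - \<eta> x) < e / 2" and "L2_on U (s k)"
    using PD[OF P_simple[OF s(1)[of k]]] P_simple[OF s(1)[of k]] P_def by blast
  then have "norm2 U (\<lambda>x. f x - \<eta> x) < e"
    using norm2_diff_triangle[OF f _ test_function_L2[OF Um \<eta>(1)], of "s k"] k by (simp add: norm2_minus_commute[of U f])
  then show ?thesis using that \<eta>(1) by blast
qed

section \<open>Weak gradients\<close>

abbreviation pd :: "real \<times> real \<Rightarrow> (real \<times> real \<Rightarrow> real) \<Rightarrow> real \<times> real \<Rightarrow> real" where
  "pd e f x \<equiv> frechet_derivative f (at x) e"

lemma fst_grad [simp]: "fst (grad f x) = pd (1,0) f x" and snd_grad [simp]: "snd (grad f x) = pd (0,1) f x"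
  by (simp_all add: grad_def)

lemma L2_integral_subset:
  fixes f :: "'a::euclidean_space \<Rightarrow> real"
  assumes "V \<subseteq> U" "V \<in> sets lebesgue" "U \<in> sets lebesgue" "\<And>x. x \<in> U \<Longrightarrow> x \<notin> V \<Longrightarrow> f x = 0"
  shows "(\<integral>x. f x \<partial>lebesgue_on V) = (\<integral>x. f x \<partial>lebesgue_on U)"
proof -
  have *: "V \<inter> space lebesgue \<in> sets lebesgue" "U \<inter> space lebesgue \<in> sets lebesgue" using assms by simp_all
  have "indicator V x *\<^sub>R f x = indicator U x *\<^sub>R f x" for x
    using assms(1,4) by (cases "x \<in> V"; cases "x \<in> U") auto
  then show ?thesis unfolding integral_restrict_space[OF *(1)] integral_restrict_space[OF *(2)] by (simp only:)
qed

lemma test_function_L2_on: "open U \<Longrightarrow> bounded U \<Longrightarrow> test_function U \<phi> \<Longrightarrow> L2_on U \<phi>"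
  by (rule test_function_L2[OF bounded_open_lmeasurable])

lemma test_function_outside: assumes "test_function V \<phi>" "x \<notin> V" shows "\<phi> x = 0"
proof (rule ccontr)
  assume "\<phi> x \<noteq> 0"
  then have "x \<in> closure {x. \<phi> x \<noteq> 0}" by (intro subsetD[OF closure_subset]) simp
  then show False using assms unfolding test_function_def by blast
qed

lemma H1_grad_iff:
  assumes U: "open U" "bounded U"
  shows "H1_grad U u v \<longleftrightarrow> L2_on U u \<and> L2_on U v \<and> (\<forall>\<phi>. test_function U \<phi> \<longrightarrow>
    (\<integral>x. u x * pd (1,0) \<phi> x \<partial>lebesgue_on U) = - (\<integral>x. \<phi> x * fst (v x) \<partial>lebesgue_on U) \<and>
    (\<integral>x. u x * pd (0,1) \<phi> x \<partial>lebesgue_on U) = - (\<integral>x. \<phi> x * snd (v x) \<partial>lebesgue_on U))"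
proof -
  have "(\<integral>x. u x *\<^sub>R grad \<phi> x \<partial>lebesgue_on U) = - (\<integral>x. \<phi> x *\<^sub>R v x \<partial>lebesgue_on U) \<longleftrightarrow>
    (\<integral>x. u x * pd (1,0) \<phi> x \<partial>lebesgue_on U) = - (\<integral>x. \<phi> x * fst (v x) \<partial>lebesgue_on U) \<and>
    (\<integral>x. u x * pd (0,1) \<phi> x \<partial>lebesgue_on U) = - (\<integral>x. \<phi> x * snd (v x) \<partial>lebesgue_on U)"
    if u: "L2_on U u" and v: "L2_on U v" and \<phi>: "test_function U \<phi>" for \<phi>
  proof -
    have t: "L2_on U (pd e \<phi>)" for e by (intro test_function_L2_on U test_function_derivative \<phi>)
    have t0: "L2_on U \<phi>" by (intro test_function_L2_on U \<phi>)
    note v' = v[unfolded L2_on_pair]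
    have pair: "integrable (lebesgue_on U) h" if "integrable (lebesgue_on U) (\<lambda>x. fst (h x))" "integrable (lebesgue_on U) (\<lambda>x. snd (h x))"
      for h :: "real \<times> real \<Rightarrow> real \<times> real"
    proof -
      have "integrable (lebesgue_on U) (\<lambda>x. fst (h x) *\<^sub>R (1::real,0::real) + snd (h x) *\<^sub>R (0::real,1::real))"
        by (intro Bochner_Integration.integrable_add integrable_scaleR_left that)
      then show ?thesis by simp
    qed
    have i1: "integrable (lebesgue_on U) (\<lambda>x. u x *\<^sub>R grad \<phi> x)"
      by (rule pair) (simp_all add: L2_mult_integrable u t)
    have i2: "integrable (lebesgue_on U) (\<lambda>x. \<phi> x *\<^sub>R v x)"
      by (rule pair) (simp_all add: L2_mult_integrable v' t0)
    show ?thesis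
      unfolding prod_eq_iff fst_uminus snd_uminus
        integral_bounded_linear[OF bounded_linear_fst i1, symmetric] integral_bounded_linear[OF bounded_linear_snd i1, symmetric]
        integral_bounded_linear[OF bounded_linear_fst i2, symmetric] integral_bounded_linear[OF bounded_linear_snd i2, symmetric]
      by simp
  qed
  then show ?thesis unfolding H1_grad_def by blast
qed

lemma H1_gradD:
  assumes "open U" "bounded U" "H1_grad U u v" "test_function U \<phi>"
  shows "(\<integral>x. u x * pd (1,0) \<phi> x \<partial>lebesgue_on U) = - (\<integral>x. \<phi> x * fst (v x) \<partial>lebesgue_on U)"
    "(\<integral>x. u x * pd (0,1) \<phi> x \<partial>lebesgue_on U) = - (\<integral>x. \<phi> x * snd (v x) \<partial>lebesgue_on U)"
  using assms H1_grad_iff[OF assms(1,2)] by blast+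

lemma H1_grad_L2: "H1_grad U u v \<Longrightarrow> L2_on U u" "H1_grad U u v \<Longrightarrow> L2_on U v"
  by (simp_all add: H1_grad_def)

text \<open>By density, a function orthogonal to all test functions is orthogonal to itself.\<close>

lemma L2_zero_of_test:
  assumes U: "open U" "bounded U" and w: "L2_on U w"
    and z: "\<And>\<phi>. test_function U \<phi> \<Longrightarrow> (\<integral>x. \<phi> x * w x \<partial>lebesgue_on U) = 0"
  shows "norm2 U w = 0"
proof (rule ccontr)
  assume "norm2 U w \<noteq> 0"
  then have pos: "norm2 U w > 0" by (simp add: less_le)
  then obtain \<phi> where \<phi>: "test_function U \<phi>" "norm2 U (\<lambda>x. w x - \<phi> x) < norm2 U w"
    using test_functions_dense[OF U w] by blast
  have t: "L2_on U \<phi>" by (intro test_function_L2_on U \<phi>)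
  have "(norm2 U w)\<^sup>2 = (\<integral>x. w x * w x \<partial>lebesgue_on U) - (\<integral>x. \<phi> x * w x \<partial>lebesgue_on U)"
    using z[OF \<phi>(1)] unfolding norm2_sq real_norm_def power2_abs by (simp add: power2_eq_square)
  also have "\<dots> = (\<integral>x. (w x - \<phi> x) * w x \<partial>lebesgue_on U)"
    using L2_mult_integrable[OF w w] L2_mult_integrable[OF t w] by (simp add: left_diff_distrib)
  also have "\<dots> \<le> norm2 U (\<lambda>x. w x - \<phi> x) * norm2 U w"
    using L2_Cauchy_Schwarz[OF L2_on_diff[OF w t] w] by simp
  also have "\<dots> < norm2 U w * norm2 U w" using \<phi>(2) pos by (intro mult_strict_right_mono)
  finally show False by (simp add: power2_eq_square)
qed

text \<open>Both components of the difference of two weak gradients are orthogonal to all test functions.\<close>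

lemma H1_grad_unique:
  assumes U: "open U" "bounded U" and "H1_grad U u v" "H1_grad U u v'"
  shows "norm2 U (\<lambda>x. v x - v' x) = 0"
proof -
  note v = H1_grad_L2(2)[OF assms(3)] and v' = H1_grad_L2(2)[OF assms(4)]
  note vp = v[unfolded L2_on_pair] and vp' = v'[unfolded L2_on_pair]
  have "norm2 U (\<lambda>x. fst (v x) - fst (v' x)) = 0"
  proof (rule L2_zero_of_test[OF U])
    fix \<phi> assume \<phi>: "test_function U \<phi>"
    then have t: "L2_on U \<phi>" by (intro test_function_L2_on U)
    show "(\<integral>x. \<phi> x * (fst (v x) - fst (v' x)) \<partial>lebesgue_on U) = 0"
      using H1_gradD(1)[OF U assms(3) \<phi>] H1_gradD(1)[OF U assms(4) \<phi>] L2_mult_integrable[OF t, of "\<lambda>x. fst (v x)"]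
        L2_mult_integrable[OF t, of "\<lambda>x. fst (v' x)"] vp vp' by (simp add: right_diff_distrib)
  qed (use vp vp' L2_on_diff in auto)
  moreover have "norm2 U (\<lambda>x. snd (v x) - snd (v' x)) = 0"
  proof (rule L2_zero_of_test[OF U])
    fix \<phi> assume \<phi>: "test_function U \<phi>"
    then have t: "L2_on U \<phi>" by (intro test_function_L2_on U)
    show "(\<integral>x. \<phi> x * (snd (v x) - snd (v' x)) \<partial>lebesgue_on U) = 0"
      using H1_gradD(2)[OF U assms(3) \<phi>] H1_gradD(2)[OF U assms(4) \<phi>] L2_mult_integrable[OF t, of "\<lambda>x. snd (v x)"]
        L2_mult_integrable[OF t, of "\<lambda>x. snd (v' x)"] vp vp' by (simp add: right_diff_distrib)
  qed (use vp vp' L2_on_diff in auto)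
  ultimately show ?thesis using norm2_pair[OF L2_on_diff[OF v v']] by simp
qed

lemma H1_grad_comb:
  assumes U: "open U" "bounded U" and "H1_grad U u v" "H1_grad U u' v'"
  shows "H1_grad U (\<lambda>x. a * u x + b * u' x) (\<lambda>x. a *\<^sub>R v x + b *\<^sub>R v' x)"
proof -
  note L = H1_grad_L2[OF assms(3)] H1_grad_L2[OF assms(4)]
  note P = L(2,4)[unfolded L2_on_pair]
  show ?thesis unfolding H1_grad_iff[OF U]
  proof (intro conjI allI impI)
    show "L2_on U (\<lambda>x. a * u x + b * u' x)" "L2_on U (\<lambda>x. a *\<^sub>R v x + b *\<^sub>R v' x)"
      using L2_on_comb[OF L(1,3), of a b] L2_on_comb[OF L(2,4), of a b] by simp_all
    fix \<phi> assume \<phi>: "test_function U \<phi>"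
    then have t: "L2_on U \<phi>" "\<And>e. L2_on U (pd e \<phi>)" by (auto intro!: test_function_L2_on U test_function_derivative)
    have e: "(\<integral>x. (a * f x + b * g x) * h x \<partial>lebesgue_on U) = a * (\<integral>x. f x * h x \<partial>lebesgue_on U) + b * (\<integral>x. g x * h x \<partial>lebesgue_on U)"
      if "L2_on U f" "L2_on U g" "L2_on U h" for f g h :: "real \<times> real \<Rightarrow> real"
      using L2_mult_integrable[OF that(1,3)] L2_mult_integrable[OF that(2,3)] by (simp add: distrib_right mult.assoc)
    have e': "(\<integral>x. h x * (a * f x + b * g x) \<partial>lebesgue_on U) = a * (\<integral>x. h x * f x \<partial>lebesgue_on U) + b * (\<integral>x. h x * g x \<partial>lebesgue_on U)"
      if "L2_on U f" "L2_on U g" "L2_on U h" for f g h :: "real \<times> real \<Rightarrow> real"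
      using e[OF that] by (simp add: mult.commute)
    show "(\<integral>x. (a * u x + b * u' x) * pd (1,0) \<phi> x \<partial>lebesgue_on U) = - (\<integral>x. \<phi> x * fst (a *\<^sub>R v x + b *\<^sub>R v' x) \<partial>lebesgue_on U)"
      using H1_gradD(1)[OF U assms(3) \<phi>] H1_gradD(1)[OF U assms(4) \<phi>] by (simp add: e e' L P t)
    show "(\<integral>x. (a * u x + b * u' x) * pd (0,1) \<phi> x \<partial>lebesgue_on U) = - (\<integral>x. \<phi> x * snd (a *\<^sub>R v x + b *\<^sub>R v' x) \<partial>lebesgue_on U)"
      using H1_gradD(2)[OF U assms(3) \<phi>] H1_gradD(2)[OF U assms(4) \<phi>] by (simp add: e e' L P t)
  qed
qed

lemma H1_grad_subset:
  assumes U: "open U" "bounded U" and V: "open V" "V \<subseteq> U" and h: "H1_grad U u v"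
  shows "H1_grad V u v"
proof -
  have b: "bounded V" using U V bounded_subset by blast
  have s: "V \<in> sets lebesgue" "U \<in> sets lebesgue" using U V by auto
  show ?thesis unfolding H1_grad_iff[OF V(1) b]
  proof (intro conjI allI impI)
    show "L2_on V u" "L2_on V v" using L2_on_subset(1)[OF _ V(2) s] H1_grad_L2[OF h] by auto
    fix \<phi> assume \<phi>: "test_function V \<phi>"
    then have \<phi>': "test_function U \<phi>" using V(2) by (rule test_function_mono)
    have z: "pd e \<phi> x = 0" if "x \<notin> V" for x e
      by (rule test_function_outside[OF test_function_derivative[OF \<phi>] that])
    have z': "\<phi> x = 0" if "x \<notin> V" for x by (rule test_function_outside[OF \<phi> that])
    have e: "(\<integral>x. f x \<partial>lebesgue_on V) = (\<integral>x. f x \<partial>lebesgue_on U)" if "\<And>x. x \<notin> V \<Longrightarrow> f x = 0" for f :: "_ \<Rightarrow> real"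
      using that by (intro L2_integral_subset[OF V(2) s]) auto
    show "(\<integral>x. u x * pd (1,0) \<phi> x \<partial>lebesgue_on V) = - (\<integral>x. \<phi> x * fst (v x) \<partial>lebesgue_on V)"
      using H1_gradD(1)[OF U h \<phi>'] by (subst (1 2) e) (simp_all add: z z')
    show "(\<integral>x. u x * pd (0,1) \<phi> x \<partial>lebesgue_on V) = - (\<integral>x. \<phi> x * snd (v x) \<partial>lebesgue_on V)"
      using H1_gradD(2)[OF U h \<phi>'] by (subst (1 2) e) (simp_all add: z z')
  qed
qed

lemma L2_inner_tendsto:
  assumes f: "\<And>k. L2_on U (f k)" "L2_on U F" and g: "L2_on U g"
    and lim: "(\<lambda>k. norm2 U (\<lambda>x. f k x - F x)) \<longlonglongrightarrow> 0"
  shows "(\<lambda>k. \<integral>x. f k x \<bullet> g x \<partial>lebesgue_on U) \<longlonglongrightarrow> (\<integral>x. F x \<bullet> g x \<partial>lebesgue_on U)"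
proof (rule LIM_zero_cancel, rule Lim_null_comparison)
  show "(\<lambda>k. norm2 U (\<lambda>x. f k x - F x) * norm2 U g) \<longlonglongrightarrow> 0" using tendsto_mult[OF lim tendsto_const] by simp
  show "\<forall>\<^sub>F k in sequentially. norm ((\<integral>x. f k x \<bullet> g x \<partial>lebesgue_on U) - (\<integral>x. F x \<bullet> g x \<partial>lebesgue_on U))
      \<le> norm2 U (\<lambda>x. f k x - F x) * norm2 U g"
    using L2_Cauchy_Schwarz[OF L2_on_diff[OF f(1,2)] g] L2_inner_integrable[OF f(1) g] L2_inner_integrable[OF f(2) g]
    by (intro always_eventually allI) (simp add: inner_diff_left)
qed

lemma norm2_tendsto_fst:
  fixes f :: "nat \<Rightarrow> 'a::euclidean_space \<Rightarrow> real \<times> real"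
  assumes f: "\<And>k. L2_on U (f k)" "L2_on U F" and lim: "(\<lambda>k. norm2 U (\<lambda>x. f k x - F x)) \<longlonglongrightarrow> 0"
  shows "(\<lambda>k. norm2 U (\<lambda>x. fst (f k x) - fst (F x))) \<longlonglongrightarrow> 0" "(\<lambda>k. norm2 U (\<lambda>x. snd (f k x) - snd (F x))) \<longlonglongrightarrow> 0"
proof -
  show "(\<lambda>k. norm2 U (\<lambda>x. fst (f k x) - fst (F x))) \<longlonglongrightarrow> 0"
    by (rule Lim_null_comparison[OF _ lim]) (use norm2_fst[OF L2_on_diff[OF f]] in simp)
  show "(\<lambda>k. norm2 U (\<lambda>x. snd (f k x) - snd (F x))) \<longlonglongrightarrow> 0"
    by (rule Lim_null_comparison[OF _ lim]) (use norm2_snd[OF L2_on_diff[OF f]] in simp)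
qed

text \<open>Closedness of the weak gradient: both sides of the defining identity are continuous in
  \<open>L\<^sup>2\<close>.\<close>

lemma H1_grad_limit:
  assumes U: "open U" "bounded U" and h: "\<And>k. H1_grad U (u k) (v k)" and L: "L2_on U u'" "L2_on U v'"
    and lu: "(\<lambda>k. norm2 U (\<lambda>x. u k x - u' x)) \<longlonglongrightarrow> 0" and lv: "(\<lambda>k. norm2 U (\<lambda>x. v k x - v' x)) \<longlonglongrightarrow> 0"
  shows "H1_grad U u' v'"
  unfolding H1_grad_iff[OF U]
proof (intro conjI allI impI L)
  fix \<phi> assume \<phi>: "test_function U \<phi>"
  then have t: "L2_on U \<phi>" "\<And>e. L2_on U (pd e \<phi>)" by (auto intro!: test_function_L2_on U test_function_derivative)
  have Lk: "L2_on U (u k)" "L2_on U (v k)" "L2_on U (\<lambda>x. fst (v k x))" "L2_on U (\<lambda>x. snd (v k x))" for k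
    using H1_grad_L2[OF h, of k] by (auto simp: L2_on_pair)
  have L': "L2_on U (\<lambda>x. fst (v' x))" "L2_on U (\<lambda>x. snd (v' x))" using L by (auto simp: L2_on_pair)
  note lv' = norm2_tendsto_fst[OF Lk(2) L(2) lv]
  show "(\<integral>x. u' x * pd (1,0) \<phi> x \<partial>lebesgue_on U) = - (\<integral>x. \<phi> x * fst (v' x) \<partial>lebesgue_on U)"
    using LIMSEQ_unique[OF L2_inner_tendsto[OF Lk(1) L(1) t(2)[of "(1,0)"] lu, simplified]]
      tendsto_minus[OF L2_inner_tendsto[OF Lk(3) L'(1) t(1) lv'(1), simplified]] H1_gradD(1)[OF U h \<phi>]
    by (simp add: mult.commute[of "\<phi> _"])
  show "(\<integral>x. u' x * pd (0,1) \<phi> x \<partial>lebesgue_on U) = - (\<integral>x. \<phi> x * snd (v' x) \<partial>lebesgue_on U)"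
    using LIMSEQ_unique[OF L2_inner_tendsto[OF Lk(1) L(1) t(2)[of "(0,1)"] lu, simplified]]
      tendsto_minus[OF L2_inner_tendsto[OF Lk(4) L'(2) t(1) lv'(2), simplified]] H1_gradD(2)[OF U h \<phi>]
    by (simp add: mult.commute[of "\<phi> _"])
qed

text \<open>The integral of a difference quotient vanishes by translation invariance, and the difference quotients converge
  boundedly, with a common bounded support, to the derivative.\<close>

lemma integral_pd_test:
  assumes \<phi>: "test_function UNIV \<phi>"
  shows "(\<integral>x. pd e \<phi> x \<partial>lebesgue) = 0"
proof -
  obtain K where "compact K" "K \<subseteq> UNIV" and K0: "\<And>x. x \<notin> K \<Longrightarrow> \<phi> x = 0" using test_functionE[OF \<phi>] by blast
  note K = \<open>compact K\<close> K0
  obtain C where C: "\<And>x. \<bar>pd e \<phi> x\<bar> \<le> C" "C \<ge> 0" using test_function_bounded[OF test_function_derivative[OF \<phi>, of e]] by blast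
  obtain R where R: "\<And>x. x \<in> K \<Longrightarrow> norm x \<le> R" using compact_imp_bounded[OF K(1)] by (auto simp: bounded_iff)
  have sm: "smooth \<phi>" using \<phi> by (rule test_function_smooth)
  have [measurable]: "\<phi> \<in> borel_measurable lborel" "pd e \<phi> \<in> borel_measurable lborel"
    using sm smooth_derivative(2)[OF sm, of e] by (auto intro!: borel_measurable_continuous_onI smooth_cont)
  define t where "t = (\<lambda>k. 1 / real (Suc k))"
  have t: "0 < t k" "t k \<le> 1" for k by (auto simp: t_def)
  have t0: "t \<longlonglongrightarrow> 0" unfolding t_def using LIMSEQ_inverse_real_of_nat by (simp add: inverse_eq_divide)
  define q where "q = (\<lambda>k x. (\<phi> (x + t k *\<^sub>R e) - \<phi> x) / t k)"
  have [measurable]: "q k \<in> borel_measurable lborel" for k unfolding q_def by measurable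
  have ray: "((\<lambda>s. \<phi> (x + s *\<^sub>R e)) has_real_derivative pd e \<phi> (x + s *\<^sub>R e)) (at s)" for x s
  proof -
    have "((\<lambda>s. x + s *\<^sub>R e) has_derivative (\<lambda>h. h *\<^sub>R e)) (at s)" by (auto intro!: derivative_eq_intros)
    from has_derivative_compose[OF this smooth_derivative(1)[OF sm]]
    have "((\<lambda>s. \<phi> (x + s *\<^sub>R e)) has_derivative (\<lambda>h. pd (h *\<^sub>R e) \<phi> (x + s *\<^sub>R e))) (at s)" .
    moreover have "pd (h *\<^sub>R e) \<phi> y = h * pd e \<phi> y" for h y
      by (simp add: linear_scale[OF has_derivative_linear[OF smooth_derivative(1)[OF sm]]])
    ultimately show ?thesis by (simp add: has_field_derivative_def mult_commute_abs)
  qed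
  have qb: "\<bar>q k x\<bar> \<le> C" for k x
  proof -
    obtain z where "\<phi> (x + t k *\<^sub>R e) - \<phi> (x + 0 *\<^sub>R e) = (t k - 0) * pd e \<phi> (x + z *\<^sub>R e)"
      using MVT2[OF t(1) ray, of k x] by blast
    then have "q k x = pd e \<phi> (x + z *\<^sub>R e)" using t(1)[of k] by (simp add: q_def)
    then show ?thesis using C by simp
  qed
  have q0: "q k x = 0" if "norm x > R + norm e" for k x
  proof -
    have "norm (t k *\<^sub>R e) \<le> norm e" using t[of k] by (simp add: mult_left_le_one_le)
    then have "norm (x + t k *\<^sub>R e) > R" using that norm_triangle_ineq4[of "x + t k *\<^sub>R e" "t k *\<^sub>R e"] by simp
    then have "x + t k *\<^sub>R e \<notin> K" using R by (meson linorder_not_le)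
    moreover have "norm x > R" using that norm_ge_zero[of e] by linarith
    then have "x \<notin> K" using R by (meson linorder_not_le)
    ultimately show ?thesis by (simp add: q_def K(2))
  qed
  have "(\<lambda>k. \<integral>x. q k x \<partial>lborel) \<longlonglongrightarrow> (\<integral>x. pd e \<phi> x \<partial>lborel)"
  proof (rule integral_dominated_convergence[where w = "\<lambda>x. indicator (cball 0 (R + norm e)) x *\<^sub>R C"])
    show "integrable lborel (\<lambda>x. indicator (cball 0 (R + norm e)) x *\<^sub>R C)"
      by (intro integrable_scaleR_left integrable_real_indicator) (use emeasure_bounded_finite[OF bounded_cball] in simp_all)
    show "AE x in lborel. (\<lambda>k. q k x) \<longlonglongrightarrow> pd e \<phi> x"
    proof (rule AE_I2)
      fix x
      have "((\<lambda>h. (\<phi> (x + (0 + h) *\<^sub>R e) - \<phi> (x + 0 *\<^sub>R e)) / h) \<longlongrightarrow> pd e \<phi> (x + 0 *\<^sub>R e)) (at 0)"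
        using ray[of x 0] by (simp add: DERIV_def)
      moreover have "filterlim t (at 0) sequentially"
        using t0 t(1) by (auto simp: filterlim_at less_imp_neq[symmetric])
      ultimately have "(\<lambda>k. (\<phi> (x + (0 + t k) *\<^sub>R e) - \<phi> (x + 0 *\<^sub>R e)) / t k) \<longlonglongrightarrow> pd e \<phi> (x + 0 *\<^sub>R e)"
        by (rule filterlim_compose)
      then show "(\<lambda>k. q k x) \<longlonglongrightarrow> pd e \<phi> x" by (simp add: q_def)
    qed
    show "AE x in lborel. norm (q k x) \<le> indicator (cball 0 (R + norm e)) x *\<^sub>R C" for k
    proof (rule AE_I2)
      fix x show "norm (q k x) \<le> indicator (cball 0 (R + norm e)) x *\<^sub>R C"
        using qb[of k x] q0[of x k] by (cases "norm x > R + norm e") (auto simp: indicator_def)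
    qed
  qed measurable
  moreover have "(\<integral>x. q k x \<partial>lborel) = 0" for k
  proof -
    have i: "integrable lborel \<phi>"
    proof -
      obtain B where B: "\<And>x. \<bar>\<phi> x\<bar> \<le> B" "B \<ge> 0" using test_function_bounded[OF \<phi>] by blast
      have w: "integrable lborel (\<lambda>x. indicator (cball 0 R) x *\<^sub>R B)"
        by (intro integrable_scaleR_left integrable_real_indicator) (use emeasure_bounded_finite[OF bounded_cball] in simp_all)
      show ?thesis
      proof (rule Bochner_Integration.integrable_bound[OF w _ AE_I2])
        fix x show "norm (\<phi> x) \<le> norm (indicator (cball 0 R) x *\<^sub>R B)"
          using B R[of x] K(2)[of x] by (cases "x \<in> K") auto
      qed measurable
    qed
    have "(\<integral>x. \<phi> (t k *\<^sub>R e + x) \<partial>lborel) = (\<integral>x. \<phi> x \<partial>distr lborel borel ((+) (t k *\<^sub>R e)))"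
      by (subst integral_distr) auto
    then have "(\<integral>x. \<phi> (x + t k *\<^sub>R e) \<partial>lborel) = (\<integral>x. \<phi> x \<partial>lborel)" by (simp add: lborel_distr_plus add.commute)
    moreover have "integrable lborel (\<lambda>x. \<phi> (x + t k *\<^sub>R e))"
    proof -
      have "integrable (distr lborel borel ((+) (t k *\<^sub>R e))) \<phi>" using i by (simp add: lborel_distr_plus)
      then have "integrable lborel (\<lambda>x. \<phi> (t k *\<^sub>R e + x))" by (subst (asm) integrable_distr_eq) auto
      then show ?thesis by (simp add: add.commute)
    qed
    ultimately show ?thesis using i by (simp add: q_def)
  qed
  ultimately have "(\<integral>x. pd e \<phi> x \<partial>lborel) = 0" by (simp add: LIMSEQ_const_iff)
  then show ?thesis by (simp add: integral_completion)
qed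

lemma smooth_slices:
  assumes f: "smooth f"
  shows "((\<lambda>s. f (s, t)) has_real_derivative pd (1,0) f (s, t)) (at s)"
    and "((\<lambda>t. f (s, t)) has_real_derivative pd (0,1) f (s, t)) (at t)"
proof -
  have a: "((\<lambda>s. (s, t)) has_derivative (\<lambda>h. (h, 0))) (at s)" by (auto intro!: derivative_eq_intros)
  have a': "((\<lambda>s. f (s, t)) has_derivative (\<lambda>h. pd (h, 0) f (s, t))) (at s)"
    using has_derivative_compose[OF a smooth_derivative(1)[OF f, of "(s, t)"]] .
  have ea: "(\<lambda>h. pd (h, 0) f (s, t)) = (*) (pd (1,0) f (s, t))"
  proof (rule ext)
    fix h show "pd (h, 0) f (s, t) = pd (1,0) f (s, t) * h"
      using has_derivative_pair_expand[OF smooth_derivative(1)[OF f], where a = h and b = 0]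
      by (simp only: mult_zero_left add_0_right mult.commute)
  qed
  show "((\<lambda>s. f (s, t)) has_real_derivative pd (1,0) f (s, t)) (at s)"
    using a' unfolding has_field_derivative_def by (simp only: ea)
  have b: "((\<lambda>t. (s, t)) has_derivative (\<lambda>h. (0, h))) (at t)" by (auto intro!: derivative_eq_intros)
  have b': "((\<lambda>t. f (s, t)) has_derivative (\<lambda>h. pd (0, h) f (s, t))) (at t)"
    using has_derivative_compose[OF b smooth_derivative(1)[OF f, of "(s, t)"]] .
  have eb: "(\<lambda>h. pd (0, h) f (s, t)) = (*) (pd (0,1) f (s, t))"
  proof (rule ext)
    fix h show "pd (0, h) f (s, t) = pd (0,1) f (s, t) * h"
      using has_derivative_pair_expand[OF smooth_derivative(1)[OF f], where a = 0 and b = h]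
      by (simp only: mult_zero_left add_0_left mult.commute)
  qed
  show "((\<lambda>t. f (s, t)) has_real_derivative pd (0,1) f (s, t)) (at t)"
    using b' unfolding has_field_derivative_def by (simp only: eb)
qed

lemma pd_mult:
  assumes "smooth f" "smooth g" shows "pd e (\<lambda>x. f x * g x) x = f x * pd e g x + pd e f x * g x"
  using frechet_derivative_at[OF has_derivative_mult[OF smooth_derivative(1)[OF assms(1)] smooth_derivative(1)[OF assms(2)]], of x]
  by metis

lemma test_integral_UNIV:
  assumes "open U" "test_function U \<phi>"
  shows "(\<integral>x. f x * \<phi> x \<partial>lebesgue_on U) = (\<integral>x. f x * \<phi> x \<partial>lebesgue)"
proof -
  have z: "\<phi> x = 0" if "x \<notin> U" for x by (rule test_function_outside[OF assms(2) that])
  have "(\<integral>x. f x * \<phi> x \<partial>lebesgue_on U) = (\<integral>x. f x * \<phi> x \<partial>lebesgue_on UNIV)"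
    using assms z by (intro L2_integral_subset) auto
  then show ?thesis by (simp add: lebesgue_on_UNIV_eq)
qed

text \<open>The product is a test function, so the integral of its derivative vanishes.\<close>

lemma integration_by_parts:
  assumes U: "open U" "bounded U" and f: "smooth f" and \<phi>: "test_function U \<phi>"
  shows "(\<integral>x. f x * pd e \<phi> x \<partial>lebesgue_on U) = - (\<integral>x. \<phi> x * pd e f x \<partial>lebesgue_on U)"
proof -
  have \<phi>': "test_function UNIV \<phi>" using \<phi> by (rule test_function_mono) simp
  have s: "smooth \<phi>" using \<phi> by (rule test_function_smooth)
  have "(\<integral>x. pd e (\<lambda>x. f x * \<phi> x) x \<partial>lebesgue) = 0"
    by (intro integral_pd_test test_function_mult \<phi>' f)
  moreover have "(\<integral>x. 1 * pd e (\<lambda>x. f x * \<phi> x) x \<partial>lebesgue_on U) = (\<integral>x. 1 * pd e (\<lambda>x. f x * \<phi> x) x \<partial>lebesgue)"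
    by (intro test_integral_UNIV U test_function_derivative test_function_mult \<phi> f)
  ultimately have "(\<integral>x. f x * pd e \<phi> x + pd e f x * \<phi> x \<partial>lebesgue_on U) = 0"
    by (simp add: pd_mult f s)
  moreover have "integrable (lebesgue_on U) (\<lambda>x. f x * pd e \<phi> x)" "integrable (lebesgue_on U) (\<lambda>x. pd e f x * \<phi> x)"
  proof -
    have one: "L2_on U (\<lambda>x. 1::real)" by (rule L2_on_bounded[where C = 1]) (auto intro: bounded_open_lmeasurable U)
    have "L2_on U (\<lambda>x. f x * pd e \<phi> x)" "L2_on U (\<lambda>x. pd e f x * \<phi> x)"
      by (intro test_function_L2_on U test_function_mult test_function_derivative smooth_derivative f \<phi>)+
    from this[THEN L2_mult_integrable[OF one]]
    show "integrable (lebesgue_on U) (\<lambda>x. f x * pd e \<phi> x)" "integrable (lebesgue_on U) (\<lambda>x. pd e f x * \<phi> x)" by simp_all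
  qed
  ultimately show ?thesis by (simp add: mult.commute)
qed

lemma smooth_L2:
  assumes U: "open U" "bounded U" and f: "smooth f" shows "L2_on U f"
proof -
  have "compact (f ` closure U)"
    using U by (intro compact_continuous_image smooth_cont f) (simp add: compact_eq_bounded_closed bounded_closure)
  then obtain C where "\<And>x. x \<in> closure U \<Longrightarrow> norm (f x) \<le> C"
    by (meson compact_imp_bounded bounded_iff imageI)
  then show ?thesis
    using closure_subset U by (intro L2_on_bounded[where C=C] bounded_open_lmeasurable smooth_measurable f) auto
qed

lemma smooth_grad_L2:
  assumes U: "open U" "bounded U" and f: "smooth f" shows "L2_on U (grad f)"
  unfolding L2_on_pair by (simp add: smooth_L2[OF U] smooth_derivative(2)[OF f])

lemma H1_grad_smooth:
  assumes U: "open U" "bounded U" and f: "smooth f" shows "H1_grad U f (grad f)"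
  unfolding H1_grad_iff[OF U]
  by (auto intro!: smooth_L2 smooth_grad_L2 U f integration_by_parts)

section \<open>Quadratic forms and their minimizers\<close>

text \<open>The bilinear form of a diagonal stiffness. The energy of a displacement depends on it through its gradient only, hence
  the arguments are vector fields.\<close>

definition form :: "(real \<times> real) set \<Rightarrow> (real \<times> real \<Rightarrow> real) \<Rightarrow> (real \<times> real \<Rightarrow> real) \<Rightarrow>
    (real \<times> real \<Rightarrow> real \<times> real) \<Rightarrow> (real \<times> real \<Rightarrow> real \<times> real) \<Rightarrow> real" where
  "form U \<alpha> \<beta> v w = (\<integral>x. \<alpha> x * (fst (v x) * fst (w x)) + \<beta> x * (snd (v x) * snd (w x)) \<partial>lebesgue_on U)"

text \<open>Only boundedness is required here: differences and derivatives of stiffnesses are weights of either sign.\<close>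

definition weight :: "(real \<times> real) set \<Rightarrow> real \<Rightarrow> (real \<times> real \<Rightarrow> real) \<Rightarrow> bool" where
  "weight U K \<alpha> \<longleftrightarrow> \<alpha> \<in> borel_measurable (lebesgue_on U) \<and> (\<forall>x\<in>U. \<bar>\<alpha> x\<bar> \<le> K)"

lemma weighted_field:
  assumes w: "weight U K \<alpha>" "weight U K \<beta>" and v: "L2_on U v"
  shows "L2_on U (\<lambda>x. (\<alpha> x * fst (v x), \<beta> x * snd (v x)))"
    and "norm2 U (\<lambda>x. (\<alpha> x * fst (v x), \<beta> x * snd (v x))) \<le> \<bar>K\<bar> * norm2 U v"
proof -
  let ?w = "\<lambda>x. (\<alpha> x * fst (v x), \<beta> x * snd (v x))"
  have K: "\<bar>\<alpha> x\<bar> \<le> \<bar>K\<bar>" "\<bar>\<beta> x\<bar> \<le> \<bar>K\<bar>" if "x \<in> U" for x using w that unfolding weight_def by force+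
  have m: "\<alpha> \<in> borel_measurable (lebesgue_on U)" "\<beta> \<in> borel_measurable (lebesgue_on U)" using w by (auto simp: weight_def)
  note vp = v[unfolded L2_on_pair]
  note a = L2_on_bounded_mult_real[OF vp[THEN conjunct1] m(1) K(1)] and b = L2_on_bounded_mult_real[OF vp[THEN conjunct2] m(2) K(2)]
  show L: "L2_on U ?w" unfolding L2_on_pair using a b by simp
  have "(norm2 U ?w)\<^sup>2 \<le> (\<bar>K\<bar> * norm2 U (\<lambda>x. fst (v x)))\<^sup>2 + (\<bar>K\<bar> * norm2 U (\<lambda>x. snd (v x)))\<^sup>2"
    unfolding norm2_pair[OF L] fst_conv snd_conv using a b by (intro add_mono power_mono) auto
  also have "\<dots> = (\<bar>K\<bar> * norm2 U v)\<^sup>2" unfolding power_mult_distrib norm2_pair[OF v] by (simp add: distrib_left)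
  finally show "norm2 U ?w \<le> \<bar>K\<bar> * norm2 U v" by (rule power2_le_imp_le) simp
qed

lemma form_inner: "form U \<alpha> \<beta> v w = (\<integral>x. (\<alpha> x * fst (v x), \<beta> x * snd (v x)) \<bullet> w x \<partial>lebesgue_on U)"
  unfolding form_def by (simp add: inner_prod_def mult.assoc)

lemma form_integrable:
  assumes "weight U K \<alpha>" "weight U K \<beta>" "L2_on U v" "L2_on U w"
  shows "integrable (lebesgue_on U) (\<lambda>x. \<alpha> x * (fst (v x) * fst (w x)) + \<beta> x * (snd (v x) * snd (w x)))"
  using L2_inner_integrable[OF weighted_field(1)[OF assms(1-3)] assms(4)] by (simp add: inner_prod_def mult.assoc)

lemma form_bound:
  assumes "weight U K \<alpha>" "weight U K \<beta>" "L2_on U v" "L2_on U w"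
  shows "\<bar>form U \<alpha> \<beta> v w\<bar> \<le> \<bar>K\<bar> * norm2 U v * norm2 U w"
  unfolding form_inner
  using L2_Cauchy_Schwarz[OF weighted_field(1)[OF assms(1-3)] assms(4)]
    mult_right_mono[OF weighted_field(2)[OF assms(1-3)] norm2_nonneg[of U w]] by linarith

lemma form_sym: "form U \<alpha> \<beta> v w = form U \<alpha> \<beta> w v"
  unfolding form_def by (simp add: mult.commute)

lemma form_comb:
  assumes "weight U K \<alpha>" "weight U K \<beta>" "L2_on U v" "L2_on U v'" "L2_on U w"
  shows "form U \<alpha> \<beta> (\<lambda>x. a *\<^sub>R v x + b *\<^sub>R v' x) w = a * form U \<alpha> \<beta> v w + b * form U \<alpha> \<beta> v' w"
proof -
  let ?f = "\<lambda>v x. \<alpha> x * (fst (v x) * fst (w x)) + \<beta> x * (snd (v x) * snd (w x))"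
  have "form U \<alpha> \<beta> (\<lambda>x. a *\<^sub>R v x + b *\<^sub>R v' x) w = (\<integral>x. a * ?f v x + b * ?f v' x \<partial>lebesgue_on U)"
    unfolding form_def by (intro Bochner_Integration.integral_cong) (auto simp: algebra_simps)
  also have "\<dots> = a * form U \<alpha> \<beta> v w + b * form U \<alpha> \<beta> v' w"
    unfolding form_def using form_integrable[OF assms(1,2) assms(3,5)] form_integrable[OF assms(1,2) assms(4,5)]
    by (subst Bochner_Integration.integral_add) (auto simp del: distrib_left_numeral)
  finally show ?thesis .
qed

lemma form_diff:
  assumes "weight U K \<alpha>" "weight U K \<beta>" "L2_on U v" "L2_on U v'" "L2_on U w"
  shows "form U \<alpha> \<beta> (\<lambda>x. v x - v' x) w = form U \<alpha> \<beta> v w - form U \<alpha> \<beta> v' w"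
    "form U \<alpha> \<beta> w (\<lambda>x. v x - v' x) = form U \<alpha> \<beta> w v - form U \<alpha> \<beta> w v'"
  using form_comb[OF assms, of 1 "-1"] by (simp_all add: form_sym[of U \<alpha> \<beta> w])

lemma form_quad:
  assumes "weight U K \<alpha>" "weight U K \<beta>" "L2_on U v" "L2_on U w"
  shows "form U \<alpha> \<beta> (\<lambda>x. a *\<^sub>R v x + b *\<^sub>R w x) (\<lambda>x. a *\<^sub>R v x + b *\<^sub>R w x) =
    a\<^sup>2 * form U \<alpha> \<beta> v v + 2 * a * b * form U \<alpha> \<beta> v w + b\<^sup>2 * form U \<alpha> \<beta> w w"
proof -
  let ?z = "\<lambda>x. a *\<^sub>R v x + b *\<^sub>R w x"
  have L: "L2_on U ?z" by (intro L2_on_comb assms)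
  have "form U \<alpha> \<beta> ?z ?z = a * form U \<alpha> \<beta> ?z v + b * form U \<alpha> \<beta> ?z w"
    unfolding form_comb[OF assms L] form_sym[of U \<alpha> \<beta> ?z] ..
  then show ?thesis
    unfolding form_comb[OF assms(1-4) assms(3)] form_comb[OF assms(1-4) assms(4)] form_sym[of U \<alpha> \<beta> w v]
    by (simp add: power2_eq_square algebra_simps)
qed

lemma form_weight_comb:
  assumes "weight U K \<alpha>" "weight U K \<beta>" "weight U K' \<alpha>'" "weight U K' \<beta>'" "L2_on U v" "L2_on U w"
  shows "form U (\<lambda>x. \<alpha> x + t * \<alpha>' x) (\<lambda>x. \<beta> x + t * \<beta>' x) v w = form U \<alpha> \<beta> v w + t * form U \<alpha>' \<beta>' v w"
proof -
  let ?f = "\<lambda>\<alpha> \<beta> x. \<alpha> x * (fst (v x) * fst (w x)) + \<beta> x * (snd (v x) * snd (w x))"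
  have "form U (\<lambda>x. \<alpha> x + t * \<alpha>' x) (\<lambda>x. \<beta> x + t * \<beta>' x) v w = (\<integral>x. ?f \<alpha> \<beta> x + t * ?f \<alpha>' \<beta>' x \<partial>lebesgue_on U)"
    unfolding form_def by (intro Bochner_Integration.integral_cong) (auto simp: algebra_simps)
  also have "\<dots> = form U \<alpha> \<beta> v w + t * form U \<alpha>' \<beta>' v w"
    unfolding form_def using form_integrable[OF assms(1,2,5,6)] form_integrable[OF assms(3,4,5,6)]
    by (subst Bochner_Integration.integral_add) auto
  finally show ?thesis .
qed

lemma form_coercive:
  assumes w: "weight U K \<alpha>" "weight U K \<beta>" and v: "L2_on U v"
    and c: "\<And>x. x \<in> U \<Longrightarrow> c \<le> \<alpha> x" "\<And>x. x \<in> U \<Longrightarrow> c \<le> \<beta> x"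
  shows "c * (norm2 U v)\<^sup>2 \<le> form U \<alpha> \<beta> v v"
proof -
  have "c * (norm2 U v)\<^sup>2 = (\<integral>x. c * (norm (v x))\<^sup>2 \<partial>lebesgue_on U)" by (simp add: norm2_sq)
  also have "\<dots> \<le> form U \<alpha> \<beta> v v"
    unfolding form_def
  proof (rule integral_mono)
    show "integrable (lebesgue_on U) (\<lambda>x. c * (norm (v x))\<^sup>2)" using v by (simp add: L2_on_def)
    fix x assume "x \<in> space (lebesgue_on U)"
    then have "x \<in> U" by simp
    then have "c * (fst (v x) * fst (v x)) \<le> \<alpha> x * (fst (v x) * fst (v x))" "c * (snd (v x) * snd (v x)) \<le> \<beta> x * (snd (v x) * snd (v x))"
      by (rule mult_right_mono[OF c(1)] mult_right_mono[OF c(2)]; simp)+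
    then show "c * (norm (v x))\<^sup>2 \<le> \<alpha> x * (fst (v x) * fst (v x)) + \<beta> x * (snd (v x) * snd (v x))"
      by (simp add: norm_prod_def distrib_left power2_eq_square)
  qed (rule form_integrable[OF w v v])
  finally show ?thesis .
qed

text \<open>What the existence of minimizers requires of a class of gradients: it is an affine set of square integrable fields and
  complete for the \<open>L\<^sup>2\<close> distance. Limits are only determined up to null sets, hence the existential
  formulation.\<close>

definition closed_affine :: "(real \<times> real) set \<Rightarrow> (real \<times> real \<Rightarrow> real \<times> real) set \<Rightarrow> bool" where
  "closed_affine U G \<longleftrightarrow> (\<forall>v\<in>G. L2_on U v) \<and>
     (\<forall>v\<in>G. \<forall>w\<in>G. \<forall>t. (\<lambda>x. (1 - t) *\<^sub>R v x + t *\<^sub>R w x) \<in> G) \<and>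
     (\<forall>f. (\<forall>k::nat. f k \<in> G) \<longrightarrow> (\<forall>e>0. \<exists>N. \<forall>i\<ge>N. \<forall>j\<ge>N. norm2 U (\<lambda>x. f i x - f j x) < e) \<longrightarrow>
        (\<exists>v\<in>G. (\<lambda>k. norm2 U (\<lambda>x. f k x - v x)) \<longlonglongrightarrow> 0))"

definition elliptic :: "(real \<times> real) set \<Rightarrow> real \<Rightarrow> real \<Rightarrow> (real \<times> real \<Rightarrow> real) \<Rightarrow> bool" where
  "elliptic U c C \<alpha> \<longleftrightarrow> \<alpha> \<in> borel_measurable (lebesgue_on U) \<and> (\<forall>x\<in>U. c \<le> \<alpha> x \<and> \<alpha> x \<le> C)"

lemma elliptic_weight: "elliptic U c C \<alpha> \<Longrightarrow> 0 < c \<Longrightarrow> weight U C \<alpha>"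
  unfolding elliptic_def weight_def by force

text \<open>Minimizers are represented by their gradients.\<close>

definition minimal :: "(real \<times> real) set \<Rightarrow> (real \<times> real \<Rightarrow> real) \<Rightarrow> (real \<times> real \<Rightarrow> real) \<Rightarrow>
    (real \<times> real \<Rightarrow> real \<times> real) set \<Rightarrow> (real \<times> real \<Rightarrow> real \<times> real) \<Rightarrow> bool" where
  "minimal U \<alpha> \<beta> G v \<longleftrightarrow> v \<in> G \<and> (\<forall>w\<in>G. form U \<alpha> \<beta> v v \<le> form U \<alpha> \<beta> w w)"

text \<open>By the parallelogram identity for the quadratic form and by convexity of the class, a minimizing sequence is a Cauchy
  sequence.\<close>

lemma minimal_exists:
  assumes G: "closed_affine U G" "G \<noteq> {}" and e: "elliptic U c C \<alpha>" "elliptic U c C \<beta>" "0 < c"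
  obtains v where "minimal U \<alpha> \<beta> G v"
proof -
  let ?Q = "\<lambda>v. form U \<alpha> \<beta> v v"
  note w = e(1,2)[THEN elliptic_weight, OF e(3)]
  have L: "L2_on U v" if "v \<in> G" for v using G(1) that by (auto simp: closed_affine_def)
  have coer: "c * (norm2 U v)\<^sup>2 \<le> ?Q v" if "L2_on U v" for v
    by (rule form_coercive[OF w that]) (use e in \<open>auto simp: elliptic_def\<close>)
  have nn: "0 \<le> ?Q v" if "v \<in> G" for v
    using coer[OF L[OF that]] e(3) by (meson less_eq_real_def mult_nonneg_nonneg order_trans zero_le_power2)
  define I where "I = Inf (?Q ` G)"
  have bdd: "bdd_below (?Q ` G)" using nn by (auto intro!: bdd_belowI[of _ 0])
  have I: "I \<le> ?Q v" if "v \<in> G" for v unfolding I_def by (rule cINF_lower[OF bdd that])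
  have "\<exists>v\<in>G. ?Q v < I + 1 / real (Suc k)" for k
  proof -
    have "Inf (?Q ` G) < I + 1 / real (Suc k)" by (simp add: I_def)
    then obtain y where "y \<in> ?Q ` G" "y < I + 1 / real (Suc k)" using cInf_lessD[of "?Q ` G"] G(2) by blast
    then show ?thesis by blast
  qed
  then obtain f where f: "\<And>k. f k \<in> G" "\<And>k. ?Q (f k) < I + 1 / real (Suc k)" by metis
  have half: "(\<lambda>x. (1/2) *\<^sub>R v x + (1/2) *\<^sub>R w x) \<in> G" if "v \<in> G" "w \<in> G" for v w
  proof -
    have "(\<lambda>x. (1 - 1/2) *\<^sub>R v x + (1/2) *\<^sub>R w x) \<in> G" using G(1) that unfolding closed_affine_def by blast
    then show ?thesis by simp
  qed
  have gap: "c * (norm2 U (\<lambda>x. f i x - f j x))\<^sup>2 \<le> 2 / real (Suc i) + 2 / real (Suc j)" for i j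
  proof -
    (* The parallelogram identity. *)
    have "?Q (\<lambda>x. 1 *\<^sub>R f i x + (-1) *\<^sub>R f j x) = 2 * ?Q (f i) + 2 * ?Q (f j) - 4 * ?Q (\<lambda>x. (1/2) *\<^sub>R f i x + (1/2) *\<^sub>R f j x)"
      unfolding form_quad[OF w L[OF f(1)] L[OF f(1)]] by (simp add: power2_eq_square)
    also have "\<dots> \<le> 2 * (I + 1 / real (Suc i)) + 2 * (I + 1 / real (Suc j)) - 4 * I"
    proof -
      have ar: "2 * x + 2 * y - 4 * z \<le> 2 * x' + 2 * y' - 4 * I" if "x < x'" "y < y'" "I \<le> z" for x y z x' y' :: real
        using that by linarith
      show ?thesis by (rule ar[OF f(2) f(2) I[OF half[OF f(1) f(1)]]])
    qed
    finally show ?thesis using coer[OF L2_on_diff[OF L[OF f(1)[of i]] L[OF f(1)[of j]]]] by simp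
  qed
  have "\<exists>N. \<forall>i\<ge>N. \<forall>j\<ge>N. norm2 U (\<lambda>x. f i x - f j x) < d" if d: "d > 0" for d
  proof -
    obtain N where N: "1 / real (Suc N) < c * d\<^sup>2 / 4"
      using nat_approx_posE[of "c * d\<^sup>2 / 4"] d e(3) by auto
    have "norm2 U (\<lambda>x. f i x - f j x) < d" if "i \<ge> N" "j \<ge> N" for i j
    proof -
      have "1 / real (Suc i) \<le> 1 / real (Suc N)" "1 / real (Suc j) \<le> 1 / real (Suc N)"
        using that by (auto intro!: divide_left_mono)
      then have "c * (norm2 U (\<lambda>x. f i x - f j x))\<^sup>2 < c * d\<^sup>2" using gap[of i j] N by linarith
      then have "(norm2 U (\<lambda>x. f i x - f j x))\<^sup>2 < d\<^sup>2" using e(3) by simp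
      then show ?thesis using d by (intro power2_less_imp_less[of _ d]) auto
    qed
    then show ?thesis by blast
  qed
  then obtain v where v: "v \<in> G" "(\<lambda>k. norm2 U (\<lambda>x. f k x - v x)) \<longlonglongrightarrow> 0"
    using G(1) f(1) unfolding closed_affine_def by blast
  have "?Q v \<le> I"
  proof (rule LIMSEQ_le)
    let ?n = "\<lambda>k. norm2 U (\<lambda>x. f k x - v x)"
    have "?Q v \<le> ?Q (f k) + 2 * (\<bar>C\<bar> * ?n k * norm2 U v)" for k
    proof -
      let ?d = "\<lambda>x. f k x - v x"
      have Ld: "L2_on U ?d" by (intro L2_on_diff L f v)
      have "?Q (f k) = ?Q v + 2 * form U \<alpha> \<beta> ?d v + ?Q ?d"
        using form_quad[OF w L[OF v(1)] Ld, of 1 1] form_sym[of U \<alpha> \<beta> ?d v] by simp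
      moreover have "0 \<le> ?Q ?d" using coer[OF Ld] e(3) by (meson less_eq_real_def mult_nonneg_nonneg order_trans zero_le_power2)
      ultimately show ?thesis using form_bound[OF w Ld L[OF v(1)]] by linarith
    qed
    then have "?Q v \<le> I + 1 / real (Suc k) + 2 * (\<bar>C\<bar> * ?n k * norm2 U v)" for k
      using f(2)[of k] by (meson add_right_mono less_imp_le order_trans)
    then show "\<exists>N. \<forall>k\<ge>N. ?Q v \<le> I + 1 / real (Suc k) + 2 * (\<bar>C\<bar> * ?n k * norm2 U v)" by blast
    have "(\<lambda>k. I + 1 / real (Suc k) + 2 * (\<bar>C\<bar> * ?n k * norm2 U v)) \<longlonglongrightarrow> I + 0 + 2 * (\<bar>C\<bar> * 0 * norm2 U v)"
      by (intro tendsto_intros v lim_1_over_n[THEN LIMSEQ_Suc])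
    then show "(\<lambda>k. I + 1 / real (Suc k) + 2 * (\<bar>C\<bar> * ?n k * norm2 U v)) \<longlonglongrightarrow> I" by simp
    show "(\<lambda>k. ?Q v) \<longlonglongrightarrow> ?Q v" by simp
  qed
  then have "minimal U \<alpha> \<beta> G v" unfolding minimal_def using v(1) I by (meson order_trans)
  then show ?thesis by (rule that)
qed

text \<open>The Euler--Lagrange equation: along the line from \<open>v\<close> to \<open>z\<close> the energy is a quadratic
  polynomial with its minimum at \<open>v\<close>.\<close>

lemma minimal_orthogonal:
  assumes G: "closed_affine U G" and w: "weight U C \<alpha>" "weight U C \<beta>"
    and v: "minimal U \<alpha> \<beta> G v" and z: "z \<in> G"
  shows "form U \<alpha> \<beta> v (\<lambda>x. z x - v x) = 0"
proof (rule ccontr)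
  let ?d = "\<lambda>x. z x - v x"
  define p q where "p = form U \<alpha> \<beta> v ?d" and "q = form U \<alpha> \<beta> ?d ?d"
  assume "\<not> form U \<alpha> \<beta> v ?d = 0"
  then have p: "p \<noteq> 0" by (simp add: p_def)
  have vG: "v \<in> G" using v by (simp add: minimal_def)
  have L: "L2_on U v" "L2_on U z" using G vG z by (auto simp: closed_affine_def)
  have "0 \<le> 2 * t * p + t\<^sup>2 * q" for t
  proof -
    have "(\<lambda>x. (1 - t) *\<^sub>R v x + t *\<^sub>R z x) \<in> G" using G vG z by (simp add: closed_affine_def)
    moreover have "(\<lambda>x. (1 - t) *\<^sub>R v x + t *\<^sub>R z x) = (\<lambda>x. 1 *\<^sub>R v x + t *\<^sub>R ?d x)"
      by (simp add: algebra_simps)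
    ultimately have "(\<lambda>x. 1 *\<^sub>R v x + t *\<^sub>R ?d x) \<in> G" by (simp only:)
    then have "form U \<alpha> \<beta> v v \<le> form U \<alpha> \<beta> (\<lambda>x. 1 *\<^sub>R v x + t *\<^sub>R ?d x) (\<lambda>x. 1 *\<^sub>R v x + t *\<^sub>R ?d x)"
      using v unfolding minimal_def by blast
    then show ?thesis unfolding form_quad[OF w L(1) L2_on_diff[OF L(2,1)]] by (simp add: p_def q_def)
  qed
  note nonneg = this
  (* For the parameter t = - p / r the quadratic polynomial is negative unless p vanishes. *)
  define r where "r = \<bar>q\<bar> + 1"
  have r: "0 < r" "q / r \<le> 1" by (simp_all add: r_def)
  have "0 \<le> - (2 * (p\<^sup>2 / r)) + p\<^sup>2 / r * (q / r)"
    using nonneg[of "- p / r"] by (simp add: power2_eq_square)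
  moreover have "p\<^sup>2 / r * (q / r) \<le> p\<^sup>2 / r * 1" using r by (intro mult_left_mono) auto
  moreover have "p\<^sup>2 / r > 0" using p r by simp
  ultimately show False by linarith
qed

text \<open>Any competitor bounds all minimizers, with a constant that depends on the stiffness through the ellipticity constants
  only.\<close>

lemma minimal_norm_bound:
  assumes G: "closed_affine U G" and e: "elliptic U c C \<alpha>" "elliptic U c C \<beta>" "0 < c"
    and v: "minimal U \<alpha> \<beta> G v" and z: "z \<in> G"
  shows "(norm2 U v)\<^sup>2 \<le> \<bar>C\<bar> / c * (norm2 U z)\<^sup>2"
proof -
  note w = e(1,2)[THEN elliptic_weight, OF e(3)]
  have L: "L2_on U v" "L2_on U z" using G v z by (auto simp: closed_affine_def minimal_def)
  have "c * (norm2 U v)\<^sup>2 \<le> form U \<alpha> \<beta> v v"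
    by (rule form_coercive[OF w L(1)]) (use e in \<open>auto simp: elliptic_def\<close>)
  also have "\<dots> \<le> form U \<alpha> \<beta> z z" using v z by (simp add: minimal_def)
  also have "\<dots> \<le> \<bar>C\<bar> * (norm2 U z)\<^sup>2" using form_bound[OF w L(2) L(2)] by (simp add: power2_eq_square mult.assoc)
  finally show ?thesis using e(3) by (simp add: field_simps)
qed

text \<open>The minimal energy is differentiable along a family of weights, and its derivative is the derivative of the weights
  evaluated at the minimizer (the envelope theorem). The old minimizer is off by \<open>O(t)\<close> in norm for the new weights,
  by coercivity and the two Euler--Lagrange equations; as a competitor for a quadratic minimum it is therefore off by
  \<open>O(t\<^sup>2)\<close> in energy. The constant involves the ellipticity constants and the norm of one competitor only, so
  it is the same for all layered materials.\<close>

lemma minimal_perturbation: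
  assumes G: "closed_affine U G" and e: "elliptic U c C \<alpha>" "elliptic U c C \<beta>" and e2: "elliptic U c C \<alpha>2" "elliptic U c C \<beta>2"
    and c: "0 < c" and K: "0 \<le> K"
    and w': "weight U K \<alpha>'" "weight U K \<beta>'"
    and d1: "weight U (K * \<bar>t\<bar>) (\<lambda>x. \<alpha>2 x - \<alpha> x)" "weight U (K * \<bar>t\<bar>) (\<lambda>x. \<beta>2 x - \<beta> x)"
    and d2: "weight U (K * t\<^sup>2) (\<lambda>x. \<alpha>2 x - \<alpha> x - t * \<alpha>' x)" "weight U (K * t\<^sup>2) (\<lambda>x. \<beta>2 x - \<beta> x - t * \<beta>' x)"
    and v: "minimal U \<alpha> \<beta> G v" and w: "minimal U \<alpha>2 \<beta>2 G w" and z: "z \<in> G" and A: "\<bar>C\<bar> / c * (norm2 U z)\<^sup>2 \<le> A"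
  shows "\<bar>form U \<alpha>2 \<beta>2 w w - form U \<alpha> \<beta> v v - t * form U \<alpha>' \<beta>' v v\<bar> \<le> (K + \<bar>C\<bar> * K\<^sup>2 / c\<^sup>2) * A * t\<^sup>2"
proof -
  let ?y = "\<lambda>x. v x - w x"
  note ww = e[THEN elliptic_weight, OF c] and ww2 = e2[THEN elliptic_weight, OF c]
  have vG: "v \<in> G" and wG: "w \<in> G" using v w by (auto simp: minimal_def)
  have L: "L2_on U v" "L2_on U w" using G vG wG by (auto simp: closed_affine_def)
  have Ly: "L2_on U ?y" by (intro L2_on_diff L)
  have vA: "(norm2 U v)\<^sup>2 \<le> A" using minimal_norm_bound[OF G e c v z] A by linarith
  have o2: "form U \<alpha>2 \<beta>2 w ?y = 0" by (rule minimal_orthogonal[OF G ww2 w vG])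
  have o1: "form U \<alpha> \<beta> v ?y = 0"
    using minimal_orthogonal[OF G ww v wG] form_diff(2)[OF ww L(1,2) L(1)] form_diff(2)[OF ww L(2,1) L(1)] by simp
  have dform: "form U \<alpha>2 \<beta>2 f g - form U \<alpha> \<beta> f g = form U (\<lambda>x. \<alpha>2 x - \<alpha> x) (\<lambda>x. \<beta>2 x - \<beta> x) f g"
    if "L2_on U f" "L2_on U g" for f g
    using form_weight_comb[OF ww d1 that, of 1] by simp
  have y: "c * norm2 U ?y \<le> K * \<bar>t\<bar> * norm2 U v"
  proof (cases "norm2 U ?y = 0")
    case True then show ?thesis using K by simp
  next
    case False
    have "c * (norm2 U ?y)\<^sup>2 \<le> form U \<alpha>2 \<beta>2 ?y ?y"
      by (rule form_coercive[OF ww2 Ly]) (use e2 in \<open>auto simp: elliptic_def\<close>)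
    also have "\<dots> = form U \<alpha>2 \<beta>2 v ?y - form U \<alpha> \<beta> v ?y"
      using form_diff(1)[OF ww2 L Ly] o1 o2 by simp
    also have "\<dots> = form U (\<lambda>x. \<alpha>2 x - \<alpha> x) (\<lambda>x. \<beta>2 x - \<beta> x) v ?y" by (rule dform[OF L(1) Ly])
    also have "\<dots> \<le> K * \<bar>t\<bar> * norm2 U v * norm2 U ?y" using form_bound[OF d1 L(1) Ly] K by (simp add: abs_mult)
    finally have "(c * norm2 U ?y) * norm2 U ?y \<le> (K * \<bar>t\<bar> * norm2 U v) * norm2 U ?y" by (simp add: power2_eq_square mult.assoc)
    then show ?thesis using False by (simp add: mult_le_cancel_right less_le)
  qed
  have "(c * norm2 U ?y)\<^sup>2 \<le> (K * \<bar>t\<bar> * norm2 U v)\<^sup>2" using y c by (intro power_mono) auto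
  then have "c\<^sup>2 * (norm2 U ?y)\<^sup>2 \<le> K\<^sup>2 * t\<^sup>2 * (norm2 U v)\<^sup>2" by (simp add: power_mult_distrib)
  also have "\<dots> \<le> K\<^sup>2 * t\<^sup>2 * A" using vA by (intro mult_left_mono) auto
  finally have y2: "(norm2 U ?y)\<^sup>2 \<le> K\<^sup>2 * t\<^sup>2 * A / c\<^sup>2" using c by (simp add: field_simps)
  (* Pythagoras for the new form: the linear term vanishes by the Euler--Lagrange equation. *)
  have "form U \<alpha>2 \<beta>2 v v = form U \<alpha>2 \<beta>2 w w + form U \<alpha>2 \<beta>2 ?y ?y"
    using form_quad[OF ww2 L(2) Ly, of 1 1] o2 by simp
  then have eq: "form U \<alpha>2 \<beta>2 w w - form U \<alpha> \<beta> v v - t * form U \<alpha>' \<beta>' v v =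
      (form U (\<lambda>x. \<alpha>2 x - \<alpha> x) (\<lambda>x. \<beta>2 x - \<beta> x) v v - t * form U \<alpha>' \<beta>' v v) - form U \<alpha>2 \<beta>2 ?y ?y"
    using dform[OF L(1) L(1)] by simp
  have "form U (\<lambda>x. \<alpha>2 x - \<alpha> x) (\<lambda>x. \<beta>2 x - \<beta> x) v v - t * form U \<alpha>' \<beta>' v v =
      form U (\<lambda>x. \<alpha>2 x - \<alpha> x - t * \<alpha>' x) (\<lambda>x. \<beta>2 x - \<beta> x - t * \<beta>' x) v v"
    using form_weight_comb[OF d1 w' L(1) L(1), of "- t"] by simp
  moreover have "\<bar>\<dots>\<bar> \<le> K * t\<^sup>2 * A"
  proof -
    have "\<bar>\<dots>\<bar> \<le> K * t\<^sup>2 * (norm2 U v)\<^sup>2"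
      using form_bound[OF d2 L(1) L(1)] K by (simp add: abs_mult power2_eq_square mult.assoc)
    also have "\<dots> \<le> K * t\<^sup>2 * A" using vA K by (intro mult_left_mono) auto
    finally show ?thesis .
  qed
  moreover have "\<bar>form U \<alpha>2 \<beta>2 ?y ?y\<bar> \<le> \<bar>C\<bar> * (K\<^sup>2 * t\<^sup>2 * A / c\<^sup>2)"
  proof -
    have "\<bar>form U \<alpha>2 \<beta>2 ?y ?y\<bar> \<le> \<bar>C\<bar> * (norm2 U ?y)\<^sup>2"
      using form_bound[OF ww2 Ly Ly] by (simp add: power2_eq_square mult.assoc)
    also have "\<dots> \<le> \<bar>C\<bar> * (K\<^sup>2 * t\<^sup>2 * A / c\<^sup>2)" using y2 by (intro mult_left_mono) auto
    finally show ?thesis .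
  qed
  ultimately have "\<bar>form U \<alpha>2 \<beta>2 w w - form U \<alpha> \<beta> v v - t * form U \<alpha>' \<beta>' v v\<bar> \<le> K * t\<^sup>2 * A + \<bar>C\<bar> * (K\<^sup>2 * t\<^sup>2 * A / c\<^sup>2)"
    unfolding eq by linarith
  also have "\<dots> = (K + \<bar>C\<bar> * K\<^sup>2 / c\<^sup>2) * A * t\<^sup>2" by (simp add: algebra_simps)
  finally show ?thesis .
qed

section \<open>Convergence of derivatives\<close>

text \<open>The uniform second order expansions make the derivatives equi-Lipschitz, so finitely many points control all others.
  At a point, the derivative differs from the difference quotient with step \<open>t\<close> by at most \<open>M t\<close>, and
  for fixed \<open>t\<close> the quotients converge.\<close>

lemma uniform_derivative_convergence:
  fixes f d :: "nat \<Rightarrow> real \<Rightarrow> real" and g h :: "real \<Rightarrow> real"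
  assumes f: "\<And>n s t. n > 0 \<Longrightarrow> \<bar>s\<bar> \<le> R \<Longrightarrow> \<bar>t\<bar> \<le> 1 \<Longrightarrow> \<bar>f n (s + t) - f n s - t * d n s\<bar> \<le> M * t\<^sup>2"
    and g: "\<And>s t. \<bar>s\<bar> \<le> R \<Longrightarrow> \<bar>t\<bar> \<le> 1 \<Longrightarrow> \<bar>g (s + t) - g s - t * h s\<bar> \<le> M * t\<^sup>2"
    and lim: "\<And>s. (\<lambda>n. f n s) \<longlonglongrightarrow> g s" and e: "e > 0"
  shows "\<forall>\<^sub>F n in sequentially. \<forall>s. \<bar>s\<bar> \<le> R \<longrightarrow> \<bar>d n s - h s\<bar> < e"
proof -
  have M: "0 \<le> M" if "\<bar>s\<bar> \<le> R" for s using g[OF that, of 1] by simp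
  (* The two Lipschitz bounds contribute e/6 each, and the comparison of the difference quotients contributes e/3. *)
  define t where "t = min 1 (e / (12 * (\<bar>M\<bar> + 1)))"
  have t: "0 < t" "t \<le> 1" "\<bar>M\<bar> * t \<le> e / 12"
  proof -
    show "0 < t" "t \<le> 1" using e by (auto simp: t_def)
    have "\<bar>M\<bar> * t \<le> (\<bar>M\<bar> + 1) * (e / (12 * (\<bar>M\<bar> + 1)))" using e by (intro mult_mono) (auto simp: t_def)
    moreover have "k * (e / (12 * k)) = e / 12" if "k > 0" for k using that by simp
    ultimately show "\<bar>M\<bar> * t \<le> e / 12" by (metis abs_ge_zero add_nonneg_pos zero_less_one)
  qed
  have lip: "\<bar>D s - D s'\<bar> \<le> 2 * \<bar>M\<bar> * \<bar>s - s'\<bar>"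
    if F: "\<And>s t. \<bar>s\<bar> \<le> R \<Longrightarrow> \<bar>t\<bar> \<le> 1 \<Longrightarrow> \<bar>F (s + t) - F s - t * D s\<bar> \<le> M * t\<^sup>2"
      and s: "\<bar>s\<bar> \<le> R" "\<bar>s'\<bar> \<le> R" "\<bar>s - s'\<bar> \<le> 1" for F D :: "real \<Rightarrow> real" and s s'
  proof (cases "s = s'")
    case False
    have "\<bar>(s - s') * (D s - D s')\<bar> \<le> 2 * M * (s - s')\<^sup>2"
    proof -
      have "\<bar>F s' - F s - (s' - s) * D s\<bar> \<le> M * (s - s')\<^sup>2" "\<bar>F s - F s' - (s - s') * D s'\<bar> \<le> M * (s - s')\<^sup>2"
        using F[OF s(1), of "s' - s"] F[OF s(2), of "s - s'"] s(3) by (simp_all add: abs_minus_commute power2_commute)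
      moreover have "(s - s') * (D s - D s') = (F s' - F s - (s' - s) * D s) + (F s - F s' - (s - s') * D s')"
        by (simp add: algebra_simps)
      ultimately show ?thesis by linarith
    qed
    moreover have "(s - s')\<^sup>2 = \<bar>s - s'\<bar> * \<bar>s - s'\<bar>" unfolding power2_eq_square by (simp only: abs_mult_self_eq)
    moreover have "\<bar>M\<bar> = M" using M[OF s(1)] by simp
    ultimately have "\<bar>s - s'\<bar> * \<bar>D s - D s'\<bar> \<le> \<bar>s - s'\<bar> * (2 * \<bar>M\<bar> * \<bar>s - s'\<bar>)"
      by (simp only: abs_mult mult_ac)
    then show ?thesis using False by simp
  qed simp
  obtain k where k: "k \<subseteq> {-R..R}" "finite k" "{-R..R} \<subseteq> (\<Union>x\<in>k. ball x t)"
    by (rule compactE_image[of "{-R..R}" "{-R..R}" "\<lambda>x. ball x t"]) (use t(1) in auto)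
  have "\<forall>\<^sub>F n in sequentially. \<bar>f n s - g s\<bar> < e * t / 12" for s
    using tendstoD[OF lim[of s], of "e * t / 12"] e t(1) by (simp add: dist_real_def)
  then have "\<forall>\<^sub>F n in sequentially. \<forall>s\<in>k. \<bar>f n s - g s\<bar> < e * t / 12 \<and> \<bar>f n (s + t) - g (s + t)\<bar> < e * t / 12"
    using k(2) by (auto intro!: eventually_ball_finite eventually_conj)
  then show ?thesis using eventually_gt_at_top[of 0]
  proof eventually_elim
    case (elim n)
    show ?case
    proof (intro allI impI)
      fix s :: real assume s: "\<bar>s\<bar> \<le> R"
      then have "s \<in> {-R..R}" by auto
      then obtain s' where s': "s' \<in> k" "\<bar>s' - s\<bar> < t" using k(3) by (auto simp: dist_real_def)
      have s'R: "\<bar>s'\<bar> \<le> R" using subsetD[OF k(1) s'(1)] by (simp add: abs_le_iff)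
      have st: "\<bar>s - s'\<bar> \<le> 1" using s'(2) t(2) by linarith
      have a: "2 * \<bar>M\<bar> * \<bar>s - s'\<bar> \<le> e / 6"
      proof -
        have "\<bar>M\<bar> * \<bar>s - s'\<bar> \<le> \<bar>M\<bar> * t" using s'(2) by (intro mult_left_mono) auto
        then show ?thesis using t(3) by linarith
      qed
      have "\<bar>d n s - d n s'\<bar> \<le> e / 6" using lip[OF f[OF elim(2)] s s'R st] a by simp
      moreover have "\<bar>h s - h s'\<bar> \<le> e / 6" using lip[OF g s s'R st] a by simp
      moreover have "\<bar>d n s' - h s'\<bar> \<le> e / 3"
      proof -
        have tt: "\<bar>t\<bar> \<le> 1" using t by simp
        have "M * t\<^sup>2 \<le> e * t / 12" using t(1) t(3) M[OF s] mult_right_mono[OF t(3), of t] by (simp add: power2_eq_square mult_ac)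
        then have "\<bar>t * d n s' - t * h s'\<bar> \<le> 4 * (e * t / 12)"
          using f[OF elim(2) s'R tt] g[OF s'R tt] elim(1)[rule_format, OF s'(1)] by linarith
        then have "t * \<bar>d n s' - h s'\<bar> \<le> t * (e / 3)" using t(1) by (simp add: abs_mult flip: right_diff_distrib)
        then show ?thesis using t(1) by simp
      qed
      ultimately show "\<bar>d n s - h s\<bar> < e" using e by linarith
    qed
  qed
qed

section \<open>Traces\<close>

lemma norm2_tendsto_iff:
  fixes f :: "nat \<Rightarrow> 'a::euclidean_space \<Rightarrow> 'b::euclidean_space"
  shows "(\<lambda>k. \<integral>x. (norm (f k x))\<^sup>2 \<partial>lebesgue_on U) \<longlonglongrightarrow> 0 \<longleftrightarrow> (\<lambda>k. norm2 U (f k)) \<longlonglongrightarrow> 0"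
proof
  show "(\<lambda>k. norm2 U (f k)) \<longlonglongrightarrow> 0" if "(\<lambda>k. \<integral>x. (norm (f k x))\<^sup>2 \<partial>lebesgue_on U) \<longlonglongrightarrow> 0"
    using tendsto_real_sqrt[OF that] by (simp add: norm2_def)
  show "(\<lambda>k. \<integral>x. (norm (f k x))\<^sup>2 \<partial>lebesgue_on U) \<longlonglongrightarrow> 0" if "(\<lambda>k. norm2 U (f k)) \<longlonglongrightarrow> 0"
    using tendsto_power[OF that, of 2] by (simp add: norm2_sq)
qed

text \<open>The limits of integrals in the definition of the trace are limits of \<open>L\<^sup>2\<close> norms.\<close>

lemma has_side_trace_iff:
  "has_side_trace X I c u f \<longleftrightarrow> L2_on I f \<and>
     (\<exists>v w. H1_grad (X \<times> I) u v \<and> (\<forall>k::nat. smooth (w k)) \<and>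
        (\<lambda>k. norm2 (X \<times> I) (\<lambda>x. w k x - u x)) \<longlonglongrightarrow> 0 \<and>
        (\<lambda>k. norm2 (X \<times> I) (\<lambda>x. grad (w k) x - v x)) \<longlonglongrightarrow> 0 \<and>
        (\<lambda>k. norm2 I (\<lambda>t. w k (c, t) - f t)) \<longlonglongrightarrow> 0)"
  unfolding has_side_trace_def norm2_tendsto_iff[symmetric] real_norm_def power2_abs ..

lemma grad_comb:
  assumes "smooth f" "smooth g" shows "grad (\<lambda>x. a * f x + b * g x) x = a *\<^sub>R grad f x + b *\<^sub>R grad g x"
proof -
  have "((\<lambda>x. a * f x + b * g x) has_derivative (\<lambda>e. a * pd e f x + b * pd e g x)) (at x)"
    by (intro has_derivative_add has_derivative_mult_right smooth_derivative assms)
  from frechet_derivative_at[OF this, symmetric] show ?thesis by (simp add: grad_def)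
qed

lemma slice_L2:
  fixes I :: "real set"
  assumes I: "open I" "bounded I" and w: "smooth w" shows "L2_on I (\<lambda>t. w (c, t))"
proof -
  have c: "continuous_on S (\<lambda>t. w (c, t))" for S
    by (rule continuous_on_compose2[OF smooth_cont[OF w, of UNIV]]) (auto intro!: continuous_intros)
  have "compact ((\<lambda>t. w (c, t)) ` closure I)"
    using I by (intro compact_continuous_image c) (simp add: compact_eq_bounded_closed bounded_closure)
  then obtain C where "\<And>t. t \<in> closure I \<Longrightarrow> norm (w (c, t)) \<le> C"
    by (meson compact_imp_bounded bounded_iff imageI)
  then show ?thesis
    using closure_subset I by (intro L2_on_bounded[where C=C] lmeasurable_open continuous_imp_measurable_on_sets_lebesgue c) auto
qed

lemma norm2_comb_tendsto:
  assumes "\<And>k. L2_on U (f k)" "\<And>k. L2_on U (g k)"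
    and "(\<lambda>k. norm2 U (f k)) \<longlonglongrightarrow> 0" "(\<lambda>k. norm2 U (g k)) \<longlonglongrightarrow> 0"
  shows "(\<lambda>k. norm2 U (\<lambda>x. a *\<^sub>R f k x + b *\<^sub>R g k x)) \<longlonglongrightarrow> 0"
proof (rule Lim_null_comparison)
  show "(\<lambda>k. \<bar>a\<bar> * norm2 U (f k) + \<bar>b\<bar> * norm2 U (g k)) \<longlonglongrightarrow> 0"
    using tendsto_add[OF tendsto_mult[OF tendsto_const assms(3)] tendsto_mult[OF tendsto_const assms(4)]] by simp
  have "norm2 U (\<lambda>x. a *\<^sub>R f k x + b *\<^sub>R g k x) \<le> \<bar>a\<bar> * norm2 U (f k) + \<bar>b\<bar> * norm2 U (g k)" for k
    using norm2_triangle[OF L2_on_scale[OF assms(1), of a k] L2_on_scale[OF assms(2), of b k]] by (simp add: norm2_scale)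
  then show "\<forall>\<^sub>F k in sequentially. norm (norm2 U (\<lambda>x. a *\<^sub>R f k x + b *\<^sub>R g k x)) \<le> \<bar>a\<bar> * norm2 U (f k) + \<bar>b\<bar> * norm2 U (g k)"
    by simp
qed

lemma has_side_trace_comb:
  assumes X: "open X" "bounded X" "open I" "bounded I"
    and u: "has_side_trace X I c u f" and u': "has_side_trace X I c u' f'"
  shows "has_side_trace X I c (\<lambda>x. a * u x + b * u' x) (\<lambda>t. a * f t + b * f' t)"
proof -
  have U: "open (X \<times> I)" "bounded (X \<times> I)" using X by (auto intro: open_Times bounded_Times)
  obtain v w where vw: "L2_on I f" "H1_grad (X \<times> I) u v" "\<And>k::nat. smooth (w k)"
      "(\<lambda>k. norm2 (X \<times> I) (\<lambda>x. w k x - u x)) \<longlonglongrightarrow> 0" "(\<lambda>k. norm2 (X \<times> I) (\<lambda>x. grad (w k) x - v x)) \<longlonglongrightarrow> 0"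
      "(\<lambda>k. norm2 I (\<lambda>t. w k (c, t) - f t)) \<longlonglongrightarrow> 0"
    using u unfolding has_side_trace_iff by blast
  obtain v' w' where vw': "L2_on I f'" "H1_grad (X \<times> I) u' v'" "\<And>k::nat. smooth (w' k)"
      "(\<lambda>k. norm2 (X \<times> I) (\<lambda>x. w' k x - u' x)) \<longlonglongrightarrow> 0" "(\<lambda>k. norm2 (X \<times> I) (\<lambda>x. grad (w' k) x - v' x)) \<longlonglongrightarrow> 0"
      "(\<lambda>k. norm2 I (\<lambda>t. w' k (c, t) - f' t)) \<longlonglongrightarrow> 0"
    using u' unfolding has_side_trace_iff by blast
  note H = H1_grad_L2[OF vw(2)] H1_grad_L2[OF vw'(2)]
  show ?thesis unfolding has_side_trace_iff
  proof (intro conjI exI[of _ "\<lambda>x. a *\<^sub>R v x + b *\<^sub>R v' x"] exI[of _ "\<lambda>k x. a * w k x + b * w' k x"] allI)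
    show "L2_on I (\<lambda>t. a * f t + b * f' t)" using L2_on_comb[OF vw(1) vw'(1), of a b] by simp
    show "H1_grad (X \<times> I) (\<lambda>x. a * u x + b * u' x) (\<lambda>x. a *\<^sub>R v x + b *\<^sub>R v' x)"
      by (rule H1_grad_comb[OF U vw(2) vw'(2)])
    show "smooth (\<lambda>x. a * w k x + b * w' k x)" for k by (intro smooth_add smooth_mult smooth_const vw vw')
    show "(\<lambda>k. norm2 (X \<times> I) (\<lambda>x. a * w k x + b * w' k x - (a * u x + b * u' x))) \<longlonglongrightarrow> 0"
      using norm2_comb_tendsto[OF L2_on_diff[OF smooth_L2[OF U vw(3)] H(1)] L2_on_diff[OF smooth_L2[OF U vw'(3)] H(3)] vw(4) vw'(4), of a b]
      by (simp add: algebra_simps)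
    show "(\<lambda>k. norm2 (X \<times> I) (\<lambda>x. grad (\<lambda>x. a * w k x + b * w' k x) x - (a *\<^sub>R v x + b *\<^sub>R v' x))) \<longlonglongrightarrow> 0"
      using norm2_comb_tendsto[OF L2_on_diff[OF smooth_grad_L2[OF U vw(3)] H(2)] L2_on_diff[OF smooth_grad_L2[OF U vw'(3)] H(4)] vw(5) vw'(5), of a b]
      by (simp add: algebra_simps grad_comb vw(3) vw'(3))
    show "(\<lambda>k. norm2 I (\<lambda>t. a * w k (c, t) + b * w' k (c, t) - (a * f t + b * f' t))) \<longlonglongrightarrow> 0"
      using norm2_comb_tendsto[OF L2_on_diff[OF slice_L2[OF X(3,4) vw(3)] vw(1)] L2_on_diff[OF slice_L2[OF X(3,4) vw'(3)] vw'(1)] vw(6) vw'(6), of a b]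
      by (simp add: algebra_simps)
  qed
qed

text \<open>All functions of the sequence have the same trace, so a diagonal sequence of smooth approximations, each of them close
  to this trace, serves for the limit.\<close>

lemma has_side_trace_limit:
  assumes X: "open X" "bounded X" "open I" "bounded I"
    and u: "\<And>n. has_side_trace X I c (u n) f" and v: "\<And>n::nat. H1_grad (X \<times> I) (u n) (v n)"
    and L: "L2_on (X \<times> I) u'" "L2_on (X \<times> I) v'"
    and lu: "(\<lambda>n. norm2 (X \<times> I) (\<lambda>x. u n x - u' x)) \<longlonglongrightarrow> 0" and lv: "(\<lambda>n. norm2 (X \<times> I) (\<lambda>x. v n x - v' x)) \<longlonglongrightarrow> 0"
  shows "has_side_trace X I c u' f"
proof -
  let ?U = "X \<times> I"
  have U: "open ?U" "bounded ?U" using X by (auto intro: open_Times bounded_Times)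
  have "\<exists>w. smooth w \<and> norm2 ?U (\<lambda>x. w x - u n x) < 1 / real (Suc n) \<and> norm2 ?U (\<lambda>x. grad w x - v n x) < 1 / real (Suc n) \<and>
      norm2 I (\<lambda>t. w (c, t) - f t) < 1 / real (Suc n)" for n
  proof -
    obtain z w where zw: "H1_grad ?U (u n) z" "\<And>k::nat. smooth (w k)"
        "(\<lambda>k. norm2 ?U (\<lambda>x. w k x - u n x)) \<longlonglongrightarrow> 0" "(\<lambda>k. norm2 ?U (\<lambda>x. grad (w k) x - z x)) \<longlonglongrightarrow> 0"
        "(\<lambda>k. norm2 I (\<lambda>t. w k (c, t) - f t)) \<longlonglongrightarrow> 0"
      using u[of n] unfolding has_side_trace_iff by blast
    have e: "1 / real (Suc n) > 0" by simp
    have "\<forall>\<^sub>F k in sequentially. norm2 ?U (\<lambda>x. w k x - u n x) < 1 / real (Suc n) \<and>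
        norm2 ?U (\<lambda>x. grad (w k) x - z x) < 1 / real (Suc n) \<and> norm2 I (\<lambda>t. w k (c, t) - f t) < 1 / real (Suc n)"
      using order_tendstoD(2)[OF zw(3) e] order_tendstoD(2)[OF zw(4) e] order_tendstoD(2)[OF zw(5) e]
      by eventually_elim simp
    then obtain k where k: "norm2 ?U (\<lambda>x. w k x - u n x) < 1 / real (Suc n)"
        "norm2 ?U (\<lambda>x. grad (w k) x - z x) < 1 / real (Suc n)" "norm2 I (\<lambda>t. w k (c, t) - f t) < 1 / real (Suc n)"
      by (auto simp: eventually_sequentially)
    have "norm2 ?U (\<lambda>x. grad (w k) x - v n x) \<le> norm2 ?U (\<lambda>x. grad (w k) x - z x) + norm2 ?U (\<lambda>x. z x - v n x)"
      by (intro norm2_diff_triangle smooth_grad_L2 U zw(2) H1_grad_L2(2)[OF zw(1)] H1_grad_L2(2)[OF v])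
    then show ?thesis using k zw(2)[of k] H1_grad_unique[OF U zw(1) v] by auto
  qed
  then have "\<forall>n. \<exists>w. smooth w \<and> norm2 ?U (\<lambda>x. w x - u n x) < 1 / real (Suc n) \<and> norm2 ?U (\<lambda>x. grad w x - v n x) < 1 / real (Suc n) \<and>
      norm2 I (\<lambda>t. w (c, t) - f t) < 1 / real (Suc n)" by (rule allI)
  from choice[OF this] obtain w where "\<forall>n. smooth (w n) \<and> norm2 ?U (\<lambda>x. w n x - u n x) < 1 / real (Suc n) \<and>
      norm2 ?U (\<lambda>x. grad (w n) x - v n x) < 1 / real (Suc n) \<and> norm2 I (\<lambda>t. w n (c, t) - f t) < 1 / real (Suc n)"
    by (rule exE)
  then have w: "smooth (w n)" "norm2 ?U (\<lambda>x. w n x - u n x) < 1 / real (Suc n)"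
      "norm2 ?U (\<lambda>x. grad (w n) x - v n x) < 1 / real (Suc n)" "norm2 I (\<lambda>t. w n (c, t) - f t) < 1 / real (Suc n)" for n
    by blast+
  have inv: "(\<lambda>n. 1 / real (Suc n)) \<longlonglongrightarrow> 0" by (rule lim_1_over_n[THEN LIMSEQ_Suc])
  show ?thesis unfolding has_side_trace_iff
  proof (intro conjI exI[of _ v'] exI[of _ w] allI w(1))
    show "L2_on I f" using u[of 0] by (simp add: has_side_trace_iff)
    show "H1_grad ?U u' v'" by (rule H1_grad_limit[OF U v L lu lv])
    show "(\<lambda>k. norm2 ?U (\<lambda>x. w k x - u' x)) \<longlonglongrightarrow> 0"
    proof (rule Lim_null_comparison)
      show "(\<lambda>k. 1 / real (Suc k) + norm2 ?U (\<lambda>x. u k x - u' x)) \<longlonglongrightarrow> 0" using tendsto_add[OF inv lu] by simp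
      have "norm2 ?U (\<lambda>x. w k x - u' x) \<le> 1 / real (Suc k) + norm2 ?U (\<lambda>x. u k x - u' x)" for k
        using norm2_diff_triangle[OF smooth_L2[OF U w(1)] H1_grad_L2(1)[OF v] L(1), of k k] w(2)[of k] by linarith
      then show "\<forall>\<^sub>F k in sequentially. norm (norm2 ?U (\<lambda>x. w k x - u' x)) \<le> 1 / real (Suc k) + norm2 ?U (\<lambda>x. u k x - u' x)"
        by simp
    qed
    show "(\<lambda>k. norm2 ?U (\<lambda>x. grad (w k) x - v' x)) \<longlonglongrightarrow> 0"
    proof (rule Lim_null_comparison)
      show "(\<lambda>k. 1 / real (Suc k) + norm2 ?U (\<lambda>x. v k x - v' x)) \<longlonglongrightarrow> 0" using tendsto_add[OF inv lv] by simp
      have "norm2 ?U (\<lambda>x. grad (w k) x - v' x) \<le> 1 / real (Suc k) + norm2 ?U (\<lambda>x. v k x - v' x)" for k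
        using norm2_diff_triangle[OF smooth_grad_L2[OF U w(1)] H1_grad_L2(2)[OF v] L(2), of k k] w(3)[of k] by linarith
      then show "\<forall>\<^sub>F k in sequentially. norm (norm2 ?U (\<lambda>x. grad (w k) x - v' x)) \<le> 1 / real (Suc k) + norm2 ?U (\<lambda>x. v k x - v' x)"
        by simp
    qed
    show "(\<lambda>k. norm2 I (\<lambda>t. w k (c, t) - f t)) \<longlonglongrightarrow> 0"
      by (rule Lim_null_comparison[OF _ inv]) (use w(4) in \<open>simp add: less_imp_le\<close>)
  qed
qed

lemma has_side_trace_smooth_zero:
  assumes X: "open X" "bounded X" "open I" "bounded I" and \<psi>: "smooth \<psi>" "\<And>t. \<psi> (c, t) = 0"
  shows "has_side_trace X I c \<psi> (\<lambda>t. 0)"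
proof -
  have U: "open (X \<times> I)" "bounded (X \<times> I)" using X by (auto intro: open_Times bounded_Times)
  show ?thesis unfolding has_side_trace_iff
    by (intro conjI exI[of _ "grad \<psi>"] exI[of _ "\<lambda>_. \<psi>"] allI H1_grad_smooth U \<psi>(1))
      (simp_all add: norm2_def \<psi>(2))
qed

section \<open>Poincare inequality\<close>

lemma continuous_integrable_open:
  fixes g :: "'a::euclidean_space \<Rightarrow> real"
  assumes U: "open U" "bounded U" and g: "continuous_on UNIV g"
  shows "integrable (lebesgue_on U) g"
proof -
  have "compact (g ` closure U)"
    using U by (intro compact_continuous_image continuous_on_subset[OF g]) (auto simp: compact_eq_bounded_closed bounded_closure)
  then obtain C where C: "\<And>x. x \<in> closure U \<Longrightarrow> norm (g x) \<le> C"
    by (meson compact_imp_bounded bounded_iff imageI)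
  interpret finite_measure "lebesgue_on U" by (intro finite_measure_lebesgue_on lmeasurable_open U)
  show ?thesis
    using C closure_subset[of U] U
    by (intro integrable_const_bound[where B=C] AE_I2 continuous_imp_measurable_on_sets_lebesgue continuous_on_subset[OF g]) auto
qed

lemma smooth_integral_box:
  assumes g: "continuous_on UNIV g"
  shows "(\<integral>x. g x \<partial>lebesgue_on ({a<..<b} \<times> {c<..<d})) = integral (cbox (a, c) (b, d)) (g :: real \<times> real \<Rightarrow> real)"
proof -
  have e: "{a<..<b} \<times> {c<..<d} = box (a, c) (b, d)" by (auto simp: mem_box Basis_prod_def)
  have "integrable (lebesgue_on (box (a,c) (b,d))) g"
    by (intro continuous_integrable_open g) (auto intro: open_box bounded_box)
  then show ?thesis unfolding e
    by (subst lebesgue_integral_eq_integral) (auto simp: integral_open_interval)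
qed

text \<open>The multiplier \<open>x - L\<close> vanishes at the end point whose value is unknown: integrating the derivative of
  \<open>(x - L) f\<^sup>2\<close> leaves \<open>L (f 0)\<^sup>2\<close> only, and the mixed term is absorbed by Young's
  inequality.\<close>

lemma poincare_line:
  fixes f f' :: "real \<Rightarrow> real"
  assumes L: "0 \<le> L" and f: "\<And>x. (f has_real_derivative f' x) (at x)" and c: "continuous_on UNIV f'"
  shows "integral {0..L} (\<lambda>x. (f x)\<^sup>2) \<le> 2 * L * (f 0)\<^sup>2 + 4 * L\<^sup>2 * integral {0..L} (\<lambda>x. (f' x)\<^sup>2)"
proof -
  have cf: "continuous_on UNIV f" using f by (meson DERIV_continuous continuous_at_imp_continuous_on)
  note cc = continuous_on_subset[OF cf] continuous_on_subset[OF c]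
  have "((\<lambda>x. (f x)\<^sup>2 + 2 * (x - L) * f x * f' x) has_integral ((L - L) * (f L)\<^sup>2 - (0 - L) * (f 0)\<^sup>2)) {0..L}"
  proof (rule fundamental_theorem_of_calculus[OF L])
    fix x
    have "((\<lambda>x. (x - L) * (f x)\<^sup>2) has_real_derivative ((f x)\<^sup>2 + 2 * (x - L) * f x * f' x)) (at x within {0..L})"
      by (auto intro!: derivative_eq_intros has_field_derivative_at_within[OF f] simp: algebra_simps)
    then show "((\<lambda>x. (x - L) * (f x)\<^sup>2) has_vector_derivative ((f x)\<^sup>2 + 2 * (x - L) * f x * f' x)) (at x within {0..L})"
      by (simp add: has_real_derivative_iff_has_vector_derivative)
  qed
  then have eq: "integral {0..L} (\<lambda>x. (f x)\<^sup>2 + 2 * (x - L) * f x * f' x) = L * (f 0)\<^sup>2"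
    by (simp add: integral_unique)
  have "integral {0..L} (\<lambda>x. (1/2) * (f x)\<^sup>2 - 2 * L\<^sup>2 * (f' x)\<^sup>2) \<le> integral {0..L} (\<lambda>x. (f x)\<^sup>2 + 2 * (x - L) * f x * f' x)"
  proof (rule integral_le)
    show "(\<lambda>x. (1/2) * (f x)\<^sup>2 - 2 * L\<^sup>2 * (f' x)\<^sup>2) integrable_on {0..L}" "(\<lambda>x. (f x)\<^sup>2 + 2 * (x - L) * f x * f' x) integrable_on {0..L}"
      by (intro integrable_continuous_real continuous_intros cc; simp)+
    fix x assume x: "x \<in> {0..L}"
    (* Young's inequality for the mixed term. *)
    have "0 \<le> (f x / 2 + (x - L) * f' x)\<^sup>2 * 2" by simp
    then have "- (2 * (x - L) * f x * f' x) \<le> (1/2) * (f x)\<^sup>2 + 2 * (x - L)\<^sup>2 * (f' x)\<^sup>2"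
      by (simp add: power2_eq_square algebra_simps)
    moreover have "(x - L)\<^sup>2 \<le> L\<^sup>2" using x by (intro abs_le_square_iff[THEN iffD1]) auto
    then have "2 * (x - L)\<^sup>2 * (f' x)\<^sup>2 \<le> 2 * L\<^sup>2 * (f' x)\<^sup>2" by (intro mult_right_mono) auto
    ultimately show "(1/2) * (f x)\<^sup>2 - 2 * L\<^sup>2 * (f' x)\<^sup>2 \<le> (f x)\<^sup>2 + 2 * (x - L) * f x * f' x" by linarith
  qed
  also have "integral {0..L} (\<lambda>x. (1/2) * (f x)\<^sup>2 - 2 * L\<^sup>2 * (f' x)\<^sup>2) = (1/2) * integral {0..L} (\<lambda>x. (f x)\<^sup>2) - 2 * L\<^sup>2 * integral {0..L} (\<lambda>x. (f' x)\<^sup>2)"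
    by (subst Henstock_Kurzweil_Integration.integral_diff) (auto intro!: integrable_continuous_real continuous_intros cc)
  finally show ?thesis using eq by simp
qed

text \<open>The one-dimensional inequality, integrated over the vertical coordinate.\<close>

lemma poincare_smooth:
  assumes L: "0 < L" and w: "smooth w"
  shows "(norm2 ({0<..<L} \<times> {a<..<b}) w)\<^sup>2 \<le> 2 * L * (norm2 {a<..<b} (\<lambda>t. w (0, t)))\<^sup>2 + 4 * L\<^sup>2 * (norm2 ({0<..<L} \<times> {a<..<b}) (pd (1,0) w))\<^sup>2"
proof -
  have cw: "continuous_on X w" "continuous_on X (pd (1,0) w)" for X
    by (intro smooth_cont w smooth_derivative(2))+
  have c2: "continuous_on UNIV (\<lambda>x. (w x)\<^sup>2)" "continuous_on UNIV (\<lambda>x. (pd (1,0) w x)\<^sup>2)" by (intro continuous_intros cw)+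
  have cs: "continuous_on UNIV (\<lambda>t. (w (0,t))\<^sup>2)"
    by (rule continuous_on_compose2[OF c2(1)]) (auto intro!: continuous_intros)
  have n0: "(norm2 {a<..<b} (\<lambda>t. w (0, t)))\<^sup>2 = integral {a..b} (\<lambda>t. (w (0,t))\<^sup>2)"
  proof -
    have "integrable (lebesgue_on {a<..<b}) (\<lambda>t. (w (0,t))\<^sup>2)"
      by (intro continuous_integrable_open cs) auto
    then have "(\<integral>t. (w (0,t))\<^sup>2 \<partial>lebesgue_on {a<..<b}) = integral {a<..<b} (\<lambda>t. (w (0,t))\<^sup>2)"
      by (rule lebesgue_integral_eq_integral) simp
    then show ?thesis by (simp add: norm2_sq integral_open_interval_real)
  qed
  have swap: "integral (cbox (0, a) (L, b)) g = integral {a..b} (\<lambda>t. integral {0..L} (\<lambda>x. g (x, t)))"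
     and par: "continuous_on {a..b} (\<lambda>t. integral {0..L} (\<lambda>x. g (x, t)))" if g: "continuous_on UNIV g" for g :: "real \<times> real \<Rightarrow> real"
  proof -
    have "integral (cbox (0, a) (L, b)) g = integral (cbox 0 L) (\<lambda>x. integral (cbox a b) (\<lambda>y. g (x, y)))"
      by (intro integral_prod_continuous continuous_on_subset[OF g]) auto
    also have "\<dots> = integral (cbox a b) (\<lambda>y. integral (cbox 0 L) (\<lambda>x. g (x, y)))"
      by (intro integral_swap_continuous) (simp add: case_prod_beta' continuous_on_subset[OF g])
    finally show "integral (cbox (0, a) (L, b)) g = integral {a..b} (\<lambda>t. integral {0..L} (\<lambda>x. g (x, t)))" by simp
    have "continuous_on ({a..b} \<times> cbox 0 L) (\<lambda>(t, x). g (x, t))"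
      unfolding case_prod_beta by (rule continuous_on_compose2[OF g]) (auto intro!: continuous_intros)
    from integral_continuous_on_param[OF this]
    show "continuous_on {a..b} (\<lambda>t. integral {0..L} (\<lambda>x. g (x, t)))" by simp
  qed
  have line: "integral {0..L} (\<lambda>x. (w (x, t))\<^sup>2) \<le> 2 * L * (w (0,t))\<^sup>2 + 4 * L\<^sup>2 * integral {0..L} (\<lambda>x. (pd (1,0) w (x,t))\<^sup>2)" for t
  proof (rule poincare_line)
    show "((\<lambda>x. w (x, t)) has_real_derivative pd (1,0) w (x, t)) (at x)" for x by (rule smooth_slices(1)[OF w])
    show "continuous_on UNIV (\<lambda>x. pd (1,0) w (x, t))"
      by (rule continuous_on_compose2[OF cw(2)[of UNIV]]) (auto intro!: continuous_intros)
  qed (use L in simp)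
  have "(norm2 ({0<..<L} \<times> {a<..<b}) w)\<^sup>2 = integral {a..b} (\<lambda>t. integral {0..L} (\<lambda>x. (w (x, t))\<^sup>2))"
    unfolding norm2_sq real_norm_def power2_abs smooth_integral_box[OF c2(1)] swap[OF c2(1)] ..
  also have "\<dots> \<le> integral {a..b} (\<lambda>t. 2 * L * (w (0,t))\<^sup>2 + 4 * L\<^sup>2 * integral {0..L} (\<lambda>x. (pd (1,0) w (x,t))\<^sup>2))"
    by (intro integral_le line integrable_continuous_real continuous_intros par c2 continuous_on_subset[OF cs]) auto
  also have "\<dots> = 2 * L * integral {a..b} (\<lambda>t. (w (0,t))\<^sup>2) + 4 * L\<^sup>2 * integral {a..b} (\<lambda>t. integral {0..L} (\<lambda>x. (pd (1,0) w (x,t))\<^sup>2))"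
    by (subst Henstock_Kurzweil_Integration.integral_add)
      (auto intro!: integrable_continuous_real continuous_intros par c2 continuous_on_subset[OF cs])
  also have "integral {a..b} (\<lambda>t. integral {0..L} (\<lambda>x. (pd (1,0) w (x,t))\<^sup>2)) = (norm2 ({0<..<L} \<times> {a<..<b}) (pd (1,0) w))\<^sup>2"
    unfolding norm2_sq real_norm_def power2_abs smooth_integral_box[OF c2(2)] swap[OF c2(2)] ..
  finally show ?thesis by (simp add: n0)
qed

text \<open>Passage to the limit in the smooth approximations that define the trace.\<close>

lemma poincare:
  assumes L: "0 < L" and z: "has_side_trace {0<..<L} {a<..<b} 0 z (\<lambda>t. 0)" and v: "H1_grad ({0<..<L} \<times> {a<..<b}) z v"
  shows "norm2 ({0<..<L} \<times> {a<..<b}) z \<le> 2 * L * norm2 ({0<..<L} \<times> {a<..<b}) v"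
proof -
  let ?U = "{0<..<L} \<times> {a<..<b}"
  have U: "open ?U" "bounded ?U" by (auto intro: open_Times bounded_Times)
  obtain y w where w: "H1_grad ?U z y" "\<And>k::nat. smooth (w k)"
        "(\<lambda>k. norm2 ?U (\<lambda>x. w k x - z x)) \<longlonglongrightarrow> 0" "(\<lambda>k. norm2 ?U (\<lambda>x. grad (w k) x - y x)) \<longlonglongrightarrow> 0"
        "(\<lambda>k. norm2 {a<..<b} (\<lambda>t. w k (0, t))) \<longlonglongrightarrow> 0"
    using z unfolding has_side_trace_iff by auto
  note zL = H1_grad_L2[OF v] H1_grad_L2(2)[OF w(1)]
  have wk: "norm2 ?U (w k) \<le> sqrt (2 * L) * norm2 {a<..<b} (\<lambda>t. w k (0, t)) + 2 * L * norm2 ?U (pd (1,0) (w k))" for k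
  proof (rule power2_le_imp_le)
    have "(norm2 ?U (w k))\<^sup>2 \<le> (sqrt (2 * L) * norm2 {a<..<b} (\<lambda>t. w k (0, t)))\<^sup>2 + (2 * L * norm2 ?U (pd (1,0) (w k)))\<^sup>2"
      using poincare_smooth[OF L w(2)[of k], of a b] L by (simp add: power_mult_distrib)
    also have "\<dots> \<le> (sqrt (2 * L) * norm2 {a<..<b} (\<lambda>t. w k (0, t)) + 2 * L * norm2 ?U (pd (1,0) (w k)))\<^sup>2"
      using L by (simp add: power2_sum)
    finally show "(norm2 ?U (w k))\<^sup>2 \<le> \<dots>" .
  qed (use L in simp)
  have "norm2 ?U z \<le> norm2 ?U (\<lambda>x. w k x - z x) + (sqrt (2 * L) * norm2 {a<..<b} (\<lambda>t. w k (0, t)) +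
      2 * L * (norm2 ?U (\<lambda>x. grad (w k) x - y x) + norm2 ?U v))" for k
  proof -
    have "norm2 ?U z \<le> norm2 ?U (\<lambda>x. w k x - z x) + norm2 ?U (w k)"
      using norm2_le_add[OF zL(1) smooth_L2[OF U w(2)], of k] by (simp add: norm2_minus_commute[of ?U z])
    moreover have "norm2 ?U (pd (1,0) (w k)) \<le> norm2 ?U (grad (w k))"
      using norm2_fst[OF smooth_grad_L2[OF U w(2)], of k] by simp
    moreover have "norm2 ?U (grad (w k)) \<le> norm2 ?U (\<lambda>x. grad (w k) x - y x) + norm2 ?U y"
      by (rule norm2_le_add[OF smooth_grad_L2[OF U w(2)] zL(3)])
    moreover have "norm2 ?U y \<le> norm2 ?U v"
      using norm2_le_add[OF zL(3) zL(2)] H1_grad_unique[OF U w(1) v] by simp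
    ultimately have a: "norm2 ?U (pd (1,0) (w k)) \<le> norm2 ?U (\<lambda>x. grad (w k) x - y x) + norm2 ?U v"
      and b: "norm2 ?U z \<le> norm2 ?U (\<lambda>x. w k x - z x) + norm2 ?U (w k)" by linarith+
    have "2 * L * norm2 ?U (pd (1,0) (w k)) \<le> 2 * L * (norm2 ?U (\<lambda>x. grad (w k) x - y x) + norm2 ?U v)"
      using a L by (intro mult_left_mono) auto
    then show ?thesis using b wk[of k] by linarith
  qed
  moreover have "(\<lambda>k. norm2 ?U (\<lambda>x. w k x - z x) + (sqrt (2 * L) * norm2 {a<..<b} (\<lambda>t. w k (0, t)) +
      2 * L * (norm2 ?U (\<lambda>x. grad (w k) x - y x) + norm2 ?U v))) \<longlonglongrightarrow> 0 + (sqrt (2 * L) * 0 + 2 * L * (0 + norm2 ?U v))"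
    by (intro tendsto_intros w)
  ultimately show ?thesis by (intro LIMSEQ_le_const[of _ "2 * L * norm2 ?U v"]) auto
qed

section \<open>Gradients of admissible functions\<close>

text \<open>The gradients of the competitors for a crack of length \<open>l\<close>.\<close>

definition grads :: "real \<Rightarrow> real \<Rightarrow> (real \<times> real \<Rightarrow> real) \<Rightarrow> real \<Rightarrow> (real \<times> real \<Rightarrow> real \<times> real) set" where
  "grads L H g l = {v. \<exists>u \<in> admissible L H g l. H1_grad (Omega L H - crack l) u v}"

lemma cracked_open: "open (Omega L H - crack l)" and cracked_bounded: "bounded (Omega L H - crack l)"
proof -
  have "open (Omega L H)" "bounded (Omega L H)" by (auto simp: Omega_def intro: open_Times bounded_Times)
  moreover have "closed (crack l)" by (auto simp: crack_def intro: closed_Times)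
  ultimately show "open (Omega L H - crack l)" "bounded (Omega L H - crack l)"
    by (auto intro: open_Diff bounded_subset)
qed

lemma half_subset:
  assumes "I \<in> {{-H<..<0}, {0<..<H}}" "0 < H" shows "{0<..<L} \<times> I \<subseteq> Omega L H - crack l"
  using assms by (auto simp: Omega_def crack_def)

text \<open>The two halves cover the cracked rectangle up to a horizontal segment, which is a null set.\<close>

lemma norm2_halves:
  assumes f: "L2_on (Omega L H - crack l) f" and H: "0 < H"
  shows "norm2 (Omega L H - crack l) f \<le> norm2 ({0<..<L} \<times> {-H<..<0}) f + norm2 ({0<..<L} \<times> {0<..<H}) f"
proof -
  let ?U = "Omega L H - crack l" and ?A = "{0<..<L} \<times> {-H<..<0}" and ?B = "{0<..<L} \<times> {0<..<H}"
  have U: "?U \<in> sets lebesgue" using cracked_open[of L H l] by auto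
  have "open ?A" "open ?B" by (intro open_Times open_greaterThanLessThan)+
  then have A: "?A \<in> sets lebesgue" "?A \<subseteq> ?U" and B: "?B \<in> sets lebesgue" "?B \<subseteq> ?U"
    by (simp_all add: half_subset[OF _ H])
  note LA = L2_on_subset(1)[OF f A(2,1) U] and LB = L2_on_subset(1)[OF f B(2,1) U]
  have sp: "?U \<inter> space lebesgue \<in> sets lebesgue" "?A \<inter> space lebesgue \<in> sets lebesgue" "?B \<inter> space lebesgue \<in> sets lebesgue"
    using U A B by simp_all
  let ?g = "\<lambda>x. (norm (f x))\<^sup>2"
  have iU: "integrable lebesgue (\<lambda>x. indicator ?U x *\<^sub>R ?g x)" using L2_on_integrable[OF f] unfolding integrable_restrict_space[OF sp(1)] .
  have iA: "integrable lebesgue (\<lambda>x. indicator ?A x *\<^sub>R ?g x)" using L2_on_integrable[OF LA] unfolding integrable_restrict_space[OF sp(2)] .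
  have iB: "integrable lebesgue (\<lambda>x. indicator ?B x *\<^sub>R ?g x)" using L2_on_integrable[OF LB] unfolding integrable_restrict_space[OF sp(3)] .
  have "negligible {x :: real \<times> real. x \<bullet> (0, 1) = 0}" by (rule negligible_standard_hyperplane) (simp add: Basis_prod_def)
  then have null: "{x :: real \<times> real. x \<bullet> (0, 1) = 0} \<in> null_sets lebesgue" by (simp add: negligible_iff_null_sets)
  have "(\<integral>x. indicator ?U x *\<^sub>R ?g x \<partial>lebesgue) = (\<integral>x. indicator ?A x *\<^sub>R ?g x + indicator ?B x *\<^sub>R ?g x \<partial>lebesgue)"
  proof (rule integral_cong_AE)
    show "AE x in lebesgue. indicator ?U x *\<^sub>R ?g x = indicator ?A x *\<^sub>R ?g x + indicator ?B x *\<^sub>R ?g x"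
      using AE_not_in[OF null]
    proof eventually_elim
      case (elim x)
      obtain p q where x: "x = (p, q)" by (cases x)
      have q: "q \<noteq> 0" using elim by (simp add: x inner_prod_def)
      have "indicat_real ?U x = indicat_real ?A x + indicat_real ?B x"
        using q H by (auto simp: x Omega_def crack_def indicator_def)
      then show ?case by (simp add: algebra_simps)
    qed
  qed (use iU iA iB in auto)
  also have "\<dots> = (\<integral>x. indicator ?A x *\<^sub>R ?g x \<partial>lebesgue) + (\<integral>x. indicator ?B x *\<^sub>R ?g x \<partial>lebesgue)"
    by (rule Bochner_Integration.integral_add[OF iA iB])
  finally have "(norm2 ?U f)\<^sup>2 = (norm2 ?A f)\<^sup>2 + (norm2 ?B f)\<^sup>2"
    unfolding norm2_sq integral_restrict_space[OF sp(1)] integral_restrict_space[OF sp(2)] integral_restrict_space[OF sp(3)] .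
  also have "\<dots> \<le> (norm2 ?A f + norm2 ?B f)\<^sup>2" by (simp add: power2_sum)
  finally show ?thesis by (rule power2_le_imp_le) simp
qed

lemma admissible_affine:
  assumes u: "u \<in> admissible L H g l" and u': "u' \<in> admissible L H g' l" and c: "\<And>x. a * g x + b * g' x = g'' x"
  shows "(\<lambda>x. a * u x + b * u' x) \<in> admissible L H g'' l"
  unfolding admissible_def
proof (intro CollectI conjI ballI)
  obtain v v' where v: "H1_grad (Omega L H - crack l) u v" "H1_grad (Omega L H - crack l) u' v'"
    using u u' unfolding admissible_def H1_def by blast
  show "(\<lambda>x. a * u x + b * u' x) \<in> H1 (Omega L H - crack l)"
    unfolding H1_def using H1_grad_comb[OF cracked_open cracked_bounded v] by blast
  fix I c' assume I: "I \<in> {{-H<..<0}, {0<..<H}}" and c': "c' \<in> {0, L}"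
  have "open I" "bounded I" using I by auto
  moreover have "has_side_trace {0<..<L} I c' u (\<lambda>t. g (c', t))" "has_side_trace {0<..<L} I c' u' (\<lambda>t. g' (c', t))"
    using u u' I c' unfolding admissible_def by blast+
  ultimately have "has_side_trace {0<..<L} I c' (\<lambda>x. a * u x + b * u' x) (\<lambda>t. a * g (c', t) + b * g' (c', t))"
    by (intro has_side_trace_comb) auto
  then show "has_side_trace {0<..<L} I c' (\<lambda>x. a * u x + b * u' x) (\<lambda>t. g'' (c', t))" by (simp only: c)
qed

lemma admissible_test_function:
  assumes \<psi>: "test_function (Omega L H - crack l) \<psi>"
  shows "\<psi> \<in> admissible L H (\<lambda>_. 0) l"
  unfolding admissible_def
proof (intro CollectI conjI ballI)
  show "\<psi> \<in> H1 (Omega L H - crack l)"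
    unfolding H1_def using H1_grad_smooth[OF cracked_open cracked_bounded test_function_smooth[OF \<psi>]] by blast
  fix I c assume "I \<in> {{-H<..<0}, {0<..<H}}" "c \<in> {0, L}"
  then show "has_side_trace {0<..<L} I c \<psi> (\<lambda>t. 0)"
    using test_function_outside[OF \<psi>]
    by (intro has_side_trace_smooth_zero test_function_smooth[OF \<psi>]) (auto simp: Omega_def)
qed

lemma grads_test_function:
  assumes v: "v \<in> grads L H g l" and \<psi>: "test_function (Omega L H - crack l) \<psi>"
  shows "(\<lambda>x. v x + grad \<psi> x) \<in> grads L H g l"
proof -
  obtain u where u: "u \<in> admissible L H g l" "H1_grad (Omega L H - crack l) u v" using v unfolding grads_def by blast
  have "(\<lambda>x. 1 * u x + 1 * \<psi> x) \<in> admissible L H g l"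
    by (rule admissible_affine[OF u(1) admissible_test_function[OF \<psi>]]) simp
  moreover have "H1_grad (Omega L H - crack l) (\<lambda>x. 1 * u x + 1 * \<psi> x) (\<lambda>x. 1 *\<^sub>R v x + 1 *\<^sub>R grad \<psi> x)"
    by (intro H1_grad_comb cracked_open cracked_bounded u H1_grad_smooth test_function_smooth[OF \<psi>])
  ultimately show ?thesis unfolding grads_def by auto
qed

text \<open>A difference of competitors vanishes on the left side of both halves, where the crack is no obstacle for horizontal
  lines.\<close>

lemma admissible_poincare:
  assumes L: "0 < L" and H: "0 < H" and u: "u \<in> admissible L H (\<lambda>_. 0) l" and v: "H1_grad (Omega L H - crack l) u v"
  shows "norm2 (Omega L H - crack l) u \<le> 4 * L * norm2 (Omega L H - crack l) v"
proof -
  let ?U = "Omega L H - crack l"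
  have half: "norm2 ({0<..<L} \<times> {a<..<b}) u \<le> 2 * L * norm2 ?U v" if I: "{a<..<b} \<in> {{-H<..<0}, {0<..<H}}" for a b
  proof -
    have tr: "has_side_trace {0<..<L} {a<..<b} 0 u (\<lambda>t. 0)" using u I unfolding admissible_def by blast
    have o: "open ({0<..<L} \<times> {a<..<b})" by (auto intro: open_Times)
    have "norm2 ({0<..<L} \<times> {a<..<b}) u \<le> 2 * L * norm2 ({0<..<L} \<times> {a<..<b}) v"
      by (rule poincare[OF L tr H1_grad_subset[OF cracked_open cracked_bounded o half_subset[OF I H] v]])
    also have "\<dots> \<le> 2 * L * norm2 ?U v"
      using L cracked_open[of L H l] o by (intro mult_left_mono L2_on_subset(2)[OF H1_grad_L2(2)[OF v] half_subset[OF I H]]) auto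
    finally show ?thesis .
  qed
  show ?thesis using norm2_halves[OF H1_grad_L2(1)[OF v] H] half[of "-H" 0] half[of 0 H] by simp
qed

text \<open>If the gradients of competitors converge, then so do the competitors, by the Poincare inequality applied to
  differences; weak gradients and traces pass to the limit.\<close>

lemma grads_closed_affine:
  assumes L: "0 < L" and H: "0 < H" shows "closed_affine (Omega L H - crack l) (grads L H g l)"
  unfolding closed_affine_def
proof (intro conjI ballI allI impI)
  let ?U = "Omega L H - crack l"
  note U = cracked_open[of L H l] cracked_bounded[of L H l]
  show "L2_on ?U v" if "v \<in> grads L H g l" for v using that H1_grad_L2(2) unfolding grads_def by blast
  show "(\<lambda>x. (1 - t) *\<^sub>R v x + t *\<^sub>R w x) \<in> grads L H g l" if v: "v \<in> grads L H g l" and w: "w \<in> grads L H g l" for v w t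
  proof -
    obtain u where u: "u \<in> admissible L H g l" "H1_grad ?U u v" using v unfolding grads_def by blast
    obtain u' where u': "u' \<in> admissible L H g l" "H1_grad ?U u' w" using w unfolding grads_def by blast
    have "(\<lambda>x. (1 - t) * u x + t * u' x) \<in> admissible L H g l"
      by (rule admissible_affine[OF u(1) u'(1)]) (simp add: algebra_simps)
    then show ?thesis using H1_grad_comb[OF U u(2) u'(2), of "1 - t" t] unfolding grads_def by blast
  qed
  fix f :: "nat \<Rightarrow> real \<times> real \<Rightarrow> real \<times> real"
  assume f: "\<forall>k. f k \<in> grads L H g l"
    and Cauchy: "\<forall>e>0. \<exists>N. \<forall>i\<ge>N. \<forall>j\<ge>N. norm2 ?U (\<lambda>x. f i x - f j x) < e"
  have "\<forall>k. \<exists>u. u \<in> admissible L H g l \<and> H1_grad ?U u (f k)" using f unfolding grads_def by blast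
  from choice[OF this] obtain u where "\<forall>k. u k \<in> admissible L H g l \<and> H1_grad ?U (u k) (f k)" by (rule exE)
  then have u: "u k \<in> admissible L H g l" "H1_grad ?U (u k) (f k)" for k by blast+
  have diff: "norm2 ?U (\<lambda>x. u i x - u j x) \<le> 4 * L * norm2 ?U (\<lambda>x. f i x - f j x)" for i j
  proof -
    have "(\<lambda>x. 1 * u i x + (-1) * u j x) \<in> admissible L H (\<lambda>_. 0) l"
      by (rule admissible_affine[OF u(1) u(1)]) simp
    moreover have "H1_grad ?U (\<lambda>x. 1 * u i x + (-1) * u j x) (\<lambda>x. 1 *\<^sub>R f i x + (-1) *\<^sub>R f j x)"
      by (rule H1_grad_comb[OF U u(2) u(2)])
    ultimately show ?thesis using admissible_poincare[OF L H] by force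
  qed
  obtain v where v: "L2_on ?U v" "(\<lambda>k. norm2 ?U (\<lambda>x. f k x - v x)) \<longlonglongrightarrow> 0"
    by (rule L2_complete[of ?U f]) (use H1_grad_L2(2)[OF u(2)] Cauchy in auto)
  have "\<exists>N. \<forall>i\<ge>N. \<forall>j\<ge>N. norm2 ?U (\<lambda>x. u i x - u j x) < e" if "e > 0" for e
  proof -
    have "e / (4 * L) > 0" using that L by simp
    then obtain N where N: "\<forall>i\<ge>N. \<forall>j\<ge>N. norm2 ?U (\<lambda>x. f i x - f j x) < e / (4 * L)" using Cauchy by blast
    have "norm2 ?U (\<lambda>x. u i x - u j x) < e" if "i \<ge> N" "j \<ge> N" for i j
    proof -
      have "4 * L * norm2 ?U (\<lambda>x. f i x - f j x) < e" using N that L by (simp add: pos_less_divide_eq mult.commute)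
      then show ?thesis using diff[of i j] by linarith
    qed
    then show ?thesis by blast
  qed
  then obtain z where z: "L2_on ?U z" "(\<lambda>k. norm2 ?U (\<lambda>x. u k x - z x)) \<longlonglongrightarrow> 0"
    by (rule L2_complete[of ?U u, rotated]) (use H1_grad_L2(1)[OF u(2)] in auto)
  have zv: "H1_grad ?U z v" by (rule H1_grad_limit[OF U u(2) z(1) v(1) z(2) v(2)])
  have "z \<in> admissible L H g l"
    unfolding admissible_def
  proof (intro CollectI conjI ballI)
    show "z \<in> H1 ?U" unfolding H1_def using zv by blast
    fix I c assume I: "I \<in> {{-H<..<0}, {0<..<H}}" and c: "c \<in> {0, L}"
    let ?V = "{0<..<L} \<times> I"
    have oI: "open I" "bounded I" "open {0<..<L}" "bounded {0<..<L}" using I by auto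
    have V: "open ?V" "?V \<subseteq> ?U" "?V \<in> sets lebesgue" "?U \<in> sets lebesgue"
      using open_Times[OF oI(3,1)] half_subset[OF I H] U by auto
    note sub = L2_on_subset[OF _ V(2-4)]
    show "has_side_trace {0<..<L} I c z (\<lambda>t. g (c, t))"
    proof (rule has_side_trace_limit[OF oI(3,4,1,2)])
      show "has_side_trace {0<..<L} I c (u k) (\<lambda>t. g (c, t))" for k using u(1)[of k] I c unfolding admissible_def by blast
      show "H1_grad ?V (u k) (f k)" for k by (rule H1_grad_subset[OF U V(1,2) u(2)])
      show "L2_on ?V z" "L2_on ?V v" by (rule sub z v)+
      show "(\<lambda>n. norm2 ?V (\<lambda>x. u n x - z x)) \<longlonglongrightarrow> 0"
        by (rule Lim_null_comparison[OF _ z(2)]) (simp add: sub(2)[OF L2_on_diff[OF H1_grad_L2(1)[OF u(2)] z(1)]])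
      show "(\<lambda>n. norm2 ?V (\<lambda>x. f n x - v x)) \<longlonglongrightarrow> 0"
        by (rule Lim_null_comparison[OF _ v(2)]) (simp add: sub(2)[OF L2_on_diff[OF H1_grad_L2(2)[OF u(2)] v(1)]])
    qed
  qed
  then show "\<exists>v\<in>grads L H g l. (\<lambda>k. norm2 ?U (\<lambda>x. f k x - v x)) \<longlonglongrightarrow> 0"
    using zv v(2) unfolding grads_def by blast
qed

lemma Least_minimal:
  assumes "minimal U \<alpha> \<beta> G v"
  shows "(LEAST e. \<exists>w\<in>G. e = 1/2 * form U \<alpha> \<beta> w w) = 1/2 * form U \<alpha> \<beta> v v"
  by (rule Least_equality) (use assms in \<open>auto simp: minimal_def\<close>)

section \<open>Horizontal diffeomorphisms\<close>

text \<open>A diffeomorphism \<open>\<Psi>\<close> of the line with inverse \<open>\<Phi>\<close>, their derivatives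
  \<open>\<psi>\<close> and \<open>\<phi>\<close>, and a common bound \<open>B\<close> for these. Smoothness of the derivatives is
  expressed in the plane, where it is used.\<close>

locale horizontal_diffeo =
  fixes \<Psi> \<psi> \<Phi> \<phi> :: "real \<Rightarrow> real" and B :: real
  assumes D: "\<And>t. (\<Psi> has_real_derivative \<psi> t) (at t)" "\<And>t. (\<Phi> has_real_derivative \<phi> t) (at t)"
    and inv: "\<And>t. \<Phi> (\<Psi> t) = t" "\<And>t. \<Psi> (\<Phi> t) = t"
    and pos: "\<And>t. 0 < \<psi> t" "\<And>t. 0 < \<phi> t"
    and bound: "\<And>t. \<psi> t \<le> B" "\<And>t. \<phi> t \<le> B"
    and smooth: "smooth (\<lambda>x. \<psi> (fst x))" "smooth (\<lambda>x. \<phi> (fst x))"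
begin

lemma mono: "\<Psi> s < \<Psi> t \<longleftrightarrow> s < t"
proof -
  have inc: "\<Psi> s < \<Psi> t" if "s < t" for s t by (rule DERIV_pos_imp_increasing[OF that]) (use D pos in blast)
  show ?thesis using inc[of s t] inc[of t s] by (cases s t rule: linorder_cases) auto
qed

lemma recip: "\<psi> t * \<phi> (\<Psi> t) = 1"
proof -
  have "((\<lambda>t. \<Phi> (\<Psi> t)) has_real_derivative \<phi> (\<Psi> t) * \<psi> t) (at t)" by (rule DERIV_chain2[OF D(2) D(1)])
  moreover have "((\<lambda>t. \<Phi> (\<Psi> t)) has_real_derivative 1) (at t)" unfolding inv by (rule DERIV_ident)
  ultimately show ?thesis using DERIV_unique by (metis mult.commute)
qed

lemma B_pos: "0 < B" using pos(1)[of 0] bound(1)[of 0] by linarith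

lemma horiz_inv: "horiz \<Phi> (horiz \<Psi> x) = x" "horiz \<Psi> (horiz \<Phi> x) = x"
  by (simp_all add: horiz_def inv)

lemma cont: "continuous_on X \<Psi>" "continuous_on X \<Phi>" "continuous_on X \<psi>"
proof -
  show "continuous_on X \<Psi>" "continuous_on X \<Phi>"
    using D by (meson DERIV_continuous continuous_at_imp_continuous_on)+
  have "continuous_on X (\<lambda>t. (\<lambda>x. \<psi> (fst x)) (t, 0::real))"
    by (rule continuous_on_compose2[OF smooth_cont[OF smooth(1), of UNIV]]) (auto intro!: continuous_intros)
  then show "continuous_on X \<psi>" by simp
qed

lemma cont_horiz: "continuous_on X (horiz \<Psi>)" "continuous_on X (horiz \<Phi>)"
  unfolding horiz_def[abs_def]
  by (auto intro!: continuous_intros continuous_on_compose2[OF cont(1)[of UNIV]] continuous_on_compose2[OF cont(2)[of UNIV]])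

lemma measurable_horiz [measurable]: "horiz \<Psi> \<in> borel_measurable borel" "(\<lambda>x::real\<times>real. ennreal (\<psi> (fst x))) \<in> borel_measurable borel"
proof -
  show "horiz \<Psi> \<in> borel_measurable borel" by (rule borel_measurable_continuous_onI[OF cont_horiz(1)])
  have "(\<lambda>x::real\<times>real. \<psi> (fst x)) \<in> borel_measurable borel" by (rule borel_measurable_continuous_onI[OF smooth_cont[OF smooth(1)]])
  then show "(\<lambda>x::real\<times>real. ennreal (\<psi> (fst x))) \<in> borel_measurable borel" by measurable
qed

text \<open>The image of the weighted measure agrees with the Lebesgue measure on boxes, by Fubini and the fundamental theorem of
  calculus in the horizontal variable.\<close>

lemma lborel_horiz: "lborel = distr (density lborel (\<lambda>x. ennreal (\<psi> (fst x)))) lborel (horiz \<Psi>)"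
proof (rule lborel_eqI)
  have [measurable]: "\<psi> \<in> borel_measurable borel" by (rule borel_measurable_continuous_onI[OF cont(3)])
  fix l u :: "real \<times> real" assume "\<And>b. b \<in> Basis \<Longrightarrow> l \<bullet> b \<le> u \<bullet> b"
  from this[of "(1,0)"] this[of "(0,1)"] have lu: "fst l \<le> fst u" "snd l \<le> snd u"
    by (auto simp: Basis_prod_def inner_prod_def)
  have phi_le: "\<Phi> (fst l) \<le> \<Phi> (fst u)" using lu(1) mono[of "\<Phi> (fst u)" "\<Phi> (fst l)"] by (simp add: inv not_less[symmetric])
  have ball: "horiz \<Psi> x \<in> box l u \<longleftrightarrow> fst x \<in> {\<Phi> (fst l)<..<\<Phi> (fst u)} \<and> snd x \<in> {snd l<..<snd u}" for x
  proof -
    have "fst l < \<Psi> (fst x) \<longleftrightarrow> \<Phi> (fst l) < fst x" "\<Psi> (fst x) < fst u \<longleftrightarrow> fst x < \<Phi> (fst u)"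
      using mono[of "\<Phi> (fst l)" "fst x"] mono[of "fst x" "\<Phi> (fst u)"] by (simp_all add: inv)
    then show ?thesis by (auto simp: mem_box Basis_prod_def inner_prod_def horiz_def)
  qed
  have "emeasure (distr (density lborel (\<lambda>x. ennreal (\<psi> (fst x)))) lborel (horiz \<Psi>)) (box l u) =
    (\<integral>\<^sup>+x. ennreal (\<psi> (fst x)) * indicator (horiz \<Psi> -` box l u) x \<partial>lborel)"
    using measurable_sets[OF measurable_horiz(1), of "box l u"] by (simp add: emeasure_distr emeasure_density)
  also have "\<dots> = (\<integral>\<^sup>+x. (ennreal (\<psi> (fst x)) * indicator {\<Phi> (fst l)<..<\<Phi> (fst u)} (fst x)) * indicator {snd l<..<snd u} (snd x) \<partial>(lborel \<Otimes>\<^sub>M lborel))"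
    unfolding lborel_prod by (intro nn_integral_cong) (auto simp: ball indicator_def)
  also have "\<dots> = (\<integral>\<^sup>+s. \<integral>\<^sup>+t. (ennreal (\<psi> s) * indicator {\<Phi> (fst l)<..<\<Phi> (fst u)} s) * indicator {snd l<..<snd u} t \<partial>lborel \<partial>lborel)"
    by (subst lborel.nn_integral_fst[symmetric]) (auto simp: case_prod_beta')
  also have "\<dots> = (\<integral>\<^sup>+s. (ennreal (\<psi> s) * indicator {\<Phi> (fst l)<..<\<Phi> (fst u)} s) * ennreal (snd u - snd l) \<partial>lborel)"
    using lu by (intro nn_integral_cong) (simp add: nn_integral_cmult)
  also have "\<dots> = (\<integral>\<^sup>+s. ennreal (\<psi> s) * indicator {\<Phi> (fst l)<..<\<Phi> (fst u)} s \<partial>lborel) * ennreal (snd u - snd l)"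
    by (rule nn_integral_multc) measurable
  also have "(\<integral>\<^sup>+s. ennreal (\<psi> s) * indicator {\<Phi> (fst l)<..<\<Phi> (fst u)} s \<partial>lborel) = (\<integral>\<^sup>+s. ennreal (\<psi> s) * indicator {\<Phi> (fst l)..\<Phi> (fst u)} s \<partial>lborel)"
  proof (rule nn_integral_cong_AE)
    have "AE s in lborel. s \<noteq> \<Phi> (fst l) \<and> s \<noteq> \<Phi> (fst u)" using AE_lborel_singleton by (intro AE_conjI)
    then show "AE s in lborel. ennreal (\<psi> s) * indicator {\<Phi> (fst l)<..<\<Phi> (fst u)} s = ennreal (\<psi> s) * indicator {\<Phi> (fst l)..\<Phi> (fst u)} s"
      by eventually_elim (auto simp: indicator_def)
  qed
  also have "\<dots> = ennreal (\<Psi> (\<Phi> (fst u)) - \<Psi> (\<Phi> (fst l)))"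
    by (intro nn_integral_FTC_Icc has_field_derivative_at_within[OF D(1), folded has_real_derivative_iff_has_vector_derivative] D(1) less_imp_le[OF pos(1)] phi_le) measurable
  also have "\<dots> * ennreal (snd u - snd l) = ennreal (\<Prod>b\<in>Basis. (u - l) \<bullet> b)"
    using lu by (simp add: inv Basis_prod_def prod.union_disjoint ennreal_mult' prod.reindex inner_prod_def mult.commute)
  finally show "emeasure (distr (density lborel (\<lambda>x. ennreal (\<psi> (fst x)))) lborel (horiz \<Psi>)) (box l u) = ennreal (\<Prod>b\<in>Basis. (u - l) \<bullet> b)" .
qed simp

text \<open>Completion of the preceding identity: functions in \<open>L\<^sup>2\<close> are only Lebesgue measurable.\<close>

lemma lebesgue_horiz:
  "lebesgue = distr (density lebesgue (\<lambda>x. ennreal (\<psi> (fst x)))) lebesgue (horiz \<Psi>)" (is "_ = distr ?C _ _")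
  "horiz \<Psi> \<in> lebesgue \<rightarrow>\<^sub>M lebesgue"
proof -
  let ?D = "density lborel (\<lambda>x. ennreal (\<psi> (fst x)))"
  have C: "completion ?D = ?C" by (rule completion_density_eq) (use pos in auto)
  have m: "horiz \<Psi> \<in> completion ?D \<rightarrow>\<^sub>M lborel" by (rule measurable_completion) simp
  have eq: "distr (completion ?D) lborel (horiz \<Psi>) = lborel"
    using lborel_horiz by (subst distr_completion) simp_all
  have n: "null_sets (distr (completion ?D) lborel (horiz \<Psi>)) = null_sets lborel" unfolding eq ..
  show "lebesgue = distr ?C lebesgue (horiz \<Psi>)"
    using completion.completion_distr_eq[OF m n, unfolded eq, unfolded C] .
  have "horiz \<Psi> \<in> completion ?D \<rightarrow>\<^sub>M lebesgue" by (rule completion.measurable_completion2[OF m]) (simp add: n)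
  then show "horiz \<Psi> \<in> lebesgue \<rightarrow>\<^sub>M lebesgue" unfolding C by simp
qed

lemma change_of_variables:
  fixes f :: "real \<times> real \<Rightarrow> real"
  assumes U: "U \<in> sets lebesgue" and U': "U' = horiz \<Psi> -` U" and f: "f \<in> borel_measurable (lebesgue_on U)"
  shows "U' \<in> sets lebesgue"
    and "(\<integral>x. f x \<partial>lebesgue_on U) = (\<integral>x. \<psi> (fst x) * f (horiz \<Psi> x) \<partial>lebesgue_on U')"
    and "integrable (lebesgue_on U) f \<longleftrightarrow> integrable (lebesgue_on U') (\<lambda>x. \<psi> (fst x) * f (horiz \<Psi> x))"
proof -
  show s: "U' \<in> sets lebesgue" using measurable_sets[OF lebesgue_horiz(2) U] by (simp add: U')
  have Us: "U \<inter> space lebesgue \<in> sets lebesgue" "U' \<inter> space lebesgue \<in> sets lebesgue" using U s by simp_all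
  let ?F = "\<lambda>x. indicator U x *\<^sub>R f x"
  have F: "?F \<in> borel_measurable lebesgue" using f U by (simp add: borel_measurable_restrict_space_iff)
  have p: "(\<lambda>x::real\<times>real. \<psi> (fst x)) \<in> borel_measurable lebesgue"
    using smooth_measurable[OF smooth(1), of UNIV] by (simp add: lebesgue_on_UNIV_eq)
  have T: "horiz \<Psi> \<in> density lebesgue (\<lambda>x. ennreal (\<psi> (fst x))) \<rightarrow>\<^sub>M lebesgue" using lebesgue_horiz(2) by simp
  have FT: "(\<lambda>x. ?F (horiz \<Psi> x)) \<in> borel_measurable lebesgue" using measurable_compose[OF lebesgue_horiz(2) F] .
  have nn: "AE x in lebesgue. 0 \<le> \<psi> (fst x)" using pos(1) less_imp_le by (intro AE_I2) blast
  have e: "\<psi> (fst x) *\<^sub>R ?F (horiz \<Psi> x) = indicator U' x *\<^sub>R (\<psi> (fst x) * f (horiz \<Psi> x))" for x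
    by (simp add: U' indicator_def)
  have "(\<integral>x. ?F x \<partial>lebesgue) = (\<integral>x. ?F x \<partial>distr (density lebesgue (\<lambda>x. ennreal (\<psi> (fst x)))) lebesgue (horiz \<Psi>))"
    using lebesgue_horiz(1) by simp
  also have "\<dots> = (\<integral>x. ?F (horiz \<Psi> x) \<partial>density lebesgue (\<lambda>x. ennreal (\<psi> (fst x))))" by (rule integral_distr[OF T F])
  also have "\<dots> = (\<integral>x. \<psi> (fst x) *\<^sub>R ?F (horiz \<Psi> x) \<partial>lebesgue)" by (rule integral_density[OF FT p nn])
  finally show "(\<integral>x. f x \<partial>lebesgue_on U) = (\<integral>x. \<psi> (fst x) * f (horiz \<Psi> x) \<partial>lebesgue_on U')"
    unfolding integral_restrict_space[OF Us(1)] integral_restrict_space[OF Us(2)] e .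
  have "integrable lebesgue ?F \<longleftrightarrow> integrable (distr (density lebesgue (\<lambda>x. ennreal (\<psi> (fst x)))) lebesgue (horiz \<Psi>)) ?F"
    using lebesgue_horiz(1) by simp
  also have "\<dots> \<longleftrightarrow> integrable (density lebesgue (\<lambda>x. ennreal (\<psi> (fst x)))) (\<lambda>x. ?F (horiz \<Psi> x))" by (rule integrable_distr_eq[OF T F])
  also have "\<dots> \<longleftrightarrow> integrable lebesgue (\<lambda>x. \<psi> (fst x) *\<^sub>R ?F (horiz \<Psi> x))" by (rule integrable_density[OF FT p nn])
  finally show "integrable (lebesgue_on U) f \<longleftrightarrow> integrable (lebesgue_on U') (\<lambda>x. \<psi> (fst x) * f (horiz \<Psi> x))"
    unfolding integrable_restrict_space[OF Us(1)] integrable_restrict_space[OF Us(2)] e .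
qed

lemma L2_horiz:
  fixes f :: "real \<times> real \<Rightarrow> 'b::euclidean_space"
  assumes U: "U \<in> sets lebesgue" and U': "U' = horiz \<Psi> -` U" and f: "L2_on U f"
  shows "L2_on U' (\<lambda>x. f (horiz \<Psi> x))" "norm2 U' (\<lambda>x. f (horiz \<Psi> x)) \<le> sqrt B * norm2 U f"
proof -
  let ?g = "\<lambda>x. (norm (f x))\<^sup>2"
  have g: "?g \<in> borel_measurable (lebesgue_on U)" using L2_on_measurable[OF f] by measurable
  note cv = change_of_variables[OF U U' g]
  have T: "horiz \<Psi> \<in> lebesgue_on U' \<rightarrow>\<^sub>M lebesgue_on U"
    using lebesgue_horiz(2) U' by (auto intro!: measurable_restrict_space3)
  have m: "(\<lambda>x. f (horiz \<Psi> x)) \<in> borel_measurable (lebesgue_on U')" by (rule measurable_compose[OF T L2_on_measurable[OF f]])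
  have i: "integrable (lebesgue_on U') (\<lambda>x. \<psi> (fst x) * ?g (horiz \<Psi> x))" using cv(3) L2_on_integrable[OF f] by blast
  then have iB: "integrable (lebesgue_on U') (\<lambda>x. B * (\<psi> (fst x) * ?g (horiz \<Psi> x)))" by simp
  have le: "?g (horiz \<Psi> x) \<le> B * (\<psi> (fst x) * ?g (horiz \<Psi> x))" for x
  proof -
    have "1 \<le> \<psi> (fst x) * B"
      using recip[of "fst x"] bound(2)[of "\<Psi> (fst x)"] pos(1)[of "fst x"] by (metis mult_le_cancel_left_pos)
    then have "1 * ?g (horiz \<Psi> x) \<le> (\<psi> (fst x) * B) * ?g (horiz \<Psi> x)" by (intro mult_right_mono) auto
    then show ?thesis by (simp add: mult_ac)
  qed
  have i2: "integrable (lebesgue_on U') (\<lambda>x. ?g (horiz \<Psi> x))"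
    by (rule Bochner_Integration.integrable_bound[OF iB]) (use m le in \<open>auto intro!: AE_I2 order_trans[OF le abs_ge_self]\<close>)
  then show L: "L2_on U' (\<lambda>x. f (horiz \<Psi> x))" using m by (simp add: L2_on_def)
  have "(norm2 U' (\<lambda>x. f (horiz \<Psi> x)))\<^sup>2 \<le> (\<integral>x. B * (\<psi> (fst x) * ?g (horiz \<Psi> x)) \<partial>lebesgue_on U')"
    unfolding norm2_sq by (rule integral_mono[OF i2 iB le])
  also have "\<dots> = (sqrt B * norm2 U f)\<^sup>2" using cv(2) B_pos by (simp add: power_mult_distrib norm2_sq)
  finally show "norm2 U' (\<lambda>x. f (horiz \<Psi> x)) \<le> sqrt B * norm2 U f" by (rule power2_le_imp_le) (use B_pos in simp)
qed

lemma pd_horiz: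
  assumes w: "smooth w"
  shows "pd (1,0) (\<lambda>x. w (horiz \<Psi> x)) x = \<psi> (fst x) * pd (1,0) w (horiz \<Psi> x)"
    and "pd (0,1) (\<lambda>x. w (horiz \<Psi> x)) x = pd (0,1) w (horiz \<Psi> x)"
proof -
  have e: "pd e (\<lambda>x. w (horiz \<Psi> x)) x = pd (\<psi> (fst x) * fst e, snd e) w (horiz \<Psi> x)" for e
    using frechet_derivative_at[OF horiz_has_derivative[OF D(1) smooth_derivative(1)[OF w]], of x, symmetric] by simp
  show "pd (1,0) (\<lambda>x. w (horiz \<Psi> x)) x = \<psi> (fst x) * pd (1,0) w (horiz \<Psi> x)"
    unfolding e using has_derivative_pair_expand[OF smooth_derivative(1)[OF w, of "horiz \<Psi> x"], of "\<psi> (fst x)" 0] by simp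
  show "pd (0,1) (\<lambda>x. w (horiz \<Psi> x)) x = pd (0,1) w (horiz \<Psi> x)"
    unfolding e by simp
qed

lemma swap: "horizontal_diffeo \<Phi> \<phi> \<Psi> \<psi> B"
  by unfold_locales (use D inv pos bound smooth in auto)

end

context horizontal_diffeo begin

lemma test_function_horiz:
  assumes U': "U' = horiz \<Psi> -` U" and \<eta>: "test_function U \<eta>"
  shows "test_function U' (\<lambda>x. \<eta> (horiz \<Psi> x))"
proof -
  obtain K where K: "compact K" "K \<subseteq> U" "\<And>x. x \<notin> K \<Longrightarrow> \<eta> x = 0" using test_functionE[OF \<eta>] by blast
  have c: "compact (horiz \<Phi> ` K)" by (rule compact_continuous_image[OF cont_horiz(2) K(1)])
  have sub: "{x. \<eta> (horiz \<Psi> x) \<noteq> 0} \<subseteq> horiz \<Phi> ` K"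
  proof
    fix x assume "x \<in> {x. \<eta> (horiz \<Psi> x) \<noteq> 0}"
    then have "horiz \<Psi> x \<in> K" using K(3)[of "horiz \<Psi> x"] by (cases "horiz \<Psi> x \<in> K") simp_all
    then have "horiz \<Phi> (horiz \<Psi> x) \<in> horiz \<Phi> ` K" by (rule imageI)
    then show "x \<in> horiz \<Phi> ` K" by (simp only: horiz_inv)
  qed
  have "horiz \<Phi> ` K \<subseteq> U'" using K(2) by (auto simp: U' horiz_inv)
  then show ?thesis
    by (rule test_function_support[OF smooth_horiz[OF D(1) smooth(1) test_function_smooth[OF \<eta>]] sub c])
qed

text \<open>The chain rule for weak gradients. A test function on the new domain is transported back by the inverse; for the
  vertical derivative it is multiplied by \<open>\<phi>\<close>, which cancels the Jacobian and does not depend on the vertical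
  coordinate.\<close>

lemma H1_grad_horiz:
  assumes U: "open U" "bounded U" and U'o: "open U'" "bounded U'" and U': "U' = horiz \<Psi> -` U" and h: "H1_grad U u v"
  shows "H1_grad U' (\<lambda>x. u (horiz \<Psi> x)) (\<lambda>x. (\<psi> (fst x) * fst (v (horiz \<Psi> x)), snd (v (horiz \<Psi> x))))"
  unfolding H1_grad_iff[OF U'o]
proof (intro conjI allI impI)
  interpret inverse: horizontal_diffeo \<Phi> \<phi> \<Psi> \<psi> B by (rule swap)
  have Us: "U \<in> sets lebesgue" "U' \<in> sets lebesgue" using U U'o by auto
  have UU: "U = horiz \<Phi> -` U'" by (simp add: U' vimage_def horiz_inv)
  note L = H1_grad_L2[OF h]
  show "L2_on U' (\<lambda>x. u (horiz \<Psi> x))" by (rule L2_horiz(1)[OF Us(1) U' L(1)])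
  have Lv: "L2_on U' (\<lambda>x. v (horiz \<Psi> x))" by (rule L2_horiz(1)[OF Us(1) U' L(2)])
  show "L2_on U' (\<lambda>x. (\<psi> (fst x) * fst (v (horiz \<Psi> x)), snd (v (horiz \<Psi> x))))"
    using Lv unfolding L2_on_pair fst_conv snd_conv
    by (intro conjI L2_on_bounded_mult_real(1)[where C=B] smooth_measurable smooth Us) (auto simp: abs_of_pos pos bound)
  fix \<eta> assume \<eta>: "test_function U' \<eta>"
  have s: "smooth \<eta>" by (rule test_function_smooth[OF \<eta>])
  have t: "test_function U (\<lambda>x. \<eta> (horiz \<Phi> x))" by (rule inverse.test_function_horiz[OF UU \<eta>])
  have m: "smooth f \<Longrightarrow> f \<in> borel_measurable (lebesgue_on U)" for f by (rule smooth_measurable[OF _ Us(1)])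
  have [measurable]: "u \<in> borel_measurable (lebesgue_on U)" "(\<lambda>x. fst (v x)) \<in> borel_measurable (lebesgue_on U)"
    "(\<lambda>x. snd (v x)) \<in> borel_measurable (lebesgue_on U)"
    using L by (auto simp: L2_on_pair L2_on_def)
  have [measurable]: "(\<lambda>x. \<eta> (horiz \<Phi> x)) \<in> borel_measurable (lebesgue_on U)"
    "(\<lambda>x. pd e \<eta> (horiz \<Phi> x)) \<in> borel_measurable (lebesgue_on U)" "(\<lambda>x. \<phi> (fst x)) \<in> borel_measurable (lebesgue_on U)" for e
    by (intro m smooth_horiz[OF D(2) smooth(2)] smooth smooth_derivative(2) s)+
  have r: "\<psi> (fst x) * (\<phi> (\<Psi> (fst x)) * a) = a" for x and a :: real
    using recip[of "fst x"] by (metis mult.assoc mult_1)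
  note cv = change_of_variables(2)[OF Us(1) U']
  have "(\<integral>x. u x * (\<phi> (fst x) * pd (1,0) \<eta> (horiz \<Phi> x)) \<partial>lebesgue_on U) = - (\<integral>x. \<eta> (horiz \<Phi> x) * fst (v x) \<partial>lebesgue_on U)"
    using H1_gradD(1)[OF U h t] unfolding inverse.pd_horiz[OF s] .
  also have "(\<integral>x. u x * (\<phi> (fst x) * pd (1,0) \<eta> (horiz \<Phi> x)) \<partial>lebesgue_on U) =
      (\<integral>x. \<psi> (fst x) * (u (horiz \<Psi> x) * (\<phi> (fst (horiz \<Psi> x)) * pd (1,0) \<eta> (horiz \<Phi> (horiz \<Psi> x)))) \<partial>lebesgue_on U')"
    by (rule cv) measurable
  also have "\<dots> = (\<integral>x. u (horiz \<Psi> x) * pd (1,0) \<eta> x \<partial>lebesgue_on U')"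
    unfolding horiz_inv by (intro Bochner_Integration.integral_cong refl) (simp add: horiz_def mult.left_commute[of _ "u _"] r)
  also have "(\<integral>x. \<eta> (horiz \<Phi> x) * fst (v x) \<partial>lebesgue_on U) = (\<integral>x. \<psi> (fst x) * (\<eta> (horiz \<Phi> (horiz \<Psi> x)) * fst (v (horiz \<Psi> x))) \<partial>lebesgue_on U')"
    by (rule cv) measurable
  finally show "(\<integral>x. u (horiz \<Psi> x) * pd (1,0) \<eta> x \<partial>lebesgue_on U') =
      - (\<integral>x. \<eta> x * fst (\<psi> (fst x) * fst (v (horiz \<Psi> x)), snd (v (horiz \<Psi> x))) \<partial>lebesgue_on U')"
    unfolding horiz_inv by (simp add: mult.left_commute)
  have t2: "test_function U (\<lambda>x. \<phi> (fst x) * \<eta> (horiz \<Phi> x))" by (rule test_function_mult[OF t smooth(2)])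
  have p0: "pd (0,1) (\<lambda>x. \<phi> (fst x)) x = 0" for x
  proof -
    have c: "((\<lambda>t. x + t *\<^sub>R (0,1)) has_derivative (\<lambda>t. t *\<^sub>R (0,1))) (at 0)" by (auto intro!: derivative_eq_intros)
    have "((\<lambda>t. \<phi> (fst (x + t *\<^sub>R (0,1::real)))) has_derivative (\<lambda>t. pd (t *\<^sub>R (0,1)) (\<lambda>x. \<phi> (fst x)) x)) (at 0)"
      using has_derivative_compose[OF c, of "\<lambda>x. \<phi> (fst x)" "\<lambda>e. pd e (\<lambda>x. \<phi> (fst x)) x"] smooth_derivative(1)[OF smooth(2), of x]
      by (simp add: zero_prod_def[symmetric])
    then have "((\<lambda>t::real. \<phi> (fst x)) has_derivative (\<lambda>t. pd (t *\<^sub>R (0,1)) (\<lambda>x. \<phi> (fst x)) x)) (at 0)" by simp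
    from has_derivative_unique[OF this has_derivative_const] have "(\<lambda>t. pd (t *\<^sub>R (0,1)) (\<lambda>x. \<phi> (fst x)) x) = (\<lambda>_. 0)" .
    from fun_cong[OF this, of 1] show ?thesis by simp
  qed
  have pd2: "pd (0,1) (\<lambda>x. \<phi> (fst x) * \<eta> (horiz \<Phi> x)) x = \<phi> (fst x) * pd (0,1) \<eta> (horiz \<Phi> x)" for x
    unfolding pd_mult[OF smooth(2) smooth_horiz[OF D(2) smooth(2) s]] inverse.pd_horiz[OF s] p0 by simp
  have "(\<integral>x. u x * (\<phi> (fst x) * pd (0,1) \<eta> (horiz \<Phi> x)) \<partial>lebesgue_on U) = - (\<integral>x. \<phi> (fst x) * \<eta> (horiz \<Phi> x) * snd (v x) \<partial>lebesgue_on U)"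
    using H1_gradD(2)[OF U h t2] unfolding pd2 .
  also have "(\<integral>x. u x * (\<phi> (fst x) * pd (0,1) \<eta> (horiz \<Phi> x)) \<partial>lebesgue_on U) =
      (\<integral>x. \<psi> (fst x) * (u (horiz \<Psi> x) * (\<phi> (fst (horiz \<Psi> x)) * pd (0,1) \<eta> (horiz \<Phi> (horiz \<Psi> x)))) \<partial>lebesgue_on U')"
    by (rule cv) measurable
  also have "\<dots> = (\<integral>x. u (horiz \<Psi> x) * pd (0,1) \<eta> x \<partial>lebesgue_on U')"
    unfolding horiz_inv by (intro Bochner_Integration.integral_cong refl) (simp add: horiz_def mult.left_commute[of _ "u _"] r)
  also have "(\<integral>x. \<phi> (fst x) * \<eta> (horiz \<Phi> x) * snd (v x) \<partial>lebesgue_on U) =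
     (\<integral>x. \<psi> (fst x) * (\<phi> (fst (horiz \<Psi> x)) * \<eta> (horiz \<Phi> (horiz \<Psi> x)) * snd (v (horiz \<Psi> x))) \<partial>lebesgue_on U')"
    by (rule cv) measurable
  also have "\<dots> = (\<integral>x. \<eta> x * snd (v (horiz \<Psi> x)) \<partial>lebesgue_on U')"
    unfolding horiz_inv by (intro Bochner_Integration.integral_cong refl) (simp add: horiz_def mult.assoc r)
  finally show "(\<integral>x. u (horiz \<Psi> x) * pd (0,1) \<eta> x \<partial>lebesgue_on U') =
      - (\<integral>x. \<eta> x * snd (\<psi> (fst x) * fst (v (horiz \<Psi> x)), snd (v (horiz \<Psi> x))) \<partial>lebesgue_on U')" by simp
qed

text \<open>The smooth approximations are composed with the map; a side whose abscissa is fixed keeps its trace.\<close>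

lemma has_side_trace_horiz:
  assumes X: "open X" "bounded X" "open I" "bounded I" and X': "\<Psi> -` X = X" and c: "\<Psi> c = c"
    and tr: "has_side_trace X I c u f"
  shows "has_side_trace X I c (\<lambda>x. u (horiz \<Psi> x)) f"
proof -
  let ?U = "X \<times> I"
  have U: "open ?U" "bounded ?U" using X by (auto intro: open_Times bounded_Times)
  have Us: "?U \<in> sets lebesgue" using U by auto
  have UU: "?U = horiz \<Psi> -` ?U" using X' by (auto simp: horiz_def)
  obtain v w where vw: "L2_on I f" "H1_grad ?U u v" "\<And>k::nat. smooth (w k)"
      "(\<lambda>k. norm2 ?U (\<lambda>x. w k x - u x)) \<longlonglongrightarrow> 0" "(\<lambda>k. norm2 ?U (\<lambda>x. grad (w k) x - v x)) \<longlonglongrightarrow> 0"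
      "(\<lambda>k. norm2 I (\<lambda>t. w k (c, t) - f t)) \<longlonglongrightarrow> 0"
    using tr unfolding has_side_trace_iff by blast
  note L = H1_grad_L2[OF vw(2)]
  show ?thesis unfolding has_side_trace_iff
  proof (intro conjI exI[of _ "\<lambda>x. (\<psi> (fst x) * fst (v (horiz \<Psi> x)), snd (v (horiz \<Psi> x)))"] exI[of _ "\<lambda>k x. w k (horiz \<Psi> x)"] allI)
    show "L2_on I f" by fact
    show "H1_grad ?U (\<lambda>x. u (horiz \<Psi> x)) (\<lambda>x. (\<psi> (fst x) * fst (v (horiz \<Psi> x)), snd (v (horiz \<Psi> x))))"
      by (rule H1_grad_horiz[OF U U UU vw(2)])
    show "smooth (\<lambda>x. w k (horiz \<Psi> x))" for k by (rule smooth_horiz[OF D(1) smooth(1) vw(3)])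
    show "(\<lambda>k. norm2 ?U (\<lambda>x. w k (horiz \<Psi> x) - u (horiz \<Psi> x))) \<longlonglongrightarrow> 0"
    proof (rule Lim_null_comparison)
      show "(\<lambda>k. sqrt B * norm2 ?U (\<lambda>x. w k x - u x)) \<longlonglongrightarrow> 0" using tendsto_mult[OF tendsto_const vw(4)] by simp
      show "\<forall>\<^sub>F k in sequentially. norm (norm2 ?U (\<lambda>x. w k (horiz \<Psi> x) - u (horiz \<Psi> x))) \<le> sqrt B * norm2 ?U (\<lambda>x. w k x - u x)"
        using L2_horiz(2)[OF Us UU L2_on_diff[OF smooth_L2[OF U vw(3)] L(1)]] by simp
    qed
    show "(\<lambda>k. norm2 ?U (\<lambda>x. grad (\<lambda>x. w k (horiz \<Psi> x)) x - (\<psi> (fst x) * fst (v (horiz \<Psi> x)), snd (v (horiz \<Psi> x))))) \<longlonglongrightarrow> 0"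
    proof (rule Lim_null_comparison)
      let ?M = "max B 1"
      show "(\<lambda>k. \<bar>?M\<bar> * (sqrt B * norm2 ?U (\<lambda>x. grad (w k) x - v x))) \<longlonglongrightarrow> 0"
        using tendsto_mult[OF tendsto_const tendsto_mult[OF tendsto_const vw(5)]] by simp
      have "norm2 ?U (\<lambda>x. grad (\<lambda>x. w k (horiz \<Psi> x)) x - (\<psi> (fst x) * fst (v (horiz \<Psi> x)), snd (v (horiz \<Psi> x)))) \<le>
          \<bar>?M\<bar> * (sqrt B * norm2 ?U (\<lambda>x. grad (w k) x - v x))" for k
      proof -
        let ?d = "\<lambda>x. grad (w k) (horiz \<Psi> x) - v (horiz \<Psi> x)"
        have Ld: "L2_on ?U (\<lambda>x. grad (w k) x - v x)" by (intro L2_on_diff smooth_grad_L2 U vw(3) L)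
        note d = L2_horiz[OF Us UU Ld]
        have w1: "weight ?U ?M (\<lambda>x. \<psi> (fst x))" "weight ?U ?M (\<lambda>x. 1)"
          unfolding weight_def using smooth_measurable[OF smooth(1) Us] bound(1) pos(1)
          by (auto simp: abs_of_pos le_max_iff_disj)
        have e: "grad (\<lambda>x. w k (horiz \<Psi> x)) x - (\<psi> (fst x) * fst (v (horiz \<Psi> x)), snd (v (horiz \<Psi> x))) = (\<psi> (fst x) * fst (?d x), 1 * snd (?d x))" for x
          by (simp add: grad_def pd_horiz[OF vw(3)] algebra_simps)
        have "norm2 ?U (\<lambda>x. (\<psi> (fst x) * fst (?d x), 1 * snd (?d x))) \<le> \<bar>?M\<bar> * norm2 ?U ?d" by (rule weighted_field(2)[OF w1 d(1)])
        also have "\<dots> \<le> \<bar>?M\<bar> * (sqrt B * norm2 ?U (\<lambda>x. grad (w k) x - v x))" by (rule mult_left_mono[OF d(2)]) simp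
        finally show ?thesis unfolding e .
      qed
      then show "\<forall>\<^sub>F k in sequentially. norm (norm2 ?U (\<lambda>x. grad (\<lambda>x. w k (horiz \<Psi> x)) x - (\<psi> (fst x) * fst (v (horiz \<Psi> x)), snd (v (horiz \<Psi> x))))) \<le>
          \<bar>?M\<bar> * (sqrt B * norm2 ?U (\<lambda>x. grad (w k) x - v x))" by simp
    qed
    show "(\<lambda>k. norm2 I (\<lambda>t. w k (horiz \<Psi> (c, t)) - f t)) \<longlonglongrightarrow> 0" using vw(6) by (simp add: horiz_def c)
  qed
qed

end

section \<open>An explicit flow fixing both lateral sides\<close>

text \<open>The reciprocal of the derivative of the map \<open>flow L s\<close> below, where it is computed. As a function of
  \<open>s\<close> it is a combination of \<open>e\<^sup>s\<close> and \<open>e\<^sup>-\<^sup>s\<close>, so the transported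
  weights are explicit and their second derivatives are bounded locally in \<open>s\<close>.\<close>

definition flow_b :: "real \<Rightarrow> real \<Rightarrow> real \<Rightarrow> real" where
  "flow_b L s x = cosh s - sinh s * cos (pi * x / L)"

text \<open>In the angle \<open>\<theta> = \<pi> x / L\<close> this is the flow \<open>tan (\<theta>/2) \<mapsto> e\<^sup>s tan
  (\<theta>/2)\<close> of Moebius transformations of the circle, written so that it is defined on the whole line. It fixes
  \<open>0\<close> and \<open>L\<close>, hence both lateral sides, and its orbit through \<open>L/2\<close> sweeps out the whole
  interval between them, so a single family of maps transports the crack \<open>[0, L/2]\<close> to every other crack.\<close>

definition flow :: "real \<Rightarrow> real \<Rightarrow> real \<Rightarrow> real" where
  "flow L s x = x + 2 * L / pi * arctan (sinh (s/2) * sin (pi * x / L) / (cosh (s/2) - sinh (s/2) * cos (pi * x / L)))"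

text \<open>The middle term is a convex combination of \<open>e\<^sup>s\<close> and \<open>e\<^sup>-\<^sup>s\<close>.\<close>

lemma exp_bounds_cosh_sinh:
  assumes "\<bar>c\<bar> \<le> (1::real)"
  shows "exp (- \<bar>s\<bar>) \<le> cosh s - sinh s * c" "cosh s - sinh s * c \<le> exp \<bar>s\<bar>"
proof -
  have e: "cosh s - sinh s * c = (1 - c) / 2 * exp s + (1 + c) / 2 * exp (- s)"
    by (simp add: cosh_def sinh_def field_simps)
  have c: "0 \<le> (1 - c) / 2" "0 \<le> (1 + c) / 2" using assms by auto
  have "(1 - c) / 2 * exp (- \<bar>s\<bar>) + (1 + c) / 2 * exp (- \<bar>s\<bar>) \<le> cosh s - sinh s * c"
    unfolding e using c by (intro add_mono mult_left_mono) auto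
  then show "exp (- \<bar>s\<bar>) \<le> cosh s - sinh s * c" by (simp add: field_simps)
  have "cosh s - sinh s * c \<le> (1 - c) / 2 * exp \<bar>s\<bar> + (1 + c) / 2 * exp \<bar>s\<bar>"
    unfolding e using c by (intro add_mono mult_left_mono) auto
  then show "cosh s - sinh s * c \<le> exp \<bar>s\<bar>" by (simp add: field_simps)
qed

lemma flow_b_bounds: "exp (- \<bar>s\<bar>) \<le> flow_b L s x" "flow_b L s x \<le> exp \<bar>s\<bar>" "0 < flow_b L s x"
proof -
  show lower: "exp (- \<bar>s\<bar>) \<le> flow_b L s x" unfolding flow_b_def by (rule exp_bounds_cosh_sinh(1)) simp
  show "flow_b L s x \<le> exp \<bar>s\<bar>" unfolding flow_b_def by (rule exp_bounds_cosh_sinh(2)) simp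
  from lower show "0 < flow_b L s x" by (meson exp_gt_zero less_le_trans)
qed

text \<open>The squared modulus of \<open>cosh (s/2) - sinh (s/2) e\<^sup>-\<^sup>i\<^sup>\<theta>\<close>, the denominator that
  appears when the arctangent is differentiated.\<close>

lemma flow_b_half:
  "flow_b L s x = (cosh (s/2) - sinh (s/2) * cos (pi * x / L))\<^sup>2 + (sinh (s/2) * sin (pi * x / L))\<^sup>2"
proof -
  let ?c = "cos (pi * x / L)" and ?g = "sin (pi * x / L)"
  have "cosh s = (cosh (s/2))\<^sup>2 + (sinh (s/2))\<^sup>2" "sinh s = 2 * sinh (s/2) * cosh (s/2)"
    using cosh_add[of "s/2" "s/2"] sinh_add[of "s/2" "s/2"] by (simp_all add: power2_eq_square)
  moreover have "(sinh (s/2) * ?g)\<^sup>2 = (sinh (s/2))\<^sup>2 * (1 - ?c\<^sup>2)" by (simp only: power_mult_distrib sin_squared_eq)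
  ultimately show ?thesis unfolding flow_b_def by (simp add: power2_eq_square algebra_simps)
qed

lemma flow_denominator_pos: "0 < cosh (s/2) - sinh (s/2) * cos t" for s t :: real
  using exp_bounds_cosh_sinh(1)[of "cos t" "s/2"] by (meson abs_cos_le_one exp_gt_zero less_le_trans)

lemma flow_deriv:
  assumes L: "L \<noteq> 0" shows "(flow L s has_real_derivative 1 / flow_b L s x) (at x)"
proof -
  define c g C S where "c = cos (pi * x / L)" and "g = sin (pi * x / L)" and "C = cosh (s/2)" and "S = sinh (s/2)"
  define d where "d = C - S * c"
  have d: "d \<noteq> 0" using flow_denominator_pos[of s "pi * x / L"] by (simp add: d_def C_def S_def c_def)
  have b: "flow_b L s x = d\<^sup>2 + (S * g)\<^sup>2" by (simp add: flow_b_half d_def C_def S_def c_def g_def)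
  have bp: "d\<^sup>2 + (S * g)\<^sup>2 > 0" using flow_b_bounds(3)[of L s x] b by simp
  have sin': "((\<lambda>x. S * sin (pi * x / L)) has_real_derivative S * (c * (pi / L))) (at x)"
    and den': "((\<lambda>x. C - S * cos (pi * x / L)) has_real_derivative S * (g * (pi / L))) (at x)"
    using L by (auto intro!: derivative_eq_intros simp: c_def g_def)
  have z: "((\<lambda>x. S * sin (pi * x / L) / (C - S * cos (pi * x / L))) has_real_derivative
      (pi / L) * (S * c * d - S * g * (S * g)) / d\<^sup>2) (at x)"
  proof (rule DERIV_cong[OF DERIV_divide[OF sin' den']])
    show "C - S * cos (pi * x / L) \<noteq> 0" using d by (simp add: d_def c_def)
    show "(S * (c * (pi / L)) * (C - S * cos (pi * x / L)) - S * sin (pi * x / L) * (S * (g * (pi / L)))) /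
        ((C - S * cos (pi * x / L)) * (C - S * cos (pi * x / L))) = (pi / L) * (S * c * d - S * g * (S * g)) / d\<^sup>2"
      unfolding c_def[symmetric] g_def[symmetric] d_def[symmetric]
      by (simp add: power2_eq_square right_diff_distrib mult_ac)
  qed
  have "(flow L s has_real_derivative
      1 + 2 * L / pi * (inverse (1 + (S * g / d)\<^sup>2) * ((pi / L) * (S * c * d - S * g * (S * g)) / d\<^sup>2))) (at x)"
    unfolding flow_def[abs_def]
    using DERIV_add[OF DERIV_ident DERIV_cmult[OF DERIV_chain2[OF DERIV_arctan z], of "2 * L / pi"]]
    by (simp add: d_def C_def S_def c_def g_def)
  moreover have "1 + 2 * L / pi * (inverse (1 + (S * g / d)\<^sup>2) * ((pi / L) * (S * c * d - S * g * (S * g)) / d\<^sup>2)) = 1 / flow_b L s x"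
  proof -
    have i: "inverse (1 + (S * g / d)\<^sup>2) = d\<^sup>2 / (d\<^sup>2 + (S * g)\<^sup>2)"
      using d by (simp add: power_divide divide_simps)
    have "2 * L / pi * (d\<^sup>2 / (d\<^sup>2 + (S * g)\<^sup>2) * ((pi / L) * (S * c * d - S * g * (S * g)) / d\<^sup>2)) =
        2 * (S * c * d - S * g * (S * g)) / (d\<^sup>2 + (S * g)\<^sup>2)"
      using d L bp by (simp add: divide_simps)
    moreover have qn: "d\<^sup>2 + (S * g)\<^sup>2 \<noteq> 0" using bp by (rule less_imp_neq[symmetric])
    ultimately have "1 + 2 * L / pi * (inverse (1 + (S * g / d)\<^sup>2) * ((pi / L) * (S * c * d - S * g * (S * g)) / d\<^sup>2)) =
        (d\<^sup>2 + (S * g)\<^sup>2 + 2 * (S * c * d - S * g * (S * g))) / (d\<^sup>2 + (S * g)\<^sup>2)"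
      by (simp only: i add_divide_distrib[of "d\<^sup>2 + (S * g)\<^sup>2"] divide_self simp_thms)
    moreover have "d\<^sup>2 + (S * g)\<^sup>2 + 2 * (S * c * d - S * g * (S * g)) = 1"
    proof -
      have g2: "g\<^sup>2 = 1 - c\<^sup>2" by (simp add: g_def c_def sin_squared_eq)
      have "d\<^sup>2 + (S * g)\<^sup>2 + 2 * (S * c * d - S * g * (S * g)) = d\<^sup>2 + 2 * (S * c * d) - S\<^sup>2 * g\<^sup>2"
        by (simp add: power2_eq_square algebra_simps)
      also have "\<dots> = C\<^sup>2 - S\<^sup>2" unfolding g2 d_def by (simp add: power2_eq_square algebra_simps)
      also have "\<dots> = 1" unfolding C_def S_def by (rule hyperbolic_pythagoras)
      finally show ?thesis .
    qed
    ultimately show ?thesis using b by simp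
  qed
  ultimately show ?thesis by simp
qed

text \<open>The infinitesimal form of the group law, which makes the map for \<open>- s\<close> the inverse of the map for
  \<open>s\<close>.\<close>

lemma flow_b_flow:
  assumes L: "L \<noteq> 0" shows "flow_b L (- s) (flow L s x) * flow_b L s x = 1"
proof -
  define c g C S where "c = cos (pi * x / L)" and "g = sin (pi * x / L)" and "C = cosh (s/2)" and "S = sinh (s/2)"
  define d where "d = C - S * c"
  define z where "z = S * g / d"
  have d: "d \<noteq> 0" using flow_denominator_pos[of s "pi * x / L"] by (simp add: d_def C_def S_def c_def)
  have b: "flow_b L s x = d\<^sup>2 + (S * g)\<^sup>2" by (simp add: flow_b_half d_def C_def S_def c_def g_def)
  have bp: "d\<^sup>2 + (S * g)\<^sup>2 > 0" using flow_b_bounds(3)[of L s x] b by simp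
  have g2: "g\<^sup>2 = 1 - c\<^sup>2" by (simp add: g_def c_def sin_squared_eq)
  have CS: "C\<^sup>2 = S\<^sup>2 + 1" using hyperbolic_pythagoras[of "s/2"] by (simp add: C_def S_def)
  have ch: "cosh s = C\<^sup>2 + S\<^sup>2" "sinh s = 2 * S * C"
    using cosh_add[of "s/2" "s/2"] sinh_add[of "s/2" "s/2"] by (simp_all add: power2_eq_square C_def S_def)
  have zp: "1 + z\<^sup>2 > 0" by (simp add: add_pos_nonneg)
  have "pi * flow L s x / L = pi * x / L + 2 * arctan z"
    using L by (simp add: flow_def z_def d_def C_def S_def c_def g_def field_simps)
  then have "cos (pi * flow L s x / L) = c * cos (2 * arctan z) - g * sin (2 * arctan z)"
    by (simp add: cos_add c_def g_def)
  also have "cos (2 * arctan z) = (1 - z\<^sup>2) / (1 + z\<^sup>2)"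
    using zp by (simp add: cos_double cos_arctan sin_arctan power_divide diff_divide_distrib)
  also have "sin (2 * arctan z) = 2 * z / (1 + z\<^sup>2)"
    using zp by (simp add: sin_double cos_arctan sin_arctan)
  also have "(1 - z\<^sup>2) / (1 + z\<^sup>2) = (d\<^sup>2 - (S * g)\<^sup>2) / (d\<^sup>2 + (S * g)\<^sup>2)"
    using d zp bp by (simp add: z_def power_divide divide_simps)
  also have "2 * z / (1 + z\<^sup>2) = 2 * (S * g) * d / (d\<^sup>2 + (S * g)\<^sup>2)"
    using d zp bp by (simp add: z_def power_divide divide_simps power2_eq_square)
  finally have "cos (pi * flow L s x / L) = (c * (d\<^sup>2 - (S * g)\<^sup>2) - g * (2 * (S * g) * d)) / (d\<^sup>2 + (S * g)\<^sup>2)"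
    by (simp add: diff_divide_distrib right_diff_distrib)
  also have "c * (d\<^sup>2 - (S * g)\<^sup>2) - g * (2 * (S * g) * d) = c * (d\<^sup>2 - S\<^sup>2 * g\<^sup>2) - 2 * S * d * g\<^sup>2"
    by (simp add: power2_eq_square algebra_simps)
  also have "\<dots> = c * (C\<^sup>2 + S\<^sup>2) - 2 * S * C"
    unfolding g2 d_def by (simp add: power2_eq_square algebra_simps)
  finally have "cos (pi * flow L s x / L) = (c * (C\<^sup>2 + S\<^sup>2) - 2 * S * C) / (d\<^sup>2 + (S * g)\<^sup>2)" .
  then have cos: "cos (pi * flow L s x / L) * (d\<^sup>2 + (S * g)\<^sup>2) = c * (C\<^sup>2 + S\<^sup>2) - 2 * S * C"
    by (rule nonzero_eq_divide_eq[OF less_imp_neq[OF bp, symmetric], THEN iffD1])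
  have dd: "d\<^sup>2 + (S * g)\<^sup>2 = (C\<^sup>2 + S\<^sup>2) - 2 * S * C * c"
    using b ch by (simp add: flow_b_def c_def)
  have "flow_b L (- s) (flow L s x) * flow_b L s x = (C\<^sup>2 + S\<^sup>2) * (d\<^sup>2 + (S * g)\<^sup>2) + 2 * S * C * (cos (pi * flow L s x / L) * (d\<^sup>2 + (S * g)\<^sup>2))"
    unfolding b by (simp add: flow_b_def ch algebra_simps)
  also have "\<dots> = (C\<^sup>2 + S\<^sup>2)\<^sup>2 - 4 * S\<^sup>2 * C\<^sup>2"
    unfolding cos unfolding dd by (simp add: power2_eq_square algebra_simps)
  also have "\<dots> = (C\<^sup>2 - S\<^sup>2)\<^sup>2" by (simp add: power2_eq_square algebra_simps)
  also have "\<dots> = 1" using CS by simp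
  finally show ?thesis .
qed

lemma flow_zero: "flow L s 0 = 0" and flow_end: "L \<noteq> 0 \<Longrightarrow> flow L s L = L"
  by (simp_all add: flow_def)

lemma flow_middle: "L \<noteq> 0 \<Longrightarrow> flow L s (L/2) = L/2 + 2 * L / pi * arctan (tanh (s/2))"
  by (simp add: flow_def tanh_def)

text \<open>The composition has derivative one and fixes the origin.\<close>

lemma flow_inverse:
  assumes L: "L \<noteq> 0" shows "flow L (- s) (flow L s x) = x"
proof -
  have "((\<lambda>x. flow L (- s) (flow L s x) - x) has_real_derivative 0) (at x)" for x
  proof -
    have "((\<lambda>x. flow L (- s) (flow L s x) - x) has_real_derivative 1 / flow_b L (- s) (flow L s x) * (1 / flow_b L s x) - 1) (at x)"
      by (intro DERIV_diff DERIV_ident DERIV_chain2[OF flow_deriv[OF L] flow_deriv[OF L]])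
    then show ?thesis using flow_b_flow[OF L, of s x] by simp
  qed
  then have "flow L (- s) (flow L s x) - x = flow L (- s) (flow L s 0) - 0"
    by (intro DERIV_isconst_all allI)
  then show ?thesis by (simp add: flow_zero)
qed

text \<open>The derivatives of \<open>1 / flow_b\<close> are polynomials in \<open>1 / flow_b\<close>, sine and cosine.\<close>

lemma smooth_flow_b: assumes L: "L \<noteq> 0" shows "smooth (\<lambda>x. 1 / flow_b L s (fst x))"
proof -
  let ?p = "\<lambda>x. 1 / flow_b L s x" and ?c = "\<lambda>x. cos (pi * x / L)" and ?g = "\<lambda>x. sin (pi * x / L)"
  let ?F = "{?p, ?c, ?g}"
  have "smooth (\<lambda>x. ?p (fst x))"
  proof (rule smooth_of_one_variable[OF _ bounded_linear_fst, where F = ?F])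
    fix f assume "f \<in> ?F"
    then consider "f = ?p" | "f = ?c" | "f = ?g" by blast
    then show "\<exists>f'. (\<forall>t. (f has_real_derivative f' t) (at t)) \<and> alg ?F f'"
    proof cases
      case 1
      have "(?p has_real_derivative (- sinh s * (pi / L)) * (?g t * (?p t * ?p t))) (at t)" for t
        using flow_b_bounds(3)[of L s t] L unfolding flow_b_def
        by (auto intro!: derivative_eq_intros simp: power2_eq_square divide_simps)
      moreover have "alg ?F (\<lambda>t. (- sinh s * (pi / L)) * (?g t * (?p t * ?p t)))"
        by (intro alg.mult[OF alg.const] alg.mult; rule alg.gen; simp)
      ultimately show ?thesis unfolding 1 by (intro exI conjI allI)
    next
      case 2
      have "(?c has_real_derivative (- pi / L) * ?g t) (at t)" for t using L by (auto intro!: derivative_eq_intros)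
      moreover have "alg ?F (\<lambda>t. (- pi / L) * ?g t)" by (intro alg.mult[OF alg.const] alg.gen) simp
      ultimately show ?thesis unfolding 2 by (intro exI conjI allI)
    next
      case 3
      have "(?g has_real_derivative (pi / L) * ?c t) (at t)" for t using L by (auto intro!: derivative_eq_intros)
      moreover have "alg ?F (\<lambda>t. (pi / L) * ?c t)" by (intro alg.mult[OF alg.const] alg.gen) simp
      ultimately show ?thesis unfolding 3 by (intro exI conjI allI)
    qed
  qed simp
  then show ?thesis .
qed

lemma flow_diffeo:
  assumes L: "L \<noteq> 0"
  shows "horizontal_diffeo (flow L s) (\<lambda>x. 1 / flow_b L s x) (flow L (- s)) (\<lambda>x. 1 / flow_b L (- s) x) (exp \<bar>s\<bar>)"
proof
  show "(flow L s has_real_derivative 1 / flow_b L s t) (at t)" "(flow L (- s) has_real_derivative 1 / flow_b L (- s) t) (at t)" for t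
    by (rule flow_deriv[OF L])+
  show "flow L (- s) (flow L s t) = t" "flow L s (flow L (- s) t) = t" for t
    using flow_inverse[OF L, of s] flow_inverse[OF L, of "- s"] by simp_all
  show "0 < 1 / flow_b L s t" "0 < 1 / flow_b L (- s) t" for t using flow_b_bounds(3) by simp_all
  have "1 / flow_b L s t \<le> exp \<bar>s\<bar>" for s t
  proof -
    have "1 \<le> exp \<bar>s\<bar> * flow_b L s t"
      using mult_left_mono[OF flow_b_bounds(1)[of s L t], of "exp \<bar>s\<bar>"] by (simp flip: exp_add)
    then show ?thesis using flow_b_bounds(3)[of L s t] by (simp add: pos_divide_le_eq)
  qed
  from this[of s] this[of "- s"] show "1 / flow_b L s t \<le> exp \<bar>s\<bar>" "1 / flow_b L (- s) t \<le> exp \<bar>s\<bar>" for t by simp_all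
  show "smooth (\<lambda>x. 1 / flow_b L s (fst x))" "smooth (\<lambda>x. 1 / flow_b L (- s) (fst x))" by (rule smooth_flow_b[OF L])+
qed

section \<open>Transport of the variational problem\<close>

context horizontal_diffeo begin

lemma vimage_interval: "\<Psi> 0 = 0 \<Longrightarrow> \<Psi> L = L \<Longrightarrow> \<Psi> -` {0<..<L} = {0<..<L}"
  using mono[of 0] mono[of _ L] by auto

lemma vimage_cracked:
  assumes f: "\<Psi> 0 = 0" "\<Psi> L = L" and l: "\<Psi> l' = l"
  shows "Omega L H - crack l' = horiz \<Psi> -` (Omega L H - crack l)"
proof -
  have "0 < \<Psi> p \<longleftrightarrow> 0 < p" "\<Psi> p < L \<longleftrightarrow> p < L" "0 \<le> \<Psi> p \<longleftrightarrow> 0 \<le> p" "\<Psi> p \<le> l \<longleftrightarrow> p \<le> l'" for p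
    using mono[of 0 p] mono[of p L] mono[of p 0] mono[of l' p] f l by (simp_all add: not_less[symmetric])
  then show ?thesis by (auto simp: Omega_def crack_def horiz_def)
qed

text \<open>The map fixes the lateral sides, hence the boundary conditions, and carries one crack to the other.\<close>

lemma grads_horiz:
  assumes f: "\<Psi> 0 = 0" "\<Psi> L = L" and l: "\<Psi> l' = l" and v: "v \<in> grads L H g l"
  shows "(\<lambda>x. (\<psi> (fst x) * fst (v (horiz \<Psi> x)), snd (v (horiz \<Psi> x)))) \<in> grads L H g l'"
proof -
  obtain u where u: "u \<in> admissible L H g l" "H1_grad (Omega L H - crack l) u v" using v unfolding grads_def by blast
  have h: "H1_grad (Omega L H - crack l') (\<lambda>x. u (horiz \<Psi> x)) (\<lambda>x. (\<psi> (fst x) * fst (v (horiz \<Psi> x)), snd (v (horiz \<Psi> x))))"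
    by (rule H1_grad_horiz[OF cracked_open cracked_bounded cracked_open cracked_bounded vimage_cracked[OF f l] u(2)])
  have "(\<lambda>x. u (horiz \<Psi> x)) \<in> admissible L H g l'"
    unfolding admissible_def
  proof (intro CollectI conjI ballI)
    show "(\<lambda>x. u (horiz \<Psi> x)) \<in> H1 (Omega L H - crack l')" unfolding H1_def using h by blast
    fix I c assume I: "I \<in> {{-H<..<0}, {0<..<H}}" and c: "c \<in> {0, L}"
    have "has_side_trace {0<..<L} I c u (\<lambda>t. g (c, t))" using u(1) I c unfolding admissible_def by blast
    then show "has_side_trace {0<..<L} I c (\<lambda>x. u (horiz \<Psi> x)) (\<lambda>t. g (c, t))"
      using I c f by (intro has_side_trace_horiz vimage_interval) auto
  qed
  then show ?thesis using h unfolding grads_def by blast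
qed

text \<open>The horizontal derivative gains a factor \<open>\<psi>\<close> and the area element another one, so the first weight
  is divided by \<open>\<psi>\<close> and the second is multiplied by it.\<close>

lemma form_horiz:
  assumes f: "\<Psi> 0 = 0" "\<Psi> L = L" and l: "\<Psi> l' = l"
    and w: "weight (Omega L H - crack l) K \<mu>1" "weight (Omega L H - crack l) K \<mu>2"
    and \<mu>: "\<And>x. \<mu>1 (horiz \<Psi> x) = \<mu>1 x" "\<And>x. \<mu>2 (horiz \<Psi> x) = \<mu>2 x" and v: "L2_on (Omega L H - crack l) v"
    and v': "\<And>x. v' x = (\<psi> (fst x) * fst (v (horiz \<Psi> x)), snd (v (horiz \<Psi> x)))"
  shows "form (Omega L H - crack l) \<mu>1 \<mu>2 v v =
    form (Omega L H - crack l') (\<lambda>x. \<mu>1 x / \<psi> (fst x)) (\<lambda>x. \<mu>2 x * \<psi> (fst x)) v' v'"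
proof -
  let ?h = "\<lambda>x. \<mu>1 x * (fst (v x) * fst (v x)) + \<mu>2 x * (snd (v x) * snd (v x))"
  have s: "Omega L H - crack l \<in> sets lebesgue" using cracked_open[of L H l] by auto
  have m: "?h \<in> borel_measurable (lebesgue_on (Omega L H - crack l))"
    using form_integrable[OF w v v] by (rule borel_measurable_integrable)
  have "\<psi> (fst x) * ?h (horiz \<Psi> x) = \<mu>1 x / \<psi> (fst x) * (fst (v' x) * fst (v' x)) + \<mu>2 x * \<psi> (fst x) * (snd (v' x) * snd (v' x))" for x
    using pos(1)[of "fst x"] by (simp add: \<mu> v' field_simps)
  then show ?thesis
    unfolding form_def change_of_variables(2)[OF s vimage_cracked[OF f l] m] by simp
qed

text \<open>The inverse diffeomorphism transports competitors back, so both problems have the same set of energies.\<close>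

lemma energies_horiz:
  assumes f: "\<Psi> 0 = 0" "\<Psi> L = L" and l: "\<Psi> l' = l"
    and w: "weight (Omega L H - crack l) K \<mu>1" "weight (Omega L H - crack l) K \<mu>2"
    and \<mu>: "\<And>x. \<mu>1 (horiz \<Psi> x) = \<mu>1 x" "\<And>x. \<mu>2 (horiz \<Psi> x) = \<mu>2 x"
  shows "(\<exists>v\<in>grads L H g l. e = 1/2 * form (Omega L H - crack l) \<mu>1 \<mu>2 v v) \<longleftrightarrow>
    (\<exists>v\<in>grads L H g l'. e = 1/2 * form (Omega L H - crack l') (\<lambda>x. \<mu>1 x / \<psi> (fst x)) (\<lambda>x. \<mu>2 x * \<psi> (fst x)) v v)"
    (is "?A \<longleftrightarrow> ?B")
proof
  have L2: "L2_on (Omega L H - crack l) v" if "v \<in> grads L H g l" for v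
    using that H1_grad_L2(2) unfolding grads_def by blast
  show ?B if A: ?A
  proof -
    obtain v where v: "v \<in> grads L H g l" "e = 1/2 * form (Omega L H - crack l) \<mu>1 \<mu>2 v v" using A by blast
    show ?thesis
      by (rule bexI[OF _ grads_horiz[OF f l v(1)]])
        (simp only: v(2) form_horiz[OF f l w \<mu> L2[OF v(1)] refl])
  qed
  show ?A if B: ?B
  proof -
    obtain v where v: "v \<in> grads L H g l'" "e = 1/2 * form (Omega L H - crack l') (\<lambda>x. \<mu>1 x / \<psi> (fst x)) (\<lambda>x. \<mu>2 x * \<psi> (fst x)) v v"
      using B by blast
    interpret inverse: horizontal_diffeo \<Phi> \<phi> \<Psi> \<psi> B by (rule swap)
    let ?v = "\<lambda>x. (\<phi> (fst x) * fst (v (horiz \<Phi> x)), snd (v (horiz \<Phi> x)))"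
    have g: "?v \<in> grads L H g l"
      by (rule inverse.grads_horiz[OF _ _ _ v(1)])
        (use f l inv(1)[of 0] inv(1)[of L] inv(1)[of l'] in simp_all)
    have vx: "v x = (\<psi> (fst x) * fst (?v (horiz \<Psi> x)), snd (?v (horiz \<Psi> x)))" for x
      using recip[of "fst x"] by (simp add: horiz_inv) (simp add: horiz_def mult.assoc[symmetric])
    have eq: "form (Omega L H - crack l) \<mu>1 \<mu>2 ?v ?v =
        form (Omega L H - crack l') (\<lambda>x. \<mu>1 x / \<psi> (fst x)) (\<lambda>x. \<mu>2 x * \<psi> (fst x)) v v"
      by (rule form_horiz[OF f l w \<mu> L2[OF g] vx])
    show ?thesis by (rule bexI[OF _ g]) (simp only: v(2) eq)
  qed
qed

end

section \<open>Symmetry of second derivatives\<close>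

text \<open>The second difference over a small square equals, by two applications of the mean value theorem in either order, both
  mixed derivatives at nearby points.\<close>

lemma pd_commute:
  assumes f: "smooth f" shows "pd (1,0) (pd (0,1) f) z = pd (0,1) (pd (1,0) f) z"
proof -
  obtain x y where z: "z = (x, y)" by (cases z)
  let ?A = "pd (1,0) (pd (0,1) f)" and ?B = "pd (0,1) (pd (1,0) f)"
  note sd = smooth_derivative(2)[OF f]
  have ex: "\<exists>a b c d. a \<in> {x..x+h} \<and> b \<in> {y..y+h} \<and> c \<in> {x..x+h} \<and> d \<in> {y..y+h} \<and> ?A (a, b) = ?B (c, d)"
    if h: "h > 0" for h
  proof -
    have xh: "x < x + h" and yh: "y < y + h" using h by auto
    obtain c where c: "x < c" "c < x + h"
      "(f (x + h, y + h) - f (x + h, y)) - (f (x, y + h) - f (x, y)) = (x + h - x) * (pd (1,0) f (c, y + h) - pd (1,0) f (c, y))"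
      using MVT2[OF xh, of "\<lambda>s. f (s, y + h) - f (s, y)" "\<lambda>s. pd (1,0) f (s, y + h) - pd (1,0) f (s, y)"]
        DERIV_diff[OF smooth_slices(1)[OF f] smooth_slices(1)[OF f]] by blast
    obtain d where d: "y < d" "d < y + h" "pd (1,0) f (c, y + h) - pd (1,0) f (c, y) = (y + h - y) * ?B (c, d)"
      using MVT2[OF yh, of "\<lambda>t. pd (1,0) f (c, t)" "\<lambda>t. ?B (c, t)"] smooth_slices(2)[OF sd] by blast
    obtain b where b: "y < b" "b < y + h"
      "(f (x + h, y + h) - f (x, y + h)) - (f (x + h, y) - f (x, y)) = (y + h - y) * (pd (0,1) f (x + h, b) - pd (0,1) f (x, b))"
      using MVT2[OF yh, of "\<lambda>t. f (x + h, t) - f (x, t)" "\<lambda>t. pd (0,1) f (x + h, t) - pd (0,1) f (x, t)"]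
        DERIV_diff[OF smooth_slices(2)[OF f] smooth_slices(2)[OF f]] by blast
    obtain a where a: "x < a" "a < x + h" "pd (0,1) f (x + h, b) - pd (0,1) f (x, b) = (x + h - x) * ?A (a, b)"
      using MVT2[OF xh, of "\<lambda>s. pd (0,1) f (s, b)" "\<lambda>s. ?A (s, b)"] smooth_slices(1)[OF sd] by blast
    have "h * (h * ?B (c, d)) = h * (h * ?A (a, b))" using a(3) b(3) c(3) d(3) by (auto simp: algebra_simps)
    then have "?A (a, b) = ?B (c, d)" using h by simp
    then show ?thesis using a b c d by (intro exI[of _ a] exI[of _ b] exI[of _ c] exI[of _ d]) simp
  qed
  have "\<forall>n. \<exists>p q. dist p z \<le> 2 / real (Suc n) \<and> dist q z \<le> 2 / real (Suc n) \<and> ?A p = ?B q"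
  proof
    fix n
    obtain a b c d where abcd: "a \<in> {x..x+1/real (Suc n)}" "b \<in> {y..y+1/real (Suc n)}" "c \<in> {x..x+1/real (Suc n)}" "d \<in> {y..y+1/real (Suc n)}"
        "?A (a, b) = ?B (c, d)"
      using ex[of "1 / real (Suc n)"] by (auto simp del: of_nat_Suc)
    have d2: "dist (p, q) (x, y) \<le> 2 / real (Suc n)" if "p \<in> {x..x+1/real (Suc n)}" "q \<in> {y..y+1/real (Suc n)}" for p q
    proof -
      have "dist (p, q) (x, y) \<le> dist p x + dist q y" unfolding dist_Pair_Pair by (rule sqrt_sum_squares_le_sum) auto
      also have "\<dots> \<le> 1 / real (Suc n) + 1 / real (Suc n)" using that by (intro add_mono) (auto simp: dist_real_def simp del: of_nat_Suc)
      finally show ?thesis by simp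
    qed
    show "\<exists>p q. dist p z \<le> 2 / real (Suc n) \<and> dist q z \<le> 2 / real (Suc n) \<and> ?A p = ?B q"
      unfolding z using d2[OF abcd(1,2)] d2[OF abcd(3,4)] abcd(5) by blast
  qed
  from choice[OF this] obtain p where "\<forall>n. \<exists>q. dist (p n) z \<le> 2 / real (Suc n) \<and> dist q z \<le> 2 / real (Suc n) \<and> ?A (p n) = ?B q" by (rule exE)
  from choice[OF this] obtain q where pq: "\<forall>n. dist (p n) z \<le> 2 / real (Suc n) \<and> dist (q n) z \<le> 2 / real (Suc n) \<and> ?A (p n) = ?B (q n)" by (rule exE)
  have inv: "(\<lambda>n. 2 / real (Suc n)) \<longlonglongrightarrow> 0"
    using tendsto_mult[OF tendsto_const[of 2] lim_1_over_n[where 'a=real, THEN LIMSEQ_Suc]] by simp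
  have lim: "r \<longlonglongrightarrow> z" if "\<forall>n. dist (r n) z \<le> 2 / real (Suc n)" for r
  proof -
    have "\<forall>\<^sub>F n in sequentially. norm (dist (r n) z) \<le> 2 / real (Suc n)"
    proof (rule always_eventually, rule allI)
      fix n show "norm (dist (r n) z) \<le> 2 / real (Suc n)"
        using spec[OF that, of n] unfolding real_norm_def abs_of_nonneg[OF zero_le_dist] .
    qed
    from Lim_null_comparison[OF this inv] show ?thesis unfolding tendsto_dist_iff[of r] .
  qed
  have iA: "isCont ?A z" "isCont ?B z"
    by (rule has_derivative_continuous[OF smooth_derivative(1)[OF smooth_derivative(2)[OF sd]]])+
  have "(\<lambda>n. ?A (p n)) \<longlonglongrightarrow> ?A z" "(\<lambda>n. ?B (q n)) \<longlonglongrightarrow> ?B z"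
    by (rule isCont_tendsto_compose[OF iA(1) lim] isCont_tendsto_compose[OF iA(2) lim]; use pq in blast)+
  then show ?thesis using pq LIMSEQ_unique by force
qed

text \<open>A weak gradient is curl free in the weak sense.\<close>

lemma H1_grad_curl:
  assumes U: "open U" "bounded U" and h: "H1_grad U u v" and \<psi>: "test_function U \<psi>"
  shows "(\<integral>x. fst (v x) * pd (0,1) \<psi> x \<partial>lebesgue_on U) = (\<integral>x. snd (v x) * pd (1,0) \<psi> x \<partial>lebesgue_on U)"
  using H1_gradD(1)[OF U h test_function_derivative[OF \<psi>, of "(0,1)"]]
    H1_gradD(2)[OF U h test_function_derivative[OF \<psi>, of "(1,0)"]]
  unfolding pd_commute[OF test_function_smooth[OF \<psi>]] by (simp add: mult.commute)

section \<open>Periodic profiles\<close>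

text \<open>The periodic indicator function of the first material, in the vertical coordinate rescaled to unit period. Interfaces
  belong to the second material.\<close>

definition profile :: "real \<Rightarrow> real \<Rightarrow> real" where
  "profile lam y = (if \<exists>j::int. y \<in> {of_int j<..<of_int j + lam} then 1 else 0)"

lemma profile_periodic: "profile lam (y + 1) = profile lam y"
proof -
  have "(\<exists>j::int. y + 1 \<in> {of_int j<..<of_int j + lam}) \<longleftrightarrow> (\<exists>j::int. y \<in> {of_int j<..<of_int j + lam})"
  proof
    assume "\<exists>j::int. y + 1 \<in> {of_int j<..<of_int j + lam}"
    then obtain j :: int where "y + 1 \<in> {of_int j<..<of_int j + lam}" by blast
    then show "\<exists>j::int. y \<in> {of_int j<..<of_int j + lam}" by (intro exI[of _ "j - 1"]) auto
  next
    assume "\<exists>j::int. y \<in> {of_int j<..<of_int j + lam}"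
    then obtain j :: int where "y \<in> {of_int j<..<of_int j + lam}" by blast
    then show "\<exists>j::int. y + 1 \<in> {of_int j<..<of_int j + lam}" by (intro exI[of _ "j + 1"]) auto
  qed
  then show ?thesis by (simp add: profile_def)
qed

lemma profile_measurable [measurable]: "profile lam \<in> borel_measurable borel"
proof -
  have "open (\<Union>j::int. {of_int j<..<of_int j + lam} :: real set)" by auto
  then have "(\<lambda>y. indicat_real (\<Union>j::int. {of_int j<..<of_int j + lam}) y) \<in> borel_measurable borel" by measurable
  moreover have "profile lam = (\<lambda>y. indicat_real (\<Union>j::int. {of_int j<..<of_int j + lam}) y)"
    by (auto simp: fun_eq_iff profile_def indicator_def)
  ultimately show ?thesis by simp
qed

lemma profile_bounds: "0 \<le> profile lam y" "profile lam y \<le> 1" by (simp_all add: profile_def)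

lemma profile_unit:
  assumes "0 < y" "y < 1" "0 < lam" "lam < 1" shows "profile lam y = (if y < lam then 1 else 0)"
proof -
  have "(\<exists>j::int. y \<in> {of_int j<..<of_int j + lam}) \<longleftrightarrow> y < lam"
  proof
    assume "\<exists>j::int. y \<in> {of_int j<..<of_int j + lam}"
    then obtain j :: int where j: "of_int j < y" "y < of_int j + lam" by auto
    then have "(of_int j :: real) < 1" "(of_int j :: real) > -1" using assms by linarith+
    then have "j = 0" by linarith
    then show "y < lam" using j by simp
  qed (use assms in \<open>auto intro!: exI[of _ 0]\<close>)
  then show ?thesis by (simp add: profile_def)
qed

lemma fun_snd_measurable:
  fixes r :: "real \<Rightarrow> real"
  assumes r: "r \<in> borel_measurable borel"
  shows "(\<lambda>x::real\<times>real. r (c * snd x)) \<in> borel_measurable (lebesgue_on U)"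
proof -
  have "(\<lambda>x :: real \<times> real. c * snd x) \<in> borel_measurable borel"
    by (intro borel_measurable_continuous_onI continuous_intros)
  from measurable_compose[OF this r]
  have "(\<lambda>x :: real \<times> real. r (c * snd x)) \<in> borel_measurable lborel" by simp
  then show ?thesis by (intro measurable_restrict_space1 measurable_completion)
qed

text \<open>The interval is cut into \<open>2 n\<close> periods, and the integral over each is translation invariant.\<close>

lemma nn_integral_periodic:
  fixes g :: "real \<Rightarrow> ennreal"
  assumes [measurable]: "g \<in> borel_measurable borel" and per: "\<And>y. g (y + 1) = g y"
  shows "(\<integral>\<^sup>+y. g y * indicator {- real n..<real n} y \<partial>lborel) = of_nat (2 * n) * (\<integral>\<^sup>+y. g y * indicator {0..<1} y \<partial>lborel)"
proof -
  interpret periodic_fun_simple' g by standard (rule per)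
  have shift: "(\<integral>\<^sup>+y. g y * indicator {of_int j..<of_int j + 1} y \<partial>lborel) = (\<integral>\<^sup>+y. g y * indicator {0..<1} y \<partial>lborel)" for j :: int
  proof -
    have "(\<integral>\<^sup>+y. g y * indicator {of_int j..<of_int j + 1} y \<partial>lborel) =
        (\<integral>\<^sup>+y. g (of_int j + 1 * y) * indicator {of_int j..<of_int j + 1} (of_int j + 1 * y) \<partial>lborel)"
      by (subst nn_integral_real_affine[where c = 1 and t = "of_int j"]) auto
    also have "\<dots> = (\<integral>\<^sup>+y. g y * indicator {0..<1} y \<partial>lborel)"
      using plus_of_int[of _ j] by (intro nn_integral_cong) (auto simp: indicator_def add.commute)
    finally show ?thesis .
  qed
  have ind: "indicator {- real n..<real n} y = (\<Sum>j\<in>{- int n..<int n}. indicator {of_int j..<of_int j + 1} y :: ennreal)" for y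
  proof -
    have "(\<Sum>j\<in>{- int n..<int n}. indicator {of_int j..<of_int j + 1} y :: ennreal) = (\<Sum>j\<in>{- int n..<int n}. if j = \<lfloor>y\<rfloor> then 1 else 0)"
      by (intro sum.cong refl) (auto simp: indicator_def floor_eq_iff[symmetric] simp flip: floor_eq_iff)
    also have "\<dots> = (if \<lfloor>y\<rfloor> \<in> {- int n..<int n} then 1 else 0)" by (subst sum.delta) auto
    also have "\<lfloor>y\<rfloor> \<in> {- int n..<int n} \<longleftrightarrow> y \<in> {- real n..<real n}" by (auto simp: le_floor_iff floor_less_iff)
    finally show ?thesis by (simp add: indicator_def)
  qed
  have "(\<integral>\<^sup>+y. g y * indicator {- real n..<real n} y \<partial>lborel) =
      (\<integral>\<^sup>+y. (\<Sum>j\<in>{- int n..<int n}. g y * indicator {of_int j..<of_int j + 1} y) \<partial>lborel)"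
    unfolding ind sum_distrib_left ..
  also have "\<dots> = (\<Sum>j\<in>{- int n..<int n}. \<integral>\<^sup>+y. g y * indicator {of_int j..<of_int j + 1} y \<partial>lborel)"
    by (rule nn_integral_sum) measurable
  also have "\<dots> = of_nat (2 * n) * (\<integral>\<^sup>+y. g y * indicator {0..<1} y \<partial>lborel)"
    unfolding shift by (simp add: nat_mult_distrib)
  finally show ?thesis .
qed

text \<open>The layers fit the height exactly, so the mean square of a rescaled periodic function over the rectangle is its mean
  square over one period, whatever the number of layers.\<close>

lemma periodic_scaled_norm:
  fixes r :: "real \<Rightarrow> real"
  assumes [measurable]: "r \<in> borel_measurable borel" and per: "\<And>y. r (y + 1) = r y" and b: "\<And>y. \<bar>r y\<bar> \<le> K"
    and L: "0 < L" and H: "0 < H" and n: "0 < n" and V: "open V" "V \<subseteq> {0<..<L} \<times> {-H<..<H}"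
  shows "(norm2 V (\<lambda>x. r (real n / H * snd x)))\<^sup>2 \<le> 2 * L * H * (norm2 {0<..<1} r)\<^sup>2"
proof -
  let ?c = "real n / H" and ?W = "{0<..<L} \<times> {-H<..<H}"
  have c: "?c > 0" using H n by simp
  have W: "open ?W" "bounded ?W" by (auto intro: open_Times bounded_Times)
  have mW: "(\<lambda>x. r (?c * snd x)) \<in> borel_measurable (lebesgue_on ?W)" by (rule fun_snd_measurable[OF assms(1)])
  have LW: "L2_on ?W (\<lambda>x. r (?c * snd x))"
    using b by (intro L2_on_bounded[OF bounded_open_lmeasurable[OF W] mW, where C=K]) auto
  have L1: "L2_on {0<..<1} r"
    using b by (intro L2_on_bounded[where C=K] measurable_restrict_space1 measurable_completion) auto
  let ?g = "\<lambda>y. ennreal ((r y)\<^sup>2)"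
  have one: "(\<integral>\<^sup>+y. ?g y * indicator {0<..<1} y \<partial>lborel) = ennreal ((norm2 {0<..<1} r)\<^sup>2)"
  proof -
    have "(\<integral>\<^sup>+y. ?g y \<partial>lebesgue_on {0<..<1}) = ennreal ((norm2 {0<..<1} r)\<^sup>2)"
      unfolding norm2_sq using L1 by (subst nn_integral_eq_integral) (auto simp: L2_on_def)
    then show ?thesis by (subst (asm) nn_integral_restrict_space) (auto simp: nn_integral_completion)
  qed
  have one': "(\<integral>\<^sup>+y. ?g y * indicator {0..<1} y \<partial>lborel) = ennreal ((norm2 {0<..<1} r)\<^sup>2)"
  proof -
    have "(\<integral>\<^sup>+y. ?g y * indicator {0..<1} y \<partial>lborel) = (\<integral>\<^sup>+y. ?g y * indicator {0<..<1} y \<partial>lborel)"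
      using AE_lborel_singleton[of 0] by (intro nn_integral_cong_AE) (auto elim!: eventually_mono simp: indicator_def)
    then show ?thesis using one by simp
  qed
  have "ennreal ((norm2 ?W (\<lambda>x. r (?c * snd x)))\<^sup>2) = (\<integral>\<^sup>+x. ?g (?c * snd x) \<partial>lebesgue_on ?W)"
    unfolding norm2_sq using LW by (subst nn_integral_eq_integral) (auto simp: L2_on_def)
  also have "\<dots> = (\<integral>\<^sup>+x. ?g (?c * snd x) * indicator ?W x \<partial>lborel)"
    using W by (subst nn_integral_restrict_space) (auto simp: nn_integral_completion)
  also have "\<dots> = (\<integral>\<^sup>+x. indicator {0<..<L} (fst x) * (?g (?c * snd x) * indicator {-H<..<H} (snd x)) \<partial>(lborel \<Otimes>\<^sub>M lborel))"
    unfolding lborel_prod by (intro nn_integral_cong) (auto simp: indicator_def)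
  also have "\<dots> = (\<integral>\<^sup>+s. \<integral>\<^sup>+t. indicator {0<..<L} s * (?g (?c * t) * indicator {-H<..<H} t) \<partial>lborel \<partial>lborel)"
    by (subst lborel.nn_integral_fst[symmetric]) (auto simp: case_prod_beta')
  also have "\<dots> = (\<integral>\<^sup>+s. indicator {0<..<L} s * (\<integral>\<^sup>+t. ?g (?c * t) * indicator {-H<..<H} t \<partial>lborel) \<partial>lborel)"
    by (intro nn_integral_cong nn_integral_cmult) measurable
  also have "\<dots> = ennreal L * (\<integral>\<^sup>+t. ?g (?c * t) * indicator {-H<..<H} t \<partial>lborel)"
    using L by (subst nn_integral_multc) auto
  also have "(\<integral>\<^sup>+t. ?g (?c * t) * indicator {-H<..<H} t \<partial>lborel) \<le> ennreal (2 * H) * ennreal ((norm2 {0<..<1} r)\<^sup>2)"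
  proof -
    have "ennreal ?c * (\<integral>\<^sup>+t. ?g (?c * t) * indicator {-H<..<H} t \<partial>lborel) \<le>
       ennreal ?c * (\<integral>\<^sup>+t. ?g (0 + ?c * t) * indicator {-real n..<real n} (0 + ?c * t) \<partial>lborel)"
    proof (intro mult_left_mono nn_integral_mono)
      fix t
      have "t \<in> {-H<..<H} \<Longrightarrow> 0 + ?c * t \<in> {-real n..<real n}"
      proof -
        assume t: "t \<in> {-H<..<H}"
        have "?c * (- H) \<le> ?c * t" "?c * t < ?c * H" using c t by (simp_all only: mult_le_cancel_left_pos mult_less_cancel_left_pos) auto
        moreover have "?c * H = real n" using H by simp
        ultimately show "0 + ?c * t \<in> {-real n..<real n}" by simp
      qed
      then show "?g (?c * t) * indicator {-H<..<H} t \<le> ?g (0 + ?c * t) * indicator {-real n..<real n} (0 + ?c * t)"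
        by (cases "t \<in> {-H<..<H}") simp_all
    qed simp
    also have "\<dots> = (\<integral>\<^sup>+y. ?g y * indicator {-real n..<real n} y \<partial>lborel)"
    proof (rule nn_integral_real_affine[where c = ?c and t = 0 and f = "\<lambda>y. ?g y * indicator {-real n..<real n} y", unfolded abs_of_pos[OF c], symmetric])
      show "(\<lambda>y. ?g y * indicator {-real n..<real n} y) \<in> borel_measurable borel" by measurable
      show "?c \<noteq> 0" using c by (rule less_imp_neq[symmetric])
    qed
    also have "\<dots> = of_nat (2 * n) * ennreal ((norm2 {0<..<1} r)\<^sup>2)"
      using nn_integral_periodic[of ?g n] per one' by simp
    also have "\<dots> = ennreal ?c * (ennreal (2 * H) * ennreal ((norm2 {0<..<1} r)\<^sup>2))"
    proof -
      have "of_nat (2 * n) = ennreal ?c * ennreal (2 * H)" using H n by (simp add: ennreal_of_nat_eq_real_of_nat flip: ennreal_mult)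
      then show ?thesis by (simp add: mult.assoc)
    qed
    finally have "ennreal (1 / ?c) * (ennreal ?c * (\<integral>\<^sup>+t. ?g (?c * t) * indicator {-H<..<H} t \<partial>lborel)) \<le>
        ennreal (1 / ?c) * (ennreal ?c * (ennreal (2 * H) * ennreal ((norm2 {0<..<1} r)\<^sup>2)))"
      by (rule mult_left_mono) simp
    moreover have "ennreal (1 / ?c) * (ennreal ?c * X) = X" for X
    proof -
      have "ennreal (1 / ?c) * (ennreal ?c * X) = ennreal (1 / ?c * ?c) * X"
        using less_imp_le[OF c] by (subst ennreal_mult) (simp_all only: mult.assoc divide_nonneg_nonneg zero_le_one)
      also have "1 / ?c * ?c = 1" using less_imp_neq[OF c] by simp
      finally show ?thesis by simp
    qed
    ultimately show ?thesis by (simp only:)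
  qed
  finally have "ennreal ((norm2 ?W (\<lambda>x. r (?c * snd x)))\<^sup>2) \<le> ennreal L * (ennreal (2 * H) * ennreal ((norm2 {0<..<1} r)\<^sup>2))"
    by (simp add: mult_left_mono)
  also have "\<dots> = ennreal (2 * L * H * (norm2 {0<..<1} r)\<^sup>2)" using L H by (simp add: mult_ac flip: ennreal_mult)
  finally have "(norm2 ?W (\<lambda>x. r (?c * snd x)))\<^sup>2 \<le> 2 * L * H * (norm2 {0<..<1} r)\<^sup>2" using L H by (simp add: ennreal_le_iff)
  moreover have "(norm2 V (\<lambda>x. r (?c * snd x)))\<^sup>2 \<le> (norm2 ?W (\<lambda>x. r (?c * snd x)))\<^sup>2"
    using V W by (intro power_mono L2_on_subset(2)[OF LW V(2)]) auto
  ultimately show ?thesis by linarith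
qed

text \<open>The centred profile is close to the derivative of a bounded smooth function. The trigonometric function
  \<open>s\<close> is positive in the first material and negative in the second, so \<open>1/2 + arctan (k s) / \<pi>\<close>
  tends to the profile; subtracting its mean makes the primitive periodic, hence bounded.\<close>

lemma profile_approximation:
  assumes lam: "0 < lam" "lam < 1" and e: "e > 0"
  obtains p r :: "real \<Rightarrow> real" and P where "\<And>y. (p has_real_derivative r y) (at y)" "\<And>y. \<bar>p y\<bar> \<le> P"
    "\<And>c. smooth (\<lambda>x. p (c * snd x))" "\<And>y. r (y + 1) = r y" "\<And>y. \<bar>r y\<bar> \<le> 2" "r \<in> borel_measurable borel"
    "norm2 {0<..<1} (\<lambda>y. profile lam y - lam - r y) < e"
proof -
  (* Centred at the middle lam/2 of the layer and vanishing at both of its ends. *)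
  define s where "s = (\<lambda>y. cos (2 * pi * y - pi * lam) - cos (pi * lam))"
  define q where "q = (\<lambda>k y. 1 / 2 + arctan (real k * s y) / pi)"
  let ?I = "{0<..<1::real}"
  have m1: "?I \<in> lmeasurable" by simp
  interpret finite_measure "lebesgue_on ?I" by (rule finite_measure_lebesgue_on[OF m1])
  have sc: "continuous_on X s" for X unfolding s_def by (intro continuous_intros)
  have qc: "continuous_on X (q k)" for X k
    unfolding q_def by (intro continuous_intros continuous_on_arctan sc) simp
  have q01: "0 \<le> q k y" "q k y \<le> 1" for k y
    using arctan_lbound[of "real k * s y"] arctan_ubound[of "real k * s y"] by (auto simp: q_def field_simps)
  have qm [measurable]: "q k \<in> borel_measurable borel" for k by (rule borel_measurable_continuous_onI[OF qc])
  have chim: "f \<in> borel_measurable (lebesgue_on ?I)" if "f \<in> borel_measurable borel" for f :: "real \<Rightarrow> real"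
    using that by (intro measurable_restrict_space1 measurable_completion) simp
  have L2: "L2_on ?I f" if "f \<in> borel_measurable borel" "\<And>y. \<bar>f y\<bar> \<le> C" for f :: "real \<Rightarrow> real" and C
    using that by (intro L2_on_bounded[OF m1 chim, where C=C]) auto
  (* The pointwise limit is 1/2 at the interface, where s vanishes. *)
  define chi where "chi = (\<lambda>y::real. if y < lam then 1 else if y = lam then 1/2 else 0 :: real)"
  have lim: "(\<lambda>k. q k y) \<longlonglongrightarrow> chi y" if y: "y \<in> ?I" for y
  proof -
    have s_pos: "s y > 0" if "y < lam"
    proof -
      have "\<bar>2 * pi * y - pi * lam\<bar> < pi * lam" using that y by (auto simp: abs_less_iff)
      then have "cos (pi * lam) < cos \<bar>2 * pi * y - pi * lam\<bar>" using lam by (intro cos_monotone_0_pi) auto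
      then show ?thesis by (simp add: s_def)
    qed
    have s_neg: "s y < 0" if "lam < y"
    proof -
      have "cos (2 * pi * y - pi * lam) = cos (2 * pi * y - pi * lam - pi + pi)" by simp
      also have "\<dots> = - cos (2 * pi * y - pi * lam - pi)" by (rule cos_periodic_pi)
      also have "\<dots> = - cos \<bar>2 * pi * y - pi * lam - pi\<bar>" by simp
      also have "\<dots> < - cos (pi - pi * lam)"
      proof -
        have a: "2 * pi * y < 2 * pi" "pi * lam < pi * y" using y that by simp_all
        have "\<bar>2 * pi * y - pi * lam - pi\<bar> < pi - pi * lam"
        proof (rule abs_less_iff[THEN iffD2], intro conjI)
          show "2 * pi * y - pi * lam - pi < pi - pi * lam" using a by linarith
          show "- (2 * pi * y - pi * lam - pi) < pi - pi * lam" using a by linarith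
        qed
        moreover have "pi - pi * lam \<le> pi" using lam by simp
        ultimately have "cos (pi - pi * lam) < cos \<bar>2 * pi * y - pi * lam - pi\<bar>"
          by (rule cos_monotone_0_pi[OF abs_ge_zero])
        then show ?thesis by (simp only: neg_less_iff_less)
      qed
      also have "\<dots> = cos (pi * lam)" by simp
      finally show ?thesis by (simp add: s_def)
    qed
    consider "y < lam" | "y = lam" | "lam < y" by linarith
    then show ?thesis
    proof cases
      case 1
      have "filterlim (\<lambda>k. s y * real k) at_top sequentially"
        by (rule filterlim_tendsto_pos_mult_at_top[OF tendsto_const s_pos[OF 1] filterlim_real_sequentially])
      then have "(\<lambda>k. arctan (s y * real k)) \<longlonglongrightarrow> pi / 2" by (rule filterlim_compose[OF tendsto_arctan_at_top])
      then have "(\<lambda>k. 1 / 2 + arctan (s y * real k) / pi) \<longlonglongrightarrow> 1 / 2 + (pi / 2) / pi" by (intro tendsto_intros) auto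
      then show ?thesis using 1 by (simp add: q_def chi_def mult.commute)
    next
      case 2
      have "s y = 0" unfolding 2 s_def by (simp add: algebra_simps)
      then show ?thesis using 2 by (simp add: q_def chi_def)
    next
      case 3
      have "filterlim (\<lambda>k. (- s y) * real k) at_top sequentially"
        using s_neg[OF 3] by (intro filterlim_tendsto_pos_mult_at_top[OF tendsto_const _ filterlim_real_sequentially]) simp
      then have "(\<lambda>k. arctan ((- s y) * real k)) \<longlonglongrightarrow> pi / 2" by (rule filterlim_compose[OF tendsto_arctan_at_top])
      then have "(\<lambda>k. 1 / 2 - arctan ((- s y) * real k) / pi) \<longlonglongrightarrow> 1 / 2 - (pi / 2) / pi" by (intro tendsto_intros) auto
      then show ?thesis using 3 by (simp add: q_def chi_def mult.commute arctan_minus)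
    qed
  qed
  have chi_m [measurable]: "chi \<in> borel_measurable borel" unfolding chi_def by measurable
  have chib: "0 \<le> chi y" "chi y \<le> 1" for y by (auto simp: chi_def)
  have conv: "(\<lambda>k. norm2 ?I (\<lambda>y. q k y - chi y)) \<longlonglongrightarrow> 0"
  proof (rule norm2_dominated[where w = "\<lambda>_. 1"])
    show "(norm (q k y - chi y))\<^sup>2 \<le> 1" for k y
      using q01[of k y] chib[of y] by (simp add: abs_square_le_1 abs_le_iff)
    show "q k \<in> borel_measurable (lebesgue_on ?I)" for k by (rule chim[OF qm])
    show "chi \<in> borel_measurable (lebesgue_on ?I)" by (rule chim[OF chi_m])
    show "integrable (lebesgue_on ?I) (\<lambda>_. 1::real)" by simp
  qed (rule lim)
  define c where "c = (\<lambda>k. \<integral>y. q k y \<partial>lebesgue_on ?I)"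
  have one: "L2_on ?I (\<lambda>y. 1::real)" by (rule L2[of _ 1]) auto
  have mI: "measure (lebesgue_on ?I) ?I = 1" by (simp add: measure_restrict_space)
  then have n1: "norm2 ?I (\<lambda>y. 1::real) = 1" by (simp add: norm2_def)
  have chi_int: "(\<integral>y. chi y \<partial>lebesgue_on ?I) = lam"
  proof -
    have sI: "?I \<inter> space lebesgue \<in> sets lebesgue" by simp
    have "(\<integral>y. chi y \<partial>lebesgue_on ?I) = (\<integral>y. indicator ?I y *\<^sub>R chi y \<partial>lebesgue)" by (rule integral_restrict_space[OF sI])
    also have "\<dots> = (\<integral>y. indicator ?I y *\<^sub>R chi y \<partial>lborel)" by (rule integral_completion) measurable
    also have "\<dots> = (\<integral>y. indicator {0<..<lam} y \<partial>lborel)"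
      using AE_lborel_singleton[of lam] lam by (intro integral_cong_AE) (auto elim!: eventually_mono simp: indicator_def chi_def)
    also have "\<dots> = lam" using lam by simp
    finally show ?thesis .
  qed
  have cl: "\<bar>c k - lam\<bar> \<le> norm2 ?I (\<lambda>y. q k y - chi y)" for k
  proof -
    have Lq: "L2_on ?I (q k)" by (rule L2[of _ 1]) (use q01 in \<open>auto simp: abs_le_iff intro: order_trans[of _ 0]\<close>)
    have Lc: "L2_on ?I chi" by (rule L2[of _ 1]) (use chib in \<open>auto simp: abs_le_iff intro: order_trans[of _ 0]\<close>)
    have "c k - lam = (\<integral>y. (q k y - chi y) * 1 \<partial>lebesgue_on ?I)"
      using L2_mult_integrable[OF Lq one] L2_mult_integrable[OF Lc one] by (simp add: c_def chi_int)
    then show ?thesis using L2_Cauchy_Schwarz[OF L2_on_diff[OF Lq Lc] one] by (simp add: n1)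
  qed
  have "\<forall>\<^sub>F k in sequentially. norm2 ?I (\<lambda>y. q k y - chi y) < e / 2" using e by (intro order_tendstoD(2)[OF conv]) simp
  then obtain k where k: "norm2 ?I (\<lambda>y. q k y - chi y) < e / 2" by (auto simp: eventually_sequentially)
  define r where "r = (\<lambda>y. q k y - c k)"
  have rc: "continuous_on X r" for X unfolding r_def by (intro continuous_intros qc)
  have c01: "0 \<le> c k" "c k \<le> 1"
  proof -
    show "0 \<le> c k" unfolding c_def by (rule Bochner_Integration.integral_nonneg) (rule q01)
    have "c k \<le> (\<integral>y. 1 \<partial>lebesgue_on ?I)" unfolding c_def
      using continuous_integrable_open[OF _ _ qc, of ?I k] by (intro integral_mono) (auto simp: q01)
    then show "c k \<le> 1" by (simp add: mI)
  qed
  have rb: "\<bar>r y\<bar> \<le> 2" for y using q01[of k y] c01 unfolding r_def by linarith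
  have sper: "s (y + 1) = s y" for y
  proof -
    have "2 * pi * (y + 1) - pi * lam = (2 * pi * y - pi * lam) + 2 * pi" by (simp add: algebra_simps)
    then show ?thesis unfolding s_def by (simp only: cos_periodic)
  qed
  then have rper: "r (y + 1) = r y" for y by (simp add: r_def q_def)
  have iC: "isCont r x" for x using rc[of UNIV] by (simp add: continuous_on_eq_continuous_at)
  have "(- \<infinity> :: ereal) < \<infinity>" by simp
  from einterval_antiderivative[OF this, of r] iC
  obtain p where "\<forall>x. (p has_vector_derivative r x) (at x)" by auto
  then have p: "(p has_real_derivative r x) (at x)" for x by (simp add: has_real_derivative_iff_has_vector_derivative)
  have "(r has_integral (p 1 - p 0)) {0..1}"
    using p by (intro fundamental_theorem_of_calculus) (auto simp: has_real_derivative_iff_has_vector_derivative[symmetric] intro: has_field_derivative_at_within)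
  then have "p 1 - p 0 = integral {0..1} r" by (simp add: integral_unique)
  also have "\<dots> = integral ?I r" by (simp add: integral_open_interval_real)
  also have "\<dots> = (\<integral>y. r y \<partial>lebesgue_on ?I)" by (intro lebesgue_integral_eq_integral[symmetric] continuous_integrable_open rc) auto
  also have "\<dots> = 0"
    using continuous_integrable_open[OF _ _ qc, of ?I k] by (simp add: r_def c_def mI)
  finally have p10: "p 1 = p 0" by simp
  have pper: "p (y + 1) = p y" for y
  proof -
    have "((\<lambda>y. p (y + 1) - p y) has_real_derivative r (y + 1) * 1 - r y) (at y)" for y
      by (intro DERIV_diff p DERIV_chain2[OF p]) (auto intro!: derivative_eq_intros)
    then have "((\<lambda>y. p (y + 1) - p y) has_real_derivative 0) (at y)" for y by (simp add: rper)
    then have "p (y + 1) - p y = p (0 + 1) - p 0" by (intro DERIV_isconst_all allI)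
    then show ?thesis using p10 by simp
  qed
  have pc: "continuous_on X p" for X using p by (meson DERIV_continuous continuous_at_imp_continuous_on)
  have "bounded (p ` {0..1})" by (intro compact_imp_bounded compact_continuous_image pc) simp
  then obtain P where P: "\<forall>y\<in>p ` {0..1}. norm y \<le> P" unfolding bounded_iff by blast
  have pb: "\<bar>p y\<bar> \<le> P" for y
  proof -
    interpret periodic_fun_simple' p by standard (rule pper)
    have "p y = p (frac y + of_int \<lfloor>y\<rfloor>)" by (simp add: frac_def)
    also have "\<dots> = p (frac y)" by (rule plus_of_int)
    finally show ?thesis using P frac_ge_0[of y] frac_lt_1[of y] by (simp add: less_imp_le)
  qed
  have sm: "smooth (\<lambda>x. p (a * snd x))" for a
  proof -
    let ?co = "\<lambda>y. cos (2 * pi * y - pi * lam)" and ?si = "\<lambda>y. sin (2 * pi * y - pi * lam)"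
      and ?at = "\<lambda>y. arctan (real k * s y)" and ?iv = "\<lambda>y. 1 / (1 + (real k * s y)\<^sup>2)"
    let ?F = "{p, ?at, ?iv, ?co, ?si}"
    have den: "1 + (real k * s y)\<^sup>2 \<noteq> 0" for y by (metis add_pos_nonneg less_numeral_extra(1) less_irrefl zero_le_power2)
    have ds: "(s has_real_derivative (- 2 * pi) * ?si y) (at y)" for y
      unfolding s_def by (auto intro!: derivative_eq_intros)
    have s_alg: "alg ?F s"
    proof -
      have "alg ?F (\<lambda>y. ?co y + (- cos (pi * lam)))" by (intro alg.add alg.const alg.gen) simp
      then show ?thesis by (simp add: s_def)
    qed
    have bl: "bounded_linear (\<lambda>x::real\<times>real. a * snd x)" by (intro bounded_linear_const_mult bounded_linear_snd)
    show ?thesis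
    proof (rule smooth_of_one_variable[OF _ bl, where F = ?F])
      fix f assume "f \<in> ?F"
      then consider "f = p" | "f = ?at" | "f = ?iv" | "f = ?co" | "f = ?si" by blast
      then show "\<exists>f'. (\<forall>t. (f has_real_derivative f' t) (at t)) \<and> alg ?F f'"
      proof cases
        case 1
        have "alg ?F (\<lambda>y. (1/2 - c k) + 1 / pi * ?at y)" by (intro alg.add alg.mult alg.const alg.gen) simp
        then have "alg ?F r" by (simp add: r_def q_def algebra_simps)
        then show ?thesis unfolding 1 using p by (intro exI conjI allI)
      next
        case 2
        have d: "((\<lambda>y. arctan (real k * s y)) has_real_derivative real k * ((- 2 * pi) * ?si y) * ?iv y) (at y)" for y
          by (rule DERIV_cong[OF DERIV_chain2[OF DERIV_arctan DERIV_cmult[OF ds]]]) (simp add: inverse_eq_divide)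
        have "alg ?F (\<lambda>y. real k * ((- 2 * pi) * ?si y) * ?iv y)"
          by (intro alg.mult[OF alg.mult[OF alg.const alg.mult[OF alg.const alg.gen]] alg.gen]) simp_all
        then show ?thesis unfolding 2 using d by (intro exI conjI allI)
      next
        case 3
        have d: "(?iv has_real_derivative (- 2 * real k * real k) * (s y * (((- 2 * pi) * ?si y) * (?iv y * ?iv y)))) (at y)" for y
          using den[of y] by (auto intro!: derivative_eq_intros ds simp: power2_eq_square divide_simps)
        have "alg ?F (\<lambda>y. (- 2 * real k * real k) * (s y * (((- 2 * pi) * ?si y) * (?iv y * ?iv y))))"
          by (intro alg.mult[OF alg.const alg.mult[OF s_alg alg.mult[OF alg.mult[OF alg.const alg.gen] alg.mult[OF alg.gen alg.gen]]]]) simp_all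
        then show ?thesis unfolding 3 using d by (intro exI conjI allI)
      next
        case 4
        have d: "(?co has_real_derivative (- 2 * pi) * ?si y) (at y)" for y by (auto intro!: derivative_eq_intros)
        have "alg ?F (\<lambda>y. (- 2 * pi) * ?si y)" by (intro alg.mult[OF alg.const alg.gen]) simp
        then show ?thesis unfolding 4 using d by (intro exI conjI allI)
      next
        case 5
        have d: "(?si has_real_derivative (2 * pi) * ?co y) (at y)" for y by (auto intro!: derivative_eq_intros)
        have "alg ?F (\<lambda>y. (2 * pi) * ?co y)" by (intro alg.mult[OF alg.const alg.gen]) simp
        then show ?thesis unfolding 5 using d by (intro exI conjI allI)
      qed
    qed simp
  qed
  have rm: "r \<in> borel_measurable borel" by (rule borel_measurable_continuous_onI[OF rc])
  have "norm2 ?I (\<lambda>y. profile lam y - lam - r y) < e"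
  proof -
    have eqn: "norm2 ?I (\<lambda>y. profile lam y - lam - r y) = norm2 ?I (\<lambda>y. (chi y - q k y) + (c k - lam))"
    proof -
      have sI: "?I \<inter> space lebesgue \<in> sets lebesgue" by simp
      have "AE y in lebesgue. y \<noteq> lam" by (rule AE_completion[OF AE_lborel_singleton])
      then have "AE y in lebesgue_on ?I. y \<noteq> lam"
        unfolding AE_restrict_space_iff[OF sI] by eventually_elim simp
      then have "AE y in lebesgue_on ?I. profile lam y - lam - r y = (chi y - q k y) + (c k - lam)"
        using AE_space
      proof eventually_elim
        case (elim y) then show ?case using profile_unit[of y lam] lam by (simp add: chi_def r_def)
      qed
      then have "AE y in lebesgue_on ?I. (norm (profile lam y - lam - r y))\<^sup>2 = (norm ((chi y - q k y) + (c k - lam)))\<^sup>2"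
        by eventually_elim (simp only:)
      moreover note [measurable] = rm
      ultimately have "(\<integral>y. (norm (profile lam y - lam - r y))\<^sup>2 \<partial>lebesgue_on ?I) = (\<integral>y. (norm ((chi y - q k y) + (c k - lam)))\<^sup>2 \<partial>lebesgue_on ?I)"
        by (intro integral_cong_AE[OF chim chim]) measurable
      then show ?thesis by (simp add: norm2_def)
    qed
    have Lq: "L2_on ?I (q k)" by (rule L2[of _ 1]) (use q01 in \<open>auto simp: abs_le_iff intro: order_trans[of _ 0]\<close>)
    have Lc: "L2_on ?I chi" by (rule L2[of _ 1]) (use chib in \<open>auto simp: abs_le_iff intro: order_trans[of _ 0]\<close>)
    have "norm2 ?I (\<lambda>y. (chi y - q k y) + (c k - lam) *\<^sub>R 1) \<le> norm2 ?I (\<lambda>y. chi y - q k y) + norm2 ?I (\<lambda>y. (c k - lam) *\<^sub>R (1::real))"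
      by (intro norm2_triangle L2_on_diff L2_on_scale Lq Lc one)
    also have "\<dots> \<le> norm2 ?I (\<lambda>y. q k y - chi y) + norm2 ?I (\<lambda>y. q k y - chi y)"
      using cl[of k] unfolding norm2_scale n1 by (simp add: norm2_minus_commute[of ?I chi])
    also have "\<dots> < e" using k by simp
    finally show ?thesis unfolding eqn by simp
  qed
  then show ?thesis using that[OF p pb sm rper rb rm] by blast
qed

section \<open>Oscillating weights\<close>

text \<open>A compensated compactness argument. The fields \<open>F n\<close> need not converge strongly, and a weakly convergent
  sequence alone cannot be multiplied by an oscillating weight. The hypothesis \<open>\<partial>\<^sub>2 F = \<partial>\<^sub>1
  G\<close> controls \<open>F\<close> exactly in the direction of the oscillation: the weight is nearly the vertical derivative of
  \<open>(H/n) p (n x\<^sub>2 / H)\<close>, and after integration by parts every term carries the factor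
  \<open>H/n\<close>.\<close>

lemma oscillation_limit:
  fixes F G :: "nat \<Rightarrow> real \<times> real \<Rightarrow> real"
  assumes L: "0 < L" and H: "0 < H" and lam: "0 < lam" "lam < 1"
    and U: "open U" "U \<subseteq> {0<..<L} \<times> {-H<..<H}"
    and F: "\<And>n. 0 < n \<Longrightarrow> L2_on U (F n)" "\<And>n. 0 < n \<Longrightarrow> norm2 U (F n) \<le> R"
    and G: "\<And>n. 0 < n \<Longrightarrow> L2_on U (G n)" "\<And>n. 0 < n \<Longrightarrow> norm2 U (G n) \<le> R"
    and curl: "\<And>n \<psi>. 0 < n \<Longrightarrow> test_function U \<psi> \<Longrightarrow>
       (\<integral>x. F n x * pd (0,1) \<psi> x \<partial>lebesgue_on U) = (\<integral>x. G n x * pd (1,0) \<psi> x \<partial>lebesgue_on U)"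
    and w: "L2_on U w"
  shows "(\<lambda>n. \<integral>x. (profile lam (real n / H * snd x) - lam) * F n x * w x \<partial>lebesgue_on U) \<longlonglongrightarrow> 0"
proof (rule tendstoI)
  fix e :: real assume e: "e > 0"
  have Ub: "bounded U" using U(2) by (rule bounded_subset[rotated]) (auto intro: bounded_Times)
  have R: "0 \<le> R" using F(2)[of 1] norm2_nonneg[of U "F 1"] by linarith
  have "e / (4 * (R + 1)) > 0" using e R by simp
  then obtain \<eta> where \<eta>: "test_function U \<eta>" "norm2 U (\<lambda>x. w x - \<eta> x) < e / (4 * (R + 1))"
    using test_functions_dense[OF U(1) Ub w] by blast
  obtain C where C: "\<And>x. \<bar>\<eta> x\<bar> \<le> C" "C \<ge> 0" using test_function_bounded[OF \<eta>(1)] by blast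
  have \<eta>s: "smooth \<eta>" by (rule test_function_smooth[OF \<eta>(1)])
  have L\<eta>: "L2_on U \<eta>" "\<And>e. L2_on U (pd e \<eta>)"
    by (rule test_function_L2_on[OF U(1) Ub \<eta>(1)] test_function_L2_on[OF U(1) Ub test_function_derivative[OF \<eta>(1)]])+
  (* Chosen so that the error of the smooth profile, tested with the bounded function, contributes at most e/4. *)
  define \<delta> where "\<delta> = e / (4 * (R + 1) * (C + 1) * (sqrt (2 * L * H) + 1))"
  have \<delta>: "\<delta> > 0" unfolding \<delta>_def using e R C(2) L H by (intro divide_pos_pos mult_pos_pos add_nonneg_pos) auto
  obtain p r :: "real \<Rightarrow> real" and P where p: "\<And>y. (p has_real_derivative r y) (at y)" "\<And>y. \<bar>p y\<bar> \<le> P"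
    and ps: "\<And>c. smooth (\<lambda>x. p (c * snd x))" and r: "\<And>y. r (y + 1) = r y" "\<And>y. \<bar>r y\<bar> \<le> 2" "r \<in> borel_measurable borel"
    and close: "norm2 {0<..<1} (\<lambda>y. profile lam y - lam - r y) < \<delta>"
    by (rule profile_approximation[OF lam \<delta>], rule that)
  have P: "0 \<le> P" using p(2)[of 0] by linarith
  let ?\<rho> = "\<lambda>y. profile lam y - lam - r y"
  have \<rho>m: "?\<rho> \<in> borel_measurable borel" using r(3) by measurable
  have mm: "(\<lambda>y. profile lam y - lam) \<in> borel_measurable borel" by measurable
  have \<rho>b: "\<bar>?\<rho> y\<bar> \<le> 4" for y using profile_bounds[of lam y] lam r(2)[of y] by linarith
  have mb: "\<bar>profile lam y - lam\<bar> \<le> 1" for y using profile_bounds[of lam y] lam by linarith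
  define D where "D = P * R * (norm2 U (pd (1,0) \<eta>) + norm2 U (pd (0,1) \<eta>))"
  have key: "\<bar>\<integral>x. (profile lam (real n / H * snd x) - lam) * F n x * w x \<partial>lebesgue_on U\<bar> \<le> e / 4 + e / 4 + H / real n * D"
    if n: "0 < n" for n
  proof -
    let ?c = "real n / H"
    let ?m = "\<lambda>x. profile lam (?c * snd x) - lam" and ?r = "\<lambda>x. r (?c * snd x)" and ?d = "\<lambda>x. ?\<rho> (?c * snd x)"
    have c: "?c > 0" using n H by simp
    note Fn = F(1)[OF n] and Gn = G(1)[OF n]
    note mF = L2_on_bounded_mult_real[OF Fn fun_snd_measurable[OF mm, of ?c] mb]
    note rF = L2_on_bounded_mult_real[OF Fn fun_snd_measurable[OF r(3), of ?c] r(2)]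
    note dF = L2_on_bounded_mult_real[OF Fn fun_snd_measurable[OF \<rho>m, of ?c] \<rho>b]
    have Lw: "L2_on U (\<lambda>x. w x - \<eta> x)" by (rule L2_on_diff[OF w L\<eta>(1)])
    (* Three parts: the error in w, the error in the profile, and the smooth oscillation tested with a test function. *)
    have "?m x * F n x * w x = (?m x * F n x) * (w x - \<eta> x) + ((?d x * F n x) * \<eta> x + (?r x * F n x) * \<eta> x)" for x
      by (simp add: algebra_simps)
    then have "(\<integral>x. ?m x * F n x * w x \<partial>lebesgue_on U) = (\<integral>x. (?m x * F n x) * (w x - \<eta> x) \<partial>lebesgue_on U)
        + ((\<integral>x. (?d x * F n x) * \<eta> x \<partial>lebesgue_on U) + (\<integral>x. (?r x * F n x) * \<eta> x \<partial>lebesgue_on U))"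
      using L2_mult_integrable[OF mF(1) Lw] L2_mult_integrable[OF dF(1) L\<eta>(1)] L2_mult_integrable[OF rF(1) L\<eta>(1)]
      by (simp only: Bochner_Integration.integral_add Bochner_Integration.integrable_add)
    moreover have "\<bar>\<integral>x. (?m x * F n x) * (w x - \<eta> x) \<partial>lebesgue_on U\<bar> \<le> e / 4"
    proof -
      have "\<bar>\<integral>x. (?m x * F n x) * (w x - \<eta> x) \<partial>lebesgue_on U\<bar> \<le> norm2 U (\<lambda>x. ?m x * F n x) * norm2 U (\<lambda>x. w x - \<eta> x)"
        using L2_Cauchy_Schwarz[OF mF(1) Lw] by simp
      also have "\<dots> \<le> (R + 1) * (e / (4 * (R + 1)))"
        using mF(2) F(2)[OF n] \<eta>(2) R by (intro mult_mono) auto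
      also have "\<dots> = e / 4"
      proof -
        have "k * (e / (4 * k)) = e / 4" if "k > 0" for k using that by simp
        from this[of "R + 1"] show ?thesis using R by linarith
      qed
      finally show ?thesis .
    qed
    moreover have "\<bar>\<integral>x. (?d x * F n x) * \<eta> x \<partial>lebesgue_on U\<bar> \<le> e / 4"
    proof -
      have Ld: "L2_on U ?d"
        using \<rho>b by (intro L2_on_bounded[OF bounded_open_lmeasurable[OF U(1) Ub] fun_snd_measurable[OF \<rho>m], where C=4]) auto
      have \<eta>F: "L2_on U (\<lambda>x. \<eta> x * F n x)" "norm2 U (\<lambda>x. \<eta> x * F n x) \<le> C * norm2 U (F n)"
        using U by (intro L2_on_bounded_mult_real[OF Fn smooth_measurable[OF \<eta>s] C(1)]; simp)+
      have nd: "norm2 U ?d \<le> sqrt (2 * L * H) * \<delta>"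
      proof (rule power2_le_imp_le)
        have "(norm2 U ?d)\<^sup>2 \<le> 2 * L * H * (norm2 {0<..<1} ?\<rho>)\<^sup>2"
          by (rule periodic_scaled_norm[OF \<rho>m _ \<rho>b L H n U]) (simp add: profile_periodic r(1))
        also have "\<dots> \<le> 2 * L * H * \<delta>\<^sup>2" using close L H by (intro mult_left_mono power_mono) auto
        also have "\<dots> = (sqrt (2 * L * H) * \<delta>)\<^sup>2" using L H by (simp add: power_mult_distrib)
        finally show "(norm2 U ?d)\<^sup>2 \<le> (sqrt (2 * L * H) * \<delta>)\<^sup>2" .
        show "0 \<le> sqrt (2 * L * H) * \<delta>" using L H \<delta> by simp
      qed
      have "\<bar>\<integral>x. (?d x * F n x) * \<eta> x \<partial>lebesgue_on U\<bar> \<le> norm2 U ?d * norm2 U (\<lambda>x. \<eta> x * F n x)"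
        using L2_Cauchy_Schwarz[OF Ld \<eta>F(1)] by (simp add: mult_ac)
      also have "\<dots> \<le> ((sqrt (2 * L * H) + 1) * \<delta>) * ((C + 1) * (R + 1))"
      proof (rule mult_mono)
        show "norm2 U ?d \<le> (sqrt (2 * L * H) + 1) * \<delta>" using nd \<delta> by (simp add: distrib_right)
        have "C * norm2 U (F n) \<le> (C + 1) * (R + 1)" using C(2) F(2)[OF n] R by (intro mult_mono) auto
        then show "norm2 U (\<lambda>x. \<eta> x * F n x) \<le> (C + 1) * (R + 1)" using \<eta>F(2) by linarith
        show "0 \<le> (sqrt (2 * L * H) + 1) * \<delta>" using L H \<delta> by simp
      qed simp
      also have "\<dots> = e / 4"
      proof -
        have "sqrt (2 * L * H) + 1 > 0" using L H by (intro add_nonneg_pos) auto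
        moreover have "(q * (e / (4 * r * c * q))) * (c * r) = e / 4" if "0 < r" "0 < c" "0 < q" for r c q :: real
          using that by (simp add: field_simps)
        ultimately show ?thesis unfolding \<delta>_def using R C(2) by (metis add_nonneg_pos zero_less_one)
      qed
      finally show ?thesis .
    qed
    moreover have "\<bar>\<integral>x. (?r x * F n x) * \<eta> x \<partial>lebesgue_on U\<bar> \<le> H / real n * D"
    proof -
      (* The vertical derivative of f is the smooth oscillation, while f itself is of order H/n. *)
      define f where "f = (\<lambda>x::real\<times>real. H / real n * p (?c * snd x))"
      have fs: "smooth f" unfolding f_def by (intro smooth_mult smooth_const ps)
      have fd: "(f has_derivative (\<lambda>e. ?r x * snd e)) (at x)" for x
      proof -
        have "((\<lambda>x::real\<times>real. ?c * snd x) has_derivative (\<lambda>e. ?c * snd e)) (at x)"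
          by (intro has_derivative_mult_right has_derivative_snd has_derivative_ident)
        note d = has_derivative_mult_right[OF has_derivative_compose[OF this p(1)[unfolded has_field_derivative_def]], of "H / real n"]
        have e: "H / real n * (r y * (?c * e)) = r y * e" for y e
        proof -
          have "H / real n * ?c = 1" using n less_imp_neq[OF H] by simp
          then show ?thesis by (metis mult.assoc mult.commute mult_1)
        qed
        show ?thesis unfolding f_def using d unfolding e .
      qed
      have pf: "pd (1,0) f x = 0" "pd (0,1) f x = ?r x" for x
        using frechet_derivative_at[OF fd, of x, symmetric] by simp_all
      have fb: "\<bar>f x\<bar> \<le> H / real n * P" for x
        unfolding f_def abs_mult using H p(2) by (intro mult_mono) auto
      have fm: "f \<in> borel_measurable (lebesgue_on U)" using U by (intro smooth_measurable fs) simp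
      note fF = L2_on_bounded_mult_real[OF Fn fm fb] and fG = L2_on_bounded_mult_real[OF Gn fm fb]
      have t: "test_function U (\<lambda>x. f x * \<eta> x)" by (rule test_function_mult[OF \<eta>(1) fs])
      have "(\<integral>x. (f x * F n x) * pd (0,1) \<eta> x + (?r x * F n x) * \<eta> x \<partial>lebesgue_on U) = (\<integral>x. (f x * G n x) * pd (1,0) \<eta> x \<partial>lebesgue_on U)"
        using curl[OF n t] unfolding pd_mult[OF fs \<eta>s] pf by (simp add: algebra_simps)
      then have "(\<integral>x. (?r x * F n x) * \<eta> x \<partial>lebesgue_on U) = (\<integral>x. (f x * G n x) * pd (1,0) \<eta> x \<partial>lebesgue_on U) - (\<integral>x. (f x * F n x) * pd (0,1) \<eta> x \<partial>lebesgue_on U)"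
        using L2_mult_integrable[OF fF(1) L\<eta>(2)] L2_mult_integrable[OF rF(1) L\<eta>(1)] by (simp only: Bochner_Integration.integral_add)
      moreover have "\<bar>\<integral>x. (f x * G n x) * pd (1,0) \<eta> x \<partial>lebesgue_on U\<bar> \<le> H / real n * P * R * norm2 U (pd (1,0) \<eta>)"
      proof -
        have "\<bar>\<integral>x. (f x * G n x) * pd (1,0) \<eta> x \<partial>lebesgue_on U\<bar> \<le> norm2 U (\<lambda>x. f x * G n x) * norm2 U (pd (1,0) \<eta>)"
          using L2_Cauchy_Schwarz[OF fG(1) L\<eta>(2)] by simp
        also have "\<dots> \<le> (H / real n * P * R) * norm2 U (pd (1,0) \<eta>)"
          using H P by (intro mult_right_mono order_trans[OF fG(2)] mult_left_mono G(2)[OF n]) auto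
        finally show ?thesis .
      qed
      moreover have "\<bar>\<integral>x. (f x * F n x) * pd (0,1) \<eta> x \<partial>lebesgue_on U\<bar> \<le> H / real n * P * R * norm2 U (pd (0,1) \<eta>)"
      proof -
        have "\<bar>\<integral>x. (f x * F n x) * pd (0,1) \<eta> x \<partial>lebesgue_on U\<bar> \<le> norm2 U (\<lambda>x. f x * F n x) * norm2 U (pd (0,1) \<eta>)"
          using L2_Cauchy_Schwarz[OF fF(1) L\<eta>(2)] by simp
        also have "\<dots> \<le> (H / real n * P * R) * norm2 U (pd (0,1) \<eta>)"
          using H P by (intro mult_right_mono order_trans[OF fF(2)] mult_left_mono F(2)[OF n]) auto
        finally show ?thesis .
      qed
      moreover have "H / real n * D = H / real n * P * R * norm2 U (pd (1,0) \<eta>) + H / real n * P * R * norm2 U (pd (0,1) \<eta>)"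
        unfolding D_def by (simp only: distrib_left mult.assoc)
      ultimately show ?thesis by linarith
    qed
    ultimately show ?thesis by linarith
  qed
  have "(\<lambda>n. H * D * (1 / real n)) \<longlonglongrightarrow> H * D * 0" by (intro tendsto_mult tendsto_const lim_1_over_n)
  then have "\<forall>\<^sub>F n in sequentially. H * D * (1 / real n) < e / 2" using e by (intro order_tendstoD(2)) auto
  then show "\<forall>\<^sub>F n in sequentially. dist (\<integral>x. (profile lam (real n / H * snd x) - lam) * F n x * w x \<partial>lebesgue_on U) 0 < e"
    using eventually_gt_at_top[of 0]
  proof eventually_elim
    case (elim n)
    have "H / real n * D = H * D * (1 / real n)" by simp
    then show ?case using key[OF elim(2)] elim(1) unfolding dist_real_def diff_0_right by linarith
  qed
qed

section \<open>Homogenization\<close>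

text \<open>The stiffness as an affine function of the profile. The same formula with the reciprocals of \<open>a\<close> and
  \<open>b\<close> gives the reciprocal stiffness, so one profile governs the oscillation of \<open>\<mu>\<^sub>1\<close> around
  its arithmetic mean and of \<open>1/\<mu>\<^sub>2\<close> around its mean.\<close>

definition mix :: "real \<Rightarrow> real \<Rightarrow> real \<Rightarrow> real \<Rightarrow> nat \<Rightarrow> real \<times> real \<Rightarrow> real" where
  "mix a b lam H n x = b + (a - b) * profile lam (real n / H * snd x)"

lemma mix_if:
  "mix a b lam H n x = (if \<exists>j::int. real n / H * snd x \<in> {of_int j<..<of_int j + lam} then a else b)"
proof -
  have "b + (a - b) * (if P then 1 else 0) = (if P then a else b)" for P by simp
  then show ?thesis unfolding mix_def profile_def .
qed

lemma mix_cases: "mix a b lam H n x = a \<and> mix a' b' lam H n x = a' \<or> mix a b lam H n x = b \<and> mix a' b' lam H n x = b'"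
  by (simp add: mix_def profile_def)

lemma mix_elliptic:
  assumes "c \<le> a" "c \<le> b" "a \<le> C" "b \<le> C" shows "elliptic U c C (mix a b lam H n)"
proof -
  have "(\<lambda>y. b + (a - b) * profile lam y) \<in> borel_measurable borel" by measurable
  from fun_snd_measurable[OF this, of "real n / H" U] have "mix a b lam H n \<in> borel_measurable (lebesgue_on U)"
    unfolding mix_def[abs_def] .
  moreover have "c \<le> mix a b lam H n x \<and> mix a b lam H n x \<le> C" for x
    using mix_cases[of a b lam H n x a b] assms by linarith
  ultimately show ?thesis unfolding elliptic_def by blast
qed

text \<open>A point of the rectangle lies within one of the \<open>2 n\<close> periods, so the finitely many layers and the
  periodic profile agree there.\<close>

lemma layered_diag:
  assumes H: "0 < H" and n: "0 < n" and x: "\<bar>snd x\<bar> < H" and lam: "lam < 1"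
  shows "layered (diag a1 a2) (diag b1 b2) lam H n x = diag (mix a1 b1 lam H n x) (mix a2 b2 lam H n x)"
proof -
  let ?h = "H / real n" and ?y = "real n / H * snd x"
  have h: "?h > 0" using H n by simp
  have y: "\<bar>?y\<bar> < real n"
  proof -
    have "real n / H * \<bar>snd x\<bar> < real n / H * H" using x H n by (intro mult_strict_left_mono) auto
    then show ?thesis using H by (simp add: abs_mult)
  qed
  have iff: "snd x \<in> {of_int j * ?h<..<(of_int j + lam) * ?h} \<longleftrightarrow> ?y \<in> {of_int j<..<of_int j + lam}" for j :: int
    using H n by (auto simp: field_simps)
  have E: "(\<exists>j::int. - int n \<le> j \<and> j \<le> int n - 1 \<and> snd x \<in> {of_int j * ?h<..<(of_int j + lam) * ?h}) \<longleftrightarrow>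
      (\<exists>j::int. ?y \<in> {of_int j<..<of_int j + lam})"
  proof
    assume "\<exists>j::int. ?y \<in> {of_int j<..<of_int j + lam}"
    then obtain j :: int where j: "?y \<in> {of_int j<..<of_int j + lam}" by blast
    have "real_of_int j < ?y" "?y < real_of_int j + lam" using j unfolding greaterThanLessThan_iff by blast+
    moreover have "?y < real n" "- real n < ?y" using y unfolding abs_less_iff by linarith+
    ultimately have "real_of_int j < real n" "- real n < real_of_int j + 1" using lam by linarith+
    then have "- int n \<le> j \<and> j \<le> int n - 1" by linarith
    then show "\<exists>j::int. - int n \<le> j \<and> j \<le> int n - 1 \<and> snd x \<in> {of_int j * ?h<..<(of_int j + lam) * ?h}"
      using j iff by blast
  qed (use iff in blast)
  show ?thesis
    unfolding layered_def Let_def mix_if E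
    by (cases "\<exists>j::int. ?y \<in> {of_int j<..<of_int j + lam}") (simp_all only: if_True if_False)
qed

lemma energy_diag:
  assumes "\<And>x. x \<in> Omega L H \<Longrightarrow> C x = diag (\<alpha> x) (\<beta> x)"
  shows "energy L H g C l = (LEAST e. \<exists>w\<in>grads L H g l. e = 1/2 * form (Omega L H - crack l) \<alpha> \<beta> w w)"
proof -
  have "(\<integral>x. v x \<bullet> C x (v x) \<partial>lebesgue_on (Omega L H - crack l)) = form (Omega L H - crack l) \<alpha> \<beta> v v" for v
    unfolding form_def
    by (intro Bochner_Integration.integral_cong refl) (simp add: assms diag_def inner_prod_def mult_ac)
  then have "(\<exists>u v. u \<in> admissible L H g l \<and> H1_grad (Omega L H - crack l) u v \<and>
     e = 1 / 2 * (\<integral>x. v x \<bullet> C x (v x) \<partial>lebesgue_on (Omega L H - crack l))) \<longleftrightarrow>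
     (\<exists>w\<in>grads L H g l. e = 1/2 * form (Omega L H - crack l) \<alpha> \<beta> w w)" for e
    unfolding grads_def by auto
  then show ?thesis unfolding energy_def by simp
qed

text \<open>The Euler--Lagrange equation for compactly supported variations: the flux is divergence free. In two dimensions this
  has the same shape as the vanishing of the curl of the gradient, with the vertical flux in place of the horizontal
  derivative.\<close>

lemma minimal_flux:
  assumes L: "0 < L" and H: "0 < H" and w: "weight (Omega L H - crack l) K \<alpha>" "weight (Omega L H - crack l) K \<beta>"
    and v: "minimal (Omega L H - crack l) \<alpha> \<beta> (grads L H g l) v" and \<psi>: "test_function (Omega L H - crack l) \<psi>"
  shows "(\<integral>x. (\<beta> x * snd (v x)) * pd (0,1) \<psi> x \<partial>lebesgue_on (Omega L H - crack l)) =
    (\<integral>x. (- (\<alpha> x * fst (v x))) * pd (1,0) \<psi> x \<partial>lebesgue_on (Omega L H - crack l))"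
proof -
  let ?U = "Omega L H - crack l"
  have G: "closed_affine ?U (grads L H g l)" by (rule grads_closed_affine[OF L H])
  have vG: "v \<in> grads L H g l" using v by (simp add: minimal_def)
  have Lv: "L2_on ?U v" using G vG by (simp add: closed_affine_def)
  have s: "smooth \<psi>" by (rule test_function_smooth[OF \<psi>])
  have t: "L2_on ?U (pd e \<psi>)" for e by (rule test_function_L2_on[OF cracked_open cracked_bounded test_function_derivative[OF \<psi>]])
  have "form ?U \<alpha> \<beta> v (\<lambda>x. (v x + grad \<psi> x) - v x) = 0"
    by (rule minimal_orthogonal[OF G w v grads_test_function[OF vG \<psi>]])
  then have "(\<integral>x. (\<alpha> x * fst (v x)) * pd (1,0) \<psi> x + (\<beta> x * snd (v x)) * pd (0,1) \<psi> x \<partial>lebesgue_on ?U) = 0"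
    by (simp add: form_def mult.assoc)
  moreover have "integrable (lebesgue_on ?U) (\<lambda>x. (\<alpha> x * fst (v x)) * pd (1,0) \<psi> x)"
    "integrable (lebesgue_on ?U) (\<lambda>x. (\<beta> x * snd (v x)) * pd (0,1) \<psi> x)"
    using weighted_field(1)[OF w Lv] by (auto simp: L2_on_pair intro!: L2_mult_integrable t)
  ultimately show ?thesis by simp
qed

text \<open>The Euler--Lagrange equation of each minimizer, tested with the other one, shows that the two energies are the two
  bilinear forms evaluated at the same pair \<open>(v n, v0)\<close>. Their difference is therefore an integral against the
  difference of the weights. For the first weight this is the oscillation \<open>\<mu>\<^sub>1 - h1\<close> times the horizontal
  derivative. For the second one \<open>\<mu>\<^sub>2 - h2 = - h2 (1/\<mu>\<^sub>2 - 1/h2) \<mu>\<^sub>2\<close> turns it into the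
  oscillation of \<open>1/\<mu>\<^sub>2\<close> times the vertical flux. Curl and divergence identities make both integrals vanish
  in the limit.\<close>

lemma minimal_energy_convergence:
  assumes L: "0 < L" and H: "0 < H" and lam: "0 < lam" "lam < 1"
    and \<mu>: "0 < \<mu>A1" "0 < \<mu>A2" "0 < \<mu>B1" "0 < \<mu>B2"
    and h1: "h1 = lam * \<mu>A1 + (1 - lam) * \<mu>B1" and h2: "h2 = 1 / (lam / \<mu>A2 + (1 - lam) / \<mu>B2)"
    and v: "\<And>n. minimal (Omega L H - crack l) (mix \<mu>A1 \<mu>B1 lam H n) (mix \<mu>A2 \<mu>B2 lam H n) (grads L H g l) (v n)"
    and v0: "minimal (Omega L H - crack l) (\<lambda>_. h1) (\<lambda>_. h2) (grads L H g l) v0"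
  shows "(\<lambda>n. form (Omega L H - crack l) (mix \<mu>A1 \<mu>B1 lam H n) (mix \<mu>A2 \<mu>B2 lam H n) (v n) (v n))
    \<longlonglongrightarrow> form (Omega L H - crack l) (\<lambda>_. h1) (\<lambda>_. h2) v0 v0"
proof (rule LIM_zero_cancel)
  let ?U = "Omega L H - crack l" and ?G = "grads L H g l"
  let ?a = "mix \<mu>A1 \<mu>B1 lam H" and ?b = "mix \<mu>A2 \<mu>B2 lam H"
  let ?m = "\<lambda>n x. profile lam (real n / H * snd x) - lam"
  have G: "closed_affine ?U ?G" by (rule grads_closed_affine[OF L H])
  define c C where "c = Min {\<mu>A1, \<mu>A2, \<mu>B1, \<mu>B2}" and "C = Max {\<mu>A1, \<mu>A2, \<mu>B1, \<mu>B2}"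
  have c: "0 < c" using \<mu> by (simp add: c_def)
  have ea: "elliptic ?U c C (?a n)" and eb: "elliptic ?U c C (?b n)" for n
    by (intro mix_elliptic; simp add: c_def C_def)+
  note wa = elliptic_weight[OF ea c] and wb = elliptic_weight[OF eb c]
  have wh: "weight ?U (max \<bar>h1\<bar> \<bar>h2\<bar>) (\<lambda>_. h1)" "weight ?U (max \<bar>h1\<bar> \<bar>h2\<bar>) (\<lambda>_. h2)" by (auto simp: weight_def)
  have vG: "v n \<in> ?G" "v0 \<in> ?G" for n using v v0 by (auto simp: minimal_def)
  have Lv: "L2_on ?U (v n)" and L0: "L2_on ?U v0" for n using G vG by (auto simp: closed_affine_def)
  define R where "R = sqrt (\<bar>C\<bar> / c * (norm2 ?U v0)\<^sup>2)"
  have R: "norm2 ?U (v n) \<le> R" for n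
    unfolding R_def using minimal_norm_bound[OF G ea eb c v vG(2)] by (intro real_le_rsqrt)
  (* Each energy is a bilinear form evaluated at the same pair of minimizers. *)
  have o1: "form ?U (?a n) (?b n) (v n) (v n) = form ?U (?a n) (?b n) (v n) v0" for n
    using minimal_orthogonal[OF G wa wb v vG(2)] form_diff(2)[OF wa wb L0 Lv Lv] by simp
  have o2: "form ?U (\<lambda>_. h1) (\<lambda>_. h2) v0 v0 = form ?U (\<lambda>_. h1) (\<lambda>_. h2) (v n) v0" for n
    using minimal_orthogonal[OF G wh v0 vG(1)] form_diff(2)[OF wh Lv L0 L0] form_sym[of ?U "\<lambda>_. h1" "\<lambda>_. h2" v0 "v n"] by simp
  have da: "?a n x - h1 = (\<mu>A1 - \<mu>B1) * ?m n x" for n x by (simp add: mix_def h1 algebra_simps)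
  have h2p: "0 < lam / \<mu>A2 + (1 - lam) / \<mu>B2" using \<mu> lam by (intro add_pos_pos) auto
  (* The product of b - h2 with a derivative is a multiple of the oscillation of 1/b times the flux. *)
  have db: "?b n x - h2 = - h2 * (1 / \<mu>A2 - 1 / \<mu>B2) * (?m n x * ?b n x)" for n x
  proof -
    let ?k = "lam / \<mu>A2 + (1 - lam) / \<mu>B2"
    have inv: "mix (1 / \<mu>A2) (1 / \<mu>B2) lam H n x * ?b n x = 1"
      using mix_cases[of "1 / \<mu>A2" "1 / \<mu>B2" lam H n x \<mu>A2 \<mu>B2] \<mu> by auto
    have k: "mix (1 / \<mu>A2) (1 / \<mu>B2) lam H n x - ?k = (1 / \<mu>A2 - 1 / \<mu>B2) * ?m n x" by (simp add: mix_def algebra_simps diff_divide_distrib)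
    have "- h2 * (1 / \<mu>A2 - 1 / \<mu>B2) * (?m n x * ?b n x) = - h2 * ((mix (1 / \<mu>A2) (1 / \<mu>B2) lam H n x - ?k) * ?b n x)"
      unfolding k by (simp only: mult.assoc)
    also have "\<dots> = - h2 * (1 - ?k * ?b n x)" unfolding left_diff_distrib inv ..
    also have "\<dots> = - h2 + (h2 * ?k) * ?b n x"
    proof -
      have "- a * (1 - k * b) = - a + (a * k) * b" for a k b :: real by (simp add: algebra_simps)
      then show ?thesis .
    qed
    also have "h2 * ?k = 1" unfolding h2 using h2p by simp
    finally show ?thesis by simp
  qed
  define F1 where "F1 = (\<lambda>n. \<integral>x. ?m n x * fst (v n x) * fst (v0 x) \<partial>lebesgue_on ?U)"
  define F2 where "F2 = (\<lambda>n. \<integral>x. ?m n x * (?b n x * snd (v n x)) * snd (v0 x) \<partial>lebesgue_on ?U)"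
  have mm: "(\<lambda>y. profile lam y - lam) \<in> borel_measurable borel" by measurable
  have mb: "\<bar>profile lam y - lam\<bar> \<le> 1" for y using profile_bounds[of lam y] lam by linarith
  have W: "L2_on ?U (\<lambda>x. ?a n x * fst (v n x))" "L2_on ?U (\<lambda>x. ?b n x * snd (v n x))"
    "norm2 ?U (\<lambda>x. ?a n x * fst (v n x)) \<le> \<bar>C\<bar> * R" "norm2 ?U (\<lambda>x. ?b n x * snd (v n x)) \<le> \<bar>C\<bar> * R" for n
  proof -
    note wf = weighted_field[OF wa wb Lv, of n n n]
    show "L2_on ?U (\<lambda>x. ?a n x * fst (v n x))" "L2_on ?U (\<lambda>x. ?b n x * snd (v n x))" using wf(1) by (simp_all add: L2_on_pair)
    have "\<bar>C\<bar> * norm2 ?U (v n) \<le> \<bar>C\<bar> * R" using R by (intro mult_left_mono) auto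
    then show "norm2 ?U (\<lambda>x. ?a n x * fst (v n x)) \<le> \<bar>C\<bar> * R" "norm2 ?U (\<lambda>x. ?b n x * snd (v n x)) \<le> \<bar>C\<bar> * R"
      using norm2_fst(1)[OF wf(1)] norm2_snd[OF wf(1)] wf(2) by simp_all
  qed
  note Lp = Lv[unfolded L2_on_pair] and L0p = L0[unfolded L2_on_pair]
  have sub: "?U \<subseteq> {0<..<L} \<times> {-H<..<H}" by (auto simp: Omega_def)
  have eq: "form ?U (?a n) (?b n) (v n) (v n) - form ?U (\<lambda>_. h1) (\<lambda>_. h2) v0 v0 =
      (\<mu>A1 - \<mu>B1) * F1 n + (- h2 * (1 / \<mu>A2 - 1 / \<mu>B2)) * F2 n" for n
  proof -
    have i1: "integrable (lebesgue_on ?U) (\<lambda>x. ?m n x * fst (v n x) * fst (v0 x))"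
      by (rule L2_mult_integrable[OF L2_on_bounded_mult_real(1)[OF _ fun_snd_measurable[OF mm] mb]]) (use Lp L0p in auto)
    have i2: "integrable (lebesgue_on ?U) (\<lambda>x. ?m n x * (?b n x * snd (v n x)) * snd (v0 x))"
      by (rule L2_mult_integrable[OF L2_on_bounded_mult_real(1)[OF W(2) fun_snd_measurable[OF mm] mb]]) (use L0p in auto)
    have "form ?U (?a n) (?b n) (v n) (v n) - form ?U (\<lambda>_. h1) (\<lambda>_. h2) v0 v0 =
      form ?U (?a n) (?b n) (v n) v0 + (-1) * form ?U (\<lambda>_. h1) (\<lambda>_. h2) (v n) v0" using o1[of n] o2[of n] by simp
    also have "\<dots> = form ?U (\<lambda>x. ?a n x + (-1) * h1) (\<lambda>x. ?b n x + (-1) * h2) (v n) v0"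
      by (rule form_weight_comb[OF wa wb wh Lv L0, symmetric])
    also have "\<dots> = (\<integral>x. (\<mu>A1 - \<mu>B1) * (?m n x * fst (v n x) * fst (v0 x)) +
        (- h2 * (1 / \<mu>A2 - 1 / \<mu>B2)) * (?m n x * (?b n x * snd (v n x)) * snd (v0 x)) \<partial>lebesgue_on ?U)"
    proof -
      have "?a n x + (-1) * h1 = (\<mu>A1 - \<mu>B1) * ?m n x" "?b n x + (-1) * h2 = - h2 * (1 / \<mu>A2 - 1 / \<mu>B2) * (?m n x * ?b n x)" for x
        using da[of n x] db[of n x] by simp_all
      then show ?thesis unfolding form_def by (simp only: mult.assoc)
    qed
    also have "\<dots> = (\<mu>A1 - \<mu>B1) * F1 n + (- h2 * (1 / \<mu>A2 - 1 / \<mu>B2)) * F2 n"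
      unfolding F1_def F2_def using i1 i2 by (subst Bochner_Integration.integral_add) (simp_all only: integrable_mult_right integral_mult_right_zero)
    finally show ?thesis .
  qed
  have F1: "F1 \<longlonglongrightarrow> 0"
    unfolding F1_def
  proof (rule oscillation_limit[OF L H lam cracked_open sub, where R = R and G = "\<lambda>n x. snd (v n x)"])
    fix n \<psi> assume \<psi>: "test_function ?U \<psi>"
    obtain u where "H1_grad ?U u (v n)" using vG(1)[of n] unfolding grads_def by blast
    then show "(\<integral>x. fst (v n x) * pd (0,1) \<psi> x \<partial>lebesgue_on ?U) = (\<integral>x. snd (v n x) * pd (1,0) \<psi> x \<partial>lebesgue_on ?U)"
      by (rule H1_grad_curl[OF cracked_open cracked_bounded _ \<psi>])
  qed (use Lp L0p order_trans[OF norm2_fst(1)[OF Lv] R] order_trans[OF norm2_snd[OF Lv] R] in simp_all)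
  have F2: "F2 \<longlonglongrightarrow> 0"
    unfolding F2_def
  proof (rule oscillation_limit[OF L H lam cracked_open sub, where R = "\<bar>C\<bar> * R" and G = "\<lambda>n x. - (?a n x * fst (v n x))"])
    show "L2_on ?U (\<lambda>x. - (?a n x * fst (v n x)))" for n using L2_on_scale[OF W(1), of "-1"] by simp
    show "norm2 ?U (\<lambda>x. - (?a n x * fst (v n x))) \<le> \<bar>C\<bar> * R" for n using norm2_scale[of ?U "-1" "\<lambda>x. ?a n x * fst (v n x)"] W(3) by simp
    show "(\<integral>x. ?b n x * snd (v n x) * pd (0,1) \<psi> x \<partial>lebesgue_on ?U) = (\<integral>x. - (?a n x * fst (v n x)) * pd (1,0) \<psi> x \<partial>lebesgue_on ?U)"
      if "test_function ?U \<psi>" for n \<psi> by (rule minimal_flux[OF L H wa wb v that])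
  qed (use W L0p in simp_all)
  have "(\<lambda>n. (\<mu>A1 - \<mu>B1) * F1 n + (- h2 * (1 / \<mu>A2 - 1 / \<mu>B2)) * F2 n) \<longlonglongrightarrow> (\<mu>A1 - \<mu>B1) * 0 + (- h2 * (1 / \<mu>A2 - 1 / \<mu>B2)) * 0"
    by (intro tendsto_intros F1 F2)
  then show "(\<lambda>n. form ?U (?a n) (?b n) (v n) (v n) - form ?U (\<lambda>_. h1) (\<lambda>_. h2) v0 v0) \<longlonglongrightarrow> 0"
    unfolding eq by simp
qed

section \<open>Differentiability of the energy along the flow\<close>

lemma second_order_bound:
  fixes f f' f'' :: "real \<Rightarrow> real"
  assumes f: "\<And>u. (f has_real_derivative f' u) (at u)" "\<And>u. (f' has_real_derivative f'' u) (at u)"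
    and b: "\<And>u. \<bar>u\<bar> \<le> S \<Longrightarrow> \<bar>f' u\<bar> \<le> K" "\<And>u. \<bar>u\<bar> \<le> S \<Longrightarrow> \<bar>f'' u\<bar> \<le> K" and s: "\<bar>s\<bar> \<le> S" "\<bar>s + t\<bar> \<le> S"
  shows "\<bar>f (s + t) - f s\<bar> \<le> K * \<bar>t\<bar>" "\<bar>f (s + t) - f s - t * f' s\<bar> \<le> K * t\<^sup>2"
proof -
  have lip: "\<bar>g x - g y\<bar> \<le> K * \<bar>x - y\<bar>"
    if "\<And>u. (g has_real_derivative g' u) (at u)" "\<And>u. \<bar>u\<bar> \<le> S \<Longrightarrow> \<bar>g' u\<bar> \<le> K" "\<bar>x\<bar> \<le> S" "\<bar>y\<bar> \<le> S" for g g' x y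
    using field_differentiable_bound[of "{-S..S}" g g' K x y] that
    by (force simp: abs_le_iff intro: has_field_derivative_at_within)
  show "\<bar>f (s + t) - f s\<bar> \<le> K * \<bar>t\<bar>" using lip[OF f(1) b(1) s(2,1)] by simp
  have K: "0 \<le> K" using b(1)[OF s(1)] by linarith
  let ?J = "{min s (s + t)..max s (s + t)}"
  have "norm ((f (s + t) - (s + t) * f' s) - (f s - s * f' s)) \<le> (K * \<bar>t\<bar>) * norm ((s + t) - s)"
  proof (rule field_differentiable_bound[of ?J "\<lambda>u. f u - u * f' s" "\<lambda>u. f' u - f' s"])
    show "((\<lambda>u. f u - u * f' s) has_real_derivative f' u - f' s) (at u within ?J)" for u
      by (rule has_field_derivative_at_within) (auto intro!: derivative_eq_intros f)
    fix u assume u: "u \<in> ?J"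
    then have "\<bar>u - s\<bar> \<le> \<bar>t\<bar>" "\<bar>u\<bar> \<le> S" using s by (auto simp: min_def max_def split: if_splits)
    then have "\<bar>f' u - f' s\<bar> \<le> K * \<bar>u - s\<bar>" using lip[OF f(2) b(2) _ s(1)] by blast
    also have "\<dots> \<le> K * \<bar>t\<bar>" using \<open>\<bar>u - s\<bar> \<le> \<bar>t\<bar>\<close> K by (rule mult_left_mono)
    finally show "norm (f' u - f' s) \<le> K * \<bar>t\<bar>" by simp
  qed auto
  moreover have "(f (s + t) - (s + t) * f' s) - (f s - s * f' s) = f (s + t) - f s - t * f' s" by (simp add: algebra_simps)
  ultimately show "\<bar>f (s + t) - f s - t * f' s\<bar> \<le> K * t\<^sup>2" by (simp add: power2_eq_square mult.assoc)
qed

definition flow_b' :: "real \<Rightarrow> real \<Rightarrow> real \<Rightarrow> real" where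
  "flow_b' L s x = sinh s - cosh s * cos (pi * x / L)"

lemma flow_b_derivs:
  "((\<lambda>s. flow_b L s x) has_real_derivative flow_b' L s x) (at s)"
  "((\<lambda>s. flow_b' L s x) has_real_derivative flow_b L s x) (at s)"
  unfolding flow_b_def flow_b'_def by (auto intro!: derivative_eq_intros)

lemma flow_b'_le: "\<bar>flow_b' L s x\<bar> \<le> flow_b L s x"
proof -
  let ?c = "cos (pi * x / L)"
  have "flow_b L s x + flow_b' L s x = exp s * (1 - ?c)" "flow_b L s x - flow_b' L s x = exp (- s) * (1 + ?c)"
    by (simp_all add: flow_b_def flow_b'_def cosh_def sinh_def field_simps)
  moreover have "0 \<le> 1 - ?c" "0 \<le> 1 + ?c" using cos_ge_minus_one[of "pi * x / L"] cos_le_one[of "pi * x / L"] by linarith+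
  ultimately have "0 \<le> flow_b L s x + flow_b' L s x" "0 \<le> flow_b L s x - flow_b' L s x" by simp_all
  then show ?thesis by linarith
qed

text \<open>Since \<open>flow_b\<close> solves \<open>f'' = f\<close> in \<open>s\<close> and dominates its derivative, its
  reciprocal and the first two derivatives of the reciprocal are bounded by multiples of \<open>1 / flow_b\<close>; the factor
  three comes from the second derivative of the reciprocal.\<close>

lemma flow_b_taylor:
  assumes s: "\<bar>s\<bar> \<le> S" "\<bar>s + t\<bar> \<le> S"
  shows "\<bar>flow_b L (s + t) x - flow_b L s x\<bar> \<le> 3 * exp S * \<bar>t\<bar>"
    "\<bar>flow_b L (s + t) x - flow_b L s x - t * flow_b' L s x\<bar> \<le> 3 * exp S * t\<^sup>2"
    "\<bar>1 / flow_b L (s + t) x - 1 / flow_b L s x\<bar> \<le> 3 * exp S * \<bar>t\<bar>"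
    "\<bar>1 / flow_b L (s + t) x - 1 / flow_b L s x - t * (- flow_b' L s x / (flow_b L s x)\<^sup>2)\<bar> \<le> 3 * exp S * t\<^sup>2"
    "\<bar>flow_b' L s x\<bar> \<le> 3 * exp S" "\<bar>- flow_b' L s x / (flow_b L s x)\<^sup>2\<bar> \<le> 3 * exp S"
proof -
  let ?b = "\<lambda>u. flow_b L u x" and ?b' = "\<lambda>u. flow_b' L u x"
  have pos: "0 < ?b u" for u by (rule flow_b_bounds(3))
  have up: "?b u \<le> exp S" if "\<bar>u\<bar> \<le> S" for u using flow_b_bounds(2)[of L u x] that by (meson exp_le_cancel_iff order_trans)
  have inv: "1 / ?b u \<le> exp S" if "\<bar>u\<bar> \<le> S" for u
  proof -
    have "exp (- S) \<le> ?b u" using flow_b_bounds(1)[of u L x] that by (meson exp_le_cancel_iff neg_le_iff_le order_trans)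
    then have "1 / ?b u \<le> 1 / exp (- S)" using pos by (intro divide_left_mono) auto
    then show ?thesis by (simp add: exp_minus inverse_eq_divide)
  qed
  have B1: "\<bar>?b' u\<bar> \<le> 3 * exp S" "\<bar>?b u\<bar> \<le> 3 * exp S" if "\<bar>u\<bar> \<le> S" for u
    using flow_b'_le[of L u x] up[OF that] pos[of u] by (auto simp: abs_of_pos)
  from second_order_bound[OF flow_b_derivs B1 s]
  show "\<bar>?b (s + t) - ?b s\<bar> \<le> 3 * exp S * \<bar>t\<bar>" "\<bar>?b (s + t) - ?b s - t * ?b' s\<bar> \<le> 3 * exp S * t\<^sup>2" by blast+
  let ?q = "\<lambda>u. 1 / ?b u" and ?q' = "\<lambda>u. - ?b' u / (?b u)\<^sup>2" and ?q'' = "\<lambda>u. - (1 / ?b u) + 2 * (?b' u)\<^sup>2 / (?b u)^3"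
  have d1: "(?q has_real_derivative ?q' u) (at u)" for u
    using pos[of u] by (auto intro!: derivative_eq_intros flow_b_derivs simp: power2_eq_square)
  have d2: "(?q' has_real_derivative ?q'' u) (at u)" for u
  proof -
    have nz: "(?b u)\<^sup>2 \<noteq> 0" using pos[of u] by simp
    have n: "((\<lambda>u. - ?b' u) has_real_derivative - ?b u) (at u)" by (rule DERIV_minus[OF flow_b_derivs(2)])
    have m: "((\<lambda>u. (?b u)\<^sup>2) has_real_derivative 2 * ?b u * ?b' u) (at u)"
      by (rule DERIV_cong[OF DERIV_power[OF flow_b_derivs(1)]]) simp
    show ?thesis
      by (rule DERIV_cong[OF DERIV_divide[OF n m nz]])
        (use pos[of u] in \<open>simp add: field_simps power2_eq_square power3_eq_cube\<close>)
  qed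
  have q1: "\<bar>?q' u\<bar> \<le> 1 / ?b u" for u
  proof -
    have "\<bar>?q' u\<bar> = \<bar>?b' u\<bar> / (?b u)\<^sup>2" by simp
    also have "\<dots> \<le> ?b u / (?b u)\<^sup>2" by (rule divide_right_mono[OF flow_b'_le]) simp
    also have "\<dots> = 1 / ?b u" by (simp add: power2_eq_square)
    finally show ?thesis .
  qed
  have q2: "\<bar>?q'' u\<bar> \<le> 3 * (1 / ?b u)" for u
  proof -
    have "(?b' u)\<^sup>2 \<le> (?b u)\<^sup>2" using flow_b'_le[of L u x] pos[of u] by (intro abs_le_square_iff[THEN iffD1]) simp
    then have "(?b' u)\<^sup>2 / (?b u)^3 \<le> (?b u)\<^sup>2 / (?b u)^3" using pos[of u] by (intro divide_right_mono) auto
    also have "\<dots> = 1 / ?b u" using pos[of u] by (simp add: power2_eq_square power3_eq_cube)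
    finally have "(?b' u)\<^sup>2 / (?b u)^3 \<le> 1 / ?b u" .
    moreover have "0 \<le> (?b' u)\<^sup>2 / (?b u)^3" "0 < 1 / ?b u" using pos[of u] by simp_all
    moreover have "?q'' u = - (1 / ?b u) + 2 * ((?b' u)\<^sup>2 / (?b u)^3)" by simp
    ultimately show ?thesis by linarith
  qed
  have B2: "\<bar>?q' u\<bar> \<le> 3 * exp S" "\<bar>?q'' u\<bar> \<le> 3 * exp S" if "\<bar>u\<bar> \<le> S" for u
    using q1[of u] q2[of u] inv[OF that] exp_gt_zero[of S] by linarith+
  from second_order_bound[OF d1 d2 B2 s]
  show "\<bar>?q (s + t) - ?q s\<bar> \<le> 3 * exp S * \<bar>t\<bar>" "\<bar>?q (s + t) - ?q s - t * ?q' s\<bar> \<le> 3 * exp S * t\<^sup>2" by blast+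
  show "\<bar>?b' s\<bar> \<le> 3 * exp S" "\<bar>?q' s\<bar> \<le> 3 * exp S" by (rule B1(1)[OF s(1)] B2(1)[OF s(1)])+
qed

lemma flow_measurable:
  assumes L: "L \<noteq> 0" and U: "U \<in> sets lebesgue"
  shows "(\<lambda>x. flow_b L s (fst x)) \<in> borel_measurable (lebesgue_on U)" "(\<lambda>x. flow_b' L s (fst x)) \<in> borel_measurable (lebesgue_on U)"
  unfolding flow_b_def flow_b'_def
  by (intro continuous_imp_measurable_on_sets_lebesgue[OF _ U] continuous_intros; use L in simp)+

text \<open>Two elliptic weights that depend on the vertical coordinate only, which is what invariance under horizontal maps says.
  Both the layered and the homogenized materials are of this kind.\<close>

locale layered_weights =
  fixes L H c C :: real and \<mu>1 \<mu>2 :: "real \<times> real \<Rightarrow> real"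
  assumes L: "0 < L" and H: "0 < H" and c: "0 < c"
    and ell: "\<And>U. elliptic U c C \<mu>1" "\<And>U. elliptic U c C \<mu>2"
    and invariant: "\<And>f x. \<mu>1 (horiz f x) = \<mu>1 x" "\<And>f x. \<mu>2 (horiz f x) = \<mu>2 x"
begin

abbreviation "U0 \<equiv> Omega L H - crack (L/2)"

text \<open>The weights transported to the crack of length \<open>L/2\<close>, and their derivatives with respect to the parameter
  of the flow.\<close>

definition w1 :: "real \<Rightarrow> real \<times> real \<Rightarrow> real" where "w1 s x = \<mu>1 x * flow_b L s (fst x)"
definition w2 :: "real \<Rightarrow> real \<times> real \<Rightarrow> real" where "w2 s x = \<mu>2 x * (1 / flow_b L s (fst x))"
definition w1' :: "real \<Rightarrow> real \<times> real \<Rightarrow> real" where "w1' s x = \<mu>1 x * flow_b' L s (fst x)"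
definition w2' :: "real \<Rightarrow> real \<times> real \<Rightarrow> real" where "w2' s x = \<mu>2 x * (- flow_b' L s (fst x) / (flow_b L s (fst x))\<^sup>2)"

text \<open>The energy for the crack of length \<open>flow L s (L/2)\<close>, expressed on the domain with the crack of length
  \<open>L/2\<close>.\<close>

definition pulled_energy :: "(real \<times> real \<Rightarrow> real) \<Rightarrow> real \<Rightarrow> real" where
  "pulled_energy g s = (LEAST e. \<exists>v\<in>grads L H g (L/2). e = 1/2 * form U0 (w1 s) (w2 s) v v)"

definition pulled_min :: "(real \<times> real \<Rightarrow> real) \<Rightarrow> real \<Rightarrow> real \<times> real \<Rightarrow> real \<times> real" where
  "pulled_min g s = (SOME v. minimal U0 (w1 s) (w2 s) (grads L H g (L/2)) v)"

definition pulled_slope :: "(real \<times> real \<Rightarrow> real) \<Rightarrow> real \<Rightarrow> real" where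
  "pulled_slope g s = 1/2 * form U0 (w1' s) (w2' s) (pulled_min g s) (pulled_min g s)"

lemma Um: "U0 \<in> sets lebesgue" using cracked_open[of L H "L/2"] by auto

lemma \<mu>_bounds: "c \<le> \<mu>1 x" "\<mu>1 x \<le> C" "c \<le> \<mu>2 x" "\<mu>2 x \<le> C"
  using ell[of UNIV] unfolding elliptic_def by blast+

lemma C: "0 < C" using \<mu>_bounds[of undefined] c by linarith

lemma measurable_weights [measurable]:
  "\<mu>1 \<in> borel_measurable (lebesgue_on U0)" "\<mu>2 \<in> borel_measurable (lebesgue_on U0)"
  "(\<lambda>x. flow_b L s (fst x)) \<in> borel_measurable (lebesgue_on U0)" "(\<lambda>x. flow_b' L s (fst x)) \<in> borel_measurable (lebesgue_on U0)"
  using ell[of U0] flow_measurable[OF _ Um, of L s] L by (simp_all add: elliptic_def)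

lemma ell_w: assumes S: "\<bar>s\<bar> \<le> S" shows "elliptic U0 (c * exp (- S)) (C * exp S) (w1 s)" "elliptic U0 (c * exp (- S)) (C * exp S) (w2 s)"
proof -
  have b: "exp (- S) \<le> flow_b L s x" "flow_b L s x \<le> exp S" for x
    by (rule order_trans[OF _ flow_b_bounds(1)[of s]], use S in simp)
      (rule order_trans[OF flow_b_bounds(2)[of L s]], use S in simp)
  have q: "exp (- S) \<le> 1 / flow_b L s x" "1 / flow_b L s x \<le> exp S" for x
  proof -
    have p: "0 < flow_b L s x" by (rule flow_b_bounds(3))
    have "1 / exp S \<le> 1 / flow_b L s x" "1 / flow_b L s x \<le> 1 / exp (- S)" using b p by (auto intro!: divide_left_mono)
    then show "exp (- S) \<le> 1 / flow_b L s x" "1 / flow_b L s x \<le> exp S" by (simp_all add: exp_minus inverse_eq_divide)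
  qed
  have "c * exp (- S) \<le> w1 s x" "w1 s x \<le> C * exp S" "c * exp (- S) \<le> w2 s x" "w2 s x \<le> C * exp S" for x
  proof -
    have p: "0 \<le> flow_b L s (fst x)" "0 \<le> 1 / flow_b L s (fst x)"
      using flow_b_bounds(3)[of L s "fst x"] by simp_all
    have n: "0 \<le> \<mu>1 x" "0 \<le> \<mu>2 x" "0 \<le> C" "0 \<le> exp (- S)" using \<mu>_bounds[of x] c C by simp_all
    show "c * exp (- S) \<le> w1 s x" "c * exp (- S) \<le> w2 s x"
      unfolding w1_def w2_def by (rule mult_mono[OF \<mu>_bounds(1) b(1) n(1,4)] mult_mono[OF \<mu>_bounds(3) q(1) n(2,4)])+
    show "w1 s x \<le> C * exp S" "w2 s x \<le> C * exp S"
      unfolding w1_def w2_def by (rule mult_mono[OF \<mu>_bounds(2) b(2) n(3) p(1)] mult_mono[OF \<mu>_bounds(4) q(2) n(3) p(2)])+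
  qed
  moreover have "w1 s \<in> borel_measurable (lebesgue_on U0)" "w2 s \<in> borel_measurable (lebesgue_on U0)"
    unfolding w1_def[abs_def] w2_def[abs_def] by measurable
  ultimately show "elliptic U0 (c * exp (- S)) (C * exp S) (w1 s)" "elliptic U0 (c * exp (- S)) (C * exp S) (w2 s)"
    unfolding elliptic_def by blast+
qed

lemma weight_mult: "weight U0 (C * K) (\<lambda>x. \<mu> x * f x)"
  if "\<mu> = \<mu>1 \<or> \<mu> = \<mu>2" "f \<in> borel_measurable (lebesgue_on U0)" "\<And>x. \<bar>f x\<bar> \<le> K"
proof -
  have "\<bar>\<mu> x\<bar> \<le> C" for x using that(1) \<mu>_bounds[of x] c by (auto simp: abs_le_iff)
  then have "\<bar>\<mu> x * f x\<bar> \<le> C * K" for x unfolding abs_mult using that(3) C by (intro mult_mono) auto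
  moreover have "(\<lambda>x. \<mu> x * f x) \<in> borel_measurable (lebesgue_on U0)"
    using that(1,2) measurable_weights(1,2) by (auto intro!: borel_measurable_times)
  ultimately show ?thesis by (simp add: weight_def)
qed

lemma pulled_min:
  assumes "grads L H g (L/2) \<noteq> {}" shows "minimal U0 (w1 s) (w2 s) (grads L H g (L/2)) (pulled_min g s)"
proof -
  have "0 < c * exp (- \<bar>s\<bar>)" using c by simp
  from minimal_exists[OF grads_closed_affine[OF L H] assms ell_w[OF order_refl] this]
  obtain v where "minimal U0 (w1 s) (w2 s) (grads L H g (L/2)) v" .
  then show ?thesis unfolding pulled_min_def by (rule someI[where P = "minimal U0 (w1 s) (w2 s) (grads L H g (L/2))"])
qed

lemma pulled_energy_eq:
  assumes "grads L H g (L/2) \<noteq> {}"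
  shows "pulled_energy g s = 1/2 * form U0 (w1 s) (w2 s) (pulled_min g s) (pulled_min g s)"
  unfolding pulled_energy_def by (rule Least_minimal[OF pulled_min[OF assms]])

text \<open>All constants depend on the ellipticity constants, on the range of \<open>s\<close> and on one competitor.\<close>

lemma pulled_expansion:
  assumes z: "z \<in> grads L H g (L/2)" and s: "\<bar>s\<bar> \<le> R" and t: "\<bar>t\<bar> \<le> 1"
    and M: "M = (let S = R + 1; c' = c * exp (- S); C' = C * exp S; K = C * (3 * exp S) in
      (K + \<bar>C'\<bar> * K\<^sup>2 / c'\<^sup>2) * (\<bar>C'\<bar> / c' * (norm2 U0 z)\<^sup>2))"
  shows "\<bar>pulled_energy g (s + t) - pulled_energy g s - t * pulled_slope g s\<bar> \<le> M * t\<^sup>2"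
proof -
  have ne: "grads L H g (L/2) \<noteq> {}" using z by blast
  define S where "S = R + 1"
  have sS: "\<bar>s\<bar> \<le> S" "\<bar>s + t\<bar> \<le> S" using s t by (auto simp: S_def)
  note T = flow_b_taylor[OF sS, of L]
  let ?K = "C * (3 * exp S)"
  have c': "0 < c * exp (- S)" using c by simp
  have K: "0 \<le> ?K" using C by simp
  have W: "weight U0 ?K (w1' s)" "weight U0 ?K (w2' s)"
    unfolding w1'_def[abs_def] w2'_def[abs_def] by (rule weight_mult; (rule T | measurable | simp))+
  have W1: "weight U0 (?K * \<bar>t\<bar>) (\<lambda>x. w1 (s + t) x - w1 s x)" "weight U0 (?K * \<bar>t\<bar>) (\<lambda>x. w2 (s + t) x - w2 s x)"
    unfolding w1_def w2_def right_diff_distrib[symmetric] mult.assoc by (rule weight_mult; (rule T[unfolded mult.assoc] | measurable | simp))+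
  have eq: "\<mu> x * p - \<mu> x * q - t * (\<mu> x * d) = \<mu> x * (p - q - t * d)" for \<mu> :: "real \<times> real \<Rightarrow> real" and x p q d by (simp add: algebra_simps)
  have W2: "weight U0 (?K * t\<^sup>2) (\<lambda>x. w1 (s + t) x - w1 s x - t * w1' s x)" "weight U0 (?K * t\<^sup>2) (\<lambda>x. w2 (s + t) x - w2 s x - t * w2' s x)"
    unfolding w1_def w2_def w1'_def w2'_def eq mult.assoc[of C] by (rule weight_mult; (rule T | measurable | simp))+
  have "\<bar>form U0 (w1 (s + t)) (w2 (s + t)) (pulled_min g (s + t)) (pulled_min g (s + t)) -
      form U0 (w1 s) (w2 s) (pulled_min g s) (pulled_min g s) - t * form U0 (w1' s) (w2' s) (pulled_min g s) (pulled_min g s)\<bar> \<le>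
      (?K + \<bar>C * exp S\<bar> * ?K\<^sup>2 / (c * exp (- S))\<^sup>2) * (\<bar>C * exp S\<bar> / (c * exp (- S)) * (norm2 U0 z)\<^sup>2) * t\<^sup>2"
    by (rule minimal_perturbation[OF grads_closed_affine[OF L H] ell_w[OF sS(1)] ell_w[OF sS(2)] c' K W W1 W2 pulled_min[OF ne] pulled_min[OF ne] z order_refl])
  also have "\<dots> = M * t\<^sup>2" unfolding M Let_def S_def ..
  finally have a: "\<bar>form U0 (w1 (s + t)) (w2 (s + t)) (pulled_min g (s + t)) (pulled_min g (s + t)) -
      form U0 (w1 s) (w2 s) (pulled_min g s) (pulled_min g s) - t * form U0 (w1' s) (w2' s) (pulled_min g s) (pulled_min g s)\<bar> \<le> M * t\<^sup>2" .
  have "pulled_energy g (s + t) - pulled_energy g s - t * pulled_slope g s = 1/2 * (form U0 (w1 (s + t)) (w2 (s + t)) (pulled_min g (s + t)) (pulled_min g (s + t)) -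
      form U0 (w1 s) (w2 s) (pulled_min g s) (pulled_min g s) - t * form U0 (w1' s) (w2' s) (pulled_min g s) (pulled_min g s))"
    unfolding pulled_energy_eq[OF ne] pulled_slope_def by (simp add: algebra_simps)
  then show ?thesis using a by (simp add: abs_mult)
qed

lemma energies_flow:
  "(\<exists>v\<in>grads L H g (flow L s (L/2)). e = 1/2 * form (Omega L H - crack (flow L s (L/2))) \<mu>1 \<mu>2 v v) \<longleftrightarrow>
   (\<exists>v\<in>grads L H g (L/2). e = 1/2 * form U0 (w1 s) (w2 s) v v)"
proof -
  have L0: "L \<noteq> 0" using L by simp
  interpret flow: horizontal_diffeo "flow L s" "\<lambda>x. 1 / flow_b L s x" "flow L (- s)" "\<lambda>x. 1 / flow_b L (- s) x" "exp \<bar>s\<bar>"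
    by (rule flow_diffeo[OF L0])
  have w: "w1 s = (\<lambda>x. \<mu>1 x / (1 / flow_b L s (fst x)))" "w2 s = (\<lambda>x. \<mu>2 x * (1 / flow_b L s (fst x)))"
    by (simp_all add: w1_def[abs_def] w2_def[abs_def])
  show ?thesis
    unfolding w by (rule flow.energies_horiz[OF flow_zero flow_end[OF L0] refl ell[THEN elliptic_weight, OF c] invariant])
qed

lemma energy_flow:
  assumes "\<And>x. x \<in> Omega L H \<Longrightarrow> Cf x = diag (\<mu>1 x) (\<mu>2 x)"
  shows "energy L H g Cf (flow L s (L/2)) = pulled_energy g s"
proof -
  have "energy L H g Cf (flow L s (L/2)) =
      (LEAST e. \<exists>v\<in>grads L H g (flow L s (L/2)). e = 1/2 * form (Omega L H - crack (flow L s (L/2))) \<mu>1 \<mu>2 v v)"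
    by (rule energy_diag[OF assms])
  also have "\<dots> = pulled_energy g s"
    unfolding pulled_energy_def by (rule arg_cong[where f = Least], rule ext, rule energies_flow)
  finally show ?thesis .
qed

lemma grads_flow_nonempty:
  assumes "grads L H g (L/2) \<noteq> {}" shows "grads L H g (flow L s (L/2)) \<noteq> {}"
proof -
  obtain v where "v \<in> grads L H g (L/2)" using assms by blast
  then have "\<exists>v\<in>grads L H g (flow L s (L/2)). 1/2 * form U0 (w1 s) (w2 s) v' v' = 1/2 * form (Omega L H - crack (flow L s (L/2))) \<mu>1 \<mu>2 v v"
    if "v' = v" for v'
    unfolding energies_flow using that by blast
  then show ?thesis by blast
qed

lemma pulled_energy_minimal:
  assumes "minimal (Omega L H - crack (flow L s (L/2))) \<mu>1 \<mu>2 (grads L H g (flow L s (L/2))) v"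
  shows "pulled_energy g s = 1/2 * form (Omega L H - crack (flow L s (L/2))) \<mu>1 \<mu>2 v v"
proof -
  have "pulled_energy g s =
      (LEAST e. \<exists>v\<in>grads L H g (flow L s (L/2)). e = 1/2 * form (Omega L H - crack (flow L s (L/2))) \<mu>1 \<mu>2 v v)"
    unfolding pulled_energy_def by (rule arg_cong[where f = Least], rule ext, rule energies_flow[symmetric])
  also have "\<dots> = 1/2 * form (Omega L H - crack (flow L s (L/2))) \<mu>1 \<mu>2 v v" by (rule Least_minimal[OF assms])
  finally show ?thesis .
qed

lemma pulled_has_derivative:
  assumes "grads L H g (L/2) \<noteq> {}"
  shows "(pulled_energy g has_real_derivative pulled_slope g s) (at s)"
proof -
  obtain z where z: "z \<in> grads L H g (L/2)" using assms by blast
  obtain M where M: "\<And>t. \<bar>t\<bar> \<le> 1 \<Longrightarrow> \<bar>pulled_energy g (s + t) - pulled_energy g s - t * pulled_slope g s\<bar> \<le> M * t\<^sup>2"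
    by (rule that, rule pulled_expansion[OF z order_refl _ refl])
  have "((\<lambda>t. (pulled_energy g (s + t) - pulled_energy g s) / t - pulled_slope g s) \<longlongrightarrow> 0) (at 0)"
  proof (rule Lim_null_comparison)
    show "\<forall>\<^sub>F t in at 0. norm ((pulled_energy g (s + t) - pulled_energy g s) / t - pulled_slope g s) \<le> M * \<bar>t\<bar>"
      unfolding eventually_at
    proof (intro exI[of _ 1] conjI ballI impI)
      fix t :: real assume t: "t \<noteq> 0 \<and> dist t 0 < 1"
      then have "\<bar>pulled_energy g (s + t) - pulled_energy g s - t * pulled_slope g s\<bar> \<le> M * t\<^sup>2" by (intro M) simp
      then have "\<bar>pulled_energy g (s + t) - pulled_energy g s - t * pulled_slope g s\<bar> / \<bar>t\<bar> \<le> M * t\<^sup>2 / \<bar>t\<bar>" by (rule divide_right_mono) simp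
      also have "M * t\<^sup>2 / \<bar>t\<bar> = M * \<bar>t\<bar>" using t by (simp add: power2_eq_square abs_if)
      also have "\<bar>pulled_energy g (s + t) - pulled_energy g s - t * pulled_slope g s\<bar> / \<bar>t\<bar> = norm ((pulled_energy g (s + t) - pulled_energy g s) / t - pulled_slope g s)"
        using t unfolding real_norm_def abs_divide[symmetric] by (simp add: diff_divide_distrib)
      finally show "norm ((pulled_energy g (s + t) - pulled_energy g s) / t - pulled_slope g s) \<le> M * \<bar>t\<bar>" .
    qed simp
    have "((\<lambda>t. M * \<bar>t\<bar>) \<longlongrightarrow> M * \<bar>0\<bar>) (at 0)" by (intro tendsto_intros)
    then show "((\<lambda>t. M * \<bar>t\<bar>) \<longlongrightarrow> 0) (at 0)" by simp
  qed
  then show ?thesis unfolding DERIV_def by (rule LIM_zero_cancel)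
qed

end

section \<open>From the parameter of the flow to the crack length\<close>

text \<open>The parameter for which the flow moves \<open>L/2\<close> to \<open>l\<close>.\<close>

definition flow_time :: "real \<Rightarrow> real \<Rightarrow> real" where
  "flow_time L l = 2 * artanh (tan (pi / 2 * (l / L - 1 / 2)))"

lemma tan_quarter: assumes "\<bar>y\<bar> < pi / 4" shows "\<bar>tan y\<bar> < 1"
proof -
  have y: "- (pi / 4) < y" "y < pi / 4" using assms by (simp_all only: abs_less_iff) linarith
  have "tan y < tan (pi / 4)" by (rule tan_monotone) (use y pi_gt_zero in linarith)+
  moreover have "tan (- (pi / 4)) < tan y" by (rule tan_monotone) (use y pi_gt_zero in linarith)+
  ultimately show ?thesis by (simp add: tan_45 abs_less_iff)
qed

lemma flow_time_angle:
  assumes "0 < L" "l \<in> {0<..<L}" shows "\<bar>pi / 2 * (l / L - 1 / 2)\<bar> < pi / 4"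
proof -
  have "0 < l / L" "l / L < 1" using assms by simp_all
  then have "\<bar>l / L - 1 / 2\<bar> < 1 / 2" by linarith
  then show ?thesis by (simp add: abs_mult)
qed

lemma tanh_artanh:
  assumes x: "\<bar>x::real\<bar> < 1" shows "tanh (artanh x) = x"
proof -
  define r where "r = (1 + x) / (1 - x)"
  have d: "0 < 1 - x" "0 < 1 + x" using x by (simp_all only: abs_less_iff) linarith+
  have r: "0 < r" using d by (simp add: r_def)
  have e: "exp (- 2 * artanh x) = 1 / r" using r by (simp add: artanh_def r_def[symmetric] exp_minus inverse_eq_divide)
  have "1 - 1 / r = (r - 1) / r" "1 + 1 / r = (r + 1) / r" using r by (simp_all add: field_simps)
  then have "(1 - 1 / r) / (1 + 1 / r) = (r - 1) / (r + 1)" using r by simp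
  also have "r - 1 = 2 * x / (1 - x)" "r + 1 = 2 / (1 - x)" using d by (simp_all add: r_def field_simps)
  then have "(r - 1) / (r + 1) = x" using d by simp
  finally show ?thesis unfolding tanh_real_altdef e .
qed

lemma flow_flow_time:
  assumes L: "0 < L" and l: "l \<in> {0<..<L}" shows "flow L (flow_time L l) (L/2) = l"
proof -
  let ?y = "pi / 2 * (l / L - 1 / 2)"
  note y = flow_time_angle[OF L l]
  have "tanh (flow_time L l / 2) = tan ?y" using tan_quarter[OF y] by (simp add: flow_time_def tanh_artanh)
  moreover have "- (pi / 2) < ?y" "?y < pi / 2" using y pi_gt_zero unfolding abs_less_iff by linarith+
  then have "arctan (tan ?y) = ?y" by (rule arctan_tan)
  moreover have "L \<noteq> 0" using L by simp
  ultimately have "flow L (flow_time L l) (L/2) = L/2 + 2 * L / pi * ?y" by (simp only: flow_middle not_False_eq_True)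
  also have "\<dots> = l" using L by (simp add: field_simps)
  finally show ?thesis .
qed

definition flow_time' :: "real \<Rightarrow> real \<Rightarrow> real" where
  "flow_time' L l = 2 * (inverse ((cos (pi / 2 * (l / L - 1 / 2)))\<^sup>2) * (pi / 2 / L) / (1 - (tan (pi / 2 * (l / L - 1 / 2)))\<^sup>2))"

lemma flow_time_cos: assumes "0 < L" "l \<in> {0<..<L}"
  shows "cos (pi / 2 * (l / L - 1 / 2)) \<noteq> 0" "1 - (tan (pi / 2 * (l / L - 1 / 2)))\<^sup>2 \<noteq> 0"
proof -
  note y = flow_time_angle[OF assms]
  show "cos (pi / 2 * (l / L - 1 / 2)) \<noteq> 0"
    by (rule less_imp_neq[symmetric], rule cos_gt_zero_pi)
      (use y pi_gt_zero in \<open>simp_all only: abs_less_iff, linarith+\<close>)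
  have "(tan (pi / 2 * (l / L - 1 / 2)))\<^sup>2 < 1" using tan_quarter[OF y] by (simp add: abs_square_less_1)
  then show "1 - (tan (pi / 2 * (l / L - 1 / 2)))\<^sup>2 \<noteq> 0" by linarith
qed

lemma flow_time_derivative:
  assumes L: "0 < L" and l: "l \<in> {0<..<L}"
  shows "(flow_time L has_real_derivative flow_time' L l) (at l)"
proof -
  let ?y = "\<lambda>l. pi / 2 * (l / L - 1 / 2)"
  have a: "(?y has_real_derivative pi / 2 / L) (at l)" using L by (auto intro!: derivative_eq_intros)
  have t: "((\<lambda>l. tan (?y l)) has_real_derivative inverse ((cos (?y l))\<^sup>2) * (pi / 2 / L)) (at l)"
    by (rule DERIV_chain2[OF DERIV_tan[OF flow_time_cos(1)[OF L l]] a])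
  have "((\<lambda>l. artanh (tan (?y l))) has_real_derivative inverse ((cos (?y l))\<^sup>2) * (pi / 2 / L) / (1 - (tan (?y l))\<^sup>2)) (at l)"
    by (rule DERIV_cong[OF DERIV_chain2[OF artanh_real_has_field_derivative[OF tan_quarter[OF flow_time_angle[OF L l]]] t]])
      (simp only: divide_inverse mult_1_left mult.commute)
  from DERIV_cmult[OF this, of 2] show ?thesis unfolding flow_time_def[abs_def] flow_time'_def .
qed

lemma flow_time_continuous:
  assumes L: "0 < L" and K: "K \<subseteq> {0<..<L}"
  shows "continuous_on K (flow_time L)" "continuous_on K (flow_time' L)"
proof -
  show "continuous_on K (flow_time L)"
    using flow_time_derivative[OF L] K by (meson DERIV_continuous continuous_at_imp_continuous_on subsetD)
  show "continuous_on K (flow_time' L)"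
    unfolding flow_time'_def using flow_time_cos[OF L] K L
    by (intro continuous_intros) (auto simp: subset_iff)
qed

context layered_weights begin

text \<open>The chain rule for \<open>l \<mapsto> s\<close>; the second factor is the same for all materials.\<close>

lemma energy_release_flow:
  assumes ne: "grads L H g (L/2) \<noteq> {}" and Cf: "\<And>x. x \<in> Omega L H \<Longrightarrow> Cf x = diag (\<mu>1 x) (\<mu>2 x)" and l: "l \<in> {0<..<L}"
  shows "energy_release L H g Cf l = - (pulled_slope g (flow_time L l) * flow_time' L l)"
proof -
  have "((\<lambda>l. pulled_energy g (flow_time L l)) has_real_derivative pulled_slope g (flow_time L l) * flow_time' L l) (at l)"
    by (rule DERIV_chain2[OF pulled_has_derivative[OF ne] flow_time_derivative[OF L l]])
  then have "(energy L H g Cf has_real_derivative pulled_slope g (flow_time L l) * flow_time' L l) (at l)"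
  proof (rule has_field_derivative_transform_within_open[where S = "{0<..<L}"])
    fix l assume l: "l \<in> {0<..<L}"
    show "pulled_energy g (flow_time L l) = energy L H g Cf l"
      using energy_flow[OF Cf, of g "flow_time L l"] unfolding flow_flow_time[OF L l] by simp
  qed (use l in auto)
  then show ?thesis unfolding energy_release_def by (simp add: DERIV_imp_deriv)
qed

text \<open>If no displacement attains the boundary values for one crack length, then none does for any other: all energies are
  the same arbitrary number, and the rates vanish.\<close>

lemma energy_release_no_competitor:
  assumes e: "grads L H g (L/2) = {}" and Cf: "\<And>x. x \<in> Omega L H \<Longrightarrow> Cf x = diag (\<mu>1 x) (\<mu>2 x)" and l: "l \<in> {0<..<L}"
  shows "energy_release L H g Cf l = 0"
proof -
  have "((\<lambda>l. LEAST e::real. False) has_real_derivative 0) (at l)" by simp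
  then have "(energy L H g Cf has_real_derivative 0) (at l)"
  proof (rule has_field_derivative_transform_within_open[where S = "{0<..<L}"])
    fix l assume l: "l \<in> {0<..<L}"
    show "(LEAST e::real. False) = energy L H g Cf l"
      using energy_flow[OF Cf, of g "flow_time L l"] unfolding flow_flow_time[OF L l] pulled_energy_def e by simp
  qed (use l in auto)
  then show ?thesis unfolding energy_release_def by (simp add: DERIV_imp_deriv)
qed

end

section \<open>Convergence of the energy release rates\<close>

lemma mix_layered_weights:
  assumes L: "0 < L" and H: "0 < H" and c: "0 < c"
    and b: "c \<le> a1" "c \<le> a2" "c \<le> b1" "c \<le> b2" "a1 \<le> C" "a2 \<le> C" "b1 \<le> C" "b2 \<le> C"
  shows "layered_weights L H c C (mix a1 b1 lam H n) (mix a2 b2 lam H n)"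
proof
  show "elliptic U c C (mix a1 b1 lam H n)" "elliptic U c C (mix a2 b2 lam H n)" for U
    by (rule mix_elliptic[OF b(1,3,5,7)] mix_elliptic[OF b(2,4,6,8)])+
qed (simp_all add: L H c mix_def horiz_def)

text \<open>Minimizers exist for every crack length, and transport does not change the minimal energy, so the convergence of
  minimal energies can be used at the crack length that belongs to \<open>s\<close>.\<close>

lemma pulled_energy_convergence:
  assumes L: "0 < L" and H: "0 < H" and lam: "0 < lam" "lam < 1"
    and \<mu>: "0 < \<mu>A1" "0 < \<mu>A2" "0 < \<mu>B1" "0 < \<mu>B2"
    and h1: "h1 = lam * \<mu>A1 + (1 - lam) * \<mu>B1" and h2: "h2 = 1 / (lam / \<mu>A2 + (1 - lam) / \<mu>B2)"
    and lw: "\<And>n. layered_weights L H c C (mix \<mu>A1 \<mu>B1 lam H n) (mix \<mu>A2 \<mu>B2 lam H n)"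
    and lw0: "layered_weights L H c C (\<lambda>_. h1) (\<lambda>_. h2)"
    and ne: "grads L H g (L/2) \<noteq> {}"
  shows "(\<lambda>n. layered_weights.pulled_energy L H (mix \<mu>A1 \<mu>B1 lam H n) (mix \<mu>A2 \<mu>B2 lam H n) g s) \<longlonglongrightarrow>
    layered_weights.pulled_energy L H (\<lambda>_. h1) (\<lambda>_. h2) g s"
proof -
  let ?l = "flow L s (L/2)"
  let ?U = "Omega L H - crack ?l" and ?G = "grads L H g ?l"
  note G = grads_closed_affine[OF L H, of ?l g]
  have ne': "?G \<noteq> {}" by (rule layered_weights.grads_flow_nonempty[OF lw0 ne])
  have c: "0 < c" by (rule layered_weights.c[OF lw0])
  have "\<forall>n. \<exists>v. minimal ?U (mix \<mu>A1 \<mu>B1 lam H n) (mix \<mu>A2 \<mu>B2 lam H n) ?G v"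
  proof
    fix n
    obtain v where "minimal ?U (mix \<mu>A1 \<mu>B1 lam H n) (mix \<mu>A2 \<mu>B2 lam H n) ?G v"
      using minimal_exists[OF G ne' layered_weights.ell(1)[OF lw] layered_weights.ell(2)[OF lw] c] .
    then show "\<exists>v. minimal ?U (mix \<mu>A1 \<mu>B1 lam H n) (mix \<mu>A2 \<mu>B2 lam H n) ?G v" by blast
  qed
  from choice[OF this] obtain v where "\<forall>n. minimal ?U (mix \<mu>A1 \<mu>B1 lam H n) (mix \<mu>A2 \<mu>B2 lam H n) ?G (v n)" by (rule exE)
  then have v: "minimal ?U (mix \<mu>A1 \<mu>B1 lam H n) (mix \<mu>A2 \<mu>B2 lam H n) ?G (v n)" for n by blast
  obtain v0 where v0: "minimal ?U (\<lambda>_. h1) (\<lambda>_. h2) ?G v0"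
    using minimal_exists[OF G ne' layered_weights.ell(1)[OF lw0] layered_weights.ell(2)[OF lw0] c] .
  show ?thesis
    unfolding layered_weights.pulled_energy_minimal[OF lw v] layered_weights.pulled_energy_minimal[OF lw0 v0]
    by (intro tendsto_mult tendsto_const minimal_energy_convergence[OF L H lam \<mu> h1 h2 v v0])
qed

theorem theorem2p8:
  fixes L H lam \<mu>A1 \<mu>A2 \<mu>B1 \<mu>B2 :: real and g :: "real \<times> real \<Rightarrow> real"
  assumes "L > 0" and "H > 0" and "0 < lam" and "lam < 1"
    and "\<mu>A1 > 0" and "\<mu>A2 > 0" and "\<mu>B1 > 0" and "\<mu>B2 > 0"
    and "g \<in> boundary_data L H"
  shows "\<forall>K. compact K \<and> K \<subseteq> {0<..<L} \<longrightarrow>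
    uniform_limit K
      (\<lambda>n. energy_release L H g (layered (diag \<mu>A1 \<mu>A2) (diag \<mu>B1 \<mu>B2) lam H n))
      (energy_release L H g (\<lambda>x. hom_tensor \<mu>A1 \<mu>A2 \<mu>B1 \<mu>B2 lam))
      (inf sequentially (principal {n. even n \<and> n > 0}))"
proof (intro allI impI)
  fix K assume K: "compact K \<and> K \<subseteq> {0<..<L}"
  note L = assms(1) and H = assms(2) and lam = assms(3,4) and \<mu> = assms(5-8)
  define h1 h2 where "h1 = lam * \<mu>A1 + (1 - lam) * \<mu>B1" and "h2 = 1 / (lam / \<mu>A2 + (1 - lam) / \<mu>B2)"
  have h: "0 < h1" "0 < h2" unfolding h1_def h2_def using lam \<mu> by (auto intro!: add_pos_pos divide_pos_pos)
  define c C where "c = Min {\<mu>A1, \<mu>A2, \<mu>B1, \<mu>B2, h1, h2}" and "C = Max {\<mu>A1, \<mu>A2, \<mu>B1, \<mu>B2, h1, h2}"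
  have c: "0 < c" using \<mu> h by (simp add: c_def)
  let ?a = "mix \<mu>A1 \<mu>B1 lam H" and ?b = "mix \<mu>A2 \<mu>B2 lam H"
  let ?Cn = "layered (diag \<mu>A1 \<mu>A2) (diag \<mu>B1 \<mu>B2) lam H" and ?Ch = "\<lambda>x::real \<times> real. hom_tensor \<mu>A1 \<mu>A2 \<mu>B1 \<mu>B2 lam"
  have lw: "layered_weights L H c C (?a n) (?b n)" for n
    by (rule mix_layered_weights[OF L H c]) (simp_all add: c_def C_def)
  have hc: "c \<le> h1" "h1 \<le> C" "c \<le> h2" "h2 \<le> C" unfolding c_def C_def by (rule Min_le Max_ge; simp)+
  have lw0: "layered_weights L H c C (\<lambda>_. h1) (\<lambda>_. h2)" by unfold_locales (simp_all add: L H c elliptic_def hc)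
  have Cn: "?Cn n x = diag (?a n x) (?b n x)" if "0 < n" "x \<in> Omega L H" for n x
    by (rule layered_diag[OF H that(1) _ lam(2)]) (use that(2) in \<open>auto simp: Omega_def abs_less_iff\<close>)
  have Ch: "?Ch x = diag h1 h2" for x by (simp add: hom_tensor_def h1_def h2_def)
  show "uniform_limit K (\<lambda>n. energy_release L H g (?Cn n)) (energy_release L H g ?Ch) (inf sequentially (principal {n. even n \<and> n > 0}))"
  proof (rule uniform_limitI)
    fix e :: real assume e: "0 < e"
    have "\<forall>\<^sub>F n in sequentially. 0 < n \<longrightarrow> (\<forall>l\<in>K. dist (energy_release L H g (?Cn n) l) (energy_release L H g ?Ch l) < e)"
    (* Without competitors the least value that defines the energy is an arbitrary constant. *)
    proof (cases "grads L H g (L/2) = {}")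
      case True
      have "dist (energy_release L H g (?Cn n) l) (energy_release L H g ?Ch l) < e" if "0 < n" "l \<in> K" for n l
      proof -
        have l: "l \<in> {0<..<L}" using K that(2) by blast
        show ?thesis
          using layered_weights.energy_release_no_competitor[OF lw True Cn[OF that(1)] l]
            layered_weights.energy_release_no_competitor[OF lw0 True Ch l] e by simp
      qed
      then show ?thesis by (intro always_eventually) blast
    next
      case False
      let ?d = "\<lambda>n. layered_weights.pulled_slope L H (?a n) (?b n) g" and ?dh = "layered_weights.pulled_slope L H (\<lambda>_. h1) (\<lambda>_. h2) g"
      have Kc: "compact (flow_time L ` K)" "compact (flow_time' L ` K)"
        using K flow_time_continuous[OF L, of K] by (auto intro: compact_continuous_image)
      obtain R where R: "\<forall>y\<in>flow_time L ` K. norm y \<le> R" using compact_imp_bounded[OF Kc(1)] unfolding bounded_iff by blast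
      obtain B where B: "\<forall>y\<in>flow_time' L ` K. norm y \<le> B" using compact_imp_bounded[OF Kc(2)] unfolding bounded_iff by blast
      obtain z where z: "z \<in> grads L H g (L/2)" using False by blast
      have eB: "e / (\<bar>B\<bar> + 1) > 0" using e by simp
      have "\<forall>\<^sub>F n in sequentially. \<forall>s. \<bar>s\<bar> \<le> R \<longrightarrow> \<bar>?d n s - ?dh s\<bar> < e / (\<bar>B\<bar> + 1)"
        by (rule uniform_derivative_convergence[OF layered_weights.pulled_expansion[OF lw z _ _ refl]
              layered_weights.pulled_expansion[OF lw0 z _ _ refl]
              pulled_energy_convergence[OF L H lam \<mu> h1_def h2_def lw lw0 False] eB])
      then show ?thesis
      proof eventually_elim
        case (elim n)
        show ?case
        proof (intro impI ballI)
          fix l assume n: "0 < n" and lK: "l \<in> K"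
          have l: "l \<in> {0<..<L}" using K lK by blast
          let ?s = "flow_time L l"
          have s: "\<bar>?s\<bar> \<le> R" and s': "\<bar>flow_time' L l\<bar> \<le> B" using R B lK by auto
          have rates: "energy_release L H g (?Cn n) l = - (?d n ?s * flow_time' L l)" "energy_release L H g ?Ch l = - (?dh ?s * flow_time' L l)"
            by (rule layered_weights.energy_release_flow[OF lw False _ l], rule Cn[OF n], assumption)
              (rule layered_weights.energy_release_flow[OF lw0 False _ l], rule Ch)
          have "dist (energy_release L H g (?Cn n) l) (energy_release L H g ?Ch l) = \<bar>?d n ?s - ?dh ?s\<bar> * \<bar>flow_time' L l\<bar>"
            unfolding rates dist_real_def abs_mult[symmetric] by (simp add: left_diff_distrib abs_minus_commute)
          also have "\<dots> \<le> \<bar>?d n ?s - ?dh ?s\<bar> * (\<bar>B\<bar> + 1)" using s' by (intro mult_left_mono) auto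
          also have "\<dots> < e" using elim s by (simp add: pos_less_divide_eq)
          finally show "dist (energy_release L H g (?Cn n) l) (energy_release L H g ?Ch l) < e" .
        qed
      qed
    qed
    then show "\<forall>\<^sub>F n in inf sequentially (principal {n. even n \<and> n > 0}). \<forall>l\<in>K. dist (energy_release L H g (?Cn n) l) (energy_release L H g ?Ch l) < e"
      unfolding eventually_inf_principal by eventually_elim simp
  qed
qed

end
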